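(* Let $D\subset\mathbb C$ be a disk, let $0<R_0<R_1$ be given, and let $\phi:D\to B_{R_1}$ be a proper holomorphic map, where $B_R$ is the ball of radius $R$ centered at the origin in $\mathbb C^n$. Let $A$ denote the area of the image $\phi(D)$, counted with multiplicity. Then the set $\phi^{-1}(B_{R_0})$ is a union of topological disks. Let $C$ be any component of $\phi^{-1}(B_{R_0})$. The set $D-C$ is a topological annulus, and $$\mathrm{Mod}(D-C)\ \ge\ \frac{\log(R_1/R_0)}{\dfrac{A}{R_1^2}\left(2+\dfrac{1}{\log(R_1/R_0)}\right)}.$$
   Context: $B_R=B(0,R)$ denotes the open Euclidean ball in $\mathbb C^n$ ($n\ge1$) of radius $R$ centered at $0$. A doubly connected domain conformally equivalent to $\{\zeta\in\mathbb C:r_1<|\zeta|<r_2\}$ has modulus $\mathrm{Mod}=\log(r_2/r_1)$ (for $D-C$ this refers to the interior annulus $D-\overline C$). The area of $\phi(D)$ is counted with multiplicity, i.e. $A=\int_D|\phi'|^2$ with respect to Lebesgue measure on $D$. *)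

theory Defs
  imports "HOL-Complex_Analysis.Complex_Analysis"
begin

definition holomorphic_map_on :: "(complex \<Rightarrow> complex ^ 'n) \<Rightarrow> complex set \<Rightarrow> bool"
  where "holomorphic_map_on \<phi> D \<longleftrightarrow> (\<forall>i. (\<lambda>z. \<phi> z $ i) holomorphic_on D)"

definition map_deriv :: "(complex \<Rightarrow> complex ^ 'n) \<Rightarrow> complex \<Rightarrow> complex ^ 'n"
  where "map_deriv \<phi> z = (\<chi> i. deriv (\<lambda>w. \<phi> w $ i) z)"

(* The value may be infinite: a proper holomorphic map need not have finite area. *)
definition image_area :: "(complex \<Rightarrow> complex ^ 'n) \<Rightarrow> complex set \<Rightarrow> ennreal"
  where "image_area \<phi> D = (\<integral>\<^sup>+z\<in>D. ennreal ((norm (map_deriv \<phi> z))\<^sup>2) \<partial>lborel)"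

definition conformally_equivalent :: "complex set \<Rightarrow> complex set \<Rightarrow> bool"
  where "conformally_equivalent U V \<longleftrightarrow> open U \<and> open V \<and>
    (\<exists>f g. f holomorphic_on U \<and> g holomorphic_on V \<and> f ` U = V \<and> g ` V = U \<and>
       (\<forall>z\<in>U. g (f z) = z) \<and> (\<forall>w\<in>V. f (g w) = w))"

definition round_annulus :: "real \<Rightarrow> real \<Rightarrow> complex set"
  where "round_annulus r1 r2 = {\<zeta>. r1 < norm \<zeta> \<and> norm \<zeta> < r2}"

(* A relation rather than a function: that a conformal class determines r2 / r1 is a theorem,
   and no choice of value is made for sets that are not conformal to a round annulus. *)
definition has_modulus :: "complex set \<Rightarrow> real \<Rightarrow> bool"
  where "has_modulus U m \<longleftrightarrow>
    (\<exists>r1 r2. 0 < r1 \<and> r1 < r2 \<and> conformally_equivalent U (round_annulus r1 r2) \<and> m = ln (r2 / r1))"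

definition topological_disk :: "complex set \<Rightarrow> bool"
  where "topological_disk S \<longleftrightarrow> S homeomorphic (ball 0 1 :: complex set)"

(* An annulus that contains its inner boundary circle but not its outer one: this is the
   kind of annulus obtained by removing an open disk from a larger open disk. *)
definition half_open_topological_annulus :: "complex set \<Rightarrow> bool"
  where "half_open_topological_annulus S \<longleftrightarrow>
    S homeomorphic {\<zeta>::complex. 1 \<le> norm \<zeta> \<and> norm \<zeta> < 2}"

end

theory Submission
  imports Defs
begin

text \<open>
  Let \<open>u = |\<phi>|\<^sup>2\<close>, let \<open>C\<close> be a component of the set \<open>|\<phi>| < R0\<close>, and let \<open>U = D - closure C\<close>.

  \<^bold>\<open>Topology.\<close>  By the maximum principle, \<open>C\<close> is simply connected (\<open>simply_connected_C\<close>) and hence a topological disc.  For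
  \<open>D - C\<close> one has to exclude that \<open>C\<close> touches itself at a critical point of \<open>u\<close> on its frontier.  In a local
  coordinate \<open>\<zeta>\<close> at a frontier point \<open>p\<close>, the function \<open>u - R0\<^sup>2\<close> is \<open>|\<phi> - \<phi> p|\<^sup>2 - 2 Re \<zeta>\<^sup>m\<close>, and a Sturm comparison on small
  circles shows that \<open>u < R0\<^sup>2\<close> holds on at most one arc in each of the \<open>m\<close> sectors with \<open>Re \<zeta>\<^sup>m > 0\<close>
  (\<open>local_normal_form\<close>).  A winding number argument shows that \<open>C\<close> enters only one of these sectors
  (\<open>unique_valley_aux\<close>).  So \<open>C\<close> and its exterior are both connected in small neighbourhoods of \<open>p\<close> (\<open>local_structure\<close>).

  \<^bold>\<open>Uniformization.\<close>  The set \<open>U\<close> is connected, and its preimage under a logarithm about a point of \<open>C\<close> is simply connected.  The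
  Riemann map of this preimage conjugates the deck transformation to a Moebius transformation without fixed points in the
  disc, and the quotient is a round annulus (\<open>conformal_annulus\<close>).  Wolff's lemma on small crosscuts, Janiszewski's
  theorem and the local connectivity of \<open>C\<close> give a continuous extension of the inverse map to the inner circle
  (\<open>small_rectangle\<close>).  The local connectivity of the exterior makes it injective there (\<open>edge_inj\<close>), and
  \<open>D - C\<close> is a half-open annulus (\<open>homeomorphic_annulus\<close>).

  \<^bold>\<open>The modulus.\<close>  Let \<open>L = log (R1 / R0)\<close>.  A truncation of \<open>log |\<phi>|\<close> grows by at least \<open>L\<close> along each radial segment of the annulus,
  so the length-area method gives \<open>2 \<pi> L\<^sup>2 \<le> Mod U \<cdot> I\<close>, where \<open>I\<close> is the integral of \<open>|\<phi>'|\<^sup>2 / max u R0\<^sup>2\<close>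
  (\<open>length_area_modulus\<close>).  Integrating the antiholomorphic derivative of a compactly supported function \<open>G(u) \<partial>u\<close> gives
  \<open>I \<le> 2 (1 + 2 L) A / R1\<^sup>2\<close> (\<open>weighted_area\<close>), a monotonicity inequality in the spirit of the theory of minimal surfaces.
  Together, \<open>Mod U \<ge> \<pi> L\<^sup>2 R1\<^sup>2 / ((1 + 2 L) A)\<close>, which is \<open>\<pi>\<close> times the claimed bound.
\<close>

unbundle no fps_syntax

section \<open>Integration in the plane\<close>

text \<open>The mutually inverse linear maps \<open>plane_of\<close> and \<open>coords_of\<close> identify \<open>real^2\<close> with \<open>complex\<close> and
  transfer the change of variables formula, a statement about \<open>real^'n\<close>, to the complex plane.\<close>

definition plane_of :: "real^2 \<Rightarrow> complex"
  where "plane_of v = Complex (v $ 1) (v $ 2)"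

definition coords_of :: "complex \<Rightarrow> real^2"
  where "coords_of z = vector [Re z, Im z]"

lemma plane_coords [simp]: "plane_of (coords_of z) = z"
  by (simp add: plane_of_def coords_of_def)

lemma coords_plane [simp]: "coords_of (plane_of v) = v"
  by (simp add: plane_of_def coords_of_def vec_eq_iff forall_2)

lemma bounded_linear_plane_of: "bounded_linear plane_of"
proof -
  have "plane_of = (\<lambda>v. of_real (v $ 1) + \<i> * of_real (v $ 2))"
    by (auto simp: plane_of_def fun_eq_iff complex_eq_iff)
  moreover have "linear (\<lambda>v::real^2. of_real (v $ 1) + \<i> * of_real (v $ 2))"
    by (rule linearI) (auto simp: complex_eq_iff algebra_simps)
  ultimately show ?thesis by (simp add: linear_conv_bounded_linear)
qed

lemma bounded_linear_coords_of: "bounded_linear coords_of"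
proof -
  have "linear coords_of"
    by (rule linearI) (auto simp: coords_of_def vec_eq_iff forall_2)
  then show ?thesis by (simp add: linear_conv_bounded_linear)
qed

lemma measurable_plane_of [measurable]: "plane_of \<in> borel_measurable borel"
  by (intro borel_measurable_continuous_onI linear_continuous_on bounded_linear_plane_of)

lemma measurable_coords_of [measurable]: "coords_of \<in> borel_measurable borel"
  by (intro borel_measurable_continuous_onI linear_continuous_on bounded_linear_coords_of)

lemma lborel_complex_eq_distr_plane_of: "(lborel :: complex measure) = distr lborel borel plane_of"
proof (rule lborel_eqI)
  fix l u :: complex
  assume le: "\<And>b. b \<in> Basis \<Longrightarrow> l \<bullet> b \<le> u \<bullet> b"
  have "plane_of -` box l u = box (coords_of l) (coords_of u)"
    by (auto simp: box_def plane_of_def coords_of_def Basis_complex_def Basis_vec_def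
        inner_axis forall_2 inner_complex_def split: if_splits)
  moreover have "\<And>b. b \<in> Basis \<Longrightarrow> coords_of l \<bullet> b \<le> coords_of u \<bullet> b"
    using le[of 1] le[of \<i>] exhaust_2
    by (auto simp: coords_of_def Basis_complex_def Basis_vec_def inner_axis inner_complex_def)
      (metis (full_types) vector_2)
  moreover have "(\<Prod>b\<in>Basis. (u - l) \<bullet> b) = (\<Prod>b\<in>Basis. (coords_of u - coords_of l) \<bullet> b)"
  proof -
    have B: "(Basis :: (real^2) set) = {axis 1 1, axis 2 1}"
      by (auto simp: Basis_vec_def UNIV_2)
    have "axis 1 1 \<noteq> (axis 2 1 :: real^2)"
      by (simp add: axis_eq_axis)
    then have "(\<Prod>b\<in>Basis. (coords_of u - coords_of l) \<bullet> b) = (Re u - Re l) * (Im u - Im l)"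
      unfolding B by (simp add: inner_axis coords_of_def)
    then show ?thesis by (simp add: Basis_complex_def)
  qed
  ultimately show "emeasure (distr lborel borel plane_of) (box l u) = ennreal (\<Prod>b\<in>Basis. (u - l) \<bullet> b)"
    by (simp add: emeasure_distr)
qed simp

lemma lborel_complex_eq_distr_Complex:
  "(lborel :: complex measure) = distr (lborel \<Otimes>\<^sub>M lborel) borel (\<lambda>(x, y). Complex x y)"
proof (rule lborel_eqI)
  have m: "(\<lambda>(x, y). Complex x y) \<in> borel_measurable (lborel \<Otimes>\<^sub>M lborel)"
    unfolding lborel_prod
    by (auto intro!: borel_measurable_continuous_onI continuous_intros simp: case_prod_unfold)
  fix l u :: complex
  assume le: "\<And>b. b \<in> Basis \<Longrightarrow> l \<bullet> b \<le> u \<bullet> b"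
  have "(\<lambda>(x, y). Complex x y) -` box l u = box (Re l, Im l) (Re u, Im u)"
    by (auto simp: box_def Basis_complex_def Basis_prod_def inner_complex_def)
  then have "emeasure (distr (lborel \<Otimes>\<^sub>M lborel) borel (\<lambda>(x, y). Complex x y)) (box l u)
      = emeasure lborel (box (Re l, Im l) (Re u, Im u))"
    by (subst emeasure_distr[OF m]) (auto simp: lborel_prod)
  also have "\<dots> = ennreal (\<Prod>b\<in>Basis. (u - l) \<bullet> b)"
  proof -
    have B: "(Basis :: (real \<times> real) set) = {(1,0), (0,1)}"
      by (auto simp: Basis_prod_def)
    have "\<And>b. b \<in> Basis \<Longrightarrow> (Re l, Im l) \<bullet> b \<le> (Re u, Im u) \<bullet> b"
      unfolding B using le[of 1] le[of \<i>] by (auto simp: Basis_complex_def)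
    moreover have "(\<Prod>b\<in>Basis. ((Re u, Im u) - (Re l, Im l)) \<bullet> b) = (Re u - Re l) * (Im u - Im l)"
      unfolding B by simp
    ultimately show ?thesis
      by (subst emeasure_lborel_box) (simp_all add: Basis_complex_def)
  qed
  finally show "emeasure (distr (lborel \<Otimes>\<^sub>M lborel) borel (\<lambda>(x, y). Complex x y)) (box l u) = \<dots>" .
qed simp

lemma measurable_Complex_pair:
  "(\<lambda>(x, y). Complex x y) \<in> borel_measurable (lborel \<Otimes>\<^sub>M lborel)"
  unfolding lborel_prod
  by (auto intro!: borel_measurable_continuous_onI continuous_intros simp: case_prod_unfold)

lemma nn_integral_complex_iterated:
  assumes f: "f \<in> borel_measurable borel"
  shows "(\<integral>\<^sup>+z. f z \<partial>(lborel :: complex measure)) = (\<integral>\<^sup>+y. \<integral>\<^sup>+x. f (Complex x y) \<partial>lborel \<partial>lborel)"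
    and "(\<integral>\<^sup>+z. f z \<partial>(lborel :: complex measure)) = (\<integral>\<^sup>+x. \<integral>\<^sup>+y. f (Complex x y) \<partial>lborel \<partial>lborel)"
proof -
  have fm: "(\<lambda>p. f (case p of (x, y) \<Rightarrow> Complex x y)) \<in> borel_measurable (lborel \<Otimes>\<^sub>M lborel)"
    using measurable_compose[OF measurable_Complex_pair f] by (simp add: comp_def)
  have *: "(\<integral>\<^sup>+z. f z \<partial>(lborel :: complex measure))
      = (\<integral>\<^sup>+p. f (case p of (x, y) \<Rightarrow> Complex x y) \<partial>(lborel \<Otimes>\<^sub>M lborel))"
    by (subst lborel_complex_eq_distr_Complex, subst nn_integral_distr[OF measurable_Complex_pair])
      (use f in auto)
  show "(\<integral>\<^sup>+z. f z \<partial>(lborel :: complex measure)) = (\<integral>\<^sup>+y. \<integral>\<^sup>+x. f (Complex x y) \<partial>lborel \<partial>lborel)"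
    unfolding * by (subst lborel_pair.nn_integral_snd[OF fm, symmetric]) simp
  show "(\<integral>\<^sup>+z. f z \<partial>(lborel :: complex measure)) = (\<integral>\<^sup>+x. \<integral>\<^sup>+y. f (Complex x y) \<partial>lborel \<partial>lborel)"
    unfolding * by (subst lborel.nn_integral_fst[OF fm, symmetric]) simp
qed

lemma measurable_restrict_open:
  fixes w :: "complex \<Rightarrow> 'b::{real_normed_vector, second_countable_topology}"
  assumes "open S" "continuous_on S w"
  shows "(\<lambda>z. indicator S z *\<^sub>R w z) \<in> borel_measurable borel"
  using borel_measurable_continuous_on_indicator[OF _ assms(2)] assms(1) by (simp add: borel_open)

lemma measurable_restrict_open_ennreal:
  fixes w :: "complex \<Rightarrow> real"
  assumes "open S" "continuous_on S w"
  shows "(\<lambda>z. ennreal (w z) * indicator S z) \<in> borel_measurable borel"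
proof -
  have "(\<lambda>z. ennreal (w z) * indicator S z) = (\<lambda>z. ennreal (indicator S z *\<^sub>R w z))"
    by (auto simp: indicator_def)
  then show ?thesis using measurable_restrict_open[OF assms] by simp
qed

lemma nn_integral_plane_of:
  assumes f: "f \<in> borel_measurable borel"
  shows "(\<integral>\<^sup>+z. f z \<partial>(lborel :: complex measure)) = (\<integral>\<^sup>+v. f (plane_of v) \<partial>lborel)"
  by (subst lborel_complex_eq_distr_plane_of, subst nn_integral_distr) (use f in auto)

text \<open>Change of variables under an injective holomorphic map, whose Jacobian is the square of the
  modulus of the derivative.  Only the inequality is needed; it has the advantage of being
  trivial when the right hand side is infinite.\<close>

lemma nn_integral_holomorphic_image:
  fixes w :: "complex \<Rightarrow> real"
  assumes S: "open S" and h: "h holomorphic_on S" and inj: "inj_on h S"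
    and w: "continuous_on (h ` S) w" and w0: "\<And>z. z \<in> h ` S \<Longrightarrow> 0 \<le> w z"
  shows "(\<integral>\<^sup>+z\<in>S. ennreal (w (h z) * (norm (deriv h z))\<^sup>2) \<partial>lborel) \<le> (\<integral>\<^sup>+z\<in>h ` S. ennreal (w z) \<partial>lborel)"
proof (cases "(\<integral>\<^sup>+z\<in>h ` S. ennreal (w z) \<partial>lborel) = \<infinity>")
  case False
  define S' where "S' = plane_of -` S"
  define h' where "h' = coords_of \<circ> h \<circ> plane_of"
  have ohS: "open (h ` S)"
    using open_mapping_thm3[OF h S inj] .
  have oS': "open S'"
    unfolding S'_def by (intro open_vimage S linear_continuous_on bounded_linear_plane_of)
  have im: "h' ` S' = plane_of -` (h ` S)"
  proof (intro equalityI subsetI)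
    fix x assume "x \<in> plane_of -` (h ` S)"
    then obtain s where "s \<in> S" "plane_of x = h s" by auto
    then have "coords_of s \<in> S'" "x = h' (coords_of s)"
      unfolding h'_def S'_def by (auto simp: comp_def) (metis coords_plane)
    then show "x \<in> h' ` S'" by blast
  qed (auto simp: h'_def S'_def)
  have ohS': "open (h' ` S')"
    unfolding im by (intro open_vimage ohS linear_continuous_on bounded_linear_plane_of)
  have injh': "inj_on h' S'"
    unfolding h'_def S'_def
    by (rule inj_onI, simp add: comp_def) (metis coords_plane inj_onD[OF inj] plane_coords)
  define D where "D v = coords_of \<circ> (\<lambda>t. deriv h (plane_of v) * t) \<circ> plane_of" for v
  have der: "(h' has_derivative D v) (at v within S')" if "v \<in> S'" for v
  proof -
    have hd: "(h has_field_derivative deriv h (plane_of v)) (at (plane_of v))"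
      using that S h unfolding S'_def by (auto intro: holomorphic_derivI)
    have "(h has_derivative (\<lambda>t. deriv h (plane_of v) * t)) (at (plane_of v))"
      using hd by (simp add: has_field_derivative_def)
    moreover have "(plane_of has_derivative plane_of) (at v within S')"
      by (rule bounded_linear_imp_has_derivative[OF bounded_linear_plane_of])
    ultimately have "(h \<circ> plane_of has_derivative (\<lambda>t. deriv h (plane_of v) * t) \<circ> plane_of) (at v within S')"
      by (metis diff_chain_within has_derivative_at_withinI)
    then have "(coords_of \<circ> (h \<circ> plane_of) has_derivative coords_of \<circ> ((\<lambda>t. deriv h (plane_of v) * t) \<circ> plane_of)) (at v within S')"
      by (metis diff_chain_within bounded_linear_imp_has_derivative[OF bounded_linear_coords_of])
    then show ?thesis unfolding h'_def D_def by (simp add: o_assoc)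
  qed
  have det: "\<bar>det (matrix (D v))\<bar> = (norm (deriv h (plane_of v)))\<^sup>2" for v
    unfolding cmod_power2
    by (simp add: D_def det_2 matrix_def axis_def plane_of_def coords_of_def power2_eq_square)
  define D' where "D' v = \<bar>det (matrix (D v))\<bar>" for v
  have wm: "(\<lambda>z. ennreal (w z) * indicator (h ` S) z) \<in> borel_measurable borel"
    by (rule measurable_restrict_open_ennreal[OF ohS w])
  have I: "(\<integral>\<^sup>+z\<in>h ` S. ennreal (w z) \<partial>lborel) = (\<integral>\<^sup>+v. ennreal (indicator (h' ` S') v *\<^sub>R w (plane_of v)) \<partial>lebesgue)"
    unfolding nn_integral_completion
    by (subst nn_integral_plane_of[OF wm]) (auto intro!: nn_integral_cong simp: indicator_def im)
  have wint: "(\<lambda>v. w (plane_of v)) absolutely_integrable_on (h' ` S')"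
    unfolding set_integrable_def
  proof (rule integrableI_nonneg)
    have "continuous_on (h' ` S') (\<lambda>v. w (plane_of v))"
      unfolding im by (rule continuous_on_compose2[OF w])
        (auto intro!: linear_continuous_on bounded_linear_plane_of)
    then have "(\<lambda>v. indicator (h' ` S') v *\<^sub>R w (plane_of v)) \<in> borel_measurable borel"
      by (intro borel_measurable_continuous_on_indicator) (use ohS' in auto)
    then show "(\<lambda>v. indicator (h' ` S') v *\<^sub>R w (plane_of v)) \<in> borel_measurable lebesgue"
      by (simp add: measurable_completion)
    show "AE v in lebesgue. 0 \<le> indicator (h' ` S') v *\<^sub>R w (plane_of v)"
      using w0 by (auto simp: indicator_def im)
    show "(\<integral>\<^sup>+v. ennreal (indicator (h' ` S') v *\<^sub>R w (plane_of v)) \<partial>lebesgue) < \<infinity>"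
      using False I by (simp add: top.not_eq_extremum)
  qed
  have "S' \<in> sets lebesgue"
    using oS' by (simp add: borel_open)
  then have "(\<lambda>v. D' v *\<^sub>R vec (w (plane_of (h' v))) :: real^1) absolutely_integrable_on S' \<and>
      integral S' (\<lambda>v. D' v *\<^sub>R vec (w (plane_of (h' v)))) = (vec (integral (h' ` S') (\<lambda>v. w (plane_of v))) :: real^1)"
    unfolding D'_def
    apply (subst has_absolute_integral_change_of_variables[OF _ der injh'])
    using wint by (auto simp: absolutely_integrable_on_1_iff integral_on_1_eq)
  then have lint: "(\<lambda>v. D' v * w (plane_of (h' v))) absolutely_integrable_on S'"
    and leq: "integral S' (\<lambda>v. D' v * w (plane_of (h' v))) = integral (h' ` S') (\<lambda>v. w (plane_of v))"
    by (auto simp: absolutely_integrable_on_1_iff integral_on_1_eq)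
  have nn: "(\<integral>\<^sup>+v. ennreal (indicator T v *\<^sub>R g v) \<partial>lebesgue) = ennreal (integral T g)"
    if "g absolutely_integrable_on T" "\<And>v. v \<in> T \<Longrightarrow> 0 \<le> g v" for g :: "real^2 \<Rightarrow> real" and T
  proof -
    have "(\<integral>\<^sup>+v. ennreal (indicator T v *\<^sub>R g v) \<partial>lebesgue) = ennreal (\<integral>v. indicator T v *\<^sub>R g v \<partial>lebesgue)"
      using that by (intro nn_integral_eq_integral) (auto simp: set_integrable_def indicator_def)
    also have "(\<integral>v. indicator T v *\<^sub>R g v \<partial>lebesgue) = integral T g"
      using set_lebesgue_integral_eq_integral(2)[OF that(1)] by (simp add: set_lebesgue_integral_def)
    finally show ?thesis .
  qed
  have cw: "continuous_on S (\<lambda>z. w (h z) * (norm (deriv h z))\<^sup>2)"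
    by (intro continuous_intros continuous_on_compose2[OF w] holomorphic_on_imp_continuous_on h
        holomorphic_deriv S) auto
  have "(\<integral>\<^sup>+z\<in>S. ennreal (w (h z) * (norm (deriv h z))\<^sup>2) \<partial>lborel)
      = (\<integral>\<^sup>+v. ennreal (indicator S' v *\<^sub>R (D' v * w (plane_of (h' v)))) \<partial>lebesgue)"
    unfolding nn_integral_completion
    by (subst nn_integral_plane_of[OF measurable_restrict_open_ennreal[OF S cw]])
      (auto intro!: nn_integral_cong simp: indicator_def S'_def D'_def det h'_def mult.commute)
  also have "\<dots> = ennreal (integral S' (\<lambda>v. D' v * w (plane_of (h' v))))"
    by (rule nn[OF lint]) (use w0 in \<open>auto simp: D'_def h'_def S'_def intro!: mult_nonneg_nonneg\<close>)
  also have "\<dots> = (\<integral>\<^sup>+v. ennreal (indicator (h' ` S') v *\<^sub>R w (plane_of v)) \<partial>lebesgue)"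
    unfolding leq by (rule nn[OF wint, symmetric]) (use w0 im in auto)
  finally show ?thesis using I by simp
qed auto

text \<open>The length-area principle on a segment: the distance between the end points is at most the
  length of the curve, and the Cauchy-Schwarz inequality bounds the square of the length by the integral
  of the square of the speed.\<close>

lemma segment_length_area:
  fixes v :: "real \<Rightarrow> 'a::euclidean_space"
  assumes ab: "\<alpha> \<le> \<beta>"
    and der: "\<And>t. t \<in> {\<alpha>..\<beta>} \<Longrightarrow> (v has_vector_derivative v' t) (at t within {\<alpha>..\<beta>})"
    and le: "\<And>t. t \<in> {\<alpha>..\<beta>} \<Longrightarrow> norm (v' t) \<le> k t"
    and k: "continuous_on {\<alpha>..\<beta>} k"
  shows "ennreal ((norm (v \<beta> - v \<alpha>))\<^sup>2) \<le> ennreal (\<beta> - \<alpha>) * (\<integral>\<^sup>+t\<in>{\<alpha>..\<beta>}. ennreal ((k t)\<^sup>2) \<partial>lborel)"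
proof (cases "\<alpha> = \<beta>")
  case False
  with ab have ab': "\<alpha> < \<beta>" by simp
  have ki: "k integrable_on {\<alpha>..\<beta>}" and k2i: "(\<lambda>t. (k t)\<^sup>2) integrable_on {\<alpha>..\<beta>}"
    using k by (auto intro!: integrable_continuous_real continuous_intros)
  have "(v' has_integral (v \<beta> - v \<alpha>)) {\<alpha>..\<beta>}"
    by (rule fundamental_theorem_of_calculus[OF ab der])
  then have 1: "norm (v \<beta> - v \<alpha>) \<le> integral {\<alpha>..\<beta>} k"
    by (metis has_integral_integrable_integral integral_norm_bound_integral[OF _ ki] le)
  define J where "J = integral {\<alpha>..\<beta>} k"
  define c where "c = J / (\<beta> - \<alpha>)"
  have "((\<lambda>t. (k t)\<^sup>2 - 2 * c * k t + c\<^sup>2) has_integral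
      (integral {\<alpha>..\<beta>} (\<lambda>t. (k t)\<^sup>2) - 2 * c * J + c\<^sup>2 * (\<beta> - \<alpha>))) {\<alpha>..\<beta>}"
    unfolding J_def using ab' has_integral_const_real[of "c\<^sup>2" \<alpha> \<beta>]
    by (intro has_integral_add has_integral_diff has_integral_mult_right integrable_integral ki k2i)
       (simp add: mult.commute)
  then have "0 \<le> integral {\<alpha>..\<beta>} (\<lambda>t. (k t)\<^sup>2) - 2 * c * J + c\<^sup>2 * (\<beta> - \<alpha>)"
  proof (rule has_integral_nonneg)
    fix t
    have "(k t)\<^sup>2 - 2 * c * k t + c\<^sup>2 = (k t - c)\<^sup>2" by (simp add: power2_diff algebra_simps)
    then show "0 \<le> (k t)\<^sup>2 - 2 * c * k t + c\<^sup>2" by simp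
  qed
  moreover have "c * (\<beta> - \<alpha>) = J" using ab' by (simp add: c_def)
  then have "c\<^sup>2 * (\<beta> - \<alpha>) = c * J" by (simp add: power2_eq_square)
  ultimately have "c * J \<le> integral {\<alpha>..\<beta>} (\<lambda>t. (k t)\<^sup>2)" by (simp add: mult.commute)
  then have "(\<beta> - \<alpha>) * (c * J) \<le> (\<beta> - \<alpha>) * integral {\<alpha>..\<beta>} (\<lambda>t. (k t)\<^sup>2)"
    using ab' by (intro mult_left_mono) auto
  then have 2: "J\<^sup>2 \<le> (\<beta> - \<alpha>) * integral {\<alpha>..\<beta>} (\<lambda>t. (k t)\<^sup>2)"
    using \<open>c * (\<beta> - \<alpha>) = J\<close> by (metis (no_types, lifting) mult.assoc mult.commute power2_eq_square)
  have "(norm (v \<beta> - v \<alpha>))\<^sup>2 \<le> J\<^sup>2"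
    using 1 unfolding J_def by (intro power_mono) auto
  with 2 have 3: "(norm (v \<beta> - v \<alpha>))\<^sup>2 \<le> (\<beta> - \<alpha>) * integral {\<alpha>..\<beta>} (\<lambda>t. (k t)\<^sup>2)" by linarith
  have "(\<integral>\<^sup>+t\<in>{\<alpha>..\<beta>}. ennreal ((k t)\<^sup>2) \<partial>lborel)
      = (\<integral>\<^sup>+t. ennreal (indicator {\<alpha>..\<beta>} t *\<^sub>R (k t)\<^sup>2) \<partial>lborel)"
    by (intro nn_integral_cong) (auto simp: indicator_def)
  also have "\<dots> = ennreal (integral {\<alpha>..\<beta>} (\<lambda>t. (k t)\<^sup>2))"
  proof (rule nn_integral_has_integral_lborel)
    show "(\<lambda>t. indicator {\<alpha>..\<beta>} t *\<^sub>R (k t)\<^sup>2) \<in> borel_measurable borel"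
      by (intro borel_measurable_continuous_on_indicator continuous_intros k) auto
    have "((\<lambda>t. if t \<in> {\<alpha>..\<beta>} then (k t)\<^sup>2 else 0) has_integral integral {\<alpha>..\<beta>} (\<lambda>t. (k t)\<^sup>2)) UNIV"
      using integrable_integral[OF k2i] by (simp only: has_integral_restrict_UNIV)
    moreover have "(\<lambda>t. if t \<in> {\<alpha>..\<beta>} then (k t)\<^sup>2 else 0) = (\<lambda>t. indicator {\<alpha>..\<beta>} t *\<^sub>R (k t)\<^sup>2)"
      by (auto simp: indicator_def)
    ultimately show "((\<lambda>t. indicator {\<alpha>..\<beta>} t *\<^sub>R (k t)\<^sup>2) has_integral integral {\<alpha>..\<beta>} (\<lambda>t. (k t)\<^sup>2)) UNIV"
      by simp
  qed (auto simp: indicator_def)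
  finally show ?thesis
    using 3 ab' by (simp add: ennreal_mult'[symmetric] ennreal_leI)
qed auto

section \<open>The maximum principle for proper holomorphic discs\<close>

text \<open>A proper holomorphic map of a disc into a ball of radius \<open>R1\<close>.\<close>

locale proper_disc =
  fixes \<phi> :: "complex \<Rightarrow> complex ^ 'n" and D :: "complex set" and a :: complex and r R1 :: real
  assumes r_pos: "0 < r" and D_eq: "D = ball a r" and R1_pos: "0 < R1"
    and hol: "holomorphic_map_on \<phi> D"
    and maps: "\<phi> ` D \<subseteq> ball 0 R1"
    and proper: "proper_map (top_of_set D) (top_of_set (ball 0 R1)) \<phi>"
begin

lemma hol_comp: "(\<lambda>z. \<phi> z $ i) holomorphic_on D"
  using hol by (simp add: holomorphic_map_on_def)

lemma open_D: "open D" and connected_D: "connected D" and bounded_D: "bounded D" and D_ne: "D \<noteq> {}"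
  using r_pos by (auto simp: D_eq)

lemma continuous_phi: "continuous_on D \<phi>"
proof -
  have "continuous_on D (\<lambda>z. \<chi> i. \<phi> z $ i)"
    by (intro continuous_on_vec_lambda holomorphic_on_imp_continuous_on hol_comp)
  then show ?thesis by simp
qed

lemma norm_less: "z \<in> D \<Longrightarrow> norm (\<phi> z) < R1"
  using maps by auto

text \<open>Properness is used only through the compactness of the closed sublevel sets.\<close>

lemma compact_sublevel:
  assumes "t < R1" shows "compact {z \<in> D. norm (\<phi> z) \<le> t}"
proof -
  have "cball (0::complex^'n) t \<subseteq> ball 0 R1"
    using assms by auto
  then have "compactin (top_of_set (ball 0 R1)) (cball (0::complex^'n) t)"
    by (simp add: compactin_subtopology)
  from compactin_proper_map_preimage[OF proper this]
  have "compactin (top_of_set D) {z \<in> topspace (top_of_set D). \<phi> z \<in> cball 0 t}" .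
  moreover have "{z \<in> topspace (top_of_set D). \<phi> z \<in> cball 0 t} = {z \<in> D. norm (\<phi> z) \<le> t}"
    by auto
  ultimately show ?thesis by (simp add: compactin_subtopology)
qed

lemma not_constant: "\<not> \<phi> constant_on D"
proof
  assume "\<phi> constant_on D"
  then obtain c where c: "\<And>z. z \<in> D \<Longrightarrow> \<phi> z = c" by (auto simp: constant_on_def)
  have "norm c < R1" using c D_ne norm_less by force
  then have "compact {z \<in> D. norm (\<phi> z) \<le> norm c}" by (rule compact_sublevel)
  moreover have "{z \<in> D. norm (\<phi> z) \<le> norm c} = D" using c by auto
  ultimately show False
    using open_D bounded_D D_ne compact_open by auto
qed

lemma constant_on_open_imp_constant:
  assumes V: "open V" "V \<noteq> {}" "V \<subseteq> D" and c: "\<And>z. z \<in> V \<Longrightarrow> \<phi> z = c"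
  shows False
proof -
  have "\<phi> z = c" if "z \<in> D" for z
  proof -
    have "\<phi> z $ i = c $ i" for i
    proof -
      have "(\<lambda>z. \<phi> z $ i - c $ i) holomorphic_on D"
        by (intro holomorphic_intros hol_comp)
      then have "\<phi> z $ i - c $ i = 0"
        by (rule analytic_continuation_open[of V D "\<lambda>z. \<phi> z $ i - c $ i" "\<lambda>_. 0", OF V(1) open_D V(2) connected_D V(3)])
          (use that c in auto)
      then show ?thesis by simp
    qed
    then show ?thesis by (simp add: vec_eq_iff)
  qed
  then show False using not_constant by (auto simp: constant_on_def)
qed

text \<open>The strong maximum principle for the norm of a vector valued holomorphic function.  At an
  interior maximum \<open>p\<close>, it reduces to the scalar function \<open>z \<mapsto> \<langle>\<phi> z, \<phi> p\<rangle>\<close>.\<close>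

lemma no_interior_maximum:
  assumes V: "open V" "V \<subseteq> D" "p \<in> V" and mx: "\<And>z. z \<in> V \<Longrightarrow> norm (\<phi> z) \<le> norm (\<phi> p)"
  shows False
proof -
  obtain e where e: "e > 0" "ball p e \<subseteq> V" using V by (meson openE)
  define q where "q z = (\<Sum>i\<in>UNIV. \<phi> z $ i * cnj (\<phi> p $ i))" for z
  have qhol: "q holomorphic_on ball p e"
    unfolding q_def using e V by (intro holomorphic_intros holomorphic_on_subset[OF hol_comp]) auto
  have re: "Re (q z) = \<phi> z \<bullet> \<phi> p" for z
    by (simp add: q_def inner_vec_def inner_complex_def)
  have nq: "norm (q z) \<le> norm (\<phi> z) * norm (\<phi> p)" for z
  proof -
    have "norm (q z) \<le> (\<Sum>i\<in>UNIV. norm (\<phi> z $ i) * norm (\<phi> p $ i))"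
      unfolding q_def by (rule order_trans[OF norm_sum]) (simp add: norm_mult)
    also have "\<dots> \<le> L2_set (\<lambda>i. norm (\<phi> z $ i)) UNIV * L2_set (\<lambda>i. norm (\<phi> p $ i)) UNIV"
      using L2_set_mult_ineq[of "\<lambda>i. norm (\<phi> z $ i)" "\<lambda>i. norm (\<phi> p $ i)" UNIV] by simp
    finally show ?thesis by (simp add: norm_vec_def)
  qed
  have qp: "q p = of_real ((norm (\<phi> p))\<^sup>2)"
  proof -
    have "q p = of_real (\<Sum>i\<in>UNIV. (norm (\<phi> p $ i))\<^sup>2)"
      unfolding q_def of_real_sum by (intro sum.cong refl) (rule complex_norm_square[symmetric])
    also have "(\<Sum>i\<in>UNIV. (norm (\<phi> p $ i))\<^sup>2) = (norm (\<phi> p))\<^sup>2"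
      by (simp add: norm_vec_def L2_set_def sum_nonneg)
    finally show ?thesis .
  qed
  have "q constant_on ball p e"
  proof (rule maximum_modulus_principle[OF qhol _ _ open_ball subset_refl])
    show "connected (ball p e)" "open (ball p e)" "p \<in> ball p e" using e by auto
    fix z assume z: "z \<in> ball p e"
    have "norm (q z) \<le> norm (\<phi> p) * norm (\<phi> p)"
      using nq[of z] mx[of z] z e by (meson mult_right_mono norm_ge_zero order_trans subsetD)
    then show "norm (q z) \<le> norm (q p)" by (simp add: qp power2_eq_square norm_mult)
  qed
  then have qc: "q z = of_real ((norm (\<phi> p))\<^sup>2)" if "z \<in> ball p e" for z
    using that e qp by (metis centre_in_ball constant_on_def)
  have "\<phi> z = \<phi> p" if z: "z \<in> ball p e" for z
  proof -
    have "\<phi> z \<bullet> \<phi> p = (norm (\<phi> p))\<^sup>2"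
      using re[of z] qc[OF z] by simp
    moreover have "norm (\<phi> z) \<le> norm (\<phi> p)" using mx z e by auto
    then have "(norm (\<phi> z))\<^sup>2 \<le> (norm (\<phi> p))\<^sup>2" by (rule power_mono) simp
    moreover have "(norm (\<phi> z - \<phi> p))\<^sup>2 = (norm (\<phi> z))\<^sup>2 - 2 * (\<phi> z \<bullet> \<phi> p) + (norm (\<phi> p))\<^sup>2"
      by (simp add: power2_norm_eq_inner inner_diff_left inner_diff_right inner_commute)
    ultimately have "(norm (\<phi> z - \<phi> p))\<^sup>2 \<le> 0" by simp
    then show ?thesis by simp
  qed
  moreover have "ball p e \<noteq> {}" "ball p e \<subseteq> D" using e V by auto
  ultimately show False
    using constant_on_open_imp_constant[of "ball p e" "\<phi> p"] by blast
qed

text \<open>A relatively compact open set cannot carry larger values than its frontier: the largest value on the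
  closure would otherwise be an interior maximum.\<close>

lemma maximum_principle:
  assumes V: "open V" "bounded V" "closure V \<subseteq> D"
    and fr: "\<And>z. z \<in> frontier V \<Longrightarrow> norm (\<phi> z) \<le> t" and z: "z \<in> V"
  shows "norm (\<phi> z) < t"
proof -
  have c: "compact (closure V)" using V by simp
  have "continuous_on (closure V) (\<lambda>z. norm (\<phi> z))"
    using continuous_on_subset[OF continuous_phi V(3)] by (intro continuous_intros)
  moreover have "closure V \<noteq> {}" using z by auto
  ultimately obtain p where p: "p \<in> closure V" "\<And>w. w \<in> closure V \<Longrightarrow> norm (\<phi> w) \<le> norm (\<phi> p)"
    using continuous_attains_sup[OF c, of "\<lambda>z. norm (\<phi> z)"] by auto
  have nV: "p' \<notin> V" if "\<And>w. w \<in> closure V \<Longrightarrow> norm (\<phi> w) \<le> norm (\<phi> p')" for p'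
  proof
    assume "p' \<in> V"
    moreover have "V \<subseteq> D" using V closure_subset by blast
    ultimately show False
      using no_interior_maximum[OF V(1)] that closure_subset by blast
  qed
  then have "p \<in> frontier V" using p V by (auto simp: frontier_def interior_open)
  then have "norm (\<phi> p) \<le> t" by (rule fr)
  moreover have "norm (\<phi> z) < norm (\<phi> p)"
  proof (rule ccontr)
    assume "\<not> ?thesis"
    then have "norm (\<phi> w) \<le> norm (\<phi> z)" if "w \<in> closure V" for w
      using p(2)[OF that] by linarith
    then show False using nV z by blast
  qed
  ultimately show ?thesis by linarith
qed

text \<open>Holes of a compact subset of a sublevel set lie in the open sublevel set.\<close>

lemma hole_subset_sublevel:
  assumes K: "compact K" "K \<subseteq> {z \<in> D. norm (\<phi> z) \<le> t}"
    and V: "V \<in> components (- K)" "bounded V"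
  shows "V \<subseteq> {z \<in> D. norm (\<phi> z) < t}"
proof -
  have clK: "closed K" using K by (simp add: compact_imp_closed)
  then have oV: "open V" using open_components[of "- K" V] V by (simp add: open_Compl)
  have frV: "frontier V \<subseteq> K"
    using frontier_of_components_subset[OF V(1)] frontier_subset_closed[OF clK]
    by (simp add: frontier_complement)
  have "V \<subseteq> D"
  proof (rule ccontr)
    assume "\<not> V \<subseteq> D"
    then obtain x where x: "x \<in> V" "x \<notin> D" by auto
    have "connected (- D)"
      unfolding D_eq by (rule connected_complement_bounded_convex) auto
    moreover have "- D \<subseteq> - K" using K by auto
    moreover have "V \<inter> - D \<noteq> {}" using x by auto
    ultimately have "- D \<subseteq> V"
      by (rule components_maximal[OF V(1)])
    then have "bounded (- D)" using bounded_subset[OF V(2)] by simp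
    then have "bounded (- D \<union> D)" using bounded_D by (simp only: bounded_Un simp_thms)
    then show False by (simp add: not_bounded_UNIV)
  qed
  moreover have "closure V \<subseteq> D"
    using frV K \<open>V \<subseteq> D\<close> closure_Un_frontier[of V] by auto
  moreover have "norm (\<phi> z) < t" if "z \<in> V" for z
    by (rule maximum_principle[OF oV V(2) \<open>closure V \<subseteq> D\<close> _ that]) (use frV K in auto)
  ultimately show ?thesis by auto
qed

text \<open>By the maximum principle the closed sublevel sets have no holes.\<close>

lemma connected_complement_sublevel:
  assumes "t < R1" shows "connected (- {z \<in> D. norm (\<phi> z) \<le> t})" (is "connected (- ?K)")
proof -
  have K: "compact ?K" using assms by (rule compact_sublevel)
  have "\<not> bounded V" if V: "V \<in> components (- ?K)" for V
  proof
    assume "bounded V"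
    then have "V \<subseteq> {z \<in> D. norm (\<phi> z) < t}" using hole_subset_sublevel[OF K order_refl V] by simp
    moreover have "V \<noteq> {}" "V \<subseteq> - ?K" using V by (auto simp: in_components_nonempty dest: in_components_subset)
    ultimately show False by fastforce
  qed
  then show ?thesis
    unfolding connected_eq_connected_components_eq
    using cobounded_unique_unbounded_components[of "- ?K"] K by (simp add: compact_imp_bounded)
qed

end

section \<open>The normal form at a point of a level set\<close>

text \<open>Sturm comparison with \<open>cos (\<mu> \<tau>)\<close>.  The Wronskian of \<open>n\<close> and the cosine is strictly increasing, so the
  quotient \<open>n \<tau> / cos (\<mu> \<tau>)\<close> has no weak interior maximum on the interval where the cosine is positive:
  its sublevel sets are intervals.\<close>

lemma sturm_valley:
  fixes n n1 n2 :: "real \<Rightarrow> real" and \<mu> b :: real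
  assumes \<mu>: "0 < \<mu>"
    and d1: "\<And>\<tau>. (n has_real_derivative n1 \<tau>) (at \<tau>)"
    and d2: "\<And>\<tau>. (n1 has_real_derivative n2 \<tau>) (at \<tau>)"
    and pos: "\<And>\<tau>. 0 < n2 \<tau> + \<mu>\<^sup>2 * n \<tau>"
    and \<tau>: "- pi / (2 * \<mu>) < \<tau>1" "\<tau>1 < \<tau>2" "\<tau>2 < \<tau>3" "\<tau>3 < pi / (2 * \<mu>)"
    and le1: "n \<tau>1 \<le> b * cos (\<mu> * \<tau>1)" and le3: "n \<tau>3 \<le> b * cos (\<mu> * \<tau>3)"
  shows "n \<tau>2 < b * cos (\<mu> * \<tau>2)"
proof (rule ccontr)
  assume neg: "\<not> ?thesis"
  have c: "0 < cos (\<mu> * x)" if "\<tau>1 \<le> x" "x \<le> \<tau>3" for x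
  proof (rule cos_gt_zero_pi)
    have "- pi / (2 * \<mu>) < x" "x < pi / (2 * \<mu>)" using that \<tau> by auto
    then show "- (pi / 2) < \<mu> * x" "\<mu> * x < pi / 2"
      using \<mu> by (auto simp: field_simps)
  qed
  define R where "R x = n x / cos (\<mu> * x)" for x
  define W where "W x = n1 x * cos (\<mu> * x) + \<mu> * n x * sin (\<mu> * x)" for x
  have dR: "(R has_real_derivative W x / (cos (\<mu> * x))\<^sup>2) (at x)" if "\<tau>1 \<le> x" "x \<le> \<tau>3" for x
    unfolding R_def W_def using c[OF that]
    by (auto intro!: derivative_eq_intros d1 simp: power2_eq_square field_simps)
  have dW: "(W has_real_derivative (n2 x + \<mu>\<^sup>2 * n x) * cos (\<mu> * x)) (at x)" for x
    unfolding W_def by (auto intro!: derivative_eq_intros d1 d2 simp: power2_eq_square algebra_simps)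
  have R1: "R \<tau>1 \<le> b" and R3: "R \<tau>3 \<le> b" and R2: "b \<le> R \<tau>2"
    using le1 le3 neg c[of \<tau>1] c[of \<tau>3] c[of \<tau>2] \<tau> by (auto simp: R_def field_simps)
  obtain x where x: "\<tau>1 < x" "x < \<tau>2" "R \<tau>2 - R \<tau>1 = (\<tau>2 - \<tau>1) * (W x / (cos (\<mu> * x))\<^sup>2)"
    using MVT2[of \<tau>1 \<tau>2 R "\<lambda>x. W x / (cos (\<mu> * x))\<^sup>2"] dR \<tau> by auto
  obtain y where y: "\<tau>2 < y" "y < \<tau>3" "R \<tau>3 - R \<tau>2 = (\<tau>3 - \<tau>2) * (W y / (cos (\<mu> * y))\<^sup>2)"
    using MVT2[of \<tau>2 \<tau>3 R "\<lambda>x. W x / (cos (\<mu> * x))\<^sup>2"] dR \<tau> by auto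
  have "0 \<le> (\<tau>2 - \<tau>1) * (W x / (cos (\<mu> * x))\<^sup>2)" using x R1 R2 by linarith
  then have Wx: "0 \<le> W x" using \<tau> c[of x] x by (simp add: zero_le_mult_iff zero_le_divide_iff)
  have "(\<tau>3 - \<tau>2) * (W y / (cos (\<mu> * y))\<^sup>2) \<le> 0" using y R3 R2 by linarith
  then have Wy: "W y \<le> 0" using \<tau> c[of y] y by (simp add: mult_le_0_iff divide_le_0_iff)
  have "W x < W y"
  proof (rule DERIV_pos_imp_increasing[of x y W])
    show "x < y" using x y by simp
    fix z assume z: "x \<le> z" "z \<le> y"
    have "0 < (n2 z + \<mu>\<^sup>2 * n z) * cos (\<mu> * z)"
      using c[of z] x y z pos[of z] by (intro mult_pos_pos) auto
    then show "\<exists>l. (W has_real_derivative l) (at z) \<and> l > 0" using dW by blast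
  qed
  then show False using Wx Wy by simp
qed

lemma circle_has_vector_derivative:
  assumes "f holomorphic_on ball 0 \<delta>" "0 < s" "s < \<delta>"
  shows "((\<lambda>\<sigma>. f (of_real s * cis \<sigma>)) has_vector_derivative
    (\<i> * (of_real s * cis \<sigma>) * deriv f (of_real s * cis \<sigma>))) (at \<sigma>)"
proof -
  have "((\<lambda>\<sigma>. of_real s * cis \<sigma>) has_vector_derivative (of_real s * (\<i> * cis \<sigma>))) (at \<sigma>)"
    unfolding cis_conv_exp
    by (rule has_vector_derivative_real_field[of "\<lambda>z. of_real s * exp (\<i> * z)"])
      (auto intro!: derivative_eq_intros)
  moreover have "(f has_field_derivative deriv f (of_real s * cis \<sigma>)) (at (of_real s * cis \<sigma>))"
    using assms by (intro holomorphic_derivI) (auto simp: norm_mult)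
  ultimately have "(f \<circ> (\<lambda>\<sigma>. of_real s * cis \<sigma>) has_vector_derivative
      (of_real s * (\<i> * cis \<sigma>)) * deriv f (of_real s * cis \<sigma>)) (at \<sigma>)"
    by (rule field_vector_diff_chain_at)
  then show ?thesis by (simp add: o_def algebra_simps)
qed

text \<open>The first two derivatives in the angle of \<open>|f|\<^sup>2\<close> on a circle about the origin.  The operator
  \<open>\<i> \<zeta> d/d\<zeta>\<close> is differentiation with respect to the angle.\<close>

lemma circle_norm_square_derivatives:
  assumes f: "f holomorphic_on ball 0 \<delta>"
  defines "f1 \<equiv> \<lambda>\<zeta>. \<i> * \<zeta> * deriv f \<zeta>"
  defines "f2 \<equiv> \<lambda>\<zeta>. \<i> * \<zeta> * deriv f1 \<zeta>"
  assumes s: "0 < s" "s < \<delta>"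
  shows "((\<lambda>\<sigma>. (norm (f (of_real s * cis \<sigma>)))\<^sup>2) has_real_derivative
      2 * (f (of_real s * cis \<sigma>) \<bullet> f1 (of_real s * cis \<sigma>))) (at \<sigma>)"
    and "((\<lambda>\<sigma>. 2 * (f (of_real s * cis \<sigma>) \<bullet> f1 (of_real s * cis \<sigma>))) has_real_derivative
      2 * (f (of_real s * cis \<sigma>) \<bullet> f2 (of_real s * cis \<sigma>) + f1 (of_real s * cis \<sigma>) \<bullet> f1 (of_real s * cis \<sigma>))) (at \<sigma>)"
proof -
  have f1h: "f1 holomorphic_on ball 0 \<delta>"
    unfolding f1_def by (intro holomorphic_intros holomorphic_deriv f) auto
  have d: "((\<lambda>\<sigma>. f (of_real s * cis \<sigma>)) has_vector_derivative f1 (of_real s * cis \<sigma>)) (at \<sigma>)" for \<sigma>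
    unfolding f1_def by (rule circle_has_vector_derivative[OF f s])
  have d1: "((\<lambda>\<sigma>. f1 (of_real s * cis \<sigma>)) has_vector_derivative f2 (of_real s * cis \<sigma>)) (at \<sigma>)" for \<sigma>
    unfolding f2_def by (rule circle_has_vector_derivative[OF f1h s])
  have "((\<lambda>\<sigma>. f (of_real s * cis \<sigma>) \<bullet> f (of_real s * cis \<sigma>)) has_vector_derivative
      (f (of_real s * cis \<sigma>) \<bullet> f1 (of_real s * cis \<sigma>) + f1 (of_real s * cis \<sigma>) \<bullet> f (of_real s * cis \<sigma>))) (at \<sigma>)"
    by (rule bounded_bilinear.has_vector_derivative[OF bounded_bilinear_inner d d])
  then show "((\<lambda>\<sigma>. (norm (f (of_real s * cis \<sigma>)))\<^sup>2) has_real_derivative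
      2 * (f (of_real s * cis \<sigma>) \<bullet> f1 (of_real s * cis \<sigma>))) (at \<sigma>)"
    by (simp add: has_real_derivative_iff_has_vector_derivative power2_norm_eq_inner inner_commute)
  have "((\<lambda>\<sigma>. f (of_real s * cis \<sigma>) \<bullet> f1 (of_real s * cis \<sigma>)) has_vector_derivative
      (f (of_real s * cis \<sigma>) \<bullet> f2 (of_real s * cis \<sigma>) + f1 (of_real s * cis \<sigma>) \<bullet> f1 (of_real s * cis \<sigma>))) (at \<sigma>)"
    by (rule bounded_bilinear.has_vector_derivative[OF bounded_bilinear_inner d d1])
  then show "((\<lambda>\<sigma>. 2 * (f (of_real s * cis \<sigma>) \<bullet> f1 (of_real s * cis \<sigma>))) has_real_derivative
      2 * (f (of_real s * cis \<sigma>) \<bullet> f2 (of_real s * cis \<sigma>) + f1 (of_real s * cis \<sigma>) \<bullet> f1 (of_real s * cis \<sigma>))) (at \<sigma>)"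
    unfolding has_real_derivative_iff_has_vector_derivative[symmetric] by (rule DERIV_cmult)
qed

text \<open>If \<open>f\<close> vanishes to order \<open>k\<close> at the origin, \<open>|f|\<^sup>2\<close> is \<open>|\<zeta>|\<^sup>2\<^sup>k\<close> times a function that tends to a
  positive constant while its angular derivatives tend to zero.  Hence \<open>N'' + M N > 0\<close> on all small circles,
  where \<open>N = |f|\<^sup>2\<close> and \<open>N1\<close>, \<open>N2\<close> are its angular derivatives.\<close>

lemma circle_convexity:
  fixes M :: real
  assumes f: "f holomorphic_on ball 0 \<rho>" and \<rho>: "0 < \<rho>" and f0: "f 0 = 0" and M: "0 < M"
  obtains \<delta> N1 N2 where "0 < \<delta>" "\<delta> \<le> \<rho>"
    "\<And>s \<sigma>. 0 < s \<Longrightarrow> s < \<delta> \<Longrightarrow>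
      ((\<lambda>\<sigma>. (norm (f (of_real s * cis \<sigma>)))\<^sup>2) has_real_derivative N1 (of_real s * cis \<sigma>)) (at \<sigma>)"
    "\<And>s \<sigma>. 0 < s \<Longrightarrow> s < \<delta> \<Longrightarrow>
      ((\<lambda>\<sigma>. N1 (of_real s * cis \<sigma>)) has_real_derivative N2 (of_real s * cis \<sigma>)) (at \<sigma>)"
    "\<And>\<zeta>::complex. \<zeta> \<noteq> 0 \<Longrightarrow> norm \<zeta> < \<delta> \<Longrightarrow> 0 \<le> N2 \<zeta> + M * (norm (f \<zeta>))\<^sup>2"
    "\<And>\<zeta>::complex. \<not> f constant_on ball 0 \<rho> \<Longrightarrow> \<zeta> \<noteq> 0 \<Longrightarrow> norm \<zeta> < \<delta> \<Longrightarrow>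
       f \<zeta> \<noteq> 0 \<and> 0 < N2 \<zeta> + M * (norm (f \<zeta>))\<^sup>2"
proof (cases "f constant_on ball 0 \<rho>")
  case True
  then obtain c where "\<And>\<zeta>. norm \<zeta> < \<rho> \<Longrightarrow> f \<zeta> = c" by (auto simp: constant_on_def)
  then have z: "f \<zeta> = 0" if "norm \<zeta> < \<rho>" for \<zeta>
    using that f0 \<rho> by (metis norm_zero)
  have "((\<lambda>\<sigma>. (norm (f (of_real s * cis \<sigma>)))\<^sup>2) has_real_derivative 0) (at \<sigma>)" if "0 < s" "s < \<rho>" for s \<sigma>
    using that by (simp add: z norm_mult)
  then show ?thesis
    using True M \<rho> by (intro that[of \<rho> "\<lambda>_. 0" "\<lambda>_. 0"]) auto
next
  case False
  have z0: "(0::complex) \<in> ball 0 \<rho>" using \<rho> by simp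
  obtain g \<rho>' k where k: "0 < k" and \<rho>': "0 < \<rho>'" "ball (0::complex) \<rho>' \<subseteq> ball 0 \<rho>"
    and g: "g holomorphic_on ball 0 \<rho>'" and fg: "\<And>w. w \<in> ball 0 \<rho>' \<Longrightarrow> f w = (w - 0) ^ k * g w"
    and gnz: "\<And>w. w \<in> ball 0 \<rho>' \<Longrightarrow> g w \<noteq> 0"
  proof (rule holomorphic_factor_zero_nonconstant[OF f open_ball connected_ball z0 f0 False])
    fix g r and n :: nat
    assume "0 < n" "0 < r" "ball (0::complex) r \<subseteq> ball 0 \<rho>" "g holomorphic_on ball 0 r"
      "\<And>w. w \<in> ball 0 r \<Longrightarrow> f w = (w - 0) ^ n * g w" "\<And>w. w \<in> ball 0 r \<Longrightarrow> g w \<noteq> 0"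
    then show thesis by (rule that)
  qed
  define g1 where "g1 = (\<lambda>\<zeta>. \<i> * \<zeta> * deriv g \<zeta>)"
  define g2 where "g2 = (\<lambda>\<zeta>. \<i> * \<zeta> * deriv g1 \<zeta>)"
  have g1h: "g1 holomorphic_on ball 0 \<rho>'"
    unfolding g1_def by (intro holomorphic_intros holomorphic_deriv g) auto
  have g2h: "g2 holomorphic_on ball 0 \<rho>'"
    unfolding g2_def by (intro holomorphic_intros holomorphic_deriv g1h) auto
  define Q where "Q \<zeta> = 2 * (g \<zeta> \<bullet> g2 \<zeta> + g1 \<zeta> \<bullet> g1 \<zeta>) + M * (norm (g \<zeta>))\<^sup>2" for \<zeta>
  have cQ: "continuous_on (ball 0 \<rho>') Q"
    unfolding Q_def by (intro continuous_intros holomorphic_on_imp_continuous_on g g1h g2h)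
  have "0 < Q 0" using M gnz[of 0] \<rho>' by (simp add: Q_def g1_def g2_def)
  have "isCont Q 0" using cQ \<rho>' by (simp add: continuous_on_eq_continuous_at)
  then obtain \<delta>0 where \<delta>0: "\<delta>0 > 0" "\<And>\<zeta>. dist \<zeta> 0 < \<delta>0 \<Longrightarrow> dist (Q \<zeta>) (Q 0) < Q 0"
    using \<open>0 < Q 0\<close> unfolding continuous_at_eps_delta by blast
  then have Qp: "0 < Q \<zeta>" if "norm \<zeta> < \<delta>0" for \<zeta>
  proof -
    have "\<bar>Q \<zeta> - Q 0\<bar> < Q 0" using that \<delta>0(2)[of \<zeta>] by (simp add: dist_real_def)
    then show ?thesis by linarith
  qed
  define \<delta> where "\<delta> = min \<delta>0 \<rho>'"
  define N1 where "N1 \<zeta> = norm \<zeta> ^ (2 * k) * (2 * (g \<zeta> \<bullet> g1 \<zeta>))" for \<zeta>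
  define N2 where "N2 \<zeta> = norm \<zeta> ^ (2 * k) * (2 * (g \<zeta> \<bullet> g2 \<zeta> + g1 \<zeta> \<bullet> g1 \<zeta>))" for \<zeta>
  have nf: "(norm (f \<zeta>))\<^sup>2 = norm \<zeta> ^ (2 * k) * (norm (g \<zeta>))\<^sup>2" if "norm \<zeta> < \<delta>" for \<zeta>
    using fg[of \<zeta>] that by (simp add: \<delta>_def norm_mult norm_power power_mult_distrib power_mult[symmetric] mult.commute)
  have gs: "g holomorphic_on ball 0 \<delta>" using g by (rule holomorphic_on_subset) (auto simp: \<delta>_def)
  have P: "0 < N2 \<zeta> + M * (norm (f \<zeta>))\<^sup>2" if "\<zeta> \<noteq> 0" "norm \<zeta> < \<delta>" for \<zeta>
  proof -
    have "N2 \<zeta> + M * (norm (f \<zeta>))\<^sup>2 = norm \<zeta> ^ (2 * k) * Q \<zeta>"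
      unfolding nf[OF that(2)] N2_def Q_def by (simp add: algebra_simps)
    then show ?thesis using that Qp[of \<zeta>] by (simp add: \<delta>_def)
  qed
  show ?thesis
  proof (rule that[of \<delta> N1 N2])
    show "0 < \<delta>" using \<delta>0 \<rho>' by (simp add: \<delta>_def)
    show "\<delta> \<le> \<rho>" using \<rho>' by (auto simp: \<delta>_def ball_subset_ball_iff)
    fix s \<sigma> :: real assume s: "0 < s" "s < \<delta>"
    have eq: "(\<lambda>\<sigma>. (norm (f (of_real s * cis \<sigma>)))\<^sup>2) = (\<lambda>\<sigma>. s ^ (2 * k) * (norm (g (of_real s * cis \<sigma>)))\<^sup>2)"
      using s by (auto simp: nf norm_mult)
    show "((\<lambda>\<sigma>. (norm (f (of_real s * cis \<sigma>)))\<^sup>2) has_real_derivative N1 (of_real s * cis \<sigma>)) (at \<sigma>)"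
      unfolding eq using DERIV_cmult[OF circle_norm_square_derivatives(1)[OF gs s], of "s ^ (2 * k)" \<sigma>] s
      by (simp add: N1_def g1_def norm_mult)
    have eq1: "(\<lambda>\<sigma>. N1 (of_real s * cis \<sigma>)) = (\<lambda>\<sigma>. s ^ (2 * k) * (2 * (g (of_real s * cis \<sigma>) \<bullet> g1 (of_real s * cis \<sigma>))))"
      using s by (auto simp: N1_def norm_mult)
    show "((\<lambda>\<sigma>. N1 (of_real s * cis \<sigma>)) has_real_derivative N2 (of_real s * cis \<sigma>)) (at \<sigma>)"
      unfolding eq1 using DERIV_cmult[OF circle_norm_square_derivatives(2)[OF gs s], of "s ^ (2 * k)" \<sigma>] s
      by (simp add: N2_def g1_def g2_def norm_mult)
  next
    fix \<zeta> :: complex assume "\<zeta> \<noteq> 0" "norm \<zeta> < \<delta>"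
    then show "0 \<le> N2 \<zeta> + M * (norm (f \<zeta>))\<^sup>2" using P by (simp add: less_imp_le)
    show "f \<zeta> \<noteq> 0 \<and> 0 < N2 \<zeta> + M * (norm (f \<zeta>))\<^sup>2"
      using P[of \<zeta>] \<open>\<zeta> \<noteq> 0\<close> \<open>norm \<zeta> < \<delta>\<close> fg[of \<zeta>] gnz[of \<zeta>] by (simp add: \<delta>_def)
  qed
qed

context proper_disc
begin

text \<open>The local picture at a point \<open>p\<close> of the level set \<open>|\<phi>| = t\<close>.  The scalar function
  \<open>q z = \<langle>\<phi> z - \<phi> p, \<phi> p\<rangle>\<close> is holomorphic with \<open>|\<phi>|\<^sup>2 - t\<^sup>2 = 2 Re q + |\<phi> - \<phi> p|\<^sup>2\<close>.  In a local coordinate \<open>\<zeta>\<close>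
  with \<open>q = - \<zeta>\<^sup>m\<close>, the function becomes \<open>G \<zeta> = |\<phi> - \<phi> p|\<^sup>2 - 2 Re \<zeta>\<^sup>m\<close>.  It is nonpositive only in the \<open>m\<close> sectors
  (called valleys below) where \<open>Re \<zeta>\<^sup>m > 0\<close>, and by Sturm comparison each circle about the origin meets
  \<open>{G \<le> 0}\<close> in at most one arc per valley, with \<open>G < 0\<close> in the interior of the arc.\<close>

lemma local_normal_form:
  assumes p: "p \<in> D" and t: "norm (\<phi> p) = t" and cl: "p \<in> closure {z \<in> D. norm (\<phi> z) < t}"
  obtains m :: nat and \<rho> :: real and e :: "complex \<Rightarrow> complex" and G :: "complex \<Rightarrow> real"
  where "0 < m" "0 < \<rho>" "e holomorphic_on ball 0 \<rho>" "inj_on e (ball 0 \<rho>)" "e 0 = p" "e ` ball 0 \<rho> \<subseteq> D"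
    "\<And>\<zeta>. \<zeta> \<in> ball 0 \<rho> \<Longrightarrow> (norm (\<phi> (e \<zeta>)))\<^sup>2 - t\<^sup>2 = G \<zeta>"
    "\<And>\<zeta>. \<zeta> \<in> ball 0 \<rho> \<Longrightarrow> \<zeta> \<noteq> 0 \<Longrightarrow> G \<zeta> \<le> 0 \<Longrightarrow> 0 < Re (\<zeta> ^ m)"
    "\<And>s \<theta> \<tau>1 \<tau>2 \<tau>3. 0 < s \<Longrightarrow> s < \<rho> \<Longrightarrow> cis (of_nat m * \<theta>) = 1 \<Longrightarrow>
       - pi / (2 * real m) < \<tau>1 \<Longrightarrow> \<tau>1 < \<tau>2 \<Longrightarrow> \<tau>2 < \<tau>3 \<Longrightarrow> \<tau>3 < pi / (2 * real m) \<Longrightarrow>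
       G (of_real s * cis (\<theta> + \<tau>1)) \<le> 0 \<Longrightarrow> G (of_real s * cis (\<theta> + \<tau>3)) \<le> 0 \<Longrightarrow>
       G (of_real s * cis (\<theta> + \<tau>2)) < 0"
proof -
  define q where "q z = (\<Sum>i\<in>UNIV. (\<phi> z $ i - \<phi> p $ i) * cnj (\<phi> p $ i))" for z
  have qhol: "q holomorphic_on D"
    unfolding q_def by (intro holomorphic_intros hol_comp)
  have q0: "q p = 0" by (simp add: q_def)
  have req: "Re (q z) = (\<phi> z - \<phi> p) \<bullet> \<phi> p" for z
    by (simp add: q_def inner_vec_def inner_complex_def)
  have sq: "(norm (\<phi> z))\<^sup>2 - t\<^sup>2 = 2 * Re (q z) + (norm (\<phi> z - \<phi> p))\<^sup>2" for z
    unfolding req t[symmetric] power2_norm_eq_inner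
    by (simp add: inner_diff_left inner_diff_right inner_commute)
  have t0: "0 \<le> t" using t by auto
  have qnc: "\<not> q constant_on D"
  proof
    assume "q constant_on D"
    then have "q z = 0" if "z \<in> D" for z using q0 p that by (auto simp: constant_on_def)
    then have "(norm (\<phi> z))\<^sup>2 - t\<^sup>2 = (norm (\<phi> z - \<phi> p))\<^sup>2" if "z \<in> D" for z using sq[of z] that by simp
    then have "t\<^sup>2 \<le> (norm (\<phi> z))\<^sup>2" if "z \<in> D" for z
      using that by (smt (verit) zero_le_power2)
    then have "t \<le> norm (\<phi> z)" if "z \<in> D" for z
      using power2_le_imp_le[of t "norm (\<phi> z)"] that by simp
    then have emp: "{z \<in> D. norm (\<phi> z) < t} = {}" by fastforce
    show False using cl unfolding emp by simp
  qed
  have "\<exists>n>0. (deriv ^^ n) q p \<noteq> 0"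
  proof (rule ccontr)
    assume "\<not> ?thesis"
    then have "q z = q p" if "z \<in> D" for z
      using holomorphic_fun_eq_const_on_connected[OF qhol open_D connected_D _ p that] by blast
    then show False using qnc by (auto simp: constant_on_def)
  qed
  note ex = this
  define m where "m = (LEAST n. 0 < n \<and> (deriv ^^ n) q p \<noteq> 0)"
  have m: "0 < m" and mnz: "(deriv ^^ m) q p \<noteq> 0"
    using LeastI_ex[OF ex] unfolding m_def by simp_all
  have mlt: "(deriv ^^ i) q p = 0" if "0 < i" "i < m" for i
  proof -
    have "\<not> (0 < i \<and> (deriv ^^ i) q p \<noteq> 0)"
      by (rule not_less_Least) (use that(2) in \<open>simp only: m_def\<close>)
    then show ?thesis using that(1) by simp
  qed
  obtain g \<rho>0 where \<rho>0: "0 < \<rho>0" and g0: "g holomorphic_on ball p \<rho>0"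
    and qg0: "\<And>w. w \<in> ball p \<rho>0 \<Longrightarrow> q w - q p = ((w - p) * g w) ^ m"
    and gnz0: "\<And>w. w \<in> ball p \<rho>0 \<Longrightarrow> g w \<noteq> 0"
  proof (rule holomorphic_factor_order_of_zero_strong[OF qhol open_D p m mnz])
    show "(deriv ^^ i) q p = 0" if "0 < i" "i < m" for i using mlt[OF that] .
  next
    fix g r
    assume "0 < r" "g holomorphic_on ball p r" "\<And>w. w \<in> ball p r \<Longrightarrow> q w - q p = ((w - p) * g w) ^ m"
      "\<And>w. w \<in> ball p r \<Longrightarrow> g w \<noteq> 0"
    then show thesis by (rule that)
  qed
  obtain \<rho>1' where \<rho>1': "0 < \<rho>1'" "ball p \<rho>1' \<subseteq> D" using open_D p by (meson openE)
  define \<rho>1 where "\<rho>1 = min \<rho>0 \<rho>1'"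
  have \<rho>1: "0 < \<rho>1" "ball p \<rho>1 \<subseteq> D" using \<rho>0 \<rho>1' by (auto simp: \<rho>1_def)
  have g: "g holomorphic_on ball p \<rho>1"
    using g0 by (rule holomorphic_on_subset) (auto simp: \<rho>1_def)
  have gnz: "g w \<noteq> 0" and qg: "q w = ((w - p) * g w) ^ m" if "w \<in> ball p \<rho>1" for w
    using that gnz0[of w] qg0[of w] q0 by (auto simp: \<rho>1_def)
  \<comment> \<open>an \<open>m\<close>-th root of \<open>-1\<close>, which produces the sign in \<open>q = - \<zeta>\<^sup>m\<close>\<close>
  define \<kappa> where "\<kappa> = cis (pi / m)"
  have \<kappa>m: "\<kappa> ^ m = -1" using m by (simp add: \<kappa>_def Complex.DeMoivre)
  have \<kappa>0: "\<kappa> \<noteq> 0" by (simp add: \<kappa>_def)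
  define Z where "Z w = (w - p) * g w / \<kappa>" for w
  have Zh: "Z holomorphic_on ball p \<rho>1"
    unfolding Z_def using \<kappa>0 by (intro holomorphic_intros g) auto
  have Zm: "Z w ^ m = - q w" if "w \<in> ball p \<rho>1" for w
    using qg[OF that] by (simp add: Z_def power_divide \<kappa>m)
  have "(Z has_field_derivative ((1 * g p + deriv g p * (p - p)) / \<kappa>)) (at p)"
    unfolding Z_def using \<rho>1
    by (auto intro!: derivative_eq_intros holomorphic_derivI[OF g] simp: \<kappa>0)
  then have dz: "deriv Z p \<noteq> 0" using gnz[of p] \<rho>1 \<kappa>0 by (auto dest!: DERIV_imp_deriv)
  have pin: "p \<in> ball p \<rho>1" using \<rho>1 by simp
  obtain \<rho>2 where \<rho>2: "0 < \<rho>2" "ball p \<rho>2 \<subseteq> ball p \<rho>1" "open (Z ` ball p \<rho>2)" "inj_on Z (ball p \<rho>2)"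
    by (rule has_complex_derivative_locally_invertible[OF Zh pin open_ball dz])
  have Zh2: "Z holomorphic_on ball p \<rho>2" using Zh \<rho>2 holomorphic_on_subset by blast
  obtain e0 where e0: "e0 holomorphic_on Z ` ball p \<rho>2" "\<And>z. z \<in> ball p \<rho>2 \<Longrightarrow> e0 (Z z) = z"
    using holomorphic_has_inverse[OF Zh2 open_ball \<rho>2(4)] by metis
  have Zp: "Z p = 0" by (simp add: Z_def)
  then have "0 \<in> Z ` ball p \<rho>2" using \<rho>2 by force
  then obtain \<rho>3 where \<rho>3: "0 < \<rho>3" "ball 0 \<rho>3 \<subseteq> Z ` ball p \<rho>2" using \<rho>2(3) by (meson openE)
  have e0b: "e0 \<zeta> \<in> ball p \<rho>2" "Z (e0 \<zeta>) = \<zeta>" if "\<zeta> \<in> ball 0 \<rho>3" for \<zeta>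
    using that \<rho>3 e0(2) by auto
  have e0D: "e0 \<zeta> \<in> D" if "\<zeta> \<in> ball 0 \<rho>3" for \<zeta>
    using e0b[OF that] \<rho>2 \<rho>1 by blast
  have e0h: "e0 holomorphic_on ball 0 \<rho>3" using e0(1) \<rho>3 holomorphic_on_subset by blast
  have e00: "e0 0 = p" using e0(2)[of p] Zp \<rho>2 by simp
  define f where "f i \<zeta> = \<phi> (e0 \<zeta>) $ i - \<phi> p $ i" for i \<zeta>
  have fh: "f i holomorphic_on ball 0 \<rho>3" for i
    unfolding f_def using e0D
    by (intro holomorphic_intros holomorphic_on_compose_gen[OF e0h hol_comp, unfolded o_def]) auto
  have f0: "f i 0 = 0" for i by (simp add: f_def e00)
  define Pr where "Pr i \<delta> N1 N2 \<longleftrightarrow> 0 < \<delta> \<and> \<delta> \<le> \<rho>3 \<and>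
    (\<forall>s \<sigma>. 0 < s \<longrightarrow> s < \<delta> \<longrightarrow>
      ((\<lambda>\<sigma>. (norm (f i (of_real s * cis \<sigma>)))\<^sup>2) has_real_derivative N1 (of_real s * cis \<sigma>)) (at \<sigma>)) \<and>
    (\<forall>s \<sigma>. 0 < s \<longrightarrow> s < \<delta> \<longrightarrow>
      ((\<lambda>\<sigma>. N1 (of_real s * cis \<sigma>)) has_real_derivative N2 (of_real s * cis \<sigma>)) (at \<sigma>)) \<and>
    (\<forall>\<zeta>::complex. \<zeta> \<noteq> 0 \<longrightarrow> norm \<zeta> < \<delta> \<longrightarrow> 0 \<le> N2 \<zeta> + (real m)\<^sup>2 * (norm (f i \<zeta>))\<^sup>2) \<and>
    (\<forall>\<zeta>::complex. \<not> f i constant_on ball 0 \<rho>3 \<longrightarrow> \<zeta> \<noteq> 0 \<longrightarrow> norm \<zeta> < \<delta> \<longrightarrow>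
       f i \<zeta> \<noteq> 0 \<and> 0 < N2 \<zeta> + (real m)\<^sup>2 * (norm (f i \<zeta>))\<^sup>2)" for i \<delta> N1 N2
  have "\<forall>i. \<exists>\<delta> N1 N2. Pr i \<delta> N1 N2"
  proof
    fix i
    obtain \<delta> N1 N2 where H1: "0 < \<delta>" and H2: "\<delta> \<le> \<rho>3"
    and H3: "\<And>s \<sigma>. 0 < s \<Longrightarrow> s < \<delta> \<Longrightarrow>
      ((\<lambda>\<sigma>. (norm (f i (of_real s * cis \<sigma>)))\<^sup>2) has_real_derivative N1 (of_real s * cis \<sigma>)) (at \<sigma>)"
    and H4: "\<And>s \<sigma>. 0 < s \<Longrightarrow> s < \<delta> \<Longrightarrow>
      ((\<lambda>\<sigma>. N1 (of_real s * cis \<sigma>)) has_real_derivative N2 (of_real s * cis \<sigma>)) (at \<sigma>)"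
    and H5: "\<And>\<zeta>::complex. \<zeta> \<noteq> 0 \<Longrightarrow> norm \<zeta> < \<delta> \<Longrightarrow> 0 \<le> N2 \<zeta> + (real m)\<^sup>2 * (norm (f i \<zeta>))\<^sup>2"
    and H6: "\<And>\<zeta>::complex. \<not> f i constant_on ball 0 \<rho>3 \<Longrightarrow> \<zeta> \<noteq> 0 \<Longrightarrow> norm \<zeta> < \<delta> \<Longrightarrow>
       f i \<zeta> \<noteq> 0 \<and> 0 < N2 \<zeta> + (real m)\<^sup>2 * (norm (f i \<zeta>))\<^sup>2"
      by (rule circle_convexity[OF fh[of i] \<rho>3(1) f0[of i], of "(real m)\<^sup>2"]) (use m in auto)
    have "Pr i \<delta> N1 N2" unfolding Pr_def
    proof (intro conjI allI impI)
      fix \<zeta> :: complex assume "\<not> f i constant_on ball 0 \<rho>3" "\<zeta> \<noteq> 0" "norm \<zeta> < \<delta>"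
      from H6[OF this] show "f i \<zeta> \<noteq> 0" "0 < N2 \<zeta> + (real m)\<^sup>2 * (norm (f i \<zeta>))\<^sup>2" by blast+
    qed (fact H1 H2 H3 H4 H5 | rule H3 H4 H5, assumption+)+
    then show "\<exists>\<delta> N1 N2. Pr i \<delta> N1 N2" by blast
  qed
  then obtain \<delta> N1 N2 where Pr: "\<And>i. Pr i (\<delta> i) (N1 i) (N2 i)" by metis
  note P = Pr[unfolded Pr_def, THEN conjunct1] Pr[unfolded Pr_def, THEN conjunct2, THEN conjunct1]
    Pr[unfolded Pr_def, THEN conjunct2, THEN conjunct2, THEN conjunct1]
    Pr[unfolded Pr_def, THEN conjunct2, THEN conjunct2, THEN conjunct2, THEN conjunct1]
    Pr[unfolded Pr_def, THEN conjunct2, THEN conjunct2, THEN conjunct2, THEN conjunct2, THEN conjunct1]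
    Pr[unfolded Pr_def, THEN conjunct2, THEN conjunct2, THEN conjunct2, THEN conjunct2, THEN conjunct2]
  have \<delta>: "\<And>i. 0 < \<delta> i" "\<And>i. \<delta> i \<le> \<rho>3"
    and d1: "\<And>i s \<sigma>. 0 < s \<Longrightarrow> s < \<delta> i \<Longrightarrow>
      ((\<lambda>\<sigma>. (norm (f i (of_real s * cis \<sigma>)))\<^sup>2) has_real_derivative N1 i (of_real s * cis \<sigma>)) (at \<sigma>)"
    and d2: "\<And>i s \<sigma>. 0 < s \<Longrightarrow> s < \<delta> i \<Longrightarrow>
      ((\<lambda>\<sigma>. N1 i (of_real s * cis \<sigma>)) has_real_derivative N2 i (of_real s * cis \<sigma>)) (at \<sigma>)"
    and nn: "\<And>i \<zeta>. \<zeta> \<noteq> 0 \<Longrightarrow> norm \<zeta> < \<delta> i \<Longrightarrow> 0 \<le> N2 i \<zeta> + (real m)\<^sup>2 * (norm (f i \<zeta>))\<^sup>2"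
    and pp: "\<And>i \<zeta>. \<not> f i constant_on ball 0 \<rho>3 \<Longrightarrow> \<zeta> \<noteq> 0 \<Longrightarrow> norm \<zeta> < \<delta> i \<Longrightarrow>
         f i \<zeta> \<noteq> 0 \<and> 0 < N2 i \<zeta> + (real m)\<^sup>2 * (norm (f i \<zeta>))\<^sup>2"
    by (fact P(1) P(2) P(3)[rule_format] P(4)[rule_format] P(5)[rule_format] P(6)[rule_format])+
  define \<rho> where "\<rho> = Min (range \<delta>)"
  have \<rho>: "0 < \<rho>" "\<And>i. \<rho> \<le> \<delta> i" using \<delta> by (auto simp: \<rho>_def)
  have \<rho>\<rho>3: "\<rho> \<le> \<rho>3" using \<delta>(2)[of undefined] \<rho>(2)[of undefined] by linarith
  \<comment> \<open>strict convexity of the sum needs one nonconstant component, and \<open>q\<close> is not constant\<close>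
  obtain j where j: "\<not> f j constant_on ball 0 \<rho>3"
  proof -
    have False if c: "\<And>i. f i constant_on ball 0 \<rho>3"
    proof -
      define \<zeta> where "\<zeta> = (of_real (\<rho>3 / 2) :: complex)"
      have \<zeta>: "\<zeta> \<in> ball 0 \<rho>3" "\<zeta> \<noteq> 0" using \<rho>3 by (auto simp: \<zeta>_def)
      have "f i \<zeta> = 0" for i
      proof -
        obtain k where "\<And>x. x \<in> ball 0 \<rho>3 \<Longrightarrow> f i x = k" using c[of i] unfolding constant_on_def by blast
        then have "f i \<zeta> = f i 0" using \<zeta>(1) \<rho>3(1) by simp
        then show ?thesis using f0 by simp
      qed
      then have "q (e0 \<zeta>) = 0" by (simp add: q_def f_def)
      moreover have "e0 \<zeta> \<in> ball p \<rho>1" using e0b[OF \<zeta>(1)] \<rho>2 by blast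
      ultimately have "\<zeta> ^ m = 0" using Zm[of "e0 \<zeta>"] e0b[OF \<zeta>(1)] by simp
      then show False using \<zeta> by simp
    qed
    then show thesis using that by blast
  qed
  define N where "N \<zeta> = (\<Sum>i\<in>UNIV. (norm (f i \<zeta>))\<^sup>2)" for \<zeta>
  define M1 where "M1 \<zeta> = (\<Sum>i\<in>UNIV. N1 i \<zeta>)" for \<zeta>
  define M2 where "M2 \<zeta> = (\<Sum>i\<in>UNIV. N2 i \<zeta>)" for \<zeta>
  define G where "G \<zeta> = N \<zeta> - 2 * Re (\<zeta> ^ m)" for \<zeta>
  have D1: "((\<lambda>\<sigma>. N (of_real s * cis \<sigma>)) has_real_derivative M1 (of_real s * cis \<sigma>)) (at \<sigma>)"
    and D2: "((\<lambda>\<sigma>. M1 (of_real s * cis \<sigma>)) has_real_derivative M2 (of_real s * cis \<sigma>)) (at \<sigma>)"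
    if "0 < s" "s < \<rho>" for s \<sigma>
  proof -
    have lt: "s < \<delta> i" for i using that(2) \<rho>(2)[of i] by linarith
    show "((\<lambda>\<sigma>. N (of_real s * cis \<sigma>)) has_real_derivative M1 (of_real s * cis \<sigma>)) (at \<sigma>)"
      unfolding N_def M1_def by (rule DERIV_sum) (rule d1[OF that(1) lt])
    show "((\<lambda>\<sigma>. M1 (of_real s * cis \<sigma>)) has_real_derivative M2 (of_real s * cis \<sigma>)) (at \<sigma>)"
      unfolding M1_def M2_def by (rule DERIV_sum) (rule d2[OF that(1) lt])
  qed
  have P: "0 < M2 \<zeta> + (real m)\<^sup>2 * N \<zeta>" if "\<zeta> \<noteq> 0" "norm \<zeta> < \<rho>" for \<zeta>
  proof -
    have lt: "norm \<zeta> < \<delta> i" for i using that(2) \<rho>(2)[of i] by linarith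
    have "0 < (\<Sum>i\<in>UNIV. N2 i \<zeta> + (real m)\<^sup>2 * (norm (f i \<zeta>))\<^sup>2)"
      by (rule sum_pos2[of UNIV j]) (use pp[OF j that(1) lt] nn[OF that(1) lt] in auto)
    then show ?thesis by (simp add: M2_def N_def sum.distrib sum_distrib_left)
  qed
  have N0: "0 < N \<zeta>" if "\<zeta> \<noteq> 0" "norm \<zeta> < \<rho>" for \<zeta>
  proof -
    have "norm \<zeta> < \<delta> j" using that(2) \<rho>(2)[of j] by linarith
    then have "0 < (norm (f j \<zeta>))\<^sup>2" using pp[OF j that(1)] by simp
    then show ?thesis unfolding N_def by (intro sum_pos2[of UNIV j]) simp_all
  qed
  have main: "(norm (\<phi> (e0 \<zeta>)))\<^sup>2 - t\<^sup>2 = G \<zeta>" if "\<zeta> \<in> ball 0 \<rho>" for \<zeta>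
  proof -
    have z3: "\<zeta> \<in> ball 0 \<rho>3" using that \<rho>\<rho>3 by auto
    have "N \<zeta> = (norm (\<phi> (e0 \<zeta>) - \<phi> p))\<^sup>2"
      by (simp add: N_def f_def norm_vec_def L2_set_def sum_nonneg)
    moreover have "e0 \<zeta> \<in> ball p \<rho>1" using e0b[OF z3] \<rho>2 by blast
    then have "q (e0 \<zeta>) = - (\<zeta> ^ m)" using Zm[of "e0 \<zeta>"] e0b[OF z3] by simp
    ultimately show ?thesis using sq[of "e0 \<zeta>"] by (simp add: G_def)
  qed
  have Re_pow: "Re ((of_real s * cis (\<theta> + \<tau>)) ^ m) = s ^ m * cos (real m * \<tau>)"
    if "cis (of_nat m * \<theta>) = 1" for s \<theta> \<tau>
  proof -
    have "(of_real s * cis (\<theta> + \<tau>)) ^ m = of_real (s ^ m) * (cis (of_nat m * \<theta>) * cis (real m * \<tau>))"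
      by (simp add: power_mult_distrib Complex.DeMoivre cis_mult distrib_left)
    then show ?thesis using that by simp
  qed
  show ?thesis
  proof (rule that[of m \<rho> e0 G])
    show "e0 holomorphic_on ball 0 \<rho>" using e0h \<rho>\<rho>3 by (auto intro: holomorphic_on_subset)
    show "inj_on e0 (ball 0 \<rho>)"
      by (rule inj_on_inverseI[of _ Z]) (use e0b \<rho>\<rho>3 in auto)
    show "e0 ` ball 0 \<rho> \<subseteq> D" using e0D \<rho>\<rho>3 by auto
    show "(norm (\<phi> (e0 \<zeta>)))\<^sup>2 - t\<^sup>2 = G \<zeta>" if "\<zeta> \<in> ball 0 \<rho>" for \<zeta> using main[OF that] .
    show "0 < Re (\<zeta> ^ m)" if "\<zeta> \<in> ball 0 \<rho>" "\<zeta> \<noteq> 0" "G \<zeta> \<le> 0" for \<zeta>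
      using N0[of \<zeta>] that by (simp add: G_def)
    fix s \<theta> \<tau>1 \<tau>2 \<tau>3 :: real
    assume s: "0 < s" "s < \<rho>" and \<theta>: "cis (of_nat m * \<theta>) = 1"
      and \<tau>: "- pi / (2 * real m) < \<tau>1" "\<tau>1 < \<tau>2" "\<tau>2 < \<tau>3" "\<tau>3 < pi / (2 * real m)"
      and le: "G (of_real s * cis (\<theta> + \<tau>1)) \<le> 0" "G (of_real s * cis (\<theta> + \<tau>3)) \<le> 0"
    have "N (of_real s * cis (\<theta> + \<tau>2)) < (2 * s ^ m) * cos (real m * \<tau>2)"
    proof (rule sturm_valley[of "real m" "\<lambda>\<tau>. N (of_real s * cis (\<theta> + \<tau>))"
          "\<lambda>\<tau>. M1 (of_real s * cis (\<theta> + \<tau>))" "\<lambda>\<tau>. M2 (of_real s * cis (\<theta> + \<tau>))" \<tau>1 \<tau>2 \<tau>3])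
      show "((\<lambda>\<tau>. N (of_real s * cis (\<theta> + \<tau>))) has_real_derivative M1 (of_real s * cis (\<theta> + \<tau>))) (at \<tau>)" for \<tau>
        using DERIV_shift[THEN iffD1, OF D1[OF s, of "\<tau> + \<theta>"]] by (simp add: add.commute)
      show "((\<lambda>\<tau>. M1 (of_real s * cis (\<theta> + \<tau>))) has_real_derivative M2 (of_real s * cis (\<theta> + \<tau>))) (at \<tau>)" for \<tau>
        using DERIV_shift[THEN iffD1, OF D2[OF s, of "\<tau> + \<theta>"]] by (simp add: add.commute)
      show "0 < M2 (of_real s * cis (\<theta> + \<tau>)) + (real m)\<^sup>2 * N (of_real s * cis (\<theta> + \<tau>))" for \<tau>
        using P[of "of_real s * cis (\<theta> + \<tau>)"] s by (simp add: norm_mult)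
      show "0 < real m" using m by simp
      show "N (of_real s * cis (\<theta> + \<tau>1)) \<le> (2 * s ^ m) * cos (real m * \<tau>1)"
        "N (of_real s * cis (\<theta> + \<tau>3)) \<le> (2 * s ^ m) * cos (real m * \<tau>3)"
        using le unfolding G_def Re_pow[OF \<theta>] by simp_all
    qed (fact \<tau>)+
    then show "G (of_real s * cis (\<theta> + \<tau>2)) < 0"
      unfolding G_def Re_pow[OF \<theta>] by simp
  qed (fact m \<rho>(1) e00 main)+
qed

end

section \<open>Local connectivity at the frontier of a component\<close>

text \<open>A component \<open>C\<close> of the open sublevel set \<open>|\<phi>| < R0\<close>.\<close>

locale proper_disc_component = proper_disc \<phi> D a r R1
  for \<phi> :: "complex \<Rightarrow> complex ^ 'n" and D a r R1 +
  fixes R0 :: real and C :: "complex set"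
  assumes R0_pos: "0 < R0" and R0_less: "R0 < R1"
    and C_comp: "C \<in> components {z \<in> D. norm (\<phi> z) < R0}"
begin

lemma open_sublevel: "open {z \<in> D. norm (\<phi> z) < t}"
proof -
  have "{z \<in> D. norm (\<phi> z) < t} = D \<inter> \<phi> -` ball 0 t" by auto
  then show ?thesis using continuous_open_preimage[OF continuous_phi open_D open_ball] by metis
qed

lemma open_C: "open C" using open_components[OF open_sublevel C_comp] .
lemma connected_C: "connected C" using C_comp in_components_connected by blast
lemma C_ne: "C \<noteq> {}" using C_comp in_components_nonempty by blast
lemma C_sub: "C \<subseteq> {z \<in> D. norm (\<phi> z) < R0}" using C_comp in_components_subset by blast
lemma C_sub_D: "C \<subseteq> D" using C_sub by auto
lemma C_max: "connected T \<Longrightarrow> T \<subseteq> {z \<in> D. norm (\<phi> z) < R0} \<Longrightarrow> C \<inter> T \<noteq> {} \<Longrightarrow> T \<subseteq> C"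
  by (rule components_maximal[OF C_comp])

lemma closure_C_sub: "closure C \<subseteq> {z \<in> D. norm (\<phi> z) \<le> R0}"
  by (rule closure_minimal) (use C_sub compact_imp_closed[OF compact_sublevel[OF R0_less]] in auto)

lemma compact_closure_C: "compact (closure C)"
  using closure_C_sub compact_sublevel[OF R0_less] bounded_subset compact_imp_bounded
  by (metis closed_closure compact_eq_bounded_closed)

lemma frontier_C: "p \<in> frontier C \<Longrightarrow> p \<in> D \<and> norm (\<phi> p) = R0 \<and> p \<notin> C"
proof -
  assume p: "p \<in> frontier C"
  then have pD: "p \<in> D" "norm (\<phi> p) \<le> R0" and pC: "p \<notin> C"
    using closure_C_sub open_C by (auto simp: frontier_def interior_open)
  have "\<not> norm (\<phi> p) < R0"
  proof
    assume "norm (\<phi> p) < R0"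
    then obtain e where e: "e > 0" "ball p e \<subseteq> {z \<in> D. norm (\<phi> z) < R0}"
      using open_sublevel pD by (metis (mono_tags, lifting) mem_Collect_eq openE)
    obtain y where "y \<in> C" "dist y p < e"
      using p e(1) by (auto simp: frontier_def closure_approachable)
    then have "C \<inter> ball p e \<noteq> {}" by (auto simp: dist_commute)
    then have "ball p e \<subseteq> C" using C_max[OF connected_ball e(2)] by blast
    then show False using pC e by (meson centre_in_ball subsetD)
  qed
  then show ?thesis using pD pC by auto
qed

text \<open>A loop in \<open>C\<close> has winding number zero about each point \<open>z\<close> outside of \<open>C\<close>: by the maximum principle every
  bounded component of the complement of the loop lies in the sublevel set and hence in \<open>C\<close>.\<close>

lemma simply_connected_C: "simply_connected C"
proof -
  have "winding_number g z = 0" if g: "path g" "path_image g \<subseteq> C" "pathfinish g = pathstart g" and z: "z \<notin> C" for g z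
  proof -
    let ?K = "path_image g"
    have K: "compact ?K" using g by (simp add: compact_path_image)
    have zK: "z \<notin> ?K" using g z by auto
    show ?thesis
    proof (cases "bounded (connected_component_set (- ?K) z)")
      case True
      let ?V = "connected_component_set (- ?K) z"
      have V: "?V \<in> components (- ?K)" using zK by (auto intro: componentsI)
      have cont: "continuous_on ?K (\<lambda>z. norm (\<phi> z))"
        using continuous_on_subset[OF continuous_phi] g C_sub_D by (intro continuous_intros) auto
      obtain w where w: "w \<in> ?K" "\<And>x. x \<in> ?K \<Longrightarrow> norm (\<phi> x) \<le> norm (\<phi> w)"
        using continuous_attains_sup[OF K path_image_nonempty cont] by blast
      have wR: "norm (\<phi> w) < R0" using w g C_sub by auto
      have "?K \<subseteq> {z \<in> D. norm (\<phi> z) \<le> norm (\<phi> w)}" using w g C_sub_D by auto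
      then have Vs: "?V \<subseteq> {z \<in> D. norm (\<phi> z) < norm (\<phi> w)}"
        by (rule hole_subset_sublevel[OF K _ V True])
      have opV: "open ?V" using K by (simp add: compact_imp_closed open_Compl open_connected_component)
      have fr: "frontier ?V \<subseteq> ?K"
        using frontier_of_components_subset[OF V] frontier_subset_closed[OF compact_imp_closed[OF K]]
        by (simp add: frontier_complement)
      have "closure ?V \<subseteq> {z \<in> D. norm (\<phi> z) < R0}"
        using Vs wR fr g C_sub closure_Un_frontier[of ?V] by fastforce
      moreover have "C \<inter> closure ?V \<noteq> {}"
      proof -
        have "frontier ?V \<noteq> {}"
          using True zK by (intro frontier_not_empty) (auto simp: not_bounded_UNIV intro: connected_component_refl)
        then show ?thesis using fr g by (auto simp: frontier_def)
      qed
      moreover have "connected (closure ?V)" by (intro connected_imp_connected_closure connected_connected_component)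
      ultimately have "closure ?V \<subseteq> C" by (intro C_max)
      moreover have "z \<in> ?V" using zK by (simp add: connected_component_refl)
      ultimately show ?thesis using z closure_subset by blast
    next
      case False
      then have "z \<in> outside ?K" using zK by (simp add: outside_def)
      then show ?thesis using winding_number_zero_in_outside g by blast
    qed
  qed
  then show ?thesis
    using simply_connected_eq_winding_number_zero[OF open_C] connected_C by blast
qed

lemma path_connected_C: "path_connected C"
  by (simp add: open_C connected_C connected_open_path_connected)

end

lemma cis_eq_imp: "cis x = cis y \<Longrightarrow> \<exists>n::int. x = y + 2 * pi * n"
  using sin_cos_eq_iff[of x y] by (metis cis.simps(1) cis.simps(2))

text \<open>The normal form at a frontier point \<open>p\<close> of \<open>C\<close>, as provided by \<open>local_normal_form\<close>.\<close>

locale valley_chart = proper_disc_component \<phi> D a r R1 R0 C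
  for \<phi> :: "complex \<Rightarrow> complex ^ 'n" and D a r R1 R0 C +
  fixes p :: complex and m :: nat and \<rho> :: real and e :: "complex \<Rightarrow> complex" and G :: "complex \<Rightarrow> real"
  assumes p: "p \<in> frontier C" and m: "0 < m" and \<rho>: "0 < \<rho>"
    and e_hol: "e holomorphic_on ball 0 \<rho>" and e_inj: "inj_on e (ball 0 \<rho>)" and e0: "e 0 = p"
    and e_D: "e ` ball 0 \<rho> \<subseteq> D"
    and G_eq: "\<And>\<zeta>. \<zeta> \<in> ball 0 \<rho> \<Longrightarrow> (norm (\<phi> (e \<zeta>)))\<^sup>2 - R0\<^sup>2 = G \<zeta>"
    and G_pos: "\<And>\<zeta>. \<zeta> \<in> ball 0 \<rho> \<Longrightarrow> \<zeta> \<noteq> 0 \<Longrightarrow> G \<zeta> \<le> 0 \<Longrightarrow> 0 < Re (\<zeta> ^ m)"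
    and G_convex: "\<And>s \<theta> \<tau>1 \<tau>2 \<tau>3. 0 < s \<Longrightarrow> s < \<rho> \<Longrightarrow> cis (of_nat m * \<theta>) = 1 \<Longrightarrow>
       - pi / (2 * real m) < \<tau>1 \<Longrightarrow> \<tau>1 < \<tau>2 \<Longrightarrow> \<tau>2 < \<tau>3 \<Longrightarrow> \<tau>3 < pi / (2 * real m) \<Longrightarrow>
       G (of_real s * cis (\<theta> + \<tau>1)) \<le> 0 \<Longrightarrow> G (of_real s * cis (\<theta> + \<tau>3)) \<le> 0 \<Longrightarrow>
       G (of_real s * cis (\<theta> + \<tau>2)) < 0"
begin

text \<open>The valley \<open>V j\<close> is the open sector with axis \<open>\<theta> j\<close> and half-angle \<open>\<kappa>\<close>, and \<open>pt j s \<tau>\<close> is its point with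
  modulus \<open>s\<close> and angle \<open>\<tau>\<close> from the axis.  The predicate \<open>hit j s\<close> says that \<open>C\<close> meets the arc of radius \<open>s\<close> in
  the valley \<open>j\<close>.\<close>

definition \<theta> :: "nat \<Rightarrow> real" where "\<theta> j = 2 * pi * real j / real m"
definition \<kappa> :: real where "\<kappa> = pi / (2 * real m)"
definition pt :: "nat \<Rightarrow> real \<Rightarrow> real \<Rightarrow> complex" where "pt j s \<tau> = of_real s * cis (\<theta> j + \<tau>)"
definition V :: "nat \<Rightarrow> complex set" where "V j = {\<zeta>. \<exists>s>0. \<exists>\<tau>. \<bar>\<tau>\<bar> < \<kappa> \<and> \<zeta> = pt j s \<tau>}"
definition hit :: "nat \<Rightarrow> real \<Rightarrow> bool" where "hit j s \<longleftrightarrow> (\<exists>\<tau>. \<bar>\<tau>\<bar> < \<kappa> \<and> e (pt j s \<tau>) \<in> C)"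

lemma \<kappa>_pos: "0 < \<kappa>" and \<kappa>_le: "\<kappa> \<le> pi / 2" and \<kappa>_m: "real m * \<kappa> = pi / 2"
  using m by (auto simp: \<kappa>_def field_simps)

lemma \<theta>_\<kappa>: "\<theta> j = 4 * \<kappa> * real j" by (simp add: \<theta>_def \<kappa>_def)

lemma norm_pt [simp]: "norm (pt j s \<tau>) = \<bar>s\<bar>" by (simp add: pt_def norm_mult)

lemma G_neg_iff: "\<zeta> \<in> ball 0 \<rho> \<Longrightarrow> G \<zeta> < 0 \<longleftrightarrow> norm (\<phi> (e \<zeta>)) < R0"
  and G_le_iff: "\<zeta> \<in> ball 0 \<rho> \<Longrightarrow> G \<zeta> \<le> 0 \<longleftrightarrow> norm (\<phi> (e \<zeta>)) \<le> R0"
  using G_eq[of \<zeta>] R0_pos by (auto simp: algebra_simps abs_square_less_1 dest: power_strict_mono power_mono)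
   (smt (verit) norm_ge_zero power2_less_imp_less power2_le_imp_le power_strict_mono power_mono)+

lemma e_open: "open S \<Longrightarrow> S \<subseteq> ball 0 \<rho> \<Longrightarrow> open (e ` S)"
  by (rule open_mapping_thm3) (use e_hol e_inj in \<open>auto intro: holomorphic_on_subset inj_on_subset\<close>)

lemma e_cont: "continuous_on (ball 0 \<rho>) e" using e_hol holomorphic_on_imp_continuous_on by blast

lemma e_eq_iff: "x \<in> ball 0 \<rho> \<Longrightarrow> y \<in> ball 0 \<rho> \<Longrightarrow> e x = e y \<longleftrightarrow> x = y"
  using e_inj by (auto simp: inj_on_def)

lemma pt_convex:
  assumes "0 < s" "s < \<rho>" "\<bar>\<tau>1\<bar> < \<kappa>" "\<bar>\<tau>3\<bar> < \<kappa>" "\<tau>1 < \<tau>2" "\<tau>2 < \<tau>3" "G (pt j s \<tau>1) \<le> 0" "G (pt j s \<tau>3) \<le> 0"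
  shows "G (pt j s \<tau>2) < 0"
proof -
  have "real m * \<theta> j = 2 * pi * real j" using m by (simp add: \<theta>_def)
  then have "cis (of_nat m * \<theta> j) = 1" by (simp add: cis_multiple_2pi)
  then show ?thesis
    using G_convex[of s "\<theta> j" \<tau>1 \<tau>2 \<tau>3] assms unfolding pt_def \<kappa>_def by (simp add: abs_less_iff)
qed

text \<open>All points of an arc at which \<open>|\<phi>| < R0\<close> belong to \<open>C\<close> as soon as one of them does.\<close>

lemma slice_in_C:
  assumes "0 < s" "s < \<rho>" "\<bar>\<tau>\<bar> < \<kappa>" "\<bar>\<tau>'\<bar> < \<kappa>" "G (pt j s \<tau>') < 0" "e (pt j s \<tau>) \<in> C"
  shows "e (pt j s \<tau>') \<in> C"
proof -
  have ptb: "pt j s x \<in> ball 0 \<rho>" for x using assms by simp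
  have neg: "G (pt j s \<tau>) < 0" using assms(6) C_sub G_neg_iff[OF ptb] by auto
  let ?T = "(\<lambda>x. e (pt j s x)) ` closed_segment \<tau> \<tau>'"
  have "continuous_on (closed_segment \<tau> \<tau>') (\<lambda>x. e (pt j s x))"
    by (rule continuous_on_compose2[OF e_cont]) (use ptb in \<open>auto simp: pt_def intro!: continuous_intros\<close>)
  then have "connected ?T" by (intro connected_continuous_image) auto
  moreover have "?T \<subseteq> {z \<in> D. norm (\<phi> z) < R0}"
  proof clarify
    fix x assume x: "x \<in> closed_segment \<tau> \<tau>'"
    have "G (pt j s x) < 0"
    proof (cases "x = \<tau> \<or> x = \<tau>'")
      case False
      then consider "\<tau> < x" "x < \<tau>'" | "\<tau>' < x" "x < \<tau>"
        using x by (auto simp: closed_segment_eq_real_ivl split: if_splits)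
      then show ?thesis
      proof cases
        case 1
        show ?thesis by (rule pt_convex[OF assms(1,2,3,4) 1 less_imp_le[OF neg] less_imp_le[OF assms(5)]])
      next
        case 2
        show ?thesis by (rule pt_convex[OF assms(1,2,4,3) 2 less_imp_le[OF assms(5)] less_imp_le[OF neg]])
      qed
    qed (use neg assms(5) in blast)
    then show "e (pt j s x) \<in> D \<and> norm (\<phi> (e (pt j s x))) < R0"
      using G_neg_iff[OF ptb] e_D ptb by auto
  qed
  moreover have "C \<inter> ?T \<noteq> {}" using assms by auto
  ultimately have "?T \<subseteq> C" by (rule C_max)
  then show ?thesis by auto
qed

lemma in_valley:
  assumes "\<zeta> \<in> ball 0 \<rho>" "\<zeta> \<noteq> 0" "G \<zeta> \<le> 0"
  shows "\<exists>j<m. \<exists>\<tau>. \<bar>\<tau>\<bar> < \<kappa> \<and> \<zeta> = pt j (norm \<zeta>) \<tau>"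
proof -
  define A where "A = Arg \<zeta>"
  have zA: "\<zeta> = of_real (norm \<zeta>) * cis A" using rcis_cmod_Arg[of \<zeta>] by (simp add: A_def rcis_def)
  have "Re (\<zeta> ^ m) = norm \<zeta> ^ m * cos (real m * A)"
    by (subst zA) (simp add: power_mult_distrib Complex.DeMoivre)
  then have c: "0 < cos (real m * A)"
    using G_pos[OF assms] assms(2) by (simp add: zero_less_mult_iff)
  define k where "k = round (real m * A / (2 * pi))"
  define \<tau> where "\<tau> = A - 2 * pi * of_int k / real m"
  have mt: "real m * \<tau> = real m * A - 2 * pi * of_int k" using m by (simp add: \<tau>_def field_simps)
  have "\<bar>of_int k - real m * A / (2 * pi)\<bar> \<le> 1/2" unfolding k_def by (rule of_int_round_abs_le)
  then have "\<bar>2 * pi * of_int k - real m * A\<bar> \<le> pi"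
    using pi_gt_zero by (simp add: abs_le_iff field_simps)
  then have le: "\<bar>real m * \<tau>\<bar> \<le> pi" unfolding mt by linarith
  have "cos (real m * \<tau>) = cos (real m * A)"
    unfolding mt cos_diff sin_int_2pin cos_int_2pin by simp
  then have "0 < cos \<bar>real m * \<tau>\<bar>" using c by simp
  then have "\<bar>real m * \<tau>\<bar> < pi / 2"
    using cos_monotone_0_pi_le[of "pi/2" "\<bar>real m * \<tau>\<bar>"] le by (smt (verit) cos_pi_half pi_half_ge_zero)
  then have t: "\<bar>\<tau>\<bar> < \<kappa>" using m by (simp add: \<kappa>_def abs_mult field_simps)
  define j where "j = nat (k mod int m)"
  have j: "j < m" using m by (simp add: j_def nat_less_iff)
  have "of_int k = real j + real m * of_int (k div int m)"
  proof -
    have "int j = k mod int m" using m by (simp add: j_def)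
    then have "k = int j + int m * (k div int m)" by (metis mod_mult_div_eq)
    then show ?thesis by (metis of_int_add of_int_mult of_int_of_nat_eq)
  qed
  then have "A = (\<theta> j + \<tau>) + 2 * pi * of_int (k div int m)"
    using m by (simp add: \<tau>_def \<theta>_def field_simps)
  then have "cis A = cis (\<theta> j + \<tau>)"
    by (simp add: cis_mult[symmetric] cis_multiple_2pi)
  then have "\<zeta> = pt j (norm \<zeta>) \<tau>" using zA by (simp add: pt_def)
  then show ?thesis using t j by blast
qed

lemma pt_inject:
  assumes "pt i s \<tau> = pt j s' \<tau>'" "0 < s" "0 < s'" "i < m" "j < m" "\<bar>\<tau>\<bar> < \<kappa>" "\<bar>\<tau>'\<bar> < \<kappa>"
  shows "i = j \<and> s = s' \<and> \<tau> = \<tau>'"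
proof -
  have s: "s = s'" using assms(1-3) by (metis norm_pt abs_of_pos)
  then have "cis (\<theta> i + \<tau>) = cis (\<theta> j + \<tau>')" using assms by (simp add: pt_def)
  then obtain n :: int where n: "\<theta> i + \<tau> = \<theta> j + \<tau>' + 2 * pi * n" using cis_eq_imp by blast
  have pk: "pi = 2 * real m * \<kappa>" using \<kappa>_m by simp
  have eq: "4 * \<kappa> * (real i - real j - real m * n) = \<tau>' - \<tau>"
    using n unfolding \<theta>_\<kappa> pk by (simp add: algebra_simps)
  then have "\<bar>4 * \<kappa> * (real i - real j - real m * n)\<bar> < 2 * \<kappa>" using assms by linarith
  then have "4 * \<kappa> * \<bar>real i - real j - real m * n\<bar> < 2 * \<kappa>" using \<kappa>_pos by (simp add: abs_mult)
  then have "\<bar>real i - real j - real m * n\<bar> < 1" using \<kappa>_pos by (simp add: field_simps)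
  then have "\<bar>of_int (int i - int j - int m * n)\<bar> < (1::real)" by simp
  then have z: "int i - int j - int m * n = 0" by linarith
  then have "real i - real j - real m * n = 0"
    by (metis of_int_0 of_int_diff of_int_mult of_int_of_nat_eq)
  with eq have "\<tau> = \<tau>'" by simp
  have "int i = int j"
  proof -
    have "\<bar>int m * n\<bar> < int m" using z assms(4,5) by linarith
    then have "n = 0" by (simp add: abs_mult) (smt (verit) m mult_le_cancel_left1 of_nat_0_less_iff)
    then show ?thesis using z by simp
  qed
  then show ?thesis using s \<open>\<tau> = \<tau>'\<close> by simp
qed

lemma V_disjoint: "i < m \<Longrightarrow> j < m \<Longrightarrow> i \<noteq> j \<Longrightarrow> V i \<inter> V j = {}"
  unfolding V_def using pt_inject by blast

lemma V_open: "open (V j)"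
proof -
  let ?W = "{w. w \<notin> \<real>\<^sub>\<le>\<^sub>0 \<and> Arg w \<in> {-\<kappa><..<\<kappa>}}"
  have W: "?W = (- \<real>\<^sub>\<le>\<^sub>0) \<inter> Arg -` {-\<kappa><..<\<kappa>}" by auto
  have oW: "open ?W"
    unfolding W by (rule continuous_open_preimage[OF continuous_on_Arg]) auto
  have eqV: "V j = (\<lambda>z. z * cis (- \<theta> j)) -` ?W"
  proof (intro equalityI subsetI)
    fix \<zeta> assume "\<zeta> \<in> V j"
    then obtain s \<tau> where s: "s > 0" "\<bar>\<tau>\<bar> < \<kappa>" "\<zeta> = pt j s \<tau>" by (auto simp: V_def)
    have eq: "\<zeta> * cis (- \<theta> j) = of_real s * cis \<tau>" by (simp add: s pt_def cis_mult mult.assoc)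
    have tp: "-pi < \<tau>" "\<tau> \<le> pi" using s \<kappa>_le pi_gt_zero by linarith+
    then have A: "Arg (of_real s * cis \<tau>) = \<tau>" using s by (simp add: Arg_cis)
    have "cos \<tau> > 0" using s \<kappa>_le by (intro cos_gt_zero_pi) auto
    then have "Re (of_real s * cis \<tau>) > 0" using s by simp
    then have "of_real s * cis \<tau> \<notin> \<real>\<^sub>\<le>\<^sub>0" by (simp add: complex_nonpos_Reals_iff)
    then show "\<zeta> \<in> (\<lambda>z. z * cis (- \<theta> j)) -` ?W" using A s eq by auto
  next
    fix \<zeta> assume "\<zeta> \<in> (\<lambda>z. z * cis (- \<theta> j)) -` ?W"
    then have w: "\<zeta> * cis (- \<theta> j) \<notin> \<real>\<^sub>\<le>\<^sub>0" "\<bar>Arg (\<zeta> * cis (- \<theta> j))\<bar> < \<kappa>" by auto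
    let ?w = "\<zeta> * cis (- \<theta> j)"
    have "?w \<noteq> 0" using w by auto
    have "?w = of_real (norm ?w) * cis (Arg ?w)" using rcis_cmod_Arg[of ?w] by (simp add: rcis_def)
    then have "\<zeta> * cis (- \<theta> j) * cis (\<theta> j) = of_real (norm ?w) * cis (Arg ?w) * cis (\<theta> j)" by simp
    then have "\<zeta> = pt j (norm ?w) (Arg ?w)" by (simp add: pt_def cis_mult mult.assoc add.commute)
    then show "\<zeta> \<in> V j" unfolding V_def using w \<open>?w \<noteq> 0\<close> by (metis (mono_tags, lifting) mem_Collect_eq zero_less_norm_iff)
  qed
  have cont: "continuous_on UNIV (\<lambda>z. z * cis (- \<theta> j))" by (intro continuous_intros)
  show ?thesis unfolding eqV by (rule open_vimage[OF oW cont])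
qed

lemma segment_in_C:
  assumes "0 < s" "s < \<rho>" "\<bar>\<tau>\<bar> < \<kappa>" "\<bar>\<tau>'\<bar> < \<kappa>" "e (pt j s \<tau>) \<in> C" "e (pt j s \<tau>') \<in> C"
    and x: "x \<in> closed_segment \<tau> \<tau>'"
  shows "\<bar>x\<bar> < \<kappa> \<and> e (pt j s x) \<in> C"
proof -
  have ptb: "pt j s y \<in> ball 0 \<rho>" for y using assms by simp
  have neg: "G (pt j s \<tau>) < 0" "G (pt j s \<tau>') < 0" using assms C_sub G_neg_iff[OF ptb] by auto
  have xk: "\<bar>x\<bar> < \<kappa>" using assms by (auto simp: closed_segment_eq_real_ivl split: if_splits)
  have "G (pt j s x) < 0"
  proof (cases "x = \<tau> \<or> x = \<tau>'")
    case False
    then consider "\<tau> < x" "x < \<tau>'" | "\<tau>' < x" "x < \<tau>"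
      using x by (auto simp: closed_segment_eq_real_ivl split: if_splits)
    then show ?thesis
    proof cases
      case 1
      show ?thesis by (rule pt_convex[OF assms(1,2,3,4) 1 less_imp_le[OF neg(1)] less_imp_le[OF neg(2)]])
    next
      case 2
      show ?thesis by (rule pt_convex[OF assms(1,2,4,3) 2 less_imp_le[OF neg(2)] less_imp_le[OF neg(1)]])
    qed
  qed (use neg in blast)
  then show ?thesis using slice_in_C[of s \<tau> x j] assms xk by simp
qed

text \<open>The set \<open>C\<close> in the local coordinate, and its part in the valley \<open>j\<close> within radius \<open>s\<close>.\<close>

definition Cpre :: "complex set" where "Cpre = {\<zeta> \<in> ball 0 \<rho>. e \<zeta> \<in> C}"
definition X :: "nat \<Rightarrow> real \<Rightarrow> complex set" where "X j s = V j \<inter> ball 0 s \<inter> Cpre"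

lemma open_Cpre: "open Cpre"
proof -
  have "Cpre = ball 0 \<rho> \<inter> e -` C" by (auto simp: Cpre_def)
  then show ?thesis using continuous_open_preimage[OF e_cont open_ball open_C] by simp
qed

lemma open_X: "open (X j s)" unfolding X_def by (intro open_Int V_open open_ball open_Cpre)

lemma Cpre_nz: "\<zeta> \<in> Cpre \<Longrightarrow> \<zeta> \<noteq> 0"
  using frontier_C[OF p] e0 by (auto simp: Cpre_def)

lemma Cpre_valley:
  assumes "\<zeta> \<in> Cpre" shows "\<exists>j<m. \<zeta> \<in> V j \<and> hit j (norm \<zeta>)"
proof -
  have z: "\<zeta> \<in> ball 0 \<rho>" "\<zeta> \<noteq> 0" "e \<zeta> \<in> C" using assms Cpre_nz by (auto simp: Cpre_def)
  then have "G \<zeta> \<le> 0" using G_neg_iff[of \<zeta>] C_sub by auto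
  then obtain j \<tau> where j: "j < m" "\<bar>\<tau>\<bar> < \<kappa>" "\<zeta> = pt j (norm \<zeta>) \<tau>"
    using in_valley[OF z(1,2)] by blast
  have "\<zeta> \<in> V j" unfolding V_def using j z by (metis (mono_tags, lifting) mem_Collect_eq zero_less_norm_iff)
  moreover have "hit j (norm \<zeta>)" unfolding hit_def using j z by metis
  ultimately show ?thesis using j by blast
qed

lemma hit_X: "hit j t \<Longrightarrow> 0 < t \<Longrightarrow> t < s \<Longrightarrow> s \<le> \<rho> \<Longrightarrow> \<exists>\<tau>. \<bar>\<tau>\<bar> < \<kappa> \<and> pt j t \<tau> \<in> X j s"
  unfolding hit_def X_def V_def Cpre_def by fastforce

lemma X_pt: "\<zeta> \<in> X j s \<Longrightarrow> \<exists>\<tau>. \<bar>\<tau>\<bar> < \<kappa> \<and> \<zeta> = pt j (norm \<zeta>) \<tau> \<and> e \<zeta> \<in> C \<and> 0 < norm \<zeta> \<and> norm \<zeta> < s"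
  unfolding X_def V_def Cpre_def by force

text \<open>Since \<open>C\<close> is connected and not contained in the small disc, the part of \<open>C\<close> in a valley cannot stay
  within the radius \<open>s'\<close>: otherwise it would be open and closed in \<open>C\<close>.\<close>

lemma hit_up:
  assumes s: "0 < s" "s < s'" "s' < \<rho>" and j: "j < m" and h: "hit j s" and n: "\<not> C \<subseteq> e ` ball 0 s'"
  shows "hit j s'"
proof (rule ccontr)
  assume nh: "\<not> hit j s'"
  define Y where "Y = e ` X j s'"
  define Z where "Z = (C \<inter> - (e ` cball 0 s')) \<union> e ` (Cpre \<inter> (\<Union>i\<in>{..<m} - {j}. V i))"
  have Xb: "X j s' \<subseteq> ball 0 \<rho>" by (auto simp: X_def Cpre_def)
  have Cb: "Cpre \<inter> (\<Union>i\<in>{..<m} - {j}. V i) \<subseteq> ball 0 \<rho>" by (auto simp: Cpre_def)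
  have cb: "cball 0 s' \<subseteq> ball 0 \<rho>" using s by auto
  have oY: "open Y" unfolding Y_def by (rule e_open[OF open_X Xb])
  have "compact (e ` cball 0 s')"
    by (intro compact_continuous_image continuous_on_subset[OF e_cont cb]) auto
  then have oZ: "open Z" unfolding Z_def
    by (intro open_Un open_Int open_C e_open[OF _ Cb] open_UN open_Cpre)
      (auto simp: open_Compl compact_imp_closed V_open)
  have YZ: "Y \<inter> Z \<inter> C = {}"
  proof -
    have "Y \<inter> - (e ` cball 0 s') = {}" by (auto simp: Y_def X_def)
    moreover have "Y \<inter> e ` (Cpre \<inter> (\<Union>i\<in>{..<m} - {j}. V i)) = {}"
    proof -
      have "X j s' \<inter> (Cpre \<inter> (\<Union>i\<in>{..<m} - {j}. V i)) = {}"
        using V_disjoint[OF _ j] by (auto simp: X_def)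
      then show ?thesis unfolding Y_def
        using inj_on_image_Int[OF e_inj Xb Cb] by simp
    qed
    ultimately show ?thesis by (auto simp: Z_def)
  qed
  have cov: "C \<subseteq> Y \<union> Z"
  proof
    fix z assume zC: "z \<in> C"
    show "z \<in> Y \<union> Z"
    proof (cases "z \<in> e ` cball 0 s'")
      case True
      then obtain \<zeta> where \<zeta>: "z = e \<zeta>" "norm \<zeta> \<le> s'" by auto
      then have zp: "\<zeta> \<in> Cpre" using zC s by (auto simp: Cpre_def)
      obtain i where i: "i < m" "\<zeta> \<in> V i" "hit i (norm \<zeta>)" using Cpre_valley[OF zp] by blast
      show ?thesis
      proof (cases "i = j")
        case True
        then have "norm \<zeta> \<noteq> s'" using i nh by auto
        then have "\<zeta> \<in> X j s'" using i True zp \<zeta> by (auto simp: X_def)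
        then show ?thesis using \<zeta> by (auto simp: Y_def)
      next
        case False
        then show ?thesis using i zp \<zeta> by (auto simp: Z_def)
      qed
    qed (use zC in \<open>auto simp: Z_def\<close>)
  qed
  obtain \<tau> where "pt j s \<tau> \<in> X j s'" using hit_X[OF h s(1,2)] s by auto
  then have "e (pt j s \<tau>) \<in> Y \<inter> C" by (auto simp: Y_def X_def Cpre_def)
  then have "Z \<inter> C = {}" using connectedD[OF connected_C oY oZ YZ cov] by blast
  then have "C \<subseteq> Y" using cov by blast
  moreover have "Y \<subseteq> e ` ball 0 s'" by (auto simp: Y_def X_def)
  ultimately show False using n by blast
qed

lemma X_connected:
  assumes s: "0 < s" "s \<le> \<rho>" and j: "j < m" and h: "\<And>t. 0 < t \<Longrightarrow> t < s \<Longrightarrow> hit j t"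
  shows "connected (X j s)"
proof (rule connectedI)
  fix P Q :: "complex set"
  assume P: "open P" and Q: "open Q" and PX: "P \<inter> X j s \<noteq> {}" and QX: "Q \<inter> X j s \<noteq> {}"
    and d: "P \<inter> Q \<inter> X j s = {}" and cov: "X j s \<subseteq> P \<union> Q"
  define T where "T R = (\<Union>\<tau>\<in>{-\<kappa><..<\<kappa>}. {0<..<s} \<inter> (\<lambda>t. pt j t \<tau>) -` (R \<inter> X j s))" for R
  have opT: "open (T R)" if "open R" for R
    unfolding T_def using that open_X
    by (intro open_UN ballI continuous_open_preimage) (auto simp: pt_def intro!: continuous_intros)
  have mem: "norm \<zeta> \<in> T R" if z: "\<zeta> \<in> R" "\<zeta> \<in> X j s" for \<zeta> R
  proof -
    obtain \<tau> where t: "\<bar>\<tau>\<bar> < \<kappa>" "\<zeta> = pt j (norm \<zeta>) \<tau>" "0 < norm \<zeta>" "norm \<zeta> < s" using X_pt[OF z(2)] by blast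
    have "pt j (norm \<zeta>) \<tau> \<in> R \<inter> X j s" using z t(2) by simp
    then have "norm \<zeta> \<in> {0<..<s} \<inter> (\<lambda>t. pt j t \<tau>) -` (R \<inter> X j s)" using t(3,4) by simp
    moreover have "\<tau> \<in> {-\<kappa><..<\<kappa>}" using t(1) by (simp add: abs_less_iff)
    ultimately show ?thesis unfolding T_def by blast
  qed
  have "T P \<inter> T Q \<inter> {0<..<s} = {}"
  proof (rule ccontr)
    assume ne: "\<not> ?thesis"
    obtain t \<tau> \<tau>' where t: "0 < t" "t < s" "\<bar>\<tau>\<bar> < \<kappa>" "\<bar>\<tau>'\<bar> < \<kappa>"
      and pP: "pt j t \<tau> \<in> P \<inter> X j s" and pQ: "pt j t \<tau>' \<in> Q \<inter> X j s"
    proof -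
      from ne obtain t where t: "t \<in> T P" "t \<in> T Q" "0 < t" "t < s" by auto
      from t(1) obtain \<tau> where "\<bar>\<tau>\<bar> < \<kappa>" "pt j t \<tau> \<in> P \<inter> X j s" by (force simp: T_def abs_less_iff)
      moreover from t(2) obtain \<tau>' where "\<bar>\<tau>'\<bar> < \<kappa>" "pt j t \<tau>' \<in> Q \<inter> X j s" by (force simp: T_def abs_less_iff)
      ultimately show thesis using t that by blast
    qed
    let ?S = "(\<lambda>x. pt j t x) ` closed_segment \<tau> \<tau>'"
    have "connected ?S"
      by (intro connected_continuous_image) (auto simp: pt_def intro!: continuous_intros)
    moreover have SX: "?S \<subseteq> X j s"
    proof clarify
      fix x assume x: "x \<in> closed_segment \<tau> \<tau>'"
      have "\<bar>x\<bar> < \<kappa> \<and> e (pt j t x) \<in> C"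
        by (rule segment_in_C[OF _ _ t(3,4) _ _ x]) (use t s pP pQ in \<open>auto simp: X_def Cpre_def\<close>)
      then show "pt j t x \<in> X j s" using t s by (auto simp: X_def V_def Cpre_def)
    qed
    ultimately have "P \<inter> ?S = {} \<or> Q \<inter> ?S = {}"
      using connectedD[of ?S P Q] P Q d cov by blast
    then show False using pP pQ by auto
  qed
  moreover have "{0<..<s} \<subseteq> T P \<union> T Q"
  proof
    fix t assume t: "t \<in> {0<..<s}"
    then obtain \<tau> where "pt j t \<tau> \<in> X j s" using hit_X[OF h] s by auto
    then show "t \<in> T P \<union> T Q" using mem[of "pt j t \<tau>"] cov t by auto
  qed
  moreover have "T P \<inter> {0<..<s} \<noteq> {}" "T Q \<inter> {0<..<s} \<noteq> {}"
    using mem X_pt PX QX by fastforce+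
  ultimately show False
    using connectedD[OF connected_Ioo opT[OF P] opT[OF Q]] by blast
qed

text \<open>Near \<open>p\<close>, each valley is met by \<open>C\<close> either at all radii or at none.\<close>

lemma dichotomy:
  assumes s2: "0 < s2"
  obtains s1 where "0 < s1" "s1 < \<rho>" "s1 \<le> s2"
    "\<And>j. j < m \<Longrightarrow> (\<forall>s. 0 < s \<longrightarrow> s < s1 \<longrightarrow> hit j s) \<or> (\<forall>s. 0 < s \<longrightarrow> s < s1 \<longrightarrow> \<not> hit j s)"
proof -
  obtain s0 where s0: "0 < s0" "s0 < \<rho>" "\<And>s'. s' \<le> s0 \<Longrightarrow> \<not> C \<subseteq> e ` ball 0 s'"
  proof -
    obtain c where c: "c \<in> C" using C_ne by blast
    show thesis
    proof (cases "c \<in> e ` ball 0 \<rho>")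
      case True
      then obtain \<zeta> where z: "c = e \<zeta>" "\<zeta> \<in> ball 0 \<rho>" by blast
      then have "\<zeta> \<noteq> 0" using c Cpre_nz by (auto simp: Cpre_def)
      moreover have "c \<notin> e ` ball 0 s'" if "s' \<le> norm \<zeta>" for s'
      proof
        assume "c \<in> e ` ball 0 s'"
        then obtain w where "e w = e \<zeta>" "norm w < s'" using z by auto
        then have "w = \<zeta>" using e_eq_iff[of w \<zeta>] z that by auto
        then show False using \<open>norm w < s'\<close> that by simp
      qed
      ultimately show thesis using that[of "norm \<zeta>"] z c by auto
    next
      case False
      have "\<not> C \<subseteq> e ` ball 0 s'" if "s' \<le> \<rho> / 2" for s'
      proof -
        have "ball (0::complex) s' \<subseteq> ball 0 \<rho>" using that \<rho> by auto
        then show ?thesis using False c by blast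
      qed
      then show thesis using that[of "\<rho> / 2"] \<rho> by auto
    qed
  qed
  have "\<exists>b. 0 < b \<and> b \<le> s0 \<and> ((\<forall>s. 0 < s \<longrightarrow> s < b \<longrightarrow> hit j s) \<or> (\<forall>s. 0 < s \<longrightarrow> s < b \<longrightarrow> \<not> hit j s))" if "j < m" for j
  proof (cases "\<forall>s. 0 < s \<longrightarrow> s < s0 \<longrightarrow> hit j s")
    case False
    then obtain t where t: "0 < t" "t < s0" "\<not> hit j t" by blast
    have "\<not> hit j s" if "0 < s" "s < t" for s
      using hit_up[OF that _ \<open>j < m\<close>] t s0 by fastforce
    then show ?thesis using t by (intro exI[of _ t]) auto
  qed (use s0 in blast)
  then obtain b where b: "\<And>j. j < m \<Longrightarrow> 0 < b j \<and> b j \<le> s0 \<and> ((\<forall>s. 0 < s \<longrightarrow> s < b j \<longrightarrow> hit j s) \<or> (\<forall>s. 0 < s \<longrightarrow> s < b j \<longrightarrow> \<not> hit j s))"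
    by metis
  define s1 where "s1 = min (min s0 s2) (Min (b ` {..<m}))"
  have ne: "b ` {..<m} \<noteq> {}" using m by auto
  have "0 < s1" using b s0 s2 ne by (auto simp: s1_def)
  moreover have le: "s1 \<le> b j" if "j < m" for j
    using that by (auto simp: s1_def intro!: min.coboundedI2 Min_le)
  moreover have "s1 < \<rho>" "s1 \<le> s2" using s0 by (auto simp: s1_def)
  ultimately show thesis
    using b that[of s1] by (metis less_le_trans)
qed

lemma exists_hit:
  assumes "0 < s1" "s1 \<le> \<rho>"
  shows "\<exists>j<m. \<exists>s. 0 < s \<and> s < s1 \<and> hit j s"
proof -
  have "open (e ` ball 0 s1)" using assms by (intro e_open) auto
  moreover have "p \<in> e ` ball 0 s1" using e0 assms by force
  moreover have "p \<in> closure C" using p by (simp add: frontier_def)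
  ultimately have "C \<inter> e ` ball 0 s1 \<noteq> {}"
    using open_Int_closure_eq_empty by (metis disjoint_iff inf_commute)
  then obtain \<zeta> where "\<zeta> \<in> ball 0 s1" "e \<zeta> \<in> C" by blast
  moreover from this have "\<zeta> \<in> Cpre" using assms by (auto simp: Cpre_def)
  ultimately show ?thesis using Cpre_valley Cpre_nz by (metis dist_0_norm mem_ball zero_less_norm_iff)
qed

text \<open>Half-way between two adjacent axes \<open>Re \<zeta>\<^sup>m\<close> is negative, so \<open>|\<phi>| > R0\<close>.\<close>

lemma ridge:
  assumes "0 < s" "s < \<rho>" "\<epsilon> = 1 \<or> \<epsilon> = -1"
  shows "R0 < norm (\<phi> (e (of_real s * cis (\<theta> j + \<epsilon> * (2 * \<kappa>)))))"
proof -
  let ?z = "of_real s * cis (\<theta> j + \<epsilon> * (2 * \<kappa>))"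
  have zb: "?z \<in> ball 0 \<rho>" and z0: "?z \<noteq> 0" using assms by (simp_all add: norm_mult)
  have mt: "real m * (\<theta> j + \<epsilon> * (2 * \<kappa>)) = 2 * pi * real j + \<epsilon> * pi"
    using m by (simp add: \<theta>_def \<kappa>_def distrib_left)
  have "?z ^ m = of_real (s ^ m) * (cis (2 * pi * real j) * cis (\<epsilon> * pi))"
    unfolding power_mult_distrib Complex.DeMoivre mt cis_mult by simp
  also have "cis (2 * pi * real j) = 1" by (simp add: cis_multiple_2pi)
  also have "cis (\<epsilon> * pi) = -1" using assms(3) by (auto simp: complex_eq_iff)
  finally have "Re (?z ^ m) = - (s ^ m)" by simp
  then have "\<not> G ?z \<le> 0" using G_pos[OF zb z0] assms(1) by (smt (verit) zero_less_power)
  then show ?thesis using G_le_iff[OF zb] by simp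
qed

lemma winding_outside:
  assumes g: "path g" "pathfinish g = pathstart g" "path_image g \<subseteq> e ` ball 0 s"
    and s: "s \<le> \<rho>" "z \<notin> e ` ball 0 s"
  shows "winding_number g z = 0"
proof -
  have sub: "ball (0::complex) s \<subseteq> ball 0 \<rho>" using s by auto
  have "ball (0::complex) s homeomorphic e ` ball 0 s"
    using sub by (intro invariance_of_domain_homeomorphic continuous_on_subset[OF e_cont] inj_on_subset[OF e_inj]) auto
  then have "simply_connected (e ` ball 0 s)"
    by (rule homeomorphic_simply_connected) (simp add: convex_imp_simply_connected)
  then show ?thesis using g s by (intro simply_connected_imp_winding_number_zero) auto
qed

lemma winding_circle:
  assumes t: "0 < t" "t < \<rho>" and y: "y \<in> ball 0 t"
  shows "winding_number (e \<circ> part_circlepath 0 t \<alpha> (\<alpha> + 2 * pi)) (e y) \<noteq> 0"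
proof -
  let ?c = "part_circlepath 0 t \<alpha> (\<alpha> + 2 * pi)"
  have im: "path_image ?c \<subseteq> sphere 0 t" using t by (intro path_image_part_circlepath_subset) auto
  then have imb: "path_image ?c \<subseteq> ball 0 \<rho>" using t by auto
  have "simple_path ?c" using t by (simp add: simple_path_part_circlepath)
  then have sp: "simple_path (e \<circ> ?c)"
    by (rule simple_path_continuous_image)
      (use imb in \<open>auto intro: continuous_on_subset[OF e_cont] inj_on_subset[OF e_inj]\<close>)
  have loop: "pathfinish (e \<circ> ?c) = pathstart (e \<circ> ?c)"
  proof -
    have "pathfinish ?c = of_real t * cis (\<alpha> + 2 * pi)" "pathstart ?c = of_real t * cis \<alpha>"
      by (simp_all add: cis_conv_exp)
    moreover have "cis (\<alpha> + 2 * pi) = cis \<alpha>" by (simp add: complex_eq_iff)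
    ultimately show ?thesis by (simp only: pathfinish_compose pathstart_compose)
  qed
  obtain z where z: "z \<in> inside (path_image (e \<circ> ?c))" "cmod (winding_number (e \<circ> ?c) z) = 1"
    using simple_closed_path_wn3[OF sp loop] .
  have zn: "z \<notin> path_image (e \<circ> ?c)" using z by (simp add: inside_def)
  have pth: "path (e \<circ> ?c)" using sp simple_path_imp_path by blast
  have imt: "path_image (e \<circ> ?c) \<subseteq> e ` ball 0 t'" if "t < t'" for t'
    using im that by (auto simp: path_image_compose)
  have "z \<in> e ` cball 0 t"
  proof (rule ccontr)
    assume n: "z \<notin> e ` cball 0 t"
    have "winding_number (e \<circ> ?c) z = 0"
    proof (cases "z \<in> e ` ball 0 \<rho>")
      case True
      then obtain \<zeta> where \<zeta>: "z = e \<zeta>" "\<zeta> \<in> ball 0 \<rho>" by blast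
      then have lt: "t < norm \<zeta>" using n by (force simp: not_le)
      have "z \<notin> e ` ball 0 (norm \<zeta>)"
      proof
        assume "z \<in> e ` ball 0 (norm \<zeta>)"
        then obtain w where w: "e w = e \<zeta>" "norm w < norm \<zeta>" using \<zeta> by auto
        then have "w = \<zeta>" using e_eq_iff[of w \<zeta>] \<zeta> by auto
        then show False using w by simp
      qed
      then show ?thesis using winding_outside[OF pth loop imt[OF lt]] \<zeta> by auto
    next
      case False
      then show ?thesis using winding_outside[OF pth loop imt[OF t(2)]] by auto
    qed
    then show False using z by simp
  qed
  then obtain \<zeta> where \<zeta>: "z = e \<zeta>" "norm \<zeta> \<le> t" by auto
  have sph: "path_image ?c = sphere 0 t"
  proof
    show "sphere 0 t \<subseteq> path_image ?c"
    proof
      fix w :: complex assume w: "w \<in> sphere 0 t"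
      define n where "n = \<lceil>(\<alpha> - Arg w) / (2 * pi)\<rceil>"
      define x where "x = Arg w + 2 * pi * n"
      have "(\<alpha> - Arg w) / (2 * pi) \<le> n" "n < (\<alpha> - Arg w) / (2 * pi) + 1"
        unfolding n_def by linarith+
      then have "\<alpha> \<le> x" "x \<le> \<alpha> + 2 * pi"
        unfolding x_def using pi_gt_zero by (auto simp: field_simps)
      moreover have "w = of_real t * cis x"
      proof -
        have "cis x = cis (Arg w)" by (simp add: x_def cis_mult[symmetric] cis_multiple_2pi)
        then show ?thesis using rcis_cmod_Arg[of w] w by (simp add: rcis_def)
      qed
      ultimately show "w \<in> path_image ?c"
        unfolding path_image_part_circlepath' by (auto simp: closed_segment_eq_real_ivl)
    qed
  qed (fact im)
  have "norm \<zeta> \<noteq> t" using zn \<zeta> sph by (auto simp: path_image_compose)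
  then have zt: "z \<in> e ` ball 0 t" using \<zeta> by auto
  have tsub: "ball (0::complex) t \<subseteq> ball 0 \<rho>" using t by auto
  have "connected (e ` ball 0 t)"
    by (intro connected_continuous_image continuous_on_subset[OF e_cont tsub]) auto
  moreover have "e ` ball 0 t \<inter> path_image (e \<circ> ?c) = {}"
  proof -
    have "ball 0 t \<inter> path_image ?c = {}" using im by auto
    then show ?thesis unfolding path_image_compose
      using inj_on_image_Int[OF e_inj tsub imb] by simp
  qed
  ultimately have "winding_number (e \<circ> ?c) (e y) = winding_number (e \<circ> ?c) z"
    using y zt by (intro winding_number_eq[OF pth loop, of _ "e ` ball 0 t"]) auto
  then show ?thesis using z by auto
qed

text \<open>At all small radii, \<open>C\<close> meets only one valley.  Suppose that it meets the valleys \<open>i\<close> and \<open>j\<close>.  A path \<open>g\<close> in \<open>C\<close>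
  and a path \<open>L\<close> through a tiny disc about the origin join the same two points of the valleys.  The loop formed by
  them stays in a sublevel set \<open>|\<phi>| \<le> R'\<close>, whose complement is connected and contains (the images of) the points \<open>y1\<close> and
  \<open>y2\<close> on the two ridges adjacent to the valley \<open>i\<close>; so its winding numbers about \<open>y1\<close> and \<open>y2\<close> agree
  (\<open>E1\<close>).  The circle through the two points is cut by them into arcs \<open>ec1\<close> and \<open>ec2\<close>, each of which avoids one of
  the two ridge rays.  Comparing \<open>g\<close> with these arcs (\<open>A\<close>, \<open>B\<close>, \<open>E2\<close>) shows that the winding number of the circle
  about \<open>y2\<close> vanishes, which it does not.\<close>

lemma unique_valley_aux:
  assumes ij: "i < j" "j < m" and s1: "0 < s1" "s1 < \<rho>"
    and hi: "\<And>s. 0 < s \<Longrightarrow> s < s1 \<Longrightarrow> hit i s" and hj: "\<And>s. 0 < s \<Longrightarrow> s < s1 \<Longrightarrow> hit j s"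
  shows False
proof -
  define t0 where "t0 = s1 / 2"
  have t0: "0 < t0" "t0 < s1" using s1 by (auto simp: t0_def)
  obtain \<alpha>0 where \<alpha>0: "\<bar>\<alpha>0\<bar> < \<kappa>" "pt i t0 \<alpha>0 \<in> X i s1"
    using hit_X[OF hi[OF t0] t0] s1 by auto
  obtain \<beta>0 where \<beta>0: "\<bar>\<beta>0\<bar> < \<kappa>" "pt j t0 \<beta>0 \<in> X j s1"
    using hit_X[OF hj[OF t0] t0] s1 by auto
  define \<alpha> where "\<alpha> = \<theta> i + \<alpha>0"
  define \<beta> where "\<beta> = \<theta> j + \<beta>0"
  define l1 where "l1 = \<theta> i + 2 * \<kappa>"
  define l2 where "l2 = \<theta> i - 2 * \<kappa>"
  define a0 where "a0 = pt i t0 \<alpha>0"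
  define b0 where "b0 = pt j t0 \<beta>0"
  have pk: "2 * pi = 4 * \<kappa> * real m" using \<kappa>_m by simp
  have "real i + 1 \<le> real j" "real j \<le> real i + real m - 1" using ij by linarith+
  then have "4 * \<kappa> * (real i + 1) \<le> 4 * \<kappa> * real j" "4 * \<kappa> * real j \<le> 4 * \<kappa> * (real i + real m - 1)"
    using \<kappa>_pos by (intro mult_left_mono; simp)+
  then have "\<theta> i + 4 * \<kappa> \<le> \<theta> j" "\<theta> j \<le> \<theta> i + 2 * pi - 4 * \<kappa>"
    unfolding \<theta>_\<kappa> pk by (simp_all add: algebra_simps)
  then have ang: "l2 < \<alpha>" "\<alpha> < l1" "l1 < \<beta>" "\<beta> < l2 + 2 * pi"
    using \<alpha>0 \<beta>0 \<kappa>_pos unfolding \<alpha>_def \<beta>_def l1_def l2_def by linarith+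
  have Xb: "X k s1 \<subseteq> ball 0 s1" for k by (auto simp: X_def)
  have s1b: "ball (0::complex) s1 \<subseteq> ball 0 \<rho>" using s1 by auto
  have eC: "e \<zeta> \<in> C" if "\<zeta> \<in> X k s1" for \<zeta> k using that by (auto simp: X_def Cpre_def)
  \<comment> \<open>a path in the component, staying away from the centre of the chart\<close>
  obtain g where g: "path g" "path_image g \<subseteq> C" "pathstart g = e a0" "pathfinish g = e b0"
    using path_connected_C eC \<alpha>0(2) \<beta>0(2) unfolding path_connected_def a0_def b0_def by blast
  have "open (ball 0 \<rho> \<inter> e -` (- path_image g))"
    using g(1) by (intro continuous_open_preimage[OF e_cont]) (auto simp: open_Compl closed_path_image)
  moreover have "0 \<in> ball 0 \<rho> \<inter> e -` (- path_image g)"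
    using \<rho> e0 frontier_C[OF p] g(2) by auto
  ultimately obtain t2' where t2': "0 < t2'" "ball 0 t2' \<subseteq> ball 0 \<rho> \<inter> e -` (- path_image g)" by (meson openE)
  define t2 where "t2 = min t2' t0"
  have t2: "0 < t2" "t2 \<le> t0" "\<And>\<zeta>. \<zeta> \<in> ball 0 t2 \<Longrightarrow> e \<zeta> \<notin> path_image g"
    using t2' t0 by (auto simp: t2_def)
  define t where "t = t2 / 2"
  have t: "0 < t" "t < t2" "t < t0" "t < \<rho>" using t2 t0 s1 by (auto simp: t_def)
  define y1 where "y1 = of_real t * cis l1"
  define y2 where "y2 = of_real t * cis l2"
  have rid: "R0 < norm (\<phi> (e (of_real s * cis l1)))" "R0 < norm (\<phi> (e (of_real s * cis l2)))" if "0 < s" "s < \<rho>" for s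
    using ridge[OF that, of 1 i] ridge[OF that, of "-1" i] by (simp_all add: l1_def l2_def)
  have yb: "y1 \<in> ball 0 t2" "y2 \<in> ball 0 t2" using t by (auto simp: y1_def y2_def norm_mult)
  obtain R' where R': "R0 < R'" "R' < norm (\<phi> (e y1))" "R' < norm (\<phi> (e y2))"
    using dense[of R0 "min (norm (\<phi> (e y1))) (norm (\<phi> (e y2)))"] rid[OF t(1,4)]
    by (auto simp: y1_def y2_def)
  have yD: "e y1 \<in> D" "e y2 \<in> D" using yb t2 t0 s1 e_D by (auto simp: image_subset_iff)
  have R'1: "R' < R1" using R' norm_less yD by force
  have "continuous_on (ball 0 \<rho>) (\<lambda>\<zeta>. norm (\<phi> (e \<zeta>)))"
    by (intro continuous_on_norm continuous_on_compose2[OF continuous_phi e_cont]) (use e_D in auto)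
  then have "open (ball 0 \<rho> \<inter> (\<lambda>\<zeta>. norm (\<phi> (e \<zeta>))) -` {..<R'})"
    by (intro continuous_open_preimage) auto
  moreover have "0 \<in> ball 0 \<rho> \<inter> (\<lambda>\<zeta>. norm (\<phi> (e \<zeta>))) -` {..<R'}"
    using \<rho> e0 frontier_C[OF p] R' by auto
  ultimately obtain \<epsilon>' where \<epsilon>': "0 < \<epsilon>'" "ball 0 \<epsilon>' \<subseteq> ball 0 \<rho> \<inter> (\<lambda>\<zeta>. norm (\<phi> (e \<zeta>))) -` {..<R'}"
    by (meson openE)
  define \<epsilon> where "\<epsilon> = min \<epsilon>' t"
  have \<epsilon>: "0 < \<epsilon>" "\<epsilon> \<le> t" "\<And>\<zeta>. \<zeta> \<in> ball 0 \<epsilon> \<Longrightarrow> norm (\<phi> (e \<zeta>)) < R'"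
    using \<epsilon>' t by (auto simp: \<epsilon>_def subset_iff)
  \<comment> \<open>a second path joining the same points through the centre of the chart\<close>
  define W where "W = X i s1 \<union> ball 0 \<epsilon> \<union> X j s1"
  have Xi: "connected (X i s1)" and Xj: "connected (X j s1)"
    using X_connected[of s1] s1 ij hi hj by auto
  have ne: "X k s1 \<inter> ball 0 \<epsilon> \<noteq> {}" if hk: "\<And>s. 0 < s \<Longrightarrow> s < s1 \<Longrightarrow> hit k s" for k
  proof -
    have e2: "0 < \<epsilon> / 2" "\<epsilon> / 2 < s1" using \<epsilon> t t0 by auto
    obtain \<tau> where "pt k (\<epsilon> / 2) \<tau> \<in> X k s1"
      using hit_X[OF hk[OF e2] e2] s1 by auto
    moreover have "pt k (\<epsilon> / 2) \<tau> \<in> ball 0 \<epsilon>" using \<epsilon> by simp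
    ultimately show ?thesis by blast
  qed
  have "connected (X i s1 \<union> ball 0 \<epsilon>)" using Xi ne[OF hi] by (intro connected_Un) auto
  moreover have "(X i s1 \<union> ball 0 \<epsilon>) \<inter> X j s1 \<noteq> {}" using ne[OF hj] by blast
  ultimately have "connected W" unfolding W_def using Xj connected_Un by blast
  moreover have "open W" unfolding W_def by (intro open_Un open_X open_ball)
  ultimately have "path_connected W" by (simp add: connected_open_path_connected)
  moreover have "a0 \<in> W" "b0 \<in> W" using \<alpha>0 \<beta>0 by (auto simp: W_def a0_def b0_def)
  ultimately obtain L where L: "path L" "path_image L \<subseteq> W" "pathstart L = b0" "pathfinish L = a0"
    unfolding path_connected_def by blast
  have Ws1: "W \<subseteq> ball 0 s1" using Xb \<epsilon> t t0 by (auto simp: W_def)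
  have WR: "e \<zeta> \<in> D \<and> norm (\<phi> (e \<zeta>)) \<le> R'" if "\<zeta> \<in> W" for \<zeta>
    using that Ws1 s1b e_D eC C_sub R'(1) \<epsilon>(3) unfolding W_def
    by (smt (verit, ccfv_threshold) Un_iff image_subset_iff mem_Collect_eq subsetD)
  have eLp: "path (e \<circ> L)"
    using L Ws1 s1b by (intro path_continuous_image continuous_on_subset[OF e_cont]) auto
  have eLi: "path_image (e \<circ> L) \<subseteq> e ` W" using L by (auto simp: path_image_compose)
  have rayW: "of_real s * cis l \<notin> W" if "t \<le> s" "s < \<rho>" "l = l1 \<or> l = l2" for s l
  proof
    assume w: "of_real s * cis l \<in> W"
    have "of_real s * cis l \<notin> ball 0 \<epsilon>" using \<epsilon> that by (simp add: norm_mult)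
    then have "e (of_real s * cis l) \<in> C" using w eC by (auto simp: W_def)
    then show False using rid[of s] that t C_sub by fastforce
  qed
  \<comment> \<open>the circle, cut into two arcs\<close>
  define c where "c = part_circlepath 0 t0 \<alpha> (\<alpha> + 2 * pi)"
  have cx: "c x = of_real t0 * cis (\<alpha> + 2 * pi * x)" for x
    by (simp add: c_def part_circlepath_def linepath_def cis_conv_exp algebra_simps)
  define u where "u = (\<beta> - \<alpha>) / (2 * pi)"
  have u: "0 \<le> u" "u \<le> 1" using ang unfolding u_def by (auto simp: field_simps)
  have au: "\<alpha> + 2 * pi * u = \<beta>" by (simp add: u_def)
  have pc: "path c" by (simp add: c_def)
  have ci: "path_image c \<subseteq> sphere 0 t0" unfolding c_def using t0 by (intro path_image_part_circlepath_subset) auto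
  have cb: "path_image c \<subseteq> ball 0 s1" using ci t0 by auto
  define ec where "ec = e \<circ> c"
  have ecp: "path ec" unfolding ec_def
    using pc cb s1b by (intro path_continuous_image continuous_on_subset[OF e_cont]) auto
  define ec1 where "ec1 = subpath 0 u ec"
  define ec2 where "ec2 = subpath u 1 ec"
  have p1: "path ec1" "path ec2" unfolding ec1_def ec2_def using ecp u by auto
  have ends: "pathstart ec1 = e a0" "pathfinish ec1 = e b0" "pathstart ec2 = e b0" "pathfinish ec2 = e a0"
    unfolding ec1_def ec2_def using cis_multiple_2pi[of 1]
    by (simp_all add: ec_def cx au a0_def b0_def pt_def \<alpha>_def \<beta>_def cis_mult[symmetric]
      flip: au[unfolded \<alpha>_def \<beta>_def])
  have i1: "path_image ec1 = e ` c ` {0..u}" "path_image ec2 = e ` c ` {u..1}"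
    unfolding ec1_def ec2_def path_image_subpath ec_def using u by (auto simp: image_comp)
  have isub: "path_image ec1 \<subseteq> e ` sphere 0 t0" "path_image ec2 \<subseteq> e ` sphere 0 t0"
    unfolding i1 using ci u by (auto simp: path_image_def image_subset_iff)
  have csp: "c x \<in> ball 0 s1" for x using t0 by (simp add: cx norm_mult)
  have ray_ne: "e (of_real s * cis l) \<noteq> e (c x)"
    if "t \<le> s" "s < \<rho>" "\<And>n::int. \<alpha> + 2 * pi * x \<noteq> l + 2 * pi * n" for s l x
  proof
    assume "e (of_real s * cis l) = e (c x)"
    then have eq: "of_real s * cis l = c x"
      using e_eq_iff[of "of_real s * cis l" "c x"] csp[of x] s1b that t by (auto simp: norm_mult)
    then have "norm (of_real s * cis l) = norm (c x)" by simp
    then have "s = t0" using that t t0 by (simp add: cx norm_mult)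
    then have "cis (\<alpha> + 2 * pi * x) = cis l" using eq t0 by (simp add: cx)
    then show False using cis_eq_imp that(3) by blast
  qed
  have no1: "\<alpha> + 2 * pi * x \<noteq> l2 + 2 * pi * n" if "x \<in> {0..u}" for x and n :: int
  proof
    assume eq: "\<alpha> + 2 * pi * x = l2 + 2 * pi * n"
    have "0 \<le> 2 * pi * x" "2 * pi * x \<le> 2 * pi * u" using that by auto
    then have "l2 < l2 + 2 * pi * n" "l2 + 2 * pi * n < l2 + 2 * pi" using eq au ang by linarith+
    then have "0 < n" "real_of_int n < 1" by (auto simp: zero_less_mult_iff)
    then show False by linarith
  qed
  have no2: "\<alpha> + 2 * pi * x \<noteq> l1 + 2 * pi * n" if "x \<in> {u..1}" for x and n :: int
  proof
    assume eq: "\<alpha> + 2 * pi * x = l1 + 2 * pi * n"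
    have "2 * pi * u \<le> 2 * pi * x" "2 * pi * x \<le> 2 * pi * 1" using that by auto
    then have "l1 < l1 + 2 * pi * n" "l1 + 2 * pi * n < l1 + 2 * pi" using eq au ang by linarith+
    then have "0 < n" "real_of_int n < 1" by (auto simp: zero_less_mult_iff)
    then show False by linarith
  qed
  define ray where "ray l = (\<lambda>s. e (of_real s * cis l)) ` {t..s1}" for l
  have cray: "connected (ray l)" for l
    unfolding ray_def by (intro connected_continuous_image continuous_on_compose2[OF e_cont] continuous_intros)
      (use t s1 in \<open>auto simp: norm_mult\<close>)
  have rayL: "ray l \<inter> path_image (e \<circ> L) = {}" if "l = l1 \<or> l = l2" for l
  proof (rule ccontr)
    assume "\<not> ?thesis"
    then obtain x where "x \<in> ray l" "x \<in> e ` W" using eLi by blast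
    then obtain s w where s: "t \<le> s" "s \<le> s1" "w \<in> W" "e (of_real s * cis l) = e w"
      unfolding ray_def by (metis (no_types, lifting) atLeastAtMost_iff imageE)
    then have "of_real s * cis l = w"
      using e_eq_iff[of "of_real s * cis l" w] Ws1 s1b s1 t by (auto simp: norm_mult subset_iff)
    then show False using rayW[of s l] s s1 that by auto
  qed
  have ray1: "ray l2 \<inter> path_image ec1 = {}"
  proof (rule ccontr)
    assume "\<not> ?thesis"
    then obtain y where y: "y \<in> ray l2" "y \<in> path_image ec1" by blast
    from y(1) obtain s where s: "s \<in> {t..s1}" "y = e (of_real s * cis l2)" unfolding ray_def by blast
    from y(2) obtain x where x: "x \<in> {0..u}" "y = e (c x)" unfolding i1 by blast
    have "e (of_real s * cis l2) \<noteq> e (c x)"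
      by (rule ray_ne) (use s s1 no1[OF x(1)] in auto)
    then show False using s x by simp
  qed
  have ray2: "ray l1 \<inter> path_image ec2 = {}"
  proof (rule ccontr)
    assume "\<not> ?thesis"
    then obtain y where y: "y \<in> ray l1" "y \<in> path_image ec2" by blast
    from y(1) obtain s where s: "s \<in> {t..s1}" "y = e (of_real s * cis l1)" unfolding ray_def by blast
    from y(2) obtain x where x: "x \<in> {u..1}" "y = e (c x)" unfolding i1 by blast
    have "e (of_real s * cis l1) \<noteq> e (c x)"
      by (rule ray_ne) (use s s1 no2[OF x(1)] in auto)
    then show False using s x by simp
  qed
  have far: "e (of_real s1 * cis l) \<notin> e ` ball 0 s1" for l
  proof
    assume "e (of_real s1 * cis l) \<in> e ` ball 0 s1"
    then obtain w where w: "norm w < s1" "e (of_real s1 * cis l) = e w" by auto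
    then have "of_real s1 * cis l = w" using e_eq_iff[of "of_real s1 * cis l" w] s1 by (auto simp: norm_mult)
    then have "norm (of_real s1 * cis l) < s1" using w by simp
    then show False using s1 by (simp add: norm_mult)
  qed
  have yray: "e y1 \<in> ray l1" "e y2 \<in> ray l2" and fray: "e (of_real s1 * cis l) \<in> ray l" for l
    unfolding ray_def y1_def y2_def using t t0 by auto
  have zero: "winding_number k (e y) = 0"
    if "path k" "pathfinish k = pathstart k" "path_image k \<subseteq> e ` ball 0 s1" "ray l \<inter> path_image k = {}" "e y \<in> ray l" for k l y
  proof -
    have "winding_number k (e y) = winding_number k (e (of_real s1 * cis l))"
      using that fray cray by (intro winding_number_eq[of k _ "ray l"]) auto
    also have "\<dots> = 0" using that s1 far by (intro winding_outside[of k s1]) auto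
    finally show ?thesis .
  qed
  have eLb: "path_image (e \<circ> L) \<subseteq> e ` ball 0 s1" using eLi Ws1 by blast
  have ecb: "path_image ec1 \<subseteq> e ` ball 0 s1" "path_image ec2 \<subseteq> e ` ball 0 s1"
    using isub t0 by (auto simp: image_subset_iff)
  have Lends: "pathstart (e \<circ> L) = e b0" "pathfinish (e \<circ> L) = e a0"
    using L by (simp_all add: pathstart_compose pathfinish_compose)
  note join = winding_number_join
  have nin: "e y1 \<notin> path_image (e \<circ> L)" "e y2 \<notin> path_image (e \<circ> L)" using rayL yray by blast+
  have ynin: "e y \<notin> path_image ec1" "e y \<notin> path_image ec2" "e y \<notin> path_image ec" if "y \<in> ball 0 t2" for y
  proof -
    have "e y \<notin> e ` sphere 0 t0"
    proof
      assume "e y \<in> e ` sphere 0 t0"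
      then obtain w where w: "norm w = t0" "e y = e w" by auto
      then have "y = w" using e_eq_iff[of y w] that t2 t0 s1 by auto
      then show False using w that t2 by auto
    qed
    then show "e y \<notin> path_image ec1" "e y \<notin> path_image ec2" "e y \<notin> path_image ec"
      using isub ci by (auto simp: ec_def path_image_compose)
  qed
  have yg: "e y1 \<notin> path_image g" "e y2 \<notin> path_image g" using t2 yb by auto
  have A: "winding_number ec1 (e y2) + winding_number (e \<circ> L) (e y2) = 0"
  proof -
    have "winding_number (ec1 +++ (e \<circ> L)) (e y2) = 0"
      by (rule zero[of _ l2]) (use p1 eLp ends Lends ecb eLb ray1 rayL[of l2, simplified] yray in \<open>auto simp: path_image_join\<close>)
    then show ?thesis using join[of ec1 "e y2" "e \<circ> L"] p1 eLp ends Lends nin ynin yb by auto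
  qed
  have B: "winding_number (e \<circ> L) (e y1) = winding_number ec2 (e y1)"
  proof -
    have "winding_number ((e \<circ> L) +++ reversepath ec2) (e y1) = 0"
      by (rule zero[of _ l1]) (use p1 eLp ends Lends ecb eLb ray2 rayL[of l1, simplified] yray in \<open>auto simp: path_image_join\<close>)
    then show ?thesis
      using join[of "e \<circ> L" "e y1" "reversepath ec2"] winding_number_reversepath[of ec2 "e y1"]
        p1 eLp ends Lends nin ynin yb by auto
  qed
  have E1: "winding_number (g +++ (e \<circ> L)) (e y1) = winding_number (g +++ (e \<circ> L)) (e y2)"
  proof (rule winding_number_eq[of _ _ "- {z \<in> D. norm (\<phi> z) \<le> R'}"])
    show "connected (- {z \<in> D. norm (\<phi> z) \<le> R'})" by (rule connected_complement_sublevel[OF R'1])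
    have "path_image g \<subseteq> {z \<in> D. norm (\<phi> z) \<le> R'}" using g C_sub R' by fastforce
    moreover have "path_image (e \<circ> L) \<subseteq> {z \<in> D. norm (\<phi> z) \<le> R'}" using eLi WR by blast
    ultimately show "- {z \<in> D. norm (\<phi> z) \<le> R'} \<inter> path_image (g +++ (e \<circ> L)) = {}"
      using g Lends by (auto simp: path_image_join)
  qed (use g eLp Lends R' in auto)
  have E2: "winding_number (g +++ ec2) (e y1) = winding_number (g +++ ec2) (e y2)"
  proof (rule winding_number_eq[of _ _ "e ` ball 0 t2"])
    show "connected (e ` ball 0 t2)"
      using t2 t0 s1 by (intro connected_continuous_image continuous_on_subset[OF e_cont]) auto
    show "e ` ball 0 t2 \<inter> path_image (g +++ ec2) = {}"
      using g ends t2(3) ynin(2) by (auto simp: path_image_join)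
  qed (use g p1 ends yb in auto)
  have "winding_number g (e y1) + winding_number (e \<circ> L) (e y1) = winding_number g (e y2) + winding_number (e \<circ> L) (e y2)"
    using E1 join[of g _ "e \<circ> L"] g eLp Lends nin yg by simp
  moreover have "winding_number g (e y1) + winding_number ec2 (e y1) = winding_number g (e y2) + winding_number ec2 (e y2)"
    using E2 join[of g _ ec2] g p1 ends ynin yb yg by simp
  ultimately have "winding_number (e \<circ> L) (e y2) = winding_number ec2 (e y2)"
    using B by (simp add: algebra_simps)
  then have "winding_number ec1 (e y2) + winding_number ec2 (e y2) = 0" using A by simp
  moreover have "winding_number ec1 (e y2) + winding_number ec2 (e y2) = winding_number ec (e y2)"
    unfolding ec1_def ec2_def using winding_number_subpath_combine[OF ecp ynin(3)[OF yb(2)], of 0 u 1] u by simp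
  moreover have "winding_number ec (e y2) \<noteq> 0"
    unfolding ec_def c_def using winding_circle[of t0 y2 \<alpha>] t0 s1 t by (simp add: y2_def norm_mult)
  ultimately show False by simp
qed

lemma unique_valley:
  assumes "i < m" "j < m" and s1: "0 < s1" "s1 < \<rho>"
    and "\<And>s. 0 < s \<Longrightarrow> s < s1 \<Longrightarrow> hit i s" and "\<And>s. 0 < s \<Longrightarrow> s < s1 \<Longrightarrow> hit j s"
  shows "i = j"
  using unique_valley_aux[of i j s1] unique_valley_aux[of j i s1] assms by (metis linorder_neqE_nat)

text \<open>The image \<open>N\<close> of a small disc.  In it, \<open>C\<close> is the part of a single valley, which is connected.  The
  complement of the closure of \<open>C\<close> is connected as well: along the circle about the origin each of its points can be
  moved, away from the valley, to the ray opposite to the axis of the valley.\<close>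

lemma neighbourhood:
  assumes \<epsilon>: "0 < \<epsilon>"
  obtains N where "open N" "p \<in> N" "N \<subseteq> ball p \<epsilon>" "N \<subseteq> D" "connected (C \<inter> N)" "connected (N - closure C)"
    "\<exists>z\<in>N. R0 < norm (\<phi> z)"
proof -
  have "open (ball 0 \<rho> \<inter> e -` ball p \<epsilon>)" by (intro continuous_open_preimage[OF e_cont]) auto
  moreover have "0 \<in> ball 0 \<rho> \<inter> e -` ball p \<epsilon>" using \<rho> \<epsilon> e0 by auto
  ultimately obtain s2 where s2: "0 < s2" "ball 0 s2 \<subseteq> ball 0 \<rho> \<inter> e -` ball p \<epsilon>" by (meson openE)
  obtain s1 where s1: "0 < s1" "s1 < \<rho>" "s1 \<le> s2"
    and dich: "\<And>j. j < m \<Longrightarrow> (\<forall>s. 0 < s \<longrightarrow> s < s1 \<longrightarrow> hit j s) \<or> (\<forall>s. 0 < s \<longrightarrow> s < s1 \<longrightarrow> \<not> hit j s)"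
    using dichotomy[OF s2(1)] by blast
  obtain j where j: "j < m" and hj: "\<And>s. 0 < s \<Longrightarrow> s < s1 \<Longrightarrow> hit j s"
    using exists_hit[of s1] dich s1 by (metis less_imp_le)
  have only: "i = j" if "i < m" "hit i s" "0 < s" "s < s1" for i s
    using unique_valley[of i j s1] dich[OF that(1)] that j hj s1 by blast
  define N where "N = e ` ball 0 s1"
  have bsub: "ball (0::complex) s1 \<subseteq> ball 0 \<rho>" using s1 by auto
  have pre: "Cpre \<inter> ball 0 s1 = X j s1"
  proof
    show "Cpre \<inter> ball 0 s1 \<subseteq> X j s1"
    proof
      fix \<zeta> assume z: "\<zeta> \<in> Cpre \<inter> ball 0 s1"
      then obtain i where i: "i < m" "\<zeta> \<in> V i" "hit i (norm \<zeta>)" using Cpre_valley by blast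
      moreover have "\<zeta> \<noteq> 0" using Cpre_nz z by blast
      ultimately have "i = j" using only z by auto
      then show "\<zeta> \<in> X j s1" using i z by (auto simp: X_def)
    qed
  qed (auto simp: X_def)
  have CN: "C \<inter> N = e ` X j s1"
    unfolding pre[symmetric] N_def Cpre_def using bsub by auto
  have "connected (X j s1)" using X_connected[of s1 j] s1 j hj by simp
  then have c1: "connected (C \<inter> N)"
    unfolding CN using bsub by (intro connected_continuous_image continuous_on_subset[OF e_cont]) (auto simp: X_def)
  \<comment> \<open>boundary points of the component lie in the closed arc cut out by the same valley\<close>
  have clos: "\<bar>\<tau>\<bar> < \<kappa> \<and> G (pt j s \<tau>) \<le> 0"
    if s: "0 < s" "s < s1" and \<tau>: "\<bar>\<tau>\<bar> \<le> pi" and cl: "e (pt j s \<tau>) \<in> closure C" for s \<tau>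
  proof -
    let ?z = "pt j s \<tau>"
    have nz: "norm ?z = s" using s by simp
    have zb: "?z \<in> ball 0 \<rho>" "?z \<noteq> 0" using nz s s1 by simp (metis nz norm_zero less_irrefl s(1))
    have Gz: "G ?z \<le> 0" using cl closure_C_sub G_le_iff[OF zb(1)] by auto
    obtain i \<tau>' where i: "i < m" "\<bar>\<tau>'\<bar> < \<kappa>" "?z = pt i s \<tau>'" using in_valley[OF zb Gz] s by auto
    have "?z \<in> V i \<inter> ball 0 s1" using i s by (auto simp: V_def)
    moreover have "open (e ` (V i \<inter> ball 0 s1))" using bsub by (intro e_open open_Int V_open) auto
    ultimately have "C \<inter> e ` (V i \<inter> ball 0 s1) \<noteq> {}"
      using cl by (metis Int_commute disjoint_iff imageI open_Int_closure_eq_empty)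
    then obtain w where w: "w \<in> V i" "w \<in> ball 0 s1" "e w \<in> C" by blast
    then have "w \<in> Cpre \<inter> ball 0 s1" using bsub by (auto simp: Cpre_def)
    then have "w \<in> X j s1" unfolding pre .
    then have "i = j" using V_disjoint[OF i(1) j] w by (auto simp: X_def)
    then have "of_real s * cis (\<theta> j + \<tau>) = of_real s * cis (\<theta> j + \<tau>')" using i by (simp add: pt_def)
    then have "cis (\<theta> j + \<tau>) = cis (\<theta> j + \<tau>')" using s by simp
    then obtain n :: int where n: "\<theta> j + \<tau> = \<theta> j + \<tau>' + 2 * pi * n" using cis_eq_imp by blast
    have "\<bar>2 * pi * n\<bar> < 2 * pi" using n \<tau> i(2) \<kappa>_le pi_gt_zero by linarith
    then have "\<bar>real_of_int n\<bar> < 1" by (simp add: abs_mult)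
    then have "n = 0" by linarith
    then show ?thesis using n i Gz by simp
  qed
  define opp where "opp s = of_real s * cis (\<theta> j + pi)" for s
  have arc: "\<exists>A. connected A \<and> A \<subseteq> ball 0 s1 - {0} \<and> e ` A \<inter> closure C = {} \<and> \<zeta> \<in> A \<and> opp (norm \<zeta>) \<in> A"
    if \<zeta>: "\<zeta> \<in> ball 0 s1" "\<zeta> \<noteq> 0" "e \<zeta> \<notin> closure C" for \<zeta>
  proof -
    define s where "s = norm \<zeta>"
    have s: "0 < s" "s < s1" using \<zeta> by (auto simp: s_def)
    define \<tau> where "\<tau> = Arg (\<zeta> * cis (- \<theta> j))"
    have "\<zeta> * cis (- \<theta> j) = of_real s * cis \<tau>"
      using rcis_cmod_Arg[of "\<zeta> * cis (- \<theta> j)"] by (simp add: rcis_def \<tau>_def s_def norm_mult)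
    then have "\<zeta> * cis (- \<theta> j) * cis (\<theta> j) = of_real s * cis \<tau> * cis (\<theta> j)" by simp
    then have zp: "\<zeta> = pt j s \<tau>" by (simp add: pt_def cis_mult mult.assoc add.commute)
    have \<tau>: "- pi < \<tau>" "\<tau> \<le> pi" using mpi_less_Arg Arg_le_pi by (auto simp: \<tau>_def)
    obtain \<tau>0 where t0: "\<bar>\<tau>0\<bar> < \<kappa>" "e (pt j s \<tau>0) \<in> C" using hj[OF s] by (auto simp: hit_def)
    have G0: "G (pt j s \<tau>0) < 0" using t0 C_sub G_neg_iff[of "pt j s \<tau>0"] s s1 by auto
    have nC: "e (pt j s \<tau>) \<notin> closure C" using \<zeta> zp by simp
    have between: False if cx: "e (pt j s x) \<in> closure C" and ax: "\<bar>x\<bar> \<le> pi" and sx: "\<tau> \<in> closed_segment \<tau>0 x" for x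
    proof -
      have x: "\<bar>x\<bar> < \<kappa>" "G (pt j s x) \<le> 0" using clos[OF s ax cx] by auto
      have ne: "\<tau> \<noteq> x" "\<tau> \<noteq> \<tau>0" using nC cx t0 closure_subset by auto
      have tk: "\<bar>\<tau>\<bar> < \<kappa>" using sx x t0 by (auto simp: closed_segment_eq_real_ivl split: if_splits)
      consider "\<tau>0 < \<tau>" "\<tau> < x" | "x < \<tau>" "\<tau> < \<tau>0"
        using sx ne by (force simp: closed_segment_eq_real_ivl split: if_splits)
      then have "G (pt j s \<tau>) < 0"
      proof cases
        case 1
        show ?thesis
          by (rule pt_convex[OF s(1) _ t0(1) x(1) 1 less_imp_le[OF G0] x(2)]) (use s s1 in simp)
      next
        case 2
        show ?thesis
          by (rule pt_convex[OF s(1) _ x(1) t0(1) 2 x(2) less_imp_le[OF G0]]) (use s s1 in simp)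
      qed
      then have "e (pt j s \<tau>) \<in> C" using slice_in_C[OF s(1) _ t0(1) tk _ t0(2)] s s1 by simp
      then show False using nC closure_subset by auto
    qed
    define f where "f = (if \<tau>0 \<le> \<tau> then pi else - pi)"
    have opp: "opp s = pt j s f"
    proof (cases "\<tau>0 \<le> \<tau>")
      case False
      have "cis (\<theta> j + pi) = cis (\<theta> j + - pi)" by (simp add: complex_eq_iff)
      then show ?thesis using False by (simp add: opp_def pt_def f_def)
    qed (simp add: opp_def pt_def f_def)
    let ?A = "pt j s ` closed_segment \<tau> f"
    have "connected ?A"
      by (intro connected_continuous_image) (auto simp: pt_def[abs_def] intro!: continuous_intros)
    moreover have "?A \<subseteq> ball 0 s1 - {0}" using s by (auto simp: pt_def norm_mult)
    moreover have "e ` ?A \<inter> closure C = {}"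
    proof -
      have "e (pt j s x) \<notin> closure C" if x: "x \<in> closed_segment \<tau> f" for x
      proof
        assume cl: "e (pt j s x) \<in> closure C"
        show False
        proof (rule between[OF cl])
          show "\<bar>x\<bar> \<le> pi" "\<tau> \<in> closed_segment \<tau>0 x"
            using x \<tau> by (auto simp: closed_segment_eq_real_ivl f_def abs_le_iff split: if_splits)
        qed
      qed
      then show ?thesis by auto
    qed
    ultimately have "connected ?A \<and> ?A \<subseteq> ball 0 s1 - {0} \<and> e ` ?A \<inter> closure C = {}" by blast
    moreover have "\<zeta> \<in> ?A" using zp by (metis ends_in_segment(1) imageI)
    moreover have "opp (norm \<zeta>) \<in> ?A" using opp unfolding s_def[symmetric] by (metis ends_in_segment(2) imageI)
    ultimately show ?thesis by blast
  qed
  define O' where "O' = opp ` {0<..<s1}"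
  have oppC: "e (opp s) \<notin> closure C" if "0 < s" "s < s1" for s
    using clos[OF that, of pi] \<kappa>_le pi_gt_zero by (auto simp: opp_def pt_def)
  have cO: "connected O'" unfolding O'_def opp_def[abs_def]
    by (intro connected_continuous_image continuous_intros) auto
  define Z where "Z = {\<zeta> \<in> ball 0 s1. e \<zeta> \<notin> closure C}"
  have Z0: "0 \<notin> Z" using e0 p by (auto simp: Z_def frontier_def)
  have OZ: "O' \<subseteq> Z" using oppC by (auto simp: O'_def Z_def opp_def norm_mult)
  have "connected Z"
  proof -
    define F where "F = {A. connected A \<and> A \<subseteq> Z \<and> A \<inter> O' \<noteq> {}}"
    have "Z = \<Union> ((\<lambda>A. A \<union> O') ` F)"
    proof
      show "Z \<subseteq> \<Union> ((\<lambda>A. A \<union> O') ` F)"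
      proof
        fix \<zeta> assume z: "\<zeta> \<in> Z"
        then have z': "\<zeta> \<in> ball 0 s1" "\<zeta> \<noteq> 0" "e \<zeta> \<notin> closure C" using Z0 by (auto simp: Z_def)
        then obtain A where A: "connected A" "A \<subseteq> ball 0 s1 - {0}" "e ` A \<inter> closure C = {}" "\<zeta> \<in> A" "opp (norm \<zeta>) \<in> A"
          using arc by blast
        have "opp (norm \<zeta>) \<in> O'" using z' by (auto simp: O'_def)
        then have "A \<in> F" using A by (auto simp: F_def Z_def)
        then show "\<zeta> \<in> \<Union> ((\<lambda>A. A \<union> O') ` F)" using A by blast
      qed
    qed (use OZ in \<open>auto simp: F_def\<close>)
    moreover have "connected (\<Union> ((\<lambda>A. A \<union> O') ` F))"
    proof (rule connected_Union)
      show "connected S" if "S \<in> (\<lambda>A. A \<union> O') ` F" for S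
        using that cO connected_Un by (auto simp: F_def)
      have "opp (s1 / 2) \<in> \<Inter> ((\<lambda>A. A \<union> O') ` F)" using s1 by (auto simp: O'_def)
      then show "\<Inter> ((\<lambda>A. A \<union> O') ` F) \<noteq> {}" by blast
    qed
    ultimately show ?thesis by simp
  qed
  moreover have "N - closure C = e ` Z" by (auto simp: N_def Z_def)
  ultimately have c2: "connected (N - closure C)"
    using bsub by (auto intro!: connected_continuous_image continuous_on_subset[OF e_cont] simp: Z_def)
  have "\<exists>z\<in>N. R0 < norm (\<phi> z)"
  proof
    show "R0 < norm (\<phi> (e (of_real (s1 / 2) * cis (\<theta> j + 1 * (2 * \<kappa>)))))" using ridge[of "s1 / 2" 1 j] s1 by simp
    show "e (of_real (s1 / 2) * cis (\<theta> j + 1 * (2 * \<kappa>))) \<in> N" using s1 by (auto simp: N_def norm_mult)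
  qed
  moreover have "open N" unfolding N_def using bsub by (intro e_open) auto
  moreover have "p \<in> N" using e0 s1 by (force simp: N_def)
  moreover have "N \<subseteq> ball p \<epsilon>" using s1 s2 by (auto simp: N_def subset_iff)
  moreover have "N \<subseteq> D" using e_D bsub by (auto simp: N_def)
  ultimately show thesis using that c1 c2 by blast
qed

end

context proper_disc_component
begin

text \<open>Frontier points of \<open>C\<close> have arbitrarily small neighbourhoods in which both \<open>C\<close> and the exterior of \<open>C\<close>
  are connected.  This is all that the boundary behaviour of the uniformizing map requires: the frontier
  of \<open>C\<close> need not be smooth and is not parametrized at this stage.\<close>

lemma local_structure:
  assumes p: "p \<in> frontier C" and \<epsilon>: "0 < \<epsilon>"
  obtains N where "open N" "p \<in> N" "N \<subseteq> ball p \<epsilon>" "N \<subseteq> D" "connected (C \<inter> N)" "connected (N - closure C)"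
    "\<exists>z\<in>N. R0 < norm (\<phi> z)"
proof -
  have pD: "p \<in> D" and np: "norm (\<phi> p) = R0" using frontier_C[OF p] by auto
  have cl: "p \<in> closure {z \<in> D. norm (\<phi> z) < R0}"
    using p closure_mono[OF C_sub] by (auto simp: frontier_def)
  show thesis
  proof (rule local_normal_form[OF pD np cl])
    fix m :: nat and \<rho> and e :: "complex \<Rightarrow> complex" and G
    assume "0 < m" "0 < \<rho>" "e holomorphic_on ball 0 \<rho>" "inj_on e (ball 0 \<rho>)" "e 0 = p" "e ` ball 0 \<rho> \<subseteq> D"
      and G: "\<And>\<zeta>. \<zeta> \<in> ball 0 \<rho> \<Longrightarrow> (norm (\<phi> (e \<zeta>)))\<^sup>2 - R0\<^sup>2 = G \<zeta>"
        "\<And>\<zeta>. \<zeta> \<in> ball 0 \<rho> \<Longrightarrow> \<zeta> \<noteq> 0 \<Longrightarrow> G \<zeta> \<le> 0 \<Longrightarrow> 0 < Re (\<zeta> ^ m)"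
        "\<And>s \<theta> \<tau>1 \<tau>2 \<tau>3. 0 < s \<Longrightarrow> s < \<rho> \<Longrightarrow> cis (of_nat m * \<theta>) = 1 \<Longrightarrow>
           - pi / (2 * real m) < \<tau>1 \<Longrightarrow> \<tau>1 < \<tau>2 \<Longrightarrow> \<tau>2 < \<tau>3 \<Longrightarrow> \<tau>3 < pi / (2 * real m) \<Longrightarrow>
           G (of_real s * cis (\<theta> + \<tau>1)) \<le> 0 \<Longrightarrow> G (of_real s * cis (\<theta> + \<tau>3)) \<le> 0 \<Longrightarrow>
           G (of_real s * cis (\<theta> + \<tau>2)) < 0"
    then interpret valley_chart \<phi> D a r R1 R0 C p m \<rho> e G
      using p by unfold_locales blast+
    show thesis using neighbourhood[OF \<epsilon>] that by blast
  qed
qed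

end

section \<open>Connectedness of the exterior\<close>

text \<open>The topological data extracted from the map: a connected open subset \<open>C\<close> of a disc \<open>D\<close> with connected
  exterior \<open>D - closure C\<close>, with the local connectivity at the frontier established above.\<close>

locale ring_domain =
  fixes D :: "complex set" and a :: complex and r :: real and C :: "complex set"
  assumes r_pos: "0 < r" and D_eq: "D = ball a r"
    and open_C: "open C" and connected_C: "connected C" and C_ne: "C \<noteq> {}"
    and closure_C_D: "closure C \<subseteq> D"
    and connected_U: "connected (D - closure C)"
    and local_structure: "\<And>p \<epsilon>. p \<in> frontier C \<Longrightarrow> 0 < \<epsilon> \<Longrightarrow>
      \<exists>N. open N \<and> p \<in> N \<and> N \<subseteq> ball p \<epsilon> \<and> N \<subseteq> D \<and> connected (C \<inter> N) \<and> connected (N - closure C) \<and> N - closure C \<noteq> {}"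
begin

definition U :: "complex set" where "U = D - closure C"

lemma D_open: "open D" by (simp add: D_eq)
lemma open_U: "open U" by (simp add: U_def D_open open_Diff)
lemma conn_U: "connected U" using connected_U by (simp add: U_def)
lemma compact_closure_C: "compact (closure C)"
  using closure_C_D bounded_subset[OF bounded_ball] by (auto simp: D_eq compact_eq_bounded_closed)

lemma inner_radius:
  assumes "compact K" "K \<subseteq> D"
  obtains s where "0 < s" "s < r" "K \<subseteq> ball a s"
proof (cases "K = {}")
  case True then show thesis using that[of "r / 2"] r_pos by auto
next
  case False
  obtain x where x: "x \<in> K" "\<And>y. y \<in> K \<Longrightarrow> dist a y \<le> dist a x"
    using continuous_attains_sup[OF assms(1) False, of "dist a"] continuous_on_dist[OF continuous_on_const continuous_on_id]
    by blast
  have "dist a x < r" using x assms D_eq by auto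
  then obtain s where s: "dist a x < s" "s < r" using dense by blast
  have "0 < s" using s zero_le_dist[of a x] by linarith
  moreover have "K \<subseteq> ball a s" using x s by force
  ultimately show thesis using that s by blast
qed

lemma frontier_C_notin: "p \<in> frontier C \<Longrightarrow> p \<in> D \<and> p \<in> closure C \<and> p \<notin> C \<and> p \<notin> U"
  using closure_C_D open_C by (auto simp: frontier_def interior_open U_def)

lemma frontier_C_closure_U: "p \<in> frontier C \<Longrightarrow> p \<in> closure U"
proof -
  assume p: "p \<in> frontier C"
  show ?thesis unfolding closure_approachable
  proof (intro allI impI)
    fix \<epsilon> :: real assume \<epsilon>: "0 < \<epsilon>"
    obtain N where N: "N \<subseteq> ball p \<epsilon>" "N \<subseteq> D" "N - closure C \<noteq> {}" using local_structure[OF p \<epsilon>] by blast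
    then obtain y where y: "y \<in> N" "y \<notin> closure C" by blast
    then have "y \<in> U" "dist y p < \<epsilon>" using N by (auto simp: U_def dist_commute)
    then show "\<exists>y\<in>U. dist y p < \<epsilon>" by blast
  qed
qed

end

text \<open>The nearest point retraction onto a slightly smaller closed disc maps the complement of \<open>K\<close> onto the
  complement of \<open>K\<close> in that disc.\<close>

lemma connected_ball_diff_compact:
  fixes K :: "complex set"
  assumes K: "compact K" "K \<subseteq> ball a r" and c: "connected (- K)"
  shows "connected (ball a r - K)"
proof -
  have "\<exists>T. connected T \<and> T \<subseteq> ball a r - K \<and> x \<in> T \<and> y \<in> T" if xy: "x \<in> ball a r - K" "y \<in> ball a r - K" for x y
  proof -
    have K': "compact (K \<union> {x, y})" "K \<union> {x, y} \<subseteq> ball a r" "K \<union> {x, y} \<noteq> {}" using K xy by auto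
    obtain z where z: "z \<in> K \<union> {x, y}" "\<And>w. w \<in> K \<union> {x, y} \<Longrightarrow> dist a w \<le> dist a z"
      using continuous_attains_sup[OF K'(1,3), of "dist a"] continuous_on_dist[OF continuous_on_const continuous_on_id]
      by blast
    have "dist a z < r" using z(1) K'(2) by auto
    then obtain s where s: "dist a z < s" "s < r" using dense by blast
    have sub: "K \<union> {x, y} \<subseteq> ball a s"
    proof
      fix w assume "w \<in> K \<union> {x, y}"
      then have "dist a w < s" using z(2)[of w] s by linarith
      then show "w \<in> ball a s" by simp
    qed
    have s0: "0 < s" using s zero_le_dist[of a z] by linarith
    let ?c = "closest_point (cball a s)"
    have "continuous_on (- K) ?c"
      using s0 by (intro continuous_on_closest_point) auto
    then have "connected (?c ` (- K))" by (rule connected_continuous_image[OF _ c])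
    moreover have "?c ` (- K) = cball a s - K"
    proof
      show "?c ` (- K) \<subseteq> cball a s - K"
      proof clarify
        fix w assume w: "w \<notin> K"
        have "?c w \<in> cball a s" using s0 by (intro closest_point_in_set) auto
        moreover have "?c w \<notin> K"
        proof (cases "w \<in> cball a s")
          case True then show ?thesis using w closest_point_self by metis
        next
          case False
          have ne: "cball a s \<noteq> {}" "interior (cball a s) \<noteq> {}" using s0 by auto
          have "w \<in> affine hull (cball a s) - rel_interior (cball a s)"
            using False ne by (auto simp: affine_hull_nonempty_interior rel_interior_nonempty_interior)
          then have "?c w \<in> rel_frontier (cball a s)"
            by (rule closest_point_in_rel_frontier[OF closed_cball ne(1)])
          then have "?c w \<in> frontier (cball a s)" using ne by (simp add: rel_frontier_nonempty_interior)
          then show ?thesis using sub by auto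
        qed
        ultimately show "?c w \<in> cball a s - K" by blast
      qed
      show "cball a s - K \<subseteq> ?c ` (- K)"
      proof
        fix w assume w: "w \<in> cball a s - K"
        then have "?c w = w" using closest_point_self[of w "cball a s"] by blast
        then show "w \<in> ?c ` (- K)" using w by (metis ComplI DiffD2 imageI)
      qed
    qed
    ultimately have "connected (cball a s - K)" by simp
    moreover have "cball a s - K \<subseteq> ball a r - K" using s by auto
    moreover have "x \<in> cball a s - K" "y \<in> cball a s - K" using sub xy by auto
    ultimately show ?thesis by blast
  qed
  note T = this
  show ?thesis
    by (rule connected_iff_connected_component[THEN iffD2], intro ballI, unfold connected_component_def) (rule T)
qed

context proper_disc_component
begin

text \<open>A bounded component of the complement of the closure of \<open>C\<close> would lie in the sublevel set \<open>|\<phi>| < R0\<close>, but near its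
  frontier points, which lie on the frontier of \<open>C\<close>, there are points with \<open>|\<phi>| > R0\<close> in the same component.\<close>

lemma connected_complement_closure_C: "connected (- closure C)"
proof -
  have "\<not> bounded V" if V: "V \<in> components (- closure C)" for V
  proof
    assume b: "bounded V"
    have Vs: "V \<subseteq> {z \<in> D. norm (\<phi> z) < R0}"
      by (rule hole_subset_sublevel[OF compact_closure_C closure_C_sub V b])
    have oV: "open V" using V by (intro open_components[of "- closure C" V]) auto
    have Vne: "V \<noteq> {}" "V \<subseteq> - closure C" using in_components_nonempty[OF V] in_components_subset[OF V] by auto
    have "V \<noteq> UNIV" using b not_bounded_UNIV by blast
    then have "frontier V \<noteq> {}" using Vne by (intro frontier_not_empty) auto
    then obtain p where p: "p \<in> frontier V" by blast
    have "p \<in> closure C"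
      using frontier_of_components_subset[OF V] p frontier_subset_closed[of "closure C"]
      by (auto simp: frontier_complement)
    moreover have "p \<notin> C"
    proof
      assume "p \<in> C"
      moreover have "p \<in> closure V" using p by (simp add: frontier_def)
      ultimately have "C \<inter> V \<noteq> {}" using open_Int_closure_eq_empty[OF open_C] by blast
      then show False using Vne closure_subset by blast
    qed
    ultimately have pC: "p \<in> frontier C" using open_C by (simp add: frontier_def interior_open)
    obtain N where N': "open N" "p \<in> N" "N \<subseteq> ball p 1" "N \<subseteq> D" "connected (C \<inter> N)" "connected (N - closure C)"
      "\<exists>z\<in>N. R0 < norm (\<phi> z)"
      by (rule local_structure[OF pC zero_less_one])
    note N = N'(1,2,6,7)
    have "p \<in> closure V" using p by (simp add: frontier_def)
    then have "N \<inter> V \<noteq> {}" using open_Int_closure_eq_empty[OF N(1)] N(2) by blast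
    then have "V \<inter> (N - closure C) \<noteq> {}" using Vne by blast
    moreover have "N - closure C \<subseteq> - closure C" by blast
    ultimately have sub: "N - closure C \<subseteq> V" using components_maximal[OF V N(3)] by blast
    obtain z where z: "z \<in> N" "R0 < norm (\<phi> z)" using N(4) by blast
    then have "z \<notin> closure C" using closure_C_sub by fastforce
    then have "z \<in> V" using sub z by blast
    then show False using Vs z by fastforce
  qed
  then show ?thesis
    unfolding connected_eq_connected_components_eq
    using cobounded_unique_unbounded_components[of "- closure C"] compact_closure_C
    by (simp add: compact_imp_bounded)
qed

sublocale ring_domain D a r C
proof
  show "connected (D - closure C)"
    unfolding D_eq
    by (rule connected_ball_diff_compact[OF compact_closure_C _ connected_complement_closure_C])
      (use closure_C_sub D_eq in blast)
  show "\<exists>N. open N \<and> p \<in> N \<and> N \<subseteq> ball p \<epsilon> \<and> N \<subseteq> D \<and> connected (C \<inter> N) \<and> connected (N - closure C) \<and> N - closure C \<noteq> {}"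
    if p: "p \<in> frontier C" and \<epsilon>: "0 < \<epsilon>" for p \<epsilon>
  proof -
    obtain N where N: "open N" "p \<in> N" "N \<subseteq> ball p \<epsilon>" "N \<subseteq> D" "connected (C \<inter> N)" "connected (N - closure C)"
      "\<exists>z\<in>N. R0 < norm (\<phi> z)" by (rule local_structure[OF p \<epsilon>])
    then obtain z where z: "z \<in> N" "R0 < norm (\<phi> z)" by blast
    then have "z \<notin> closure C" using closure_C_sub by fastforce
    then show ?thesis using N z by blast
  qed
qed (use r_pos D_eq open_C connected_C C_ne closure_C_sub in auto)

end

section \<open>Quotients by logarithmic periods\<close>

lemma exp_eq_shift: "exp w = exp z \<Longrightarrow> \<exists>n::int. w = z + 2 * pi * n * \<i>"
  by (auto simp: exp_eq algebra_simps)

lemma periodic_int: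
  fixes F :: "complex \<Rightarrow> 'b"
  assumes per: "\<And>w. w \<in> S \<Longrightarrow> F (w + 2 * pi * \<i>) = F w" and S: "\<And>w. w + 2 * pi * \<i> \<in> S \<longleftrightarrow> w \<in> S"
    and w: "w \<in> S"
  shows "F (w + 2 * pi * of_int n * \<i>) = F w \<and> w + 2 * pi * of_int n * \<i> \<in> S"
proof (induction n rule: int_induct[where k = 0])
  case base then show ?case using w by simp
next
  case (step1 i)
  have "w + 2 * pi * of_int (i + 1) * \<i> = (w + 2 * pi * of_int i * \<i>) + 2 * pi * \<i>" by (simp add: algebra_simps)
  then show ?case using step1 per S by metis
next
  case (step2 i)
  have "w + 2 * pi * of_int i * \<i> = (w + 2 * pi * of_int (i - 1) * \<i>) + 2 * pi * \<i>" by (simp add: algebra_simps)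
  then show ?case using step2 per S by metis
qed

lemma exp_shift [simp]: "exp (w + 2 * complex_of_real pi * \<i>) = exp w"
  by (simp add: exp_add)

text \<open>Functions on the logarithmic preimage \<open>{w. exp w \<in> S}\<close> with period \<open>2 \<pi> \<i>\<close> descend to \<open>S\<close>; the value at \<open>z\<close> is
  written \<open>F (Ln z)\<close>, and periodicity removes the discontinuity of the principal branch.\<close>

lemma descend_eq:
  fixes F :: "complex \<Rightarrow> 'b"
  assumes per: "\<And>w. exp w \<in> S \<Longrightarrow> F (w + 2 * pi * \<i>) = F w" and eq: "exp w = exp z" and "exp w \<in> S"
  shows "F w = F z"
proof -
  obtain n :: int where n: "w = z + 2 * pi * n * \<i>" using exp_eq_shift[OF eq] by blast
  have "F (z + 2 * pi * of_int n * \<i>) = F z \<and> z + 2 * pi * of_int n * \<i> \<in> {w. exp w \<in> S}"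
    by (rule periodic_int[of "{w. exp w \<in> S}"]) (use assms in \<open>auto simp: exp_shift\<close>)
  then show ?thesis using n by simp
qed

lemma descend_local:
  fixes F :: "complex \<Rightarrow> complex"
  assumes S0: "0 \<notin> S" and per: "\<And>w. exp w \<in> S \<Longrightarrow> F (w + 2 * pi * \<i>) = F w"
    and w1: "exp w1 \<in> S" and z: "z \<in> S"
  shows "F (Ln z) = F (w1 + Ln (z / exp w1))"
proof (rule descend_eq[where S = S and F = F])
  show "exp (Ln z) = exp (w1 + Ln (z / exp w1))"
  proof -
    have "z \<noteq> 0" using z S0 by auto
    then show ?thesis by (simp add: exp_add)
  qed
  show "exp (Ln z) \<in> S" using z S0 by (metis exp_Ln)
  show "F (w + 2 * pi * \<i>) = F w" if "exp w \<in> S" for w using per[OF that] .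
qed

lemma descend_holomorphic:
  assumes S: "open S" "0 \<notin> S" and F: "F holomorphic_on {w. exp w \<in> S}"
    and per: "\<And>w. exp w \<in> S \<Longrightarrow> F (w + 2 * pi * \<i>) = F w"
  shows "(\<lambda>z. F (Ln z)) holomorphic_on S"
proof -
  have oS: "open {w. exp w \<in> S}"
  proof -
    have "{w. exp w \<in> S} = exp -` S" by auto
    then show ?thesis using S open_vimage[OF S(1), of exp] by (simp add: continuous_on_exp)
  qed
  have "(\<lambda>z. F (Ln z)) field_differentiable (at z1 within S)" if z1: "z1 \<in> S" for z1
  proof -
    define w1 where "w1 = Ln z1"
    have nz: "z1 \<noteq> 0" using z1 S by auto
    have e1: "exp w1 = z1" using nz by (simp add: w1_def)
    have "((\<lambda>z. w1 + Ln (z / exp w1)) has_field_derivative (1 / z1)) (at z1)"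
      unfolding e1 using nz by (auto intro!: derivative_eq_intros)
    moreover have "(F has_field_derivative deriv F (w1 + Ln (z1 / exp w1))) (at (w1 + Ln (z1 / exp w1)))"
      by (rule holomorphic_derivI[OF F oS]) (use e1 z1 nz in simp)
    ultimately have "(F \<circ> (\<lambda>z. w1 + Ln (z / exp w1)) has_field_derivative deriv F (w1 + Ln (z1 / exp w1)) * (1 / z1)) (at z1)"
      by (intro DERIV_chain) 
    then have "((\<lambda>z. F (w1 + Ln (z / exp w1))) has_field_derivative deriv F (w1 + Ln (z1 / exp w1)) * (1 / z1)) (at z1)"
      by (simp add: o_def)
    then have "((\<lambda>z. F (Ln z)) has_field_derivative deriv F (w1 + Ln (z1 / exp w1)) * (1 / z1)) (at z1)"
    proof (rule has_field_derivative_transform_within_open[OF _ S(1) z1])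
      show "F (w1 + Ln (z / exp w1)) = F (Ln z)" if "z \<in> S" for z
        using descend_local[of S F w1 z] S(2) per e1 z1 that by simp
    qed
    then show ?thesis using field_differentiable_at_within field_differentiable_def by blast
  qed
  then show ?thesis by (simp add: holomorphic_on_def)
qed

text \<open>A biholomorphic map between the logarithmic preimages of two plane domains that avoid the
  origin descends to the domains, provided it respects the periods.\<close>

lemma descend_conformal:
  assumes S: "open S" "0 \<notin> S" and T: "open T" "0 \<notin> T"
    and \<psi>: "\<psi> holomorphic_on {w. exp w \<in> S}" and h: "h holomorphic_on {w. exp w \<in> T}"
    and \<psi>T: "\<And>w. exp w \<in> S \<Longrightarrow> exp (\<psi> w) \<in> T \<and> h (\<psi> w) = w"
    and hS: "\<And>w. exp w \<in> T \<Longrightarrow> exp (h w) \<in> S \<and> \<psi> (h w) = w"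
    and per\<psi>: "\<And>w. exp w \<in> S \<Longrightarrow> exp (\<psi> (w + 2 * pi * \<i>)) = exp (\<psi> w)"
    and perh: "\<And>w. exp w \<in> T \<Longrightarrow> exp (h (w + 2 * pi * \<i>)) = exp (h w)"
  shows "conformally_equivalent S T"
proof -
  define f where "f z = exp (\<psi> (Ln z))" for z
  define g where "g z = exp (h (Ln z))" for z
  have f: "f holomorphic_on S" unfolding f_def
    by (rule descend_holomorphic[OF S, of "\<lambda>w. exp (\<psi> w)"]) (use \<psi> per\<psi> in \<open>auto intro: holomorphic_intros\<close>)
  have g: "g holomorphic_on T" unfolding g_def
    by (rule descend_holomorphic[OF T, of "\<lambda>w. exp (h w)"]) (use h perh in \<open>auto intro: holomorphic_intros\<close>)
  have eL: "exp (Ln z) = z" if "z \<in> S \<union> T" for z using that S T by (metis UnE exp_Ln)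
  have fT: "f z \<in> T" if "z \<in> S" for z using \<psi>T[of "Ln z"] that eL[of z] by (simp add: f_def)
  have gS: "g z \<in> S" if "z \<in> T" for z using hS[of "Ln z"] that eL[of z] by (simp add: g_def)
  have gf: "g (f z) = z" if z: "z \<in> S" for z
  proof -
    have "exp (h (Ln (f z))) = exp (h (\<psi> (Ln z)))"
    proof (rule descend_eq[of T "\<lambda>w. exp (h w)"])
      show "exp (Ln (f z)) = exp (\<psi> (Ln z))" by (simp add: f_def)
      show "exp (Ln (f z)) \<in> T" using eL[of "f z"] fT[OF z] by simp
    qed (use perh in auto)
    then show ?thesis using \<psi>T[of "Ln z"] z eL[of z] by (simp add: g_def)
  qed
  have fg: "f (g z) = z" if z: "z \<in> T" for z
  proof -
    have "exp (\<psi> (Ln (g z))) = exp (\<psi> (h (Ln z)))"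
    proof (rule descend_eq[of S "\<lambda>w. exp (\<psi> w)"])
      show "exp (Ln (g z)) = exp (h (Ln z))" by (simp add: g_def)
      show "exp (Ln (g z)) \<in> S" using eL[of "g z"] gS[OF z] by simp
    qed (use per\<psi> in auto)
    then show ?thesis using hS[of "Ln z"] z eL[of z] by (simp add: f_def)
  qed
  have "f ` S = T" using fT gS fg by (metis (no_types, lifting) image_subset_iff subsetI subset_antisym image_eqI)
  moreover have "g ` T = S" using fT gS gf by (metis (no_types, lifting) image_subset_iff subsetI subset_antisym image_eqI)
  ultimately show ?thesis
    unfolding conformally_equivalent_def using S(1) T(1) f g gf fg by blast
qed

text \<open>The exponential function has the path lifting property on components: from a given \<open>w\<close>, every value \<open>z\<close> in
  a connected set is attained in the component of \<open>w\<close>.\<close>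

lemma lift_connected:
  fixes w z :: complex
  assumes S: "open S" "connected S" "0 \<notin> S" and w: "exp w \<in> S" and z: "z \<in> S"
  obtains w' where "exp w' = z" "connected_component {w. exp w \<in> S} w w'"
proof -
  have "path_connected S" using S by (simp add: connected_open_path_connected)
  then obtain g where g: "path g" "path_image g \<subseteq> S" "pathstart g = exp w" "pathfinish g = z"
    using w z unfolding path_connected_def by blast
  have "path_image g \<subseteq> - {0}" using g S by auto
  then obtain h where h: "path h" "pathstart h = w" "\<And>t. t \<in> {0..1} \<Longrightarrow> exp (h t) = g t"
    using covering_space_lift_path_strong[OF covering_space_exp_punctured_plane, of w g] g by auto
  have "connected (path_image h)" using h by (simp add: connected_path_image)
  moreover have "path_image h \<subseteq> {w. exp w \<in> S}" using h(3) g(2) by (auto simp: path_image_def)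
  moreover have "w \<in> path_image h" using h by (metis pathstart_in_path_image)
  moreover have "pathfinish h \<in> path_image h" by (rule pathfinish_in_path_image)
  ultimately have "connected_component {w. exp w \<in> S} w (pathfinish h)"
    unfolding connected_component_def by blast
  moreover have "exp (pathfinish h) = z" using h(3)[of 1] g by (simp add: pathfinish_def)
  ultimately show thesis using that by blast
qed

section \<open>Automorphisms of the disc and of the half plane\<close>

text \<open>An automorphism of the unit disc is a Moebius transformation: after moving the zero \<open>b\<close> to the origin,
  the Schwarz lemma applied to the map and its inverse makes it a rotation.\<close>

lemma disc_automorphism_Moebius:
  assumes s: "\<sigma> holomorphic_on ball 0 1" and t: "\<tau> holomorphic_on ball 0 1"
    and sb: "\<And>z. norm z < 1 \<Longrightarrow> norm (\<sigma> z) < 1" and tb: "\<And>z. norm z < 1 \<Longrightarrow> norm (\<tau> z) < 1"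
    and ts: "\<And>z. norm z < 1 \<Longrightarrow> \<tau> (\<sigma> z) = z" and st: "\<And>z. norm z < 1 \<Longrightarrow> \<sigma> (\<tau> z) = z"
  obtains \<kappa> b where "norm \<kappa> = 1" "norm b < 1" "\<And>z. norm z < 1 \<Longrightarrow> \<sigma> z = \<kappa> * (z - b) / (1 - cnj b * z)"
proof -
  define b where "b = \<tau> 0"
  have b: "norm b < 1" "\<sigma> b = 0" using tb[of 0] st[of 0] by (auto simp: b_def)
  define M where "M = Moebius_function 0 b"
  define N where "N = Moebius_function 0 (- b)"
  have Mb: "norm (M z) < 1" "norm (N z) < 1" if "norm z < 1" for z
    using Moebius_function_norm_lt_1[of b z 0] Moebius_function_norm_lt_1[of "-b" z 0] b that by (auto simp: M_def N_def)
  have Mh: "M holomorphic_on ball 0 1" "N holomorphic_on ball 0 1"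
    using Moebius_function_holomorphic[of b] Moebius_function_holomorphic[of "-b"] b by (auto simp: M_def N_def)
  have MN: "M (N z) = z" "N (M z) = z" if "norm z < 1" for z
    using Moebius_function_compose[of b "-b" z] Moebius_function_compose[of "-b" b z] b that by (auto simp: M_def N_def)
  have N0: "N 0 = b" "M b = 0" by (simp_all add: N_def M_def Moebius_function_def)
  define F where "F = \<sigma> \<circ> N"
  define G where "G = M \<circ> \<tau>"
  have Fh: "F holomorphic_on ball 0 1" unfolding F_def
    by (rule holomorphic_on_compose_gen[OF Mh(2) s]) (use Mb in auto)
  have Gh: "G holomorphic_on ball 0 1" unfolding G_def
    by (rule holomorphic_on_compose_gen[OF t Mh(1)]) (use tb in auto)
  have Fb: "norm (F z) < 1" if "norm z < 1" for z using sb Mb that by (simp add: F_def)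
  have Gb: "norm (G z) < 1" if "norm z < 1" for z using tb Mb that by (simp add: G_def)
  have F0: "F 0 = 0" and G0: "G 0 = 0" using N0 b by (auto simp: F_def G_def b_def)
  have GF: "G (F z) = z" if "norm z < 1" for z using ts Mb MN that by (simp add: F_def G_def)
  have le1: "norm (F z) \<le> norm z" if "norm z < 1" for z by (rule Schwarz_Lemma(1)[OF Fh F0 Fb that])
  have le2: "norm (G z) \<le> norm z" if "norm z < 1" for z by (rule Schwarz_Lemma(1)[OF Gh G0 Gb that])
  have half: "norm (1/2 :: complex) < 1" by simp
  have "norm (F (1/2)) = norm (1/2::complex)"
    using le1[OF half] le2[of "F (1/2)"] GF[OF half] Fb[OF half] by simp
  then have "\<exists>\<alpha>. (\<forall>z. norm z < 1 \<longrightarrow> F z = \<alpha> * z) \<and> norm \<alpha> = 1"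
    by (intro Schwarz_Lemma(3)[OF Fh F0 Fb half] disjI1 exI[of _ "1/2"]) auto
  then obtain \<kappa> where \<kappa>: "\<And>z. norm z < 1 \<Longrightarrow> F z = \<kappa> * z" "norm \<kappa> = 1" by blast
  have "\<sigma> z = \<kappa> * (z - b) / (1 - cnj b * z)" if "norm z < 1" for z
  proof -
    have "\<sigma> z = F (M z)" using MN that by (simp add: F_def)
    also have "\<dots> = \<kappa> * M z" using \<kappa>(1) Mb that by blast
    finally show ?thesis by (simp add: M_def Moebius_function_simple)
  qed
  then show thesis using that \<kappa>(2) b by blast
qed

text \<open>The fixed points are the roots of a quadratic polynomial \<open>q\<close>, whose set of roots is invariant under
  inversion in the unit circle.  If there is no root inside the disc, the roots are therefore on the circle.\<close>

lemma Moebius_boundary_fixpoint: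
  fixes \<kappa> b :: complex
  assumes \<kappa>: "norm \<kappa> = 1" and b: "norm b < 1"
    and nofix: "\<And>z. norm z < 1 \<Longrightarrow> \<kappa> * (z - b) / (1 - cnj b * z) \<noteq> z"
  obtains z1 where "norm z1 = 1" "\<kappa> * (z1 - b) = z1 * (1 - cnj b * z1)"
proof -
  have b0: "b \<noteq> 0" using nofix[of 0] by auto
  have \<kappa>0: "\<kappa> \<noteq> 0" using \<kappa> by auto
  define q where "q z = cnj b * z\<^sup>2 + (\<kappa> - 1) * z - \<kappa> * b" for z
  have inner: "norm z \<ge> 1" if "q z = 0" for z
  proof (rule ccontr)
    assume "\<not> ?thesis"
    then have z: "norm z < 1" by simp
    have "norm b * norm z \<le> norm b * 1" using z by (intro mult_left_mono) auto
    then have "norm (cnj b * z) < 1" using b by (simp add: norm_mult)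
    then have "1 - cnj b * z \<noteq> 0" by (metis less_irrefl norm_one right_minus_eq)
    moreover have "\<kappa> * (z - b) = z * (1 - cnj b * z)" using that by (simp add: q_def power2_eq_square algebra_simps)
    ultimately have "\<kappa> * (z - b) / (1 - cnj b * z) = z" by (simp add: field_simps)
    then show False using nofix z by blast
  qed
  define d where "d = csqrt ((\<kappa> - 1)\<^sup>2 + 4 * cnj b * \<kappa> * b)"
  define z1 where "z1 = (- (\<kappa> - 1) + d) / (2 * cnj b)"
  have "d\<^sup>2 = (\<kappa> - 1)\<^sup>2 + 4 * cnj b * \<kappa> * b" by (simp add: d_def)
  moreover have "4 * cnj b * q z1 = (2 * cnj b * z1 + (\<kappa> - 1))\<^sup>2 - ((\<kappa> - 1)\<^sup>2 + 4 * cnj b * \<kappa> * b)"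
    by (simp add: q_def power2_eq_square algebra_simps)
  moreover have "2 * cnj b * z1 + (\<kappa> - 1) = d" using b0 by (simp add: z1_def)
  ultimately have "4 * cnj b * q z1 = 0" by simp
  then have q1: "q z1 = 0" using b0 by simp
  have z10: "z1 \<noteq> 0" using q1 b0 \<kappa>0 by (auto simp: q_def)
  have kk: "\<kappa> * cnj \<kappa> = 1" using \<kappa> by (metis complex_norm_square of_real_1 power_one)
  define w where "w = 1 / cnj z1"
  have w0: "w \<noteq> 0" and cz: "cnj z1 = 1 / w" using z10 by (auto simp: w_def)
  have "cnj (q z1) = 0" using q1 by simp
  then have "b * (1 / w)\<^sup>2 + (cnj \<kappa> - 1) * (1 / w) - cnj \<kappa> * cnj b = 0" by (simp add: q_def cz)
  then have "(- \<kappa> * w\<^sup>2) * (b * (1 / w)\<^sup>2 + (cnj \<kappa> - 1) * (1 / w) - cnj \<kappa> * cnj b) = 0" by simp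
  moreover have "(- \<kappa> * w\<^sup>2) * (b * (1 / w)\<^sup>2 + (cnj \<kappa> - 1) * (1 / w) - cnj \<kappa> * cnj b)
      = - \<kappa> * b - (\<kappa> * cnj \<kappa> - \<kappa>) * w + (\<kappa> * cnj \<kappa>) * cnj b * w\<^sup>2"
    using w0 by (simp add: field_simps power2_eq_square)
  ultimately have "q w = 0" unfolding kk q_def by (simp add: algebra_simps)
  then have "norm w \<ge> 1" by (rule inner)
  then have "norm z1 \<le> 1" using z10 by (simp add: w_def norm_divide)
  with inner[OF q1] have "norm z1 = 1" by simp
  moreover have "\<kappa> * (z1 - b) = z1 * (1 - cnj b * z1)" using q1 by (simp add: q_def power2_eq_square algebra_simps)
  ultimately show thesis using that by blast
qed

text \<open>The Cayley transform \<open>z \<mapsto> z1 / (z1 - z)\<close> sends the fixed point \<open>z1\<close> to infinity, so it turns the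
  transformation into an affine map.\<close>

lemma Moebius_affine:
  fixes \<kappa> b z1 z :: complex
  assumes \<kappa>: "norm \<kappa> = 1" and b: "norm b < 1" and z1: "norm z1 = 1" "\<kappa> * (z1 - b) = z1 * (1 - cnj b * z1)"
    and z: "norm z < 1"
  defines "s \<equiv> \<kappa> * (z - b) / (1 - cnj b * z)"
  defines "A \<equiv> (1 - cnj b * z1)\<^sup>2 / (\<kappa> * (1 - b * cnj b))"
  defines "B \<equiv> z1 * cnj b * (1 - cnj b * z1) / (\<kappa> * (1 - b * cnj b))"
  assumes s: "norm s < 1"
  shows "z1 / (z1 - s) = A * (z1 / (z1 - z)) + B"
proof -
  have nz: "1 - cnj b * w \<noteq> 0" if "norm w \<le> 1" for w
  proof
    assume "1 - cnj b * w = 0"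
    then have "norm (cnj b * w) = 1" by (metis norm_one right_minus_eq)
    then have "1 \<le> norm b * 1" using that mult_left_mono[OF that norm_ge_zero[of b]] by (simp add: norm_mult)
    then show False using b by simp
  qed
  have n1: "1 - cnj b * z \<noteq> 0" "1 - cnj b * z1 \<noteq> 0" using nz z z1 by auto
  have bb: "1 - b * cnj b \<noteq> 0"
  proof -
    have "b * cnj b = of_real ((norm b)\<^sup>2)" by (metis complex_norm_square)
    moreover have "(norm b)\<^sup>2 < 1" using b by (simp add: power_less_one_iff)
    ultimately show ?thesis by (metis less_irrefl of_real_1 of_real_eq_iff right_minus_eq)
  qed
  have \<kappa>0: "\<kappa> \<noteq> 0" using \<kappa> by auto
  have d: "z1 - z \<noteq> 0" "z1 - s \<noteq> 0" using z z1 s by auto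
  have eq: "(z1 - s) * ((1 - cnj b * z) * (1 - cnj b * z1)) = \<kappa> * (1 - b * cnj b) * (z1 - z)"
  proof -
    have "s * (1 - cnj b * z) = \<kappa> * (z - b)" using n1 by (simp add: s_def)
    then have "(z1 - s) * ((1 - cnj b * z) * (1 - cnj b * z1))
       = z1 * (1 - cnj b * z1) * (1 - cnj b * z) - \<kappa> * (z - b) * (1 - cnj b * z1)"
    proof -
      have "(z1 - s) * (X * Y) = z1 * Y * X - (s * X) * Y" for X Y by (simp add: algebra_simps)
      then show ?thesis using \<open>s * (1 - cnj b * z) = \<kappa> * (z - b)\<close> by metis
    qed
    also have "\<dots> = \<kappa> * (z1 - b) * (1 - cnj b * z) - \<kappa> * (z - b) * (1 - cnj b * z1)" using z1(2) by simp
    finally show ?thesis by (simp add: algebra_simps)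
  qed
  then have "1 / (z1 - s) = (1 - cnj b * z) * (1 - cnj b * z1) / (\<kappa> * (1 - b * cnj b) * (z1 - z))"
    unfolding eq[symmetric] using n1 by simp
  also have "(1 - cnj b * z) = (1 - cnj b * z1) + cnj b * (z1 - z)" by (simp add: algebra_simps)
  also have "((1 - cnj b * z1) + cnj b * (z1 - z)) * (1 - cnj b * z1) / (\<kappa> * (1 - b * cnj b) * (z1 - z))
      = A / (z1 - z) + B / z1"
  proof -
    have "z1 \<noteq> 0" using z1 by auto
    moreover have "(Y + c * X) * Y / (K * X) = Y\<^sup>2 / K / X + z1 * c * Y / K / z1"
      if "K \<noteq> 0" "X \<noteq> 0" "z1 \<noteq> 0" for K X Y c z1 :: complex
      using that by (simp add: field_simps power2_eq_square)
    moreover have "\<kappa> * (1 - b * cnj b) \<noteq> 0" using bb \<kappa>0 by simp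
    ultimately show ?thesis unfolding A_def B_def using d by blast
  qed
  finally have "1 / (z1 - s) = A / (z1 - z) + B / z1" .
  then have "z1 * (1 / (z1 - s)) = z1 * (A / (z1 - z) + B / z1)" by simp
  moreover have "z1 \<noteq> 0" using z1 by auto
  ultimately show ?thesis by (simp add: distrib_left)
qed

lemma halfplane_affine:
  fixes A B :: complex
  assumes into: "\<And>\<xi>. 0 < Re \<xi> \<Longrightarrow> 0 < Re (A * \<xi> + B)"
    and onto: "\<And>\<xi>. 0 < Re \<xi> \<Longrightarrow> \<exists>\<xi>'. 0 < Re \<xi>' \<and> A * \<xi>' + B = \<xi>"
  shows "A = of_real (Re A) \<and> 0 < Re A \<and> Re B = 0"
proof -
  have imA: "Im A = 0"
  proof (rule ccontr)
    assume "Im A \<noteq> 0"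
    define y where "y = (Re A + Re B + 1) / Im A"
    have "0 < Re (A * Complex 1 y + B)" by (rule into) simp
    then show False using \<open>Im A \<noteq> 0\<close> by (simp add: y_def)
  qed
  have pos: "0 < Re A * x + Re B" if "0 < x" for x
    using into[of "of_real x"] that imA by simp
  have B0: "0 \<le> Re B"
  proof (rule ccontr)
    assume n: "\<not> 0 \<le> Re B"
    define x where "x = - Re B / (2 * (\<bar>Re A\<bar> + 1))"
    have x: "0 < x" unfolding x_def using n by (intro divide_pos_pos) auto
    have "Re A * x \<le> \<bar>Re A\<bar> * x" using x by (intro mult_right_mono) auto
    also have "\<dots> \<le> (\<bar>Re A\<bar> + 1) * x" using x by (intro mult_right_mono) auto
    also have "\<dots> = - Re B / 2" by (simp add: x_def field_simps)
    finally show False using pos[OF x] n by simp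
  qed
  have A0: "0 \<le> Re A"
  proof (rule ccontr)
    assume n: "\<not> 0 \<le> Re A"
    have "0 < (Re B + 1) / (- Re A)" using n B0 by (intro divide_pos_pos) auto
    from pos[OF this] show False using n by (simp add: field_simps)
  qed
  have "Re B < x" if x: "0 < x" for x
  proof -
    obtain \<xi>' where \<xi>': "0 < Re \<xi>'" "A * \<xi>' + B = of_real x" using onto[of "of_real x"] x by auto
    then have eq: "Re A * Re \<xi>' + Re B = x" using imA proof -
      have "Re (A * \<xi>' + B) = x" using \<xi>'(2) by simp
      then show ?thesis using imA by simp
    qed
    have "Re A \<noteq> 0"
    proof
      assume "Re A = 0"
      then have "A = 0" using imA by (simp add: complex_eq_iff)
      then show False using onto[of "B + 1"] onto[of "B + 2"] B0 by (auto simp: complex_eq_iff)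
    qed
    then have "0 < Re A * Re \<xi>'" using A0 \<xi>' by simp
    then show ?thesis using eq by simp
  qed
  then have "Re B = 0" using B0 by (metis less_irrefl order.order_iff_strict)
  moreover have "Re A \<noteq> 0" using pos[of 1] \<open>Re B = 0\<close> by auto
  ultimately show ?thesis using imA A0 by (auto simp: complex_eq_iff)
qed

section \<open>Uniformization by a round annulus\<close>

context ring_domain
begin

text \<open>With a point \<open>c0\<close> of \<open>C\<close> moved to the origin, the logarithmic preimage of \<open>U\<close> is simply connected, so the Riemann
  mapping theorem applies to it.  It is connected because it contains the connected preimage \<open>\<eta>\<close> of a whole
  circle around \<open>C\<close>.  Each component of its complement is unbounded: points over the closure of \<open>C\<close> lie in the closure of
  the preimage \<open>X\<close> of \<open>C\<close>, which contains a left half plane \<open>H\<close>, and points over the outside of \<open>D\<close> are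
  joined to infinity by horizontal rays.\<close>

lemma lifted_domain:
  assumes c0: "c0 \<in> C"
  shows "open {w. c0 + exp w \<in> U}" "simply_connected {w. c0 + exp w \<in> U}" "{w. c0 + exp w \<in> U} \<noteq> {}" "{w. c0 + exp w \<in> U} \<noteq> UNIV"
proof -
  let ?L = "{w. c0 + exp w \<in> U}"
  define S where "S = (\<lambda>z. z - c0) ` U"
  have memS: "z \<in> S \<longleftrightarrow> c0 + z \<in> U" for z by (auto simp: S_def image_iff algebra_simps)
  have Lim: "?L = {w. exp w \<in> S}" by (simp add: memS)
  have cU: "c0 \<notin> U" using c0 closure_subset by (auto simp: U_def)
  have S: "open S" "connected S" "0 \<notin> S"
    using open_U conn_U cU unfolding S_def
    by (auto intro!: connected_continuous_image continuous_intros simp: open_translation_subtract)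
  have vim: "?L = (\<lambda>w. c0 + exp w) -` U" by auto
  show oL: "open ?L" unfolding vim by (intro open_vimage open_U continuous_intros)
  obtain s where s: "0 < s" "s < r" "closure C \<subseteq> ball a s"
    by (rule inner_radius[OF compact_closure_C closure_C_D])
  have "c0 \<in> ball a s" using c0 s(3) closure_subset by blast
  then have c0s: "norm (a - c0) < s" by (simp add: dist_norm)
  \<comment> \<open>a continuous logarithm of \<open>a + s e\<^sup>i\<^sup>t - c0\<close> for all real \<open>t\<close>\<close>
  define \<eta> where "\<eta> t = of_real (ln s) + \<i> * of_real t + Ln (1 + ((a - c0) / of_real s) * cis (- t))" for t
  have small: "norm ((a - c0) / of_real s * cis (- t)) < 1" for t
    using c0s s by (simp add: norm_mult norm_divide)
  have Re1: "0 < Re (1 + (a - c0) / of_real s * cis (- t))" for t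
  proof -
    have "0 < Re (1 + z)" if "norm z < 1" for z
      using abs_Re_le_cmod[of z] that by simp
    then show ?thesis using small by blast
  qed
  have Ln1: "1 + (a - c0) / of_real s * cis (- t) \<notin> \<real>\<^sub>\<le>\<^sub>0" for t
    using Re1[of t] by (metis complex_nonpos_Reals_iff not_le)
  have cont\<eta>: "continuous_on UNIV \<eta>"
    unfolding \<eta>_def using Ln1 s by (intro continuous_intros) auto
  have e\<eta>: "c0 + exp (\<eta> t) = a + of_real s * cis t" for t
  proof -
    have "1 + (a - c0) / of_real s * cis (- t) \<noteq> 0" using Re1[of t] by (metis less_irrefl zero_complex.sel(1))
    then have "exp (\<eta> t) = of_real s * cis t * (1 + (a - c0) / of_real s * cis (- t))"
      using s by (simp add: \<eta>_def exp_add exp_of_real cis_conv_exp)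
    also have "\<dots> = of_real s * cis t + (a - c0) * (cis t * cis (- t))"
      using s by (simp add: distrib_left field_simps)
    also have "cis t * cis (- t) = 1" by (simp add: cis_mult)
    finally show ?thesis by simp
  qed
  have circ: "a + of_real s * cis t \<in> U" for t
  proof -
    have "a + of_real s * cis t \<in> D" using s by (simp add: D_eq dist_norm norm_mult)
    moreover have "a + of_real s * cis t \<notin> ball a s" using s by (simp add: dist_norm norm_mult)
    ultimately show ?thesis using s(3) unfolding U_def by blast
  qed
  have conn\<eta>: "connected (range \<eta>)" by (rule connected_continuous_image[OF cont\<eta> connected_UNIV])
  have sub\<eta>: "range \<eta> \<subseteq> ?L" using e\<eta> circ by auto
  show "?L \<noteq> {}" using sub\<eta> by blast
  have ends: "\<exists>y\<in>range \<eta>. connected_component ?L w y" if w: "w \<in> ?L" for w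
  proof -
    have "exp w \<in> S" using w by (simp add: memS)
    moreover have "exp (\<eta> 0) \<in> S" using e\<eta>[of 0] circ[of 0] by (simp add: memS)
    ultimately obtain w' where w': "exp w' = exp (\<eta> 0)" "connected_component {w. exp w \<in> S} w w'"
      using lift_connected[OF S] by metis
    then obtain n :: int where n: "w' = \<eta> 0 + 2 * pi * n * \<i>" using exp_eq_shift by blast
    have "cis (- (2 * pi * n)) = 1" using cis_multiple_2pi[of "- n"] by simp
    then have "\<eta> (2 * pi * n) = w'" unfolding n by (simp add: \<eta>_def)
    then show ?thesis using w'(2) Lim by (metis rangeI)
  qed
  have connL: "connected ?L"
  proof (rule connected_iff_connected_component[THEN iffD2], intro ballI)
    fix w w' assume w: "w \<in> ?L" "w' \<in> ?L"
    obtain y y' where y: "y \<in> range \<eta>" "connected_component ?L w y" "y' \<in> range \<eta>" "connected_component ?L w' y'"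
      using ends w by meson
    have "connected_component ?L y y'" unfolding connected_component_def using conn\<eta> sub\<eta> y by blast
    then show "connected_component ?L w w'"
      using y by (meson connected_component_sym connected_component_trans)
  qed
  define X where "X = {w. c0 + exp w \<in> C}"
  obtain \<epsilon> where \<epsilon>: "0 < \<epsilon>" "ball c0 \<epsilon> \<subseteq> C" using open_C c0 by (meson openE)
  define H where "H = {w. Re w < ln \<epsilon>}"
  have HX: "H \<subseteq> X"
  proof
    fix w assume "w \<in> H"
    then have "norm (exp w) < \<epsilon>" using \<epsilon> by (simp add: H_def) (metis exp_less_cancel_iff exp_ln)
    then show "w \<in> X" using \<epsilon> by (auto simp: X_def dist_norm)
  qed
  have cH: "connected H" unfolding H_def by (intro convex_connected convex_halfspace_Re_lt)
  define S' where "S' = (\<lambda>z. z - c0) ` C - {0}"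
  have memS': "z \<in> S' \<longleftrightarrow> c0 + z \<in> C \<and> z \<noteq> 0" for z by (auto simp: S'_def image_iff algebra_simps)
  have oS'': "open ((\<lambda>z. z - c0) ` C)" "connected ((\<lambda>z. z - c0) ` C)"
    using open_C connected_C by (auto intro!: connected_continuous_image continuous_intros simp: open_translation_subtract)
  have S': "open S'" "connected S'" "0 \<notin> S'"
    using oS'' unfolding S'_def by (auto intro!: connected_open_delete open_delete)
  have XS': "X = {w. exp w \<in> S'}" by (auto simp: X_def memS')
  have toH: "\<exists>y\<in>H. connected_component X w y" if w: "w \<in> X" for w
  proof -
    have "exp w \<in> S'" using w XS' by blast
    moreover have "of_real (\<epsilon> / 2) \<in> S'" using \<epsilon> by (auto simp: memS' dist_norm subset_iff)
    ultimately obtain w' where w': "exp w' = of_real (\<epsilon> / 2)" "connected_component {w. exp w \<in> S'} w w'"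
      using lift_connected[OF S'] by metis
    have "exp (Re w') = \<epsilon> / 2" using w'(1) \<epsilon> by (metis abs_of_pos half_gt_zero norm_exp_eq_Re norm_of_real)
    then have "exp (Re w') < exp (ln \<epsilon>)" using \<epsilon> by simp
    then have "w' \<in> H" unfolding H_def by simp
    then show ?thesis using w' XS' by metis
  qed
  have connX: "connected X"
  proof (rule connected_iff_connected_component[THEN iffD2], intro ballI)
    fix w w' assume w: "w \<in> X" "w' \<in> X"
    obtain y y' where y: "y \<in> H" "connected_component X w y" "y' \<in> H" "connected_component X w' y'"
      using toH w by meson
    have "connected_component X y y'" unfolding connected_component_def using cH HX y by blast
    then show "connected_component X w w'"
      using y by (meson connected_component_sym connected_component_trans)
  qed
  have clX: "closure X \<subseteq> {w. c0 + exp w \<in> closure C}"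
  proof (rule closure_minimal)
    have "{w. c0 + exp w \<in> closure C} = (\<lambda>w. c0 + exp w) -` closure C" by auto
    then show "closed {w. c0 + exp w \<in> closure C}"
      by (simp add: closed_vimage continuous_on_add continuous_on_exp)
  qed (use closure_subset in \<open>auto simp: X_def\<close>)
  have inclX: "w \<in> closure X" if w: "c0 + exp w \<in> closure C" for w
    unfolding closure_approachable
  proof (intro allI impI)
    fix e :: real assume e: "0 < e"
    have "\<not> exp constant_on (UNIV :: complex set)"
    proof
      assume "exp constant_on (UNIV :: complex set)"
      then have "exp (0::complex) = exp (\<i> * pi)" unfolding constant_on_def by (metis UNIV_I)
      then show False by simp
    qed
    then have "open (exp ` ball w e)"
      by (intro open_mapping_thm[of exp UNIV "ball w e"]) (auto intro: holomorphic_intros)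
    then have "open ((+) c0 ` exp ` ball w e)" by (rule open_translation)
    moreover have "c0 + exp w \<in> (+) c0 ` exp ` ball w e" using e by auto
    ultimately have "C \<inter> (+) c0 ` exp ` ball w e \<noteq> {}"
      using w by (metis Int_commute disjoint_iff open_Int_closure_eq_empty)
    then obtain y where "y \<in> ball w e" "c0 + exp y \<in> C" by blast
    then show "\<exists>y\<in>X. dist y w < e" by (auto simp: X_def dist_commute)
  qed
  have unbH: "\<not> bounded H"
  proof
    assume "bounded H"
    then obtain B where B: "\<And>w. w \<in> H \<Longrightarrow> norm w \<le> B" by (auto simp: bounded_iff)
    define x where "x = min (ln \<epsilon>) (- \<bar>B\<bar>) - 1"
    have "norm (complex_of_real x) \<le> B" by (rule B) (simp add: H_def x_def)
    then have "\<bar>x\<bar> \<le> B" by (simp only: norm_of_real)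
    moreover have "x \<le> - \<bar>B\<bar> - 1" by (simp add: x_def)
    ultimately show False by linarith
  qed
  have unb: "\<exists>T. connected T \<and> \<not> bounded T \<and> w \<in> T \<and> T \<subseteq> - ?L" if w: "w \<in> - ?L" for w
  proof (cases "c0 + exp w \<in> D")
    case True
    then have "c0 + exp w \<in> closure C" using w by (auto simp: U_def)
    then have "w \<in> closure X" by (rule inclX)
    moreover have "\<not> bounded (closure X)" using unbH HX bounded_subset closure_subset by (metis subset_trans)
    moreover have "closure X \<subseteq> - ?L" using clX by (auto simp: U_def)
    moreover have "connected (closure X)" using connX by (rule connected_imp_connected_closure)
    ultimately show ?thesis by blast
  next
    case False
    define T where "T = (\<lambda>t. w + of_real t) ` {0..}"
    have "connected T" unfolding T_def by (intro connected_continuous_image continuous_intros) auto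
    moreover have "\<not> bounded T"
    proof
      assume "bounded T"
      then obtain B where B: "\<And>y. y \<in> T \<Longrightarrow> norm y \<le> B" by (auto simp: bounded_iff)
      have "w + of_real (\<bar>B\<bar> + norm w + 1) \<in> T" unfolding T_def by (rule imageI) simp
      then have "norm (w + of_real (\<bar>B\<bar> + norm w + 1)) \<le> B" by (rule B)
      moreover have "norm (complex_of_real (\<bar>B\<bar> + norm w + 1)) - norm w \<le> norm (w + of_real (\<bar>B\<bar> + norm w + 1))"
        by (metis add.commute norm_diff_ineq)
      moreover have "norm (complex_of_real (\<bar>B\<bar> + norm w + 1)) = \<bar>B\<bar> + norm w + 1" by (simp only: norm_of_real) simp
      ultimately show False by linarith
    qed
    moreover have "w \<in> T" unfolding T_def by (rule image_eqI[of _ _ 0]) auto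
    moreover have "T \<subseteq> - ?L"
    proof -
      have "c0 + exp (w + of_real t) \<notin> D" if t: "0 \<le> t" for t
      proof
        assume inD: "c0 + exp (w + of_real t) \<in> D"
        have cD: "c0 \<in> D" using c0 closure_C_D closure_subset by blast
        have conv: "convex D" by (simp add: D_eq)
        have "exp (- t) \<le> 1" using t by simp
        then have "(1 - exp (- t)) *\<^sub>R c0 + exp (- t) *\<^sub>R (c0 + exp (w + of_real t)) \<in> D"
          using convexD[OF conv cD inD, of "1 - exp (- t)" "exp (- t)"] by simp
        also have "(1 - exp (- t)) *\<^sub>R c0 + exp (- t) *\<^sub>R (c0 + exp (w + of_real t))
            = c0 + exp (complex_of_real (- t)) * exp (w + of_real t)"
          unfolding exp_of_real by (simp add: scaleR_conv_of_real algebra_simps)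
        also have "\<dots> = c0 + exp w" by (simp add: exp_add[symmetric])
        finally show False using False by simp
      qed
      then show ?thesis by (auto simp: T_def U_def)
    qed
    ultimately show ?thesis by blast
  qed
  have "\<not> bounded K" if K: "K \<in> components (- ?L)" for K
  proof -
    obtain w where w: "w \<in> K" using K in_components_nonempty by blast
    then have "w \<in> - ?L" using K in_components_subset by blast
    then obtain T where T: "connected T" "\<not> bounded T" "w \<in> T" "T \<subseteq> - ?L" using unb by blast
    have "T \<subseteq> K" by (rule components_maximal[OF K T(1,4)]) (use w T in blast)
    then show ?thesis using T(2) bounded_subset by blast
  qed
  then show "simply_connected ?L"
    using simply_connected_eq_unbounded_complement_components[OF oL] connL by blast
  show "?L \<noteq> UNIV"
  proof -
    have "complex_of_real (ln \<epsilon> - 1) \<in> H" by (simp add: H_def)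
    then have "complex_of_real (ln \<epsilon> - 1) \<in> X" using HX by blast
    then show ?thesis using closure_subset by (auto simp: X_def U_def)
  qed
qed

text \<open>A conformal map from the punctured disc extends to the centre by boundedness, and sends it to an isolated
  point of the complement of \<open>U\<close>.  There is none, because \<open>C\<close> is open and the complement of \<open>D\<close> is closed under
  moving away from the centre \<open>a\<close>.\<close>

lemma not_conformal_punctured_disc: "\<not> conformally_equivalent U (ball 0 1 - {0})"
proof
  assume "conformally_equivalent U (ball 0 1 - {0})"
  then obtain f g where fg: "f holomorphic_on U" "g holomorphic_on ball 0 1 - {0}" "g ` (ball 0 1 - {0}) = U"
    "\<And>w. w \<in> ball 0 1 - {0} \<Longrightarrow> f (g w) = w"
    unfolding conformally_equivalent_def by auto
  have gU: "g w \<in> U" if "w \<in> ball 0 1 - {0}" for w using fg(3) that by blast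
  have "bounded D" by (simp add: D_eq)
  then have "bounded U" by (rule bounded_subset) (auto simp: U_def)
  then obtain B where B: "\<And>z. z \<in> U \<Longrightarrow> norm z \<le> B" by (auto simp: bounded_iff)
  have "eventually (\<lambda>z. norm (g z) \<le> B) (at 0)"
    unfolding eventually_at by (rule exI[of _ 1]) (use B gU in auto)
  then have "\<exists>G. G holomorphic_on ball 0 1 \<and> (\<forall>z\<in>ball 0 1 - {0}. G z = g z)"
    using holomorphic_on_extend_bounded[of g "ball 0 1" 0] fg(2) by auto
  then obtain G where G: "G holomorphic_on ball 0 1" "\<And>z. z \<in> ball 0 1 - {0} \<Longrightarrow> G z = g z" by blast
  have half: "(1/2::complex) \<in> ball 0 1 - {0}" "(1/3::complex) \<in> ball 0 1 - {0}" by auto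
  have inj: "g x = g y \<Longrightarrow> x = y" if "x \<in> ball 0 1 - {0}" "y \<in> ball 0 1 - {0}" for x y
    using fg(4) that by metis
  have nc: "\<not> G constant_on ball 0 1"
  proof
    assume "G constant_on ball 0 1"
    then have "G (1/2) = G (1/3)" unfolding constant_on_def by auto
    then have "(1/2::complex) = 1/3" using inj[OF half] G(2) half by simp
    then show False by simp
  qed
  have op: "open (G ` W)" if "open W" "W \<subseteq> ball 0 1" for W
    by (rule open_mapping_thm[OF G(1) open_ball connected_ball that nc])
  define z0 where "z0 = G 0"
  have z0U: "z0 \<notin> U"
  proof
    assume "z0 \<in> U"
    then have "z0 \<in> g ` (ball 0 1 - {0})" using fg(3) by simp
    then obtain w where w: "w \<in> ball 0 1 - {0}" "g w = z0" by (metis imageE)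
    then have "0 \<noteq> w" by auto
    then obtain W1 W2 where W: "open W1" "open W2" "0 \<in> W1" "w \<in> W2" "W1 \<inter> W2 = {}"
      using hausdorff[of 0 w] by metis
    have "open (G ` (W1 \<inter> ball 0 1) \<inter> G ` (W2 \<inter> ball 0 1))" using W by (intro open_Int op) auto
    moreover have "z0 \<in> G ` (W1 \<inter> ball 0 1) \<inter> G ` (W2 \<inter> ball 0 1)"
    proof
      show "z0 \<in> G ` (W1 \<inter> ball 0 1)" unfolding z0_def using W by (intro imageI) simp
      have "z0 = G w" using w G(2) by simp
      then show "z0 \<in> G ` (W2 \<inter> ball 0 1)" using W w by blast
    qed
    ultimately obtain e where e: "0 < e" "ball z0 e \<subseteq> G ` (W1 \<inter> ball 0 1) \<inter> G ` (W2 \<inter> ball 0 1)" by (meson openE)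
    define z where "z = z0 + of_real (e / 2)"
    have z: "z \<in> ball z0 e" "z \<noteq> z0" using e by (auto simp: z_def dist_norm)
    have zz: "z \<in> G ` (W1 \<inter> ball 0 1)" "z \<in> G ` (W2 \<inter> ball 0 1)" using subsetD[OF e(2) z(1)] by (simp_all only: Int_iff)
    obtain x where x: "x \<in> W1 \<inter> ball 0 1" "G x = z" using zz(1) by (metis imageE)
    obtain y where y: "y \<in> W2 \<inter> ball 0 1" "G y = z" using zz(2) by (metis imageE)
    note xy = x(1) y(1) x(2) y(2)
    have "x \<noteq> 0" using xy z by (auto simp: z0_def)
    moreover have "y \<noteq> 0" using xy W by blast
    ultimately have "x = y" using inj[of x y] G(2) xy by auto
    then show False using xy W by blast
  qed
  have "open (G ` ball 0 1)" by (rule op) auto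
  moreover have "z0 \<in> G ` ball 0 1" by (simp add: z0_def)
  ultimately obtain e where e: "0 < e" "ball z0 e \<subseteq> G ` ball 0 1" by (meson openE)
  have pun: "z \<in> U" if zb: "z \<in> ball z0 e" and zn: "z \<noteq> z0" for z
  proof -
    obtain x where x: "x \<in> ball 0 1" "z = G x" using subsetD[OF e(2) zb] by (metis imageE)
    then have "x \<noteq> 0" using zn by (auto simp: z0_def)
    then show ?thesis using x G(2)[of x] gU[of x] by simp
  qed
  show False
  proof (cases "z0 \<in> D")
    case True
    then have "z0 \<in> closure C" using z0U by (simp add: U_def)
    then obtain y where y: "y \<in> C" "dist y z0 < e" using e by (meson closure_approachable)
    then obtain e' where e': "0 < e'" "ball y e' \<subseteq> C \<inter> ball z0 e"
      using open_C by (metis Int_iff dist_commute mem_ball open_Int open_ball openE)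
    define y' where "y' = y + of_real (e' / 2)"
    have yy: "y' \<in> ball y e'" "y' \<noteq> y" "y \<in> ball y e'" using e' by (auto simp: y'_def dist_norm)
    have "y \<in> C \<inter> ball z0 e" "y' \<in> C \<inter> ball z0 e" using subsetD[OF e'(2)] yy by auto
    then obtain x where x: "x \<in> C" "x \<in> ball z0 e" "x \<noteq> z0" using yy(2) by blast
    then show False using pun[OF x(2,3)] closure_subset[of C] by (auto simp: U_def)
  next
    case False
    define z where "z = z0 + of_real (e / (2 * norm (z0 - a))) * (z0 - a)"
    have n: "r \<le> norm (z0 - a)" using False by (simp add: D_eq dist_norm norm_minus_commute)
    then have n0: "0 < norm (z0 - a)" using r_pos by linarith
    have "norm (z - z0) = e / 2" using n0 e by (simp add: z_def norm_mult norm_divide)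
    then have zb: "z \<in> ball z0 e" "z \<noteq> z0" using e by (auto simp: dist_norm norm_minus_commute)
    have "z - a = of_real (1 + e / (2 * norm (z0 - a))) * (z0 - a)" by (simp add: z_def algebra_simps)
    then have "norm (z - a) = \<bar>1 + e / (2 * norm (z0 - a))\<bar> * norm (z0 - a)" by (simp only: norm_mult norm_of_real)
    moreover have "1 \<le> \<bar>1 + e / (2 * norm (z0 - a))\<bar>" using e n0 by simp
    ultimately have "norm (z0 - a) \<le> norm (z - a)" using n0 by (metis mult_le_cancel_right1 less_le_not_le not_less)
    then have "z \<notin> D" using n by (simp add: D_eq dist_norm norm_minus_commute)
    then show False using pun[OF zb] by (simp add: U_def)
  qed
qed

end

lemma conformally_equivalent_trans:
  assumes "conformally_equivalent R S" "conformally_equivalent S T"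
  shows "conformally_equivalent R T"
proof -
  obtain f g where fg: "open R" "open S" "f holomorphic_on R" "g holomorphic_on S" "f ` R = S" "g ` S = R"
    "\<And>z. z \<in> R \<Longrightarrow> g (f z) = z" "\<And>z. z \<in> S \<Longrightarrow> f (g z) = z"
    using assms(1) unfolding conformally_equivalent_def by metis
  obtain f' g' where fg': "open T" "f' holomorphic_on S" "g' holomorphic_on T" "f' ` S = T" "g' ` T = S"
    "\<And>z. z \<in> S \<Longrightarrow> g' (f' z) = z" "\<And>z. z \<in> T \<Longrightarrow> f' (g' z) = z"
    using assms(2) unfolding conformally_equivalent_def by metis
  have "f' \<circ> f holomorphic_on R" using fg fg' by (intro holomorphic_on_compose) auto
  moreover have "g \<circ> g' holomorphic_on T" using fg fg' by (intro holomorphic_on_compose) auto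
  moreover have "(f' \<circ> f) ` R = T" "(g \<circ> g') ` T = R" using fg(5,6) fg'(4,5) by (metis image_comp)+
  moreover have "(g \<circ> g') ((f' \<circ> f) z) = z" if "z \<in> R" for z
    using that fg(5,7) fg'(6) by (metis comp_apply imageI)
  moreover have "(f' \<circ> f) ((g \<circ> g') z) = z" if "z \<in> T" for z
    using that fg(8) fg'(5,7) by (metis comp_apply imageI)
  ultimately show ?thesis unfolding conformally_equivalent_def using fg(1) fg'(1) by blast
qed

lemma conformally_equivalent_translate:
  assumes "open S" shows "conformally_equivalent S ((\<lambda>z. z - c) ` S)"
  unfolding conformally_equivalent_def
proof (intro conjI exI)
  show "open ((\<lambda>z. z - c) ` S)" using assms by (simp add: open_translation_subtract)
  show "(\<lambda>z. z - c) holomorphic_on S" "(\<lambda>z. z + c) holomorphic_on (\<lambda>z. z - c) ` S" by (intro holomorphic_intros)+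
  show "(\<lambda>z. z + c) ` (\<lambda>z. z - c) ` S = S" by (simp add: image_comp comp_def)
qed (use assms in auto)

text \<open>The quotient of the right half plane by the deck transformation \<open>\<xi> \<mapsto> \<alpha> \<xi> + B\<close> is a round annulus in the
  hyperbolic case \<open>\<alpha> \<noteq> 1\<close> and a punctured disc in the parabolic case \<open>\<alpha> = 1\<close>.  In the first case a logarithm about
  the finite fixed point \<open>\<xi>0\<close> maps the half plane to a strip on which the transformation is a translation.\<close>

lemma conformal_quotient:
  fixes S :: "complex set"
  assumes S: "open S" "0 \<notin> S"
    and Q: "Q holomorphic_on {w. exp w \<in> S}" and G: "G holomorphic_on {\<xi>. 0 < Re \<xi>}"
    and QG: "\<And>w. exp w \<in> S \<Longrightarrow> 0 < Re (Q w) \<and> G (Q w) = w"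
    and GQ: "\<And>\<xi>. 0 < Re \<xi> \<Longrightarrow> exp (G \<xi>) \<in> S \<and> Q (G \<xi>) = \<xi>"
    and ne: "S \<noteq> {}"
    and deck: "\<And>w. exp w \<in> S \<Longrightarrow> Q (w + 2 * pi * \<i>) = of_real \<alpha> * Q w + B"
    and \<alpha>: "0 < \<alpha>" and B: "Re B = 0"
  shows "(\<exists>r1 r2. 0 < r1 \<and> r1 < r2 \<and> conformally_equivalent S (round_annulus r1 r2)) \<or>
    conformally_equivalent S (ball 0 1 - {0})"
proof (cases "\<alpha> = 1")
  case False
  define l where "l = ln \<alpha>"
  have l0: "l \<noteq> 0" using False \<alpha> by (simp add: l_def)
  have expl: "exp (complex_of_real l) = of_real \<alpha>" using \<alpha> by (simp add: l_def exp_of_real)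
  define \<xi>0 where "\<xi>0 = B / of_real (1 - \<alpha>)"
  have re0: "Re \<xi>0 = 0" using B by (simp add: \<xi>0_def Re_divide_of_real)
  have fix0: "of_real \<alpha> * \<xi>0 + B = \<xi>0"
  proof -
    have "\<xi>0 * of_real (1 - \<alpha>) = B" using False by (simp add: \<xi>0_def)
    then show ?thesis by (simp add: algebra_simps)
  qed
  \<comment> \<open>the logarithm of the half plane has imaginary part less than \<open>\<pi> / 2\<close>; it is scaled by \<open>2 \<pi> / l\<close>\<close>
  define M where "M = pi\<^sup>2 / \<bar>l\<bar>"
  have M: "0 < M" using l0 by (simp add: M_def)
  define T where "T = round_annulus (exp (- M)) (exp M)"
  have memT: "exp w \<in> T \<longleftrightarrow> \<bar>Re w\<bar> < M" for w by (auto simp: T_def round_annulus_def)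
  define E where "E \<omega> = exp (\<omega> * of_real l / (2 * pi * \<i>))" for \<omega> :: complex
  have imE: "Im (\<omega> * of_real l / (2 * pi * \<i>)) = - Re \<omega> * l / (2 * pi)" for \<omega> :: complex
    by (simp add: Im_divide power2_eq_square field_simps)
  have small: "\<bar>Im (\<omega> * of_real l / (2 * pi * \<i>))\<bar> < pi / 2" if "\<bar>Re \<omega>\<bar> < M" for \<omega> :: complex
  proof -
    have "\<bar>Re \<omega>\<bar> * \<bar>l\<bar> < pi * pi" using that l0 by (simp add: M_def field_simps power2_eq_square)
    then have "\<bar>Re \<omega>\<bar> * \<bar>l\<bar> / (2 * pi) < pi / 2" by (simp add: field_simps)
    then show ?thesis unfolding imE by (simp add: abs_mult)
  qed
  have LnE: "Ln (E \<omega>) = \<omega> * of_real l / (2 * pi * \<i>)" if "\<bar>Re \<omega>\<bar> < M" for \<omega> :: complex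
    unfolding E_def using small[OF that] by (intro Ln_exp) (auto simp: abs_less_iff)
  have ReE: "0 < Re (E \<omega>)" if "\<bar>Re \<omega>\<bar> < M" for \<omega> :: complex
  proof -
    have "E \<omega> \<noteq> 0" by (simp add: E_def)
    then show ?thesis using Re_Ln_pos_lt[of "E \<omega>"] LnE[OF that] small[OF that] by simp
  qed
  have ReE': "0 < Re (E \<omega> + \<xi>0)" if "\<bar>Re \<omega>\<bar> < M" for \<omega> :: complex using ReE[OF that] re0 by simp
  define \<psi> where "\<psi> w = (2 * pi * \<i> / of_real l) * Ln (Q w - \<xi>0)" for w
  define h where "h \<omega> = G (E \<omega> + \<xi>0)" for \<omega>
  have Re\<psi>: "Re (\<psi> w) = - (2 * pi / l) * Im (Ln (Q w - \<xi>0))" for w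
    by (simp add: \<psi>_def Re_divide field_simps power2_eq_square)
  have Qre: "0 < Re (Q w - \<xi>0)" if "exp w \<in> S" for w using QG[OF that] re0 by simp
  have Qnr: "Q w - \<xi>0 \<notin> \<real>\<^sub>\<le>\<^sub>0" "Q w - \<xi>0 \<noteq> 0" if "exp w \<in> S" for w
    using Qre[OF that] by (auto simp: complex_nonpos_Reals_iff)
  have E\<psi>: "E (\<psi> w) = Q w - \<xi>0" if "exp w \<in> S" for w
  proof -
    have "\<psi> w * of_real l / (2 * pi * \<i>) = Ln (Q w - \<xi>0)" using l0 by (simp add: \<psi>_def)
    then show ?thesis using Qnr[OF that] by (simp add: E_def)
  qed
  have "conformally_equivalent S T"
  proof (rule descend_conformal[OF S, where \<psi> = \<psi> and h = h])
    show "open T" unfolding T_def round_annulus_def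
      by (intro open_Collect_conj open_Collect_less continuous_intros)
    show "0 \<notin> T" using M by (simp add: T_def round_annulus_def)
    show "\<psi> holomorphic_on {w. exp w \<in> S}"
      unfolding \<psi>_def using Qnr by (intro holomorphic_intros Q) auto
    have "E holomorphic_on {w. exp w \<in> T}" unfolding E_def by (intro holomorphic_intros) auto
    then have "(\<lambda>\<omega>. E \<omega> + \<xi>0) holomorphic_on {w. exp w \<in> T}" by (intro holomorphic_intros)
    then have "G \<circ> (\<lambda>\<omega>. E \<omega> + \<xi>0) holomorphic_on {w. exp w \<in> T}"
      by (rule holomorphic_on_compose_gen[OF _ G]) (use ReE' memT in auto)
    then show "h holomorphic_on {w. exp w \<in> T}" by (simp add: h_def[abs_def] comp_def)
    show "exp (\<psi> w) \<in> T \<and> h (\<psi> w) = w" if w: "exp w \<in> S" for w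
    proof
      have "\<bar>Im (Ln (Q w - \<xi>0))\<bar> < pi / 2" using Re_Ln_pos_lt[OF Qnr(2)[OF w]] Qre[OF w] by simp
      then have "(2 * pi / \<bar>l\<bar>) * \<bar>Im (Ln (Q w - \<xi>0))\<bar> < (2 * pi / \<bar>l\<bar>) * (pi / 2)"
        using l0 by (intro mult_strict_left_mono) auto
      then have "\<bar>Re (\<psi> w)\<bar> < M" unfolding Re\<psi> M_def by (simp add: abs_mult power2_eq_square)
      then show "exp (\<psi> w) \<in> T" by (simp add: memT)
      show "h (\<psi> w) = w" unfolding h_def E\<psi>[OF w] using QG[OF w] by simp
    qed
    show "exp (h \<omega>) \<in> S \<and> \<psi> (h \<omega>) = \<omega>" if w: "exp \<omega> \<in> T" for \<omega>
    proof
      have r: "\<bar>Re \<omega>\<bar> < M" using w memT by blast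
      show "exp (h \<omega>) \<in> S" unfolding h_def using GQ[OF ReE'[OF r]] by simp
      have "Q (h \<omega>) = E \<omega> + \<xi>0" unfolding h_def using GQ[OF ReE'[OF r]] by simp
      then show "\<psi> (h \<omega>) = \<omega>" unfolding \<psi>_def using LnE[OF r] l0 by simp
    qed
    show "exp (\<psi> (w + 2 * pi * \<i>)) = exp (\<psi> w)" if w: "exp w \<in> S" for w
    proof -
      have "Q (w + 2 * pi * \<i>) - \<xi>0 = of_real \<alpha> * (Q w - \<xi>0)"
        using deck[OF w] fix0 by (simp add: algebra_simps)
      then have "Ln (Q (w + 2 * pi * \<i>) - \<xi>0) = of_real l + Ln (Q w - \<xi>0)"
        using Ln_times_of_real[OF \<alpha> Qnr(2)[OF w]] Ln_of_real[OF \<alpha>] by (simp add: l_def)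
      then have "\<psi> (w + 2 * pi * \<i>) = \<psi> w + 2 * complex_of_real pi * \<i>"
        unfolding \<psi>_def using l0 by (simp add: distrib_left)
      then show ?thesis by (simp only: exp_shift)
    qed
    show "exp (h (\<omega> + 2 * pi * \<i>)) = exp (h \<omega>)" if w: "exp \<omega> \<in> T" for \<omega>
    proof -
      have r: "\<bar>Re \<omega>\<bar> < M" using w memT by blast
      have "(\<omega> + 2 * pi * \<i>) * of_real l / (2 * pi * \<i>) = \<omega> * of_real l / (2 * pi * \<i>) + of_real l"
        by (simp add: field_simps)
      then have E2: "E (\<omega> + 2 * pi * \<i>) = of_real \<alpha> * E \<omega>" unfolding E_def by (simp add: exp_add expl)
      have hS: "exp (h \<omega>) \<in> S" and Qh: "Q (h \<omega>) = E \<omega> + \<xi>0"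
        using GQ[OF ReE'[OF r]] by (simp_all add: h_def)
      have "Q (h \<omega> + 2 * pi * \<i>) = of_real \<alpha> * E \<omega> + \<xi>0"
        using deck[OF hS] fix0 unfolding Qh by (simp add: algebra_simps)
      moreover have "exp (h \<omega> + 2 * pi * \<i>) \<in> S" using hS by simp
      ultimately have "G (of_real \<alpha> * E \<omega> + \<xi>0) = h \<omega> + 2 * pi * \<i>" using QG by metis
      then have "h (\<omega> + 2 * pi * \<i>) = h \<omega> + 2 * complex_of_real pi * \<i>" using E2 by (simp add: h_def)
      then show ?thesis by (simp only: exp_shift)
    qed
  qed
  then show ?thesis using M unfolding T_def by (intro disjI1 exI[of _ "exp (- M)"] exI[of _ "exp M"]) auto
next
  case True
  define \<beta> where "\<beta> = Im B"
  have B\<beta>: "B = \<i> * of_real \<beta>" using B by (simp add: complex_eq_iff \<beta>_def)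
  have deck': "Q (w + 2 * pi * \<i>) = Q w + B" if "exp w \<in> S" for w using deck[OF that] True by simp
  obtain z where z: "z \<in> S" using ne by blast
  then have "exp (Ln z) \<in> S" using S by (metis exp_Ln)
  note w0 = this
  have \<beta>0: "\<beta> \<noteq> 0"
  proof
    assume "\<beta> = 0"
    then have "Q (Ln z + 2 * pi * \<i>) = Q (Ln z)" using deck'[OF w0] B\<beta> by simp
    moreover have "exp (Ln z + 2 * pi * \<i>) \<in> S" using w0 by simp
    ultimately have "Ln z + 2 * pi * \<i> = Ln z" using QG w0 by metis
    then show False by simp
  qed
  define T where "T = ball (0::complex) 1 - {0}"
  have memT: "exp w \<in> T \<longleftrightarrow> Re w < 0" for w by (auto simp: T_def)
  define b where "b = 2 * pi / \<bar>\<beta>\<bar>"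
  have b: "0 < b" "b * \<bar>\<beta>\<bar> = 2 * pi" using \<beta>0 by (auto simp: b_def)
  have bp: "b * \<beta> = 2 * pi \<or> b * \<beta> = - (2 * pi)" using b(2) by (cases "0 \<le> \<beta>") auto
  define \<psi> where "\<psi> w = - of_real b * Q w" for w
  define h where "h \<omega> = G (- \<omega> / of_real b)" for \<omega>
  have Reh: "0 < Re (- \<omega> / of_real b)" if "Re \<omega> < 0" for \<omega>
    using that b by (simp add: divide_neg_pos)
  have "conformally_equivalent S T"
  proof (rule descend_conformal[OF S, where \<psi> = \<psi> and h = h])
    show "open T" "0 \<notin> T" by (auto simp: T_def open_delete)
    show "\<psi> holomorphic_on {w. exp w \<in> S}" unfolding \<psi>_def by (intro holomorphic_intros Q)
    have "(\<lambda>\<omega>. - \<omega> / of_real b) holomorphic_on {w. exp w \<in> T}" using b by (intro holomorphic_intros) auto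
    then have "G \<circ> (\<lambda>\<omega>. - \<omega> / of_real b) holomorphic_on {w. exp w \<in> T}"
      by (rule holomorphic_on_compose_gen[OF _ G]) (use Reh memT in auto)
    then show "h holomorphic_on {w. exp w \<in> T}" by (simp add: h_def[abs_def] comp_def)
    show "exp (\<psi> w) \<in> T \<and> h (\<psi> w) = w" if w: "exp w \<in> S" for w
      using QG[OF w] b by (simp add: memT \<psi>_def h_def)
    show "exp (h \<omega>) \<in> S \<and> \<psi> (h \<omega>) = \<omega>" if w: "exp \<omega> \<in> T" for \<omega>
      using GQ[OF Reh] w b by (simp add: memT \<psi>_def h_def)
    show "exp (\<psi> (w + 2 * pi * \<i>)) = exp (\<psi> w)" if w: "exp w \<in> S" for w
    proof -
      have "\<psi> (w + 2 * pi * \<i>) = \<psi> w - \<i> * of_real (b * \<beta>)" unfolding \<psi>_def deck'[OF w] B\<beta> by (simp add: algebra_simps)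
      then have "exp (\<psi> (w + 2 * pi * \<i>)) = exp (\<psi> w) / exp (\<i> * of_real (b * \<beta>))" by (simp only: exp_diff)
      moreover have "exp (\<i> * of_real (b * \<beta>)) = 1"
      proof -
        have "exp (\<i> * of_real (b * \<beta>)) = cis (b * \<beta>)" by (simp only: cis_conv_exp)
        moreover have "cis (b * \<beta>) = 1" using bp by (auto simp: complex_eq_iff)
        ultimately show ?thesis by (simp only:)
      qed
      ultimately show ?thesis by simp
    qed
    show "exp (h (\<omega> + 2 * pi * \<i>)) = exp (h \<omega>)" if w: "exp \<omega> \<in> T" for \<omega>
    proof -
      have r: "Re \<omega> < 0" using w memT by blast
      have hS: "exp (h \<omega>) \<in> S" and Qh: "Q (h \<omega>) = - \<omega> / of_real b"
        using GQ[OF Reh[OF r]] by (simp_all add: h_def)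
      have eq: "- (\<omega> + 2 * pi * \<i>) / of_real b = - \<omega> / of_real b - \<i> * of_real \<bar>\<beta>\<bar>"
      proof -
        have "complex_of_real (2 * pi) = of_real b * of_real \<bar>\<beta>\<bar>" by (metis b(2) of_real_mult)
        then show ?thesis using b by (simp add: field_simps)
      qed
      show ?thesis
      proof (cases "\<beta> < 0")
        case True
        then have "- \<omega> / of_real b - \<i> * of_real \<bar>\<beta>\<bar> = Q (h \<omega> + 2 * pi * \<i>)"
          unfolding deck'[OF hS] Qh B\<beta> by simp
        moreover have "exp (h \<omega> + 2 * pi * \<i>) \<in> S" using hS by simp
        ultimately have "h (\<omega> + 2 * pi * \<i>) = h \<omega> + 2 * complex_of_real pi * \<i>"
          using QG unfolding h_def[of "\<omega> + 2 * pi * \<i>"] eq by simp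
        then show ?thesis by (simp only: exp_shift)
      next
        case False
        define w' where "w' = h \<omega> - 2 * complex_of_real pi * \<i>"
        have hw: "h \<omega> = w' + 2 * complex_of_real pi * \<i>" by (simp add: w'_def)
        then have w'S: "exp w' \<in> S" using hS by simp
        have "Q w' + B = - \<omega> / of_real b" using deck'[OF w'S] Qh hw by simp
        then have "Q w' = - \<omega> / of_real b - B" by (metis add_diff_cancel_right')
        then have "- \<omega> / of_real b - \<i> * of_real \<bar>\<beta>\<bar> = Q w'"
          using False unfolding B\<beta> by simp
        then have "h (\<omega> + 2 * pi * \<i>) = w'"
          using QG[OF w'S] unfolding h_def[of "\<omega> + 2 * pi * \<i>"] eq by simp
        then show ?thesis unfolding hw by (simp only: exp_shift)
      qed
    qed
  qed
  then show ?thesis by (simp add: T_def)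
qed

context ring_domain
begin

text \<open>The exterior \<open>U\<close> is conformally a round annulus.  The Riemann map \<open>f\<close> of the logarithmic preimage conjugates
  translation by \<open>2 \<pi> \<i>\<close> to an automorphism \<open>\<sigma>\<close> of the disc without fixed points.  Sending a boundary fixed point to
  infinity makes it an affine automorphism of the right half plane.\<close>

theorem conformal_annulus:
  "\<exists>r1 r2. 0 < r1 \<and> r1 < r2 \<and> conformally_equivalent U (round_annulus r1 r2)"
proof -
  obtain c0 where c0: "c0 \<in> C" using C_ne by blast
  let ?L = "{w. c0 + exp w \<in> U}"
  define S where "S = (\<lambda>z. z - c0) ` U"
  have memS: "z \<in> S \<longleftrightarrow> c0 + z \<in> U" for z by (auto simp: S_def image_iff algebra_simps)
  have L: "?L = {w. exp w \<in> S}" by (simp add: memS)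
  have cU: "c0 \<notin> U" using c0 closure_subset by (auto simp: U_def)
  have S: "open S" "0 \<notin> S"
    using open_U cU by (auto simp: S_def open_translation_subtract)
  have neS: "S \<noteq> {}" using lifted_domain(3)[OF c0] memS by blast
  note ld = lifted_domain[OF c0, unfolded L]
  let ?L' = "{w. exp w \<in> S}"
  have "\<exists>f g. f holomorphic_on ?L' \<and> g holomorphic_on ball 0 1 \<and>
      (\<forall>z\<in>?L'. f z \<in> ball 0 1 \<and> g (f z) = z) \<and> (\<forall>z\<in>ball 0 1. g z \<in> ?L' \<and> f (g z) = z)"
    using Riemann_mapping_theorem[of ?L'] ld by blast
  then obtain f g where f: "f holomorphic_on ?L'" and g: "g holomorphic_on ball 0 1"
    and fg': "\<forall>z\<in>?L'. f z \<in> ball 0 1 \<and> g (f z) = z" and gf': "\<forall>z\<in>ball 0 1. g z \<in> ?L' \<and> f (g z) = z"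
    by blast
  have fg: "f w \<in> ball 0 1 \<and> g (f w) = w" if "exp w \<in> S" for w using fg' that by blast
  have gf: "exp (g z) \<in> S \<and> f (g z) = z" if "z \<in> ball 0 1" for z using gf' that by blast
  define \<sigma> where "\<sigma> z = f (g z + 2 * pi * \<i>)" for z
  define \<tau> where "\<tau> z = f (g z - 2 * pi * \<i>)" for z
  have shS: "exp (w + 2 * pi * \<i>) \<in> S \<longleftrightarrow> exp w \<in> S" for w by simp
  have shS': "exp (w - 2 * pi * \<i>) \<in> S \<longleftrightarrow> exp w \<in> S" for w using shS[of "w - 2 * pi * \<i>"] by simp
  have \<sigma>h: "\<sigma> holomorphic_on ball 0 1"
  proof -
    have "f \<circ> (\<lambda>z. g z + 2 * pi * \<i>) holomorphic_on ball 0 1"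
      by (rule holomorphic_on_compose_gen[OF _ f]) (use gf shS in \<open>auto intro!: holomorphic_intros g\<close>)
    then show ?thesis by (simp add: \<sigma>_def[abs_def] comp_def)
  qed
  have \<tau>h: "\<tau> holomorphic_on ball 0 1"
  proof -
    have "f \<circ> (\<lambda>z. g z - 2 * pi * \<i>) holomorphic_on ball 0 1"
      by (rule holomorphic_on_compose_gen[OF _ f]) (use gf shS' in \<open>auto intro!: holomorphic_intros g\<close>)
    then show ?thesis by (simp add: \<tau>_def[abs_def] comp_def)
  qed
  have \<sigma>b: "norm (\<sigma> z) < 1" "g (\<sigma> z) = g z + 2 * pi * \<i>" if "norm z < 1" for z
    using fg[of "g z + 2 * pi * \<i>"] gf[of z] shS[of "g z"] that by (auto simp: \<sigma>_def)
  have \<tau>b: "norm (\<tau> z) < 1" "g (\<tau> z) = g z - 2 * pi * \<i>" if "norm z < 1" for z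
    using fg[of "g z - 2 * pi * \<i>"] gf[of z] shS'[of "g z"] that by (auto simp: \<tau>_def)
  have \<tau>\<sigma>: "\<tau> (\<sigma> z) = z" and \<sigma>\<tau>: "\<sigma> (\<tau> z) = z" if "norm z < 1" for z
    using \<sigma>b(2)[OF that] \<tau>b(2)[OF that] gf[of z] that by (auto simp: \<tau>_def[of "\<sigma> z"] \<sigma>_def[of "\<tau> z"])
  obtain \<kappa> b where \<kappa>: "norm \<kappa> = 1" and b: "norm b < 1"
    and mob: "\<And>z. norm z < 1 \<Longrightarrow> \<sigma> z = \<kappa> * (z - b) / (1 - cnj b * z)"
  proof (rule disc_automorphism_Moebius[OF \<sigma>h \<tau>h \<sigma>b(1) \<tau>b(1) \<tau>\<sigma> \<sigma>\<tau>])
    fix \<kappa> b :: complex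
    assume "norm \<kappa> = 1" "norm b < 1" "\<And>z. norm z < 1 \<Longrightarrow> \<sigma> z = \<kappa> * (z - b) / (1 - cnj b * z)"
    then show thesis by (rule that)
  qed
  have nofix: "\<kappa> * (z - b) / (1 - cnj b * z) \<noteq> z" if "norm z < 1" for z
  proof
    assume "\<kappa> * (z - b) / (1 - cnj b * z) = z"
    then have "\<sigma> z = z" using mob[OF that] by simp
    then have "g z = g z + 2 * pi * \<i>" using \<sigma>b(2)[OF that] by simp
    then show False by simp
  qed
  obtain z1 where z1: "norm z1 = 1" "\<kappa> * (z1 - b) = z1 * (1 - cnj b * z1)"
    by (rule Moebius_boundary_fixpoint[OF \<kappa> b nofix])
  have z10: "z1 \<noteq> 0" using z1 by auto
  define A where "A = (1 - cnj b * z1)\<^sup>2 / (\<kappa> * (1 - b * cnj b))"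
  define B0 where "B0 = z1 * cnj b * (1 - cnj b * z1) / (\<kappa> * (1 - b * cnj b))"
  define P where "P z = z1 / (z1 - z) - 1/2" for z
  define Pi where "Pi \<xi> = z1 * (1 - 1 / (\<xi> + 1/2))" for \<xi>
  have d: "z1 - z \<noteq> 0" if "norm z < 1" for z using that z1 by auto
  have PRe: "0 < Re (P z)" if "norm z < 1" for z
  proof -
    define q where "q = z / z1"
    have q: "norm q < 1" using that z1 by (simp add: q_def norm_divide)
    then have q1: "1 - q \<noteq> 0" by auto
    have "P z = 1 / (1 - q) - 1/2"
      using d[OF that] z10 by (simp add: P_def q_def field_simps)
    also have "\<dots> = (1 + q) / (2 * (1 - q))" using q1 by (simp add: field_simps)
    also have "\<dots> = ((1 + q) * cnj (1 - q)) / (2 * ((1 - q) * cnj (1 - q)))" using q1 by simp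
    also have "(1 - q) * cnj (1 - q) = of_real ((norm (1 - q))\<^sup>2)" by (metis complex_norm_square)
    finally have "P z = ((1 + q) * cnj (1 - q)) / of_real (2 * (norm (1 - q))\<^sup>2)" by simp
    then have "Re (P z) = Re ((1 + q) * cnj (1 - q)) / (2 * (norm (1 - q))\<^sup>2)" by (simp only: Re_divide_of_real)
    moreover have "Re ((1 + q) * cnj (1 - q)) = 1 - (norm q)\<^sup>2"
      unfolding cmod_power2 by (simp add: algebra_simps power2_eq_square)
    moreover have "(norm q)\<^sup>2 < 1" using q by (simp add: power_less_one_iff)
    ultimately show ?thesis using q1 by simp
  qed
  have Pib: "norm (Pi \<xi>) < 1" and PPi: "P (Pi \<xi>) = \<xi>" if "0 < Re \<xi>" for \<xi>
  proof -
    have n0: "\<xi> + 1/2 \<noteq> 0" using that by (auto simp: complex_eq_iff)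
    have e1: "\<xi> - 1/2 = (\<xi> + 1/2) - 1" by simp
    have "1 - 1 / (\<xi> + 1/2) = (\<xi> - 1/2) / (\<xi> + 1/2)"
      unfolding e1 diff_divide_distrib using n0 by simp
    moreover have "norm (\<xi> - 1/2) < norm (\<xi> + 1/2)"
    proof -
      have "(norm (\<xi> - 1/2))\<^sup>2 < (norm (\<xi> + 1/2))\<^sup>2" unfolding cmod_power2 using that by (simp add: power2_eq_square algebra_simps)
      then show ?thesis by (rule power2_less_imp_less) simp
    qed
    ultimately show "norm (Pi \<xi>) < 1" using z1 n0 by (simp add: Pi_def norm_mult norm_divide divide_less_eq_1)
    have "z1 - Pi \<xi> = z1 / (\<xi> + 1/2)" by (simp add: Pi_def algebra_simps)
    then show "P (Pi \<xi>) = \<xi>" unfolding P_def using z10 n0 by simp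
  qed
  have PiP: "Pi (P z) = z" if "norm z < 1" for z
    using d[OF that] z10 by (simp add: Pi_def P_def field_simps)
  define Q where "Q w = P (f w)" for w
  define G where "G \<xi> = g (Pi \<xi>)" for \<xi>
  have fb: "norm (f w) < 1" if "exp w \<in> S" for w using fg[OF that] by simp
  have Qh: "Q holomorphic_on ?L'"
    unfolding Q_def P_def using d fb by (intro holomorphic_intros f) auto
  have Gh: "G holomorphic_on {\<xi>. 0 < Re \<xi>}"
  proof -
    have "\<xi> + 1/2 \<noteq> 0" if "0 < Re \<xi>" for \<xi> using that by (auto simp: complex_eq_iff)
    then have "Pi holomorphic_on {\<xi>. 0 < Re \<xi>}" unfolding Pi_def by (intro holomorphic_intros) auto
    then have "g \<circ> Pi holomorphic_on {\<xi>. 0 < Re \<xi>}"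
      by (rule holomorphic_on_compose_gen[OF _ g]) (use Pib in auto)
    then show ?thesis by (simp add: G_def[abs_def] comp_def)
  qed
  have QG: "0 < Re (Q w) \<and> G (Q w) = w" if "exp w \<in> S" for w
    using PRe[OF fb[OF that]] PiP[OF fb[OF that]] fg[OF that] by (simp add: Q_def G_def)
  have GQ: "exp (G \<xi>) \<in> S \<and> Q (G \<xi>) = \<xi>" if "0 < Re \<xi>" for \<xi>
    using Pib[OF that] PPi[OF that] gf[of "Pi \<xi>"] by (simp add: Q_def G_def)
  define B where "B = A / 2 + B0 - 1/2"
  have deck: "Q (w + 2 * pi * \<i>) = A * Q w + B" if w: "exp w \<in> S" for w
  proof -
    have "f (w + 2 * pi * \<i>) = \<sigma> (f w)" using fg[OF w] by (simp add: \<sigma>_def)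
    then have s: "f (w + 2 * pi * \<i>) = \<kappa> * (f w - b) / (1 - cnj b * f w)" using mob[OF fb[OF w]] by simp
    have sb: "norm (\<kappa> * (f w - b) / (1 - cnj b * f w)) < 1" using \<sigma>b(1)[OF fb[OF w]] mob[OF fb[OF w]] by simp
    have "z1 / (z1 - f (w + 2 * pi * \<i>)) = A * (z1 / (z1 - f w)) + B0"
      unfolding s A_def B0_def by (rule Moebius_affine[OF \<kappa> b z1 fb[OF w] sb])
    then show ?thesis by (simp add: Q_def P_def B_def algebra_simps)
  qed
  have AB: "A = of_real (Re A) \<and> 0 < Re A \<and> Re B = 0"
  proof (rule halfplane_affine)
    fix \<xi> assume \<xi>: "0 < Re \<xi>"
    have "0 < Re (Q (G \<xi> + 2 * pi * \<i>))" using QG[of "G \<xi> + 2 * pi * \<i>"] GQ[OF \<xi>] shS by blast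
    then show "0 < Re (A * \<xi> + B)" using deck[of "G \<xi>"] GQ[OF \<xi>] by simp
    have eS: "exp (G \<xi> - 2 * pi * \<i>) \<in> S" using GQ[OF \<xi>] shS' by blast
    have "A * Q (G \<xi> - 2 * pi * \<i>) + B = \<xi>"
      using deck[OF eS] GQ[OF \<xi>] by simp
    then show "\<exists>\<xi>'. 0 < Re \<xi>' \<and> A * \<xi>' + B = \<xi>" using QG[OF eS] by blast
  qed
  have "(\<exists>r1 r2. 0 < r1 \<and> r1 < r2 \<and> conformally_equivalent S (round_annulus r1 r2)) \<or>
    conformally_equivalent S (ball 0 1 - {0})"
    by (rule conformal_quotient[OF S Qh Gh QG GQ neS, of "Re A" B]) (use deck AB in auto)
  moreover have "conformally_equivalent U S" unfolding S_def by (rule conformally_equivalent_translate[OF open_U])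
  ultimately show ?thesis
    using conformally_equivalent_trans not_conformal_punctured_disc by blast
qed

end

section \<open>Correspondence of the ends\<close>

lemma connected_round_annulus:
  assumes "0 < r1" shows "connected (round_annulus r1 r2)"
proof (cases "r1 < r2")
  case True
  have "round_annulus r1 r2 = exp ` ({w. ln r1 < Re w} \<inter> {w. Re w < ln r2})"
  proof (intro equalityI subsetI)
    fix z assume z: "z \<in> round_annulus r1 r2"
    then have n: "r1 < norm z" "norm z < r2" by (auto simp: round_annulus_def)
    then have z0: "z \<noteq> 0" using assms by auto
    have "ln r1 < ln (norm z)" "ln (norm z) < ln r2" using n assms z0 by auto
    then show "z \<in> exp ` ({w. ln r1 < Re w} \<inter> {w. Re w < ln r2})"
      using z0 by (intro image_eqI[of _ _ "Ln z"]) auto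
  next
    fix z assume "z \<in> exp ` ({w. ln r1 < Re w} \<inter> {w. Re w < ln r2})"
    then obtain w where w: "z = exp w" "ln r1 < Re w" "Re w < ln r2" by auto
    have "exp (ln r1) < exp (Re w)" "exp (Re w) < exp (ln r2)" using w by auto
    then show "z \<in> round_annulus r1 r2" using assms True w by (simp add: round_annulus_def)
  qed
  moreover have "connected ({w. ln r1 < Re w} \<inter> {w. Re w < ln r2})"
    by (intro convex_connected convex_Int convex_halfspace_Re_gt convex_halfspace_Re_lt)
  ultimately show ?thesis by (simp add: connected_continuous_image continuous_on_exp)
next
  case False
  then have "round_annulus r1 r2 = {}" by (auto simp: round_annulus_def)
  then show ?thesis by simp
qed

lemma compact_subset_annulus:
  assumes K: "compact K" "K \<subseteq> round_annulus r1 r2" and r: "r1 < r2"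
  obtains s1 s2 where "r1 < s1" "s1 < s2" "s2 < r2" "\<And>z. z \<in> K \<Longrightarrow> s1 < norm z \<and> norm z < s2"
proof (cases "K = {}")
  case True
  obtain s1 where s1: "r1 < s1" "s1 < r2" using dense r by blast
  obtain s2 where "s1 < s2" "s2 < r2" using dense s1 by blast
  then show thesis using that s1 True by blast
next
  case False
  obtain x where x: "x \<in> K" "\<And>y. y \<in> K \<Longrightarrow> norm y \<le> norm x"
    using continuous_attains_sup[OF K(1) False, of norm] continuous_on_norm_id by blast
  obtain y where y: "y \<in> K" "\<And>z. z \<in> K \<Longrightarrow> norm y \<le> norm z"
    using continuous_attains_inf[OF K(1) False, of norm] continuous_on_norm_id by blast
  have xy: "r1 < norm y" "norm x < r2" using x y K by (auto simp: round_annulus_def)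
  obtain s1 where s1: "r1 < s1" "s1 < norm y" using dense xy by blast
  obtain s2 where s2: "norm x < s2" "s2 < r2" using dense xy by blast
  have "norm y \<le> norm x" using x y by blast
  then have "s1 < s2" using s1 s2 by linarith
  moreover have "s1 < norm z \<and> norm z < s2" if "z \<in> K" for z
    using x(2)[OF that] y(2)[OF that] s1 s2 by linarith
  ultimately show thesis using that[of s1 s2] s1(1) s2(2) by blast
qed

text \<open>A conformal map \<open>f\<close> of \<open>U\<close> onto a round annulus, with inverse \<open>g\<close>.\<close>

locale annulus_chart = ring_domain +
  fixes r1 r2 :: real and f g :: "complex \<Rightarrow> complex"
  assumes r1: "0 < r1" and r12: "r1 < r2"
    and f_hol: "f holomorphic_on U" and g_hol: "g holomorphic_on round_annulus r1 r2"
    and f_im: "f ` U = round_annulus r1 r2" and g_im: "g ` round_annulus r1 r2 = U"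
    and gf: "\<And>z. z \<in> U \<Longrightarrow> g (f z) = z" and fg: "\<And>z. z \<in> round_annulus r1 r2 \<Longrightarrow> f (g z) = z"
begin

lemma f_cont: "continuous_on U f" and g_cont: "continuous_on (round_annulus r1 r2) g"
  using f_hol g_hol by (auto intro: holomorphic_on_imp_continuous_on)

lemma gU: "z \<in> round_annulus r1 r2 \<Longrightarrow> g z \<in> U" using g_im by blast
lemma fA: "z \<in> U \<Longrightarrow> f z \<in> round_annulus r1 r2" using f_im by blast

text \<open>Compact subsets of \<open>U\<close> correspond to sets that stay away from both boundary circles.\<close>

lemma compact_preimage:
  assumes "compact K" "K \<subseteq> U"
  obtains s1 s2 where "r1 < s1" "s1 < s2" "s2 < r2"
    "\<And>z. z \<in> round_annulus r1 r2 \<Longrightarrow> g z \<in> K \<Longrightarrow> s1 < norm z \<and> norm z < s2"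
proof -
  have "compact (f ` K)" using assms f_cont by (intro compact_continuous_image) (auto intro: continuous_on_subset)
  moreover have "f ` K \<subseteq> round_annulus r1 r2" using assms f_im by blast
  ultimately obtain s1 s2 where s: "r1 < s1" "s1 < s2" "s2 < r2" "\<And>z. z \<in> f ` K \<Longrightarrow> s1 < norm z \<and> norm z < s2"
    using compact_subset_annulus[OF _ _ r12] by metis
  have "s1 < norm z \<and> norm z < s2" if "z \<in> round_annulus r1 r2" "g z \<in> K" for z
    using s(4)[of z] fg[OF that(1)] that(2) by (metis imageI)
  then show thesis using that s by blast
qed

text \<open>The chart is oriented if the inner circle corresponds to \<open>C\<close> and the outer circle to the boundary of \<open>D\<close>.
  Both statements are formulated by neighbourhoods, without boundary values of \<open>g\<close>.\<close>

definition inner_to_C :: bool where "inner_to_C \<longleftrightarrow>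
  (\<forall>W. open W \<longrightarrow> closure C \<subseteq> W \<longrightarrow> (\<exists>s>r1. \<forall>z. r1 < norm z \<longrightarrow> norm z < s \<longrightarrow> z \<in> round_annulus r1 r2 \<longrightarrow> g z \<in> W))"

definition outer_to_D :: bool where "outer_to_D \<longleftrightarrow>
  (\<forall>t<r. \<exists>s<r2. \<forall>z \<in> round_annulus r1 r2. s < norm z \<longrightarrow> t < dist a (g z))"

lemma ends_aux:
  assumes s: "s < r" "closure C \<subseteq> ball a s"
    and i1: "r1 < s1" "s1 < r2" "g ` round_annulus r1 s1 \<subseteq> ball a s"
    and i2: "r1 < s2" "s2 < r2" "g ` round_annulus s2 r2 \<subseteq> - cball a s"
  shows "inner_to_C \<and> outer_to_D"
proof
  have cb: "cball a t \<subseteq> D" if "t < r" for t using that by (auto simp: D_eq)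
  show inner_to_C unfolding inner_to_C_def
  proof (intro allI impI)
    fix W assume W: "open W" "closure C \<subseteq> W"
    have c1: "compact (cball a s - W)" using W by (intro compact_diff) auto
    have c2: "cball a s - W \<subseteq> U" using cb[OF s(1)] W by (auto simp: U_def)
    obtain t1 t2 where t: "r1 < t1" "t1 < t2" "t2 < r2" "\<And>z. z \<in> round_annulus r1 r2 \<Longrightarrow> g z \<in> cball a s - W \<Longrightarrow> t1 < norm z \<and> norm z < t2"
      proof (rule compact_preimage[OF c1 c2])
      fix s1 s2
      assume "r1 < s1" "s1 < s2" "s2 < r2"
        "\<And>z. z \<in> round_annulus r1 r2 \<Longrightarrow> g z \<in> cball a s - W \<Longrightarrow> s1 < norm z \<and> norm z < s2"
      then show thesis by (rule that)
    qed
    have "g z \<in> W" if "r1 < norm z" "norm z < min s1 t1" "z \<in> round_annulus r1 r2" for z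
    proof (rule ccontr)
      assume "g z \<notin> W"
      moreover have "g z \<in> ball a s" using i1(3) that by (auto simp: round_annulus_def)
      ultimately have "t1 < norm z" using t(4)[OF that(3)] by auto
      then show False using that by simp
    qed
    then show "\<exists>s>r1. \<forall>z. r1 < norm z \<longrightarrow> norm z < s \<longrightarrow> z \<in> round_annulus r1 r2 \<longrightarrow> g z \<in> W"
      using i1(1) t(1) by (intro exI[of _ "min s1 t1"]) auto
  qed
  show outer_to_D unfolding outer_to_D_def
  proof (intro allI impI)
    fix t assume t: "t < r"
    define t' where "t' = max t s"
    have c1: "compact (cball a t' - ball a s)" by (intro compact_diff) auto
    have c2: "cball a t' - ball a s \<subseteq> U" 
    proof -
      have "cball a t' \<subseteq> D" by (rule cb) (use t s in \<open>auto simp: t'_def\<close>)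
      then show ?thesis using s(2) by (auto simp: U_def)
    qed
    obtain t1 t2 where tt: "r1 < t1" "t1 < t2" "t2 < r2" "\<And>z. z \<in> round_annulus r1 r2 \<Longrightarrow> g z \<in> cball a t' - ball a s \<Longrightarrow> t1 < norm z \<and> norm z < t2"
      proof (rule compact_preimage[OF c1 c2])
      fix s1 s2
      assume "r1 < s1" "s1 < s2" "s2 < r2"
        "\<And>z. z \<in> round_annulus r1 r2 \<Longrightarrow> g z \<in> cball a t' - ball a s \<Longrightarrow> s1 < norm z \<and> norm z < s2"
      then show thesis by (rule that)
    qed
    have "t < dist a (g z)" if "z \<in> round_annulus r1 r2" "max s2 t2 < norm z" for z
    proof (rule ccontr)
      assume n: "\<not> t < dist a (g z)"
      have "z \<in> round_annulus s2 r2" using that by (auto simp: round_annulus_def)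
      then have "g z \<notin> cball a s" using i2(3) by blast
      then have "g z \<in> cball a t' - ball a s" using n by (auto simp: t'_def)
      then have "norm z < t2" using tt(4)[OF that(1)] by blast
      then show False using that by simp
    qed
    then show "\<exists>s<r2. \<forall>z \<in> round_annulus r1 r2. s < norm z \<longrightarrow> t < dist a (g z)"
      using i2(2) tt(3) by (intro exI[of _ "max s2 t2"]) auto
  qed
qed

text \<open>A circle around \<open>C\<close> separates the images of the two ends of the annulus: each end is connected and avoids the
  circle, and both cannot lie on the same side, because their images together with a compact set fill \<open>U\<close>.\<close>

lemma ends_cases:
  obtains s s1 s2 where "s < r" "closure C \<subseteq> ball a s" "r1 < s1" "s1 < s2" "s2 < r2"
    "(g ` round_annulus r1 s1 \<subseteq> ball a s \<and> g ` round_annulus s2 r2 \<subseteq> - cball a s) \<or>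
     (g ` round_annulus r1 s1 \<subseteq> - cball a s \<and> g ` round_annulus s2 r2 \<subseteq> ball a s)"
proof -
  obtain s where s: "0 < s" "s < r" "closure C \<subseteq> ball a s"
    by (rule inner_radius[OF compact_closure_C closure_C_D])
  have "sphere a s \<subseteq> D" using s by (auto simp: D_eq)
  then have "sphere a s \<subseteq> U" using s(3) by (auto simp: U_def)
  then obtain s1 s2 where s12: "r1 < s1" "s1 < s2" "s2 < r2"
    and sp: "\<And>z. z \<in> round_annulus r1 r2 \<Longrightarrow> g z \<in> sphere a s \<Longrightarrow> s1 < norm z \<and> norm z < s2"
    using compact_preimage[OF compact_sphere] by metis
  have side: "g ` R \<subseteq> ball a s \<or> g ` R \<subseteq> - cball a s"
    if R: "connected R" "R \<subseteq> round_annulus r1 r2" "\<And>z. z \<in> R \<Longrightarrow> \<not> (s1 < norm z \<and> norm z < s2)" for R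
  proof -
    have c: "connected (g ` R)" using R g_cont by (intro connected_continuous_image) (auto intro: continuous_on_subset)
    have "g ` R \<inter> sphere a s = {}" using sp R by blast
    then have cov: "g ` R \<subseteq> ball a s \<union> - cball a s" by (auto simp: not_le)
    have "ball a s \<inter> g ` R = {} \<or> - cball a s \<inter> g ` R = {}"
      by (rule connectedD[OF c open_ball _ _ cov]) auto
    then show ?thesis using cov by blast
  qed
  have sub: "round_annulus r1 s1 \<subseteq> round_annulus r1 r2" "round_annulus s2 r2 \<subseteq> round_annulus r1 r2"
    using s12 by (auto simp: round_annulus_def)
  have c1: "g ` round_annulus r1 s1 \<subseteq> ball a s \<or> g ` round_annulus r1 s1 \<subseteq> - cball a s"
    by (rule side[OF connected_round_annulus[OF r1] sub(1)]) (auto simp: round_annulus_def)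
  have c2: "g ` round_annulus s2 r2 \<subseteq> ball a s \<or> g ` round_annulus s2 r2 \<subseteq> - cball a s"
    by (rule side[OF connected_round_annulus sub(2)]) (use s12 r1 in \<open>auto simp: round_annulus_def\<close>)
  define K where "K = {z::complex. s1 \<le> norm z \<and> norm z \<le> s2}"
  have "K = cball 0 s2 - ball 0 s1" by (auto simp: K_def)
  then have "compact K" by (simp add: compact_diff)
  moreover have KA: "K \<subseteq> round_annulus r1 r2" using s12 by (auto simp: K_def round_annulus_def)
  ultimately have cK: "compact (g ` K)" "g ` K \<subseteq> U"
    using g_cont g_im by (auto intro!: compact_continuous_image intro: continuous_on_subset)
  have split: "z \<in> g ` round_annulus r1 s1 \<union> g ` K \<union> g ` round_annulus s2 r2" if "z \<in> U" for z
  proof -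
    have "f z \<in> round_annulus r1 s1 \<union> K \<union> round_annulus s2 r2"
      using fA[OF that] by (auto simp: K_def round_annulus_def)
    then show ?thesis using gf[OF that] by (metis UnE UnI1 UnI2 imageI)
  qed
  have not_in: "\<not> (g ` round_annulus r1 s1 \<subseteq> ball a s \<and> g ` round_annulus s2 r2 \<subseteq> ball a s)"
  proof
    assume b: "g ` round_annulus r1 s1 \<subseteq> ball a s \<and> g ` round_annulus s2 r2 \<subseteq> ball a s"
    have "g ` K \<subseteq> D" using cK(2) by (auto simp: U_def)
    then obtain s' where s': "s' < r" "g ` K \<subseteq> ball a s'" using inner_radius[OF cK(1)] by blast
    obtain t where t: "max s s' < t" "t < r" using dense[of "max s s'" r] s s' by auto
    define z where "z = a + of_real t"
    have dz: "dist a z = t" using t s by (simp add: z_def dist_norm)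
    have "z \<notin> ball a s" "z \<notin> ball a s'" "z \<in> D" using dz t by (auto simp: D_eq)
    moreover have "z \<in> U" unfolding U_def using calculation(1,3) s(3) by blast
    ultimately show False using split[of z] b s' by blast
  qed
  have not_out: "\<not> (g ` round_annulus r1 s1 \<subseteq> - cball a s \<and> g ` round_annulus s2 r2 \<subseteq> - cball a s)"
  proof
    assume b: "g ` round_annulus r1 s1 \<subseteq> - cball a s \<and> g ` round_annulus s2 r2 \<subseteq> - cball a s"
    have "C \<noteq> UNIV" using compact_closure_C not_bounded_UNIV compact_imp_bounded closure_subset bounded_subset by metis
    then obtain p where p: "p \<in> frontier C" using frontier_not_empty[OF C_ne] by blast
    have "open (ball a s \<inter> - g ` K)" using cK by (intro open_Int) (auto simp: open_Compl compact_imp_closed)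
    moreover have "p \<in> ball a s \<inter> - g ` K" using frontier_C_notin[OF p] s cK(2) by blast
    moreover have "p \<in> closure U" by (rule frontier_C_closure_U[OF p])
    ultimately have "U \<inter> (ball a s \<inter> - g ` K) \<noteq> {}"
      by (metis Int_commute disjoint_iff open_Int_closure_eq_empty)
    then obtain z where "z \<in> U" "z \<in> ball a s" "z \<notin> g ` K" by blast
    then show False using split[of z] b by (auto simp: subset_iff) 
  qed
  show thesis using that[OF s(2,3) s12] c1 c2 not_in not_out by blast
qed

end

locale oriented_chart = annulus_chart +
  assumes inner: "inner_to_C" and outer: "outer_to_D"

context ring_domain
begin

text \<open>Inversion of the annulus in a circle exchanges the boundary circles and keeps the radii.\<close>

lemma obtain_oriented_chart:
  assumes r: "0 < r1" "r1 < r2" and ce: "conformally_equivalent U (round_annulus r1 r2)"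
  obtains f g where "oriented_chart D a r C r1 r2 f g"
proof -
  obtain f g where "f holomorphic_on U" "g holomorphic_on round_annulus r1 r2"
    "f ` U = round_annulus r1 r2" "g ` round_annulus r1 r2 = U"
    "\<And>z. z \<in> U \<Longrightarrow> g (f z) = z" "\<And>z. z \<in> round_annulus r1 r2 \<Longrightarrow> f (g z) = z"
    using ce unfolding conformally_equivalent_def by metis
  then interpret A: annulus_chart D a r C r1 r2 f g
    using r by unfold_locales auto
  obtain s s1 s2 where s: "s < r" "closure C \<subseteq> ball a s" "r1 < s1" "s1 < s2" "s2 < r2"
    "(g ` round_annulus r1 s1 \<subseteq> ball a s \<and> g ` round_annulus s2 r2 \<subseteq> - cball a s) \<or>
     (g ` round_annulus r1 s1 \<subseteq> - cball a s \<and> g ` round_annulus s2 r2 \<subseteq> ball a s)"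
    by (rule A.ends_cases)
  from s(6) show thesis
  proof
    assume "g ` round_annulus r1 s1 \<subseteq> ball a s \<and> g ` round_annulus s2 r2 \<subseteq> - cball a s"
    then have "A.inner_to_C \<and> A.outer_to_D" using A.ends_aux[of s s1 s2] s by auto
    then have "oriented_chart D a r C r1 r2 f g" by unfold_locales auto
    then show thesis by (rule that)
  next
    assume swap: "g ` round_annulus r1 s1 \<subseteq> - cball a s \<and> g ` round_annulus s2 r2 \<subseteq> ball a s"
    define \<iota> where "\<iota> z = of_real (r1 * r2) / z" for z :: complex
    have nz: "z \<noteq> 0" if "z \<in> round_annulus u v" "0 < u" for z u v using that by (auto simp: round_annulus_def)
    have r2: "0 < r2" using r by simp
    have \<iota>A: "\<iota> z \<in> round_annulus (r1 * r2 / v) (r1 * r2 / u)" if "z \<in> round_annulus u v" "0 < u" for z u v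
    proof -
      have n: "0 < norm z" "u < norm z" "norm z < v" using that by (auto simp: round_annulus_def)
      have "norm (\<iota> z) = r1 * r2 / norm z" using r r2 by (simp add: \<iota>_def norm_divide norm_mult)
      then show ?thesis using n r r2 that(2) by (simp add: round_annulus_def divide_strict_left_mono)
    qed
    have \<iota>R: "\<iota> z \<in> round_annulus r1 r2" if "z \<in> round_annulus r1 r2" for z
      using \<iota>A[OF that r(1)] r r2 by simp
    have \<iota>\<iota>: "\<iota> (\<iota> z) = z" if "z \<in> round_annulus r1 r2" for z
      using nz[OF that r(1)] r r2 by (simp add: \<iota>_def)
    have \<iota>h: "\<iota> holomorphic_on round_annulus r1 r2"
      unfolding \<iota>_def using nz r by (intro holomorphic_intros) auto
    have f': "\<iota> \<circ> f holomorphic_on U"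
      by (rule holomorphic_on_compose_gen[OF A.f_hol \<iota>h]) (use A.fA in auto)
    have g': "g \<circ> \<iota> holomorphic_on round_annulus r1 r2"
      by (rule holomorphic_on_compose_gen[OF \<iota>h A.g_hol]) (use \<iota>R in auto)
    have inv1: "(g \<circ> \<iota>) ((\<iota> \<circ> f) z) = z" if "z \<in> U" for z using \<iota>\<iota>[OF A.fA[OF that]] A.gf[OF that] by simp
    have inv2: "(\<iota> \<circ> f) ((g \<circ> \<iota>) z) = z" if "z \<in> round_annulus r1 r2" for z
      using \<iota>\<iota>[OF that] A.fg[OF \<iota>R[OF that]] by simp
    have m1: "(\<iota> \<circ> f) z \<in> round_annulus r1 r2" if "z \<in> U" for z using \<iota>R[OF A.fA[OF that]] by simp
    have m2: "(g \<circ> \<iota>) z \<in> U" if "z \<in> round_annulus r1 r2" for z using A.gU[OF \<iota>R[OF that]] by simp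
    have im1: "(\<iota> \<circ> f) ` U = round_annulus r1 r2"
      using m1 m2 inv2 by (metis (no_types, lifting) image_subset_iff subsetI subset_antisym image_eqI)
    have im2: "(g \<circ> \<iota>) ` round_annulus r1 r2 = U"
      using m1 m2 inv1 by (metis (no_types, lifting) image_subset_iff subsetI subset_antisym image_eqI)
    interpret B: annulus_chart D a r C r1 r2 "\<iota> \<circ> f" "g \<circ> \<iota>"
      by unfold_locales (fact r f' g' im1 im2 inv1 inv2)+
    define t1 where "t1 = r1 * r2 / s2"
    define t2 where "t2 = r1 * r2 / s1"
    have t: "r1 < t1" "t1 < r2" "r1 < t2" "t2 < r2"
      using r r2 s unfolding t1_def t2_def by (auto simp: field_simps)
    have "(g \<circ> \<iota>) ` round_annulus r1 t1 \<subseteq> ball a s"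
    proof -
      have "\<iota> z \<in> round_annulus s2 r2" if "z \<in> round_annulus r1 t1" for z
        using \<iota>A[OF that r(1)] r r2 s by (simp add: t1_def)
      then show ?thesis using swap by auto
    qed
    moreover have "(g \<circ> \<iota>) ` round_annulus t2 r2 \<subseteq> - cball a s"
    proof -
      have "\<iota> z \<in> round_annulus r1 s1" if "z \<in> round_annulus t2 r2" for z
        using \<iota>A[OF that] t r r2 s by (simp add: t2_def)
      then show ?thesis using swap by auto
    qed
    ultimately have "B.inner_to_C \<and> B.outer_to_D" using B.ends_aux[of s t1 t2] s t by auto
    then have "oriented_chart D a r C r1 r2 (\<iota> \<circ> f) (g \<circ> \<iota>)" by unfold_locales auto
    then show thesis by (rule that)
  qed
qed

end

section \<open>Boundary behaviour on the inner circle\<close>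

lemma measurable_slices:
  fixes e :: "complex \<Rightarrow> ennreal"
  assumes "e \<in> borel_measurable borel"
  shows "(\<lambda>y. \<integral>\<^sup>+x. e (Complex x y) \<partial>lborel) \<in> borel_measurable borel"
    and "(\<lambda>x. \<integral>\<^sup>+y. e (Complex x y) \<partial>lborel) \<in> borel_measurable borel"
proof -
  have c: "(\<lambda>p. e (Complex (fst p) (snd p))) \<in> borel_measurable (lborel \<Otimes>\<^sub>M lborel)"
    using measurable_compose[OF measurable_Complex_pair assms] by (simp add: case_prod_unfold)
  have c': "(\<lambda>p. e (Complex (snd p) (fst p))) \<in> borel_measurable (lborel \<Otimes>\<^sub>M lborel)"
    using measurable_compose[OF measurable_pair_swap'[of lborel lborel] c] by (simp add: case_prod_unfold)
  have "(\<lambda>y. \<integral>\<^sup>+x. e (Complex x y) \<partial>lborel) \<in> borel_measurable lborel"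
    by (rule lborel.borel_measurable_nn_integral) (use c' in \<open>simp add: case_prod_unfold\<close>)
  then show "(\<lambda>y. \<integral>\<^sup>+x. e (Complex x y) \<partial>lborel) \<in> borel_measurable borel" by simp
  have "(\<lambda>x. \<integral>\<^sup>+y. e (Complex x y) \<partial>lborel) \<in> borel_measurable lborel"
    by (rule lborel.borel_measurable_nn_integral) (use c in \<open>simp add: case_prod_unfold\<close>)
  then show "(\<lambda>x. \<integral>\<^sup>+y. e (Complex x y) \<partial>lborel) \<in> borel_measurable borel" by simp
qed

text \<open>Otherwise \<open>F \<rho> \<ge> c / \<rho>\<close> near zero, which is not integrable.\<close>

lemma exists_small_scale:
  fixes F :: "real \<Rightarrow> ennreal"
  assumes F: "F \<in> borel_measurable borel" and fin: "(\<integral>\<^sup>+\<rho>. F \<rho> \<partial>lborel) < \<infinity>"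
    and c: "0 < c" and \<rho>0: "0 < \<rho>0"
  shows "\<exists>\<rho>. 0 < \<rho> \<and> \<rho> < \<rho>0 \<and> ennreal \<rho> * F \<rho> < ennreal c"
proof (rule ccontr)
  assume no: "\<not> (\<exists>\<rho>. 0 < \<rho> \<and> \<rho> < \<rho>0 \<and> ennreal \<rho> * F \<rho> < ennreal c)"
  have ge: "ennreal c \<le> ennreal \<rho> * F \<rho>" if "0 < \<rho>" "\<rho> < \<rho>0" for \<rho>
    using that no by (meson not_le)
  have ge': "ennreal (c / \<rho>) \<le> F \<rho>" if "0 < \<rho>" "\<rho> < \<rho>0" for \<rho>
  proof -
    have "ennreal (c / \<rho>) = ennreal c / ennreal \<rho>" using c that by (simp add: divide_ennreal)
    also have "\<dots> \<le> (F \<rho> * ennreal \<rho>) / ennreal \<rho>"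
      using ge[OF that] by (intro divide_right_mono_ennreal) (simp add: mult.commute)
    also have "\<dots> = F \<rho>" using that by (intro ennreal_mult_divide_eq) auto
    finally show ?thesis .
  qed
  obtain M where M: "(\<integral>\<^sup>+\<rho>. F \<rho> \<partial>lborel) = ennreal M" "0 \<le> M"
    using fin by (metis ennreal_cases infinity_ennreal_def less_irrefl)
  define b where "b = \<rho>0 / 2"
  have b: "0 < b" "b < \<rho>0" using \<rho>0 by (auto simp: b_def)
  define \<eta> where "\<eta> = b * exp (- (M + 1) / c)"
  have "exp (- (M + 1) / c) \<le> 1" using M(2) c by (simp add: field_simps)
  then have \<eta>: "0 < \<eta>" "\<eta> \<le> b" using b by (auto simp: \<eta>_def mult_left_le)
  have ln\<eta>: "ln \<eta> = ln b - (M + 1) / c" using b by (simp add: \<eta>_def ln_mult diff_divide_distrib add_divide_distrib)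
  have "(\<integral>\<^sup>+\<rho>\<in>{\<eta>..b}. ennreal (c / \<rho>) \<partial>lborel) = ennreal (c * ln b - c * ln \<eta>)"
  proof (rule nn_integral_FTC_Icc)
    show "((\<lambda>x. c * ln x) has_real_derivative c / x) (at x)" if "x \<in> {\<eta>..b}" for x
      using that \<eta> by (auto intro!: derivative_eq_intros)
  qed (use c \<eta> in auto)
  also have "c * ln b - c * ln \<eta> = M + 1" using c by (simp add: ln\<eta> field_simps)
  finally have "ennreal (M + 1) = (\<integral>\<^sup>+\<rho>\<in>{\<eta>..b}. ennreal (c / \<rho>) \<partial>lborel)" by simp
  also have "\<dots> \<le> (\<integral>\<^sup>+\<rho>. F \<rho> \<partial>lborel)"
    using ge' \<eta> b by (intro nn_integral_mono) (auto simp: indicator_def)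
  finally show False using M by simp
qed

text \<open>Wolff's lemma: for a density of finite mass there are arbitrarily small \<open>\<rho>\<close> such that the energy on the
  lines that contain the sides, other than the left one, of the rectangle \<open>[x0, x0 + \<rho>] \<times> [y0 - \<rho>, y0 + \<rho>]\<close> is small in
  comparison with \<open>1 / \<rho>\<close>.\<close>

lemma exists_small_crosscut:
  fixes e :: "complex \<Rightarrow> ennreal"
  assumes e: "e \<in> borel_measurable borel" and fin: "(\<integral>\<^sup>+z. e z \<partial>lborel) < \<infinity>"
    and c: "0 < c" and \<rho>0: "0 < \<rho>0"
  obtains \<rho> where "0 < \<rho>" "\<rho> < \<rho>0"
    "ennreal \<rho> * (\<integral>\<^sup>+x. e (Complex x (y0 + \<rho>)) \<partial>lborel) < ennreal c"
    "ennreal \<rho> * (\<integral>\<^sup>+x. e (Complex x (y0 - \<rho>)) \<partial>lborel) < ennreal c"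
    "ennreal \<rho> * (\<integral>\<^sup>+y. e (Complex (x0 + \<rho>) y) \<partial>lborel) < ennreal c"
proof -
  define J where "J y = (\<integral>\<^sup>+x. e (Complex x y) \<partial>lborel)" for y
  define I where "I x = (\<integral>\<^sup>+y. e (Complex x y) \<partial>lborel)" for x
  have J[measurable]: "J \<in> borel_measurable borel" and I[measurable]: "I \<in> borel_measurable borel"
    using measurable_slices[OF e] by (simp_all add: J_def[abs_def] I_def[abs_def])
  define F where "F \<rho> = J (y0 + \<rho>) + J (y0 - \<rho>) + I (x0 + \<rho>)" for \<rho>
  have Fm: "F \<in> borel_measurable borel" unfolding F_def by measurable
  have 1: "(\<integral>\<^sup>+\<rho>. J (y0 + \<rho>) \<partial>lborel) = (\<integral>\<^sup>+z. e z \<partial>lborel)"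
    using nn_integral_real_affine[OF J, of 1 y0] nn_integral_complex_iterated(1)[OF e] by (simp add: J_def)
  have 2: "(\<integral>\<^sup>+\<rho>. J (y0 - \<rho>) \<partial>lborel) = (\<integral>\<^sup>+z. e z \<partial>lborel)"
    using nn_integral_real_affine[OF J, of "-1" y0] nn_integral_complex_iterated(1)[OF e] by (simp add: J_def)
  have 3: "(\<integral>\<^sup>+\<rho>. I (x0 + \<rho>) \<partial>lborel) = (\<integral>\<^sup>+z. e z \<partial>lborel)"
    using nn_integral_real_affine[OF I, of 1 x0] nn_integral_complex_iterated(2)[OF e] by (simp add: I_def)
  have "(\<integral>\<^sup>+\<rho>. F \<rho> \<partial>lborel) = (\<integral>\<^sup>+z. e z \<partial>lborel) + (\<integral>\<^sup>+z. e z \<partial>lborel) + (\<integral>\<^sup>+z. e z \<partial>lborel)"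
    unfolding F_def by (simp add: nn_integral_add 1 2 3)
  then have "(\<integral>\<^sup>+\<rho>. F \<rho> \<partial>lborel) < \<infinity>" using fin by simp
  from exists_small_scale[OF Fm this c \<rho>0]
  obtain \<rho> where \<rho>: "0 < \<rho>" "\<rho> < \<rho>0" "ennreal \<rho> * F \<rho> < ennreal c" by blast
  have le: "ennreal \<rho> * a < ennreal c" if "a \<le> F \<rho>" for a
    using \<rho>(3) mult_left_mono[OF that, of "ennreal \<rho>"] by (simp add: le_less_trans)
  have l1: "J (y0 + \<rho>) \<le> F \<rho>" "J (y0 - \<rho>) \<le> F \<rho>" "I (x0 + \<rho>) \<le> F \<rho>"
    unfolding F_def by (auto intro: add_increasing add_increasing2)
  show thesis using that[OF \<rho>(1,2)] le[OF l1(1)] le[OF l1(2)] le[OF l1(3)] unfolding J_def I_def by blast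
qed

text \<open>The density of the Dirichlet integral on \<open>S\<close>, extended by zero.\<close>

definition energy :: "(complex \<Rightarrow> complex) \<Rightarrow> complex set \<Rightarrow> complex \<Rightarrow> ennreal"
  where "energy h S z = ennreal ((norm (deriv h z))\<^sup>2) * indicator S z"

lemma measurable_energy:
  assumes "open S" "h holomorphic_on S" shows "energy h S \<in> borel_measurable borel"
proof -
  have "continuous_on S (\<lambda>z. (norm (deriv h z))\<^sup>2)"
    by (intro continuous_intros holomorphic_on_imp_continuous_on holomorphic_deriv assms)
  then show ?thesis unfolding energy_def[abs_def] by (rule measurable_restrict_open_ennreal[OF assms(1)])
qed

lemma horizontal_length_area:
  assumes S: "open S" and h: "h holomorphic_on S" and ab: "\<alpha> \<le> \<beta>"
    and seg: "\<And>t. t \<in> {\<alpha>..\<beta>} \<Longrightarrow> Complex t y \<in> S"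
  shows "ennreal ((norm (h (Complex \<beta> y) - h (Complex \<alpha> y)))\<^sup>2) \<le>
    ennreal (\<beta> - \<alpha>) * (\<integral>\<^sup>+t. energy h S (Complex t y) \<partial>lborel)"
proof -
  define v where "v t = h (Complex t y)" for t
  define k where "k t = norm (deriv h (Complex t y))" for t
  have cC: "continuous_on {\<alpha>..\<beta>} (\<lambda>t. Complex t y)" by (intro continuous_intros)
  have der: "(v has_vector_derivative deriv h (Complex t y)) (at t within {\<alpha>..\<beta>})" if "t \<in> {\<alpha>..\<beta>}" for t
  proof -
    have "(h has_field_derivative deriv h (Complex t y)) (at (Complex t y))"
      using holomorphic_derivI[OF h S seg[OF that]] .
    moreover have "((\<lambda>t. Complex t y) has_vector_derivative 1) (at t within {\<alpha>..\<beta>})"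
      by (auto simp: has_vector_derivative_complex_iff intro!: derivative_eq_intros)
    ultimately have "(h \<circ> (\<lambda>t. Complex t y) has_vector_derivative 1 * deriv h (Complex t y)) (at t within {\<alpha>..\<beta>})"
      by (intro field_vector_diff_chain_within) (auto intro: has_field_derivative_at_within)
    then show ?thesis by (simp add: v_def[abs_def] comp_def)
  qed
  have "continuous_on {\<alpha>..\<beta>} k"
    unfolding k_def
    by (intro continuous_intros continuous_on_compose2[OF holomorphic_on_imp_continuous_on[OF holomorphic_deriv[OF h S]] cC])
      (use seg in auto)
  from segment_length_area[OF ab der _ this]
  have "ennreal ((norm (v \<beta> - v \<alpha>))\<^sup>2) \<le> ennreal (\<beta> - \<alpha>) * (\<integral>\<^sup>+t\<in>{\<alpha>..\<beta>}. ennreal ((k t)\<^sup>2) \<partial>lborel)"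
    by (simp add: k_def)
  also have "\<dots> \<le> ennreal (\<beta> - \<alpha>) * (\<integral>\<^sup>+t. energy h S (Complex t y) \<partial>lborel)"
    using seg by (intro mult_left_mono nn_integral_mono) (auto simp: indicator_def energy_def k_def)
  finally show ?thesis by (simp add: v_def)
qed

lemma vertical_length_area:
  assumes S: "open S" and h: "h holomorphic_on S" and ab: "\<alpha> \<le> \<beta>"
    and seg: "\<And>t. t \<in> {\<alpha>..\<beta>} \<Longrightarrow> Complex x t \<in> S"
  shows "ennreal ((norm (h (Complex x \<beta>) - h (Complex x \<alpha>)))\<^sup>2) \<le>
    ennreal (\<beta> - \<alpha>) * (\<integral>\<^sup>+t. energy h S (Complex x t) \<partial>lborel)"
proof -
  define v where "v t = h (Complex x t)" for t
  define k where "k t = norm (deriv h (Complex x t))" for t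
  have cC: "continuous_on {\<alpha>..\<beta>} (\<lambda>t. Complex x t)" by (intro continuous_intros)
  have der: "(v has_vector_derivative \<i> * deriv h (Complex x t)) (at t within {\<alpha>..\<beta>})" if "t \<in> {\<alpha>..\<beta>}" for t
  proof -
    have "(h has_field_derivative deriv h (Complex x t)) (at (Complex x t))"
      using holomorphic_derivI[OF h S seg[OF that]] .
    moreover have "((\<lambda>t. Complex x t) has_vector_derivative \<i>) (at t within {\<alpha>..\<beta>})"
      by (auto simp: has_vector_derivative_complex_iff intro!: derivative_eq_intros)
    ultimately have "(h \<circ> (\<lambda>t. Complex x t) has_vector_derivative \<i> * deriv h (Complex x t)) (at t within {\<alpha>..\<beta>})"
      by (intro field_vector_diff_chain_within) (auto intro: has_field_derivative_at_within)
    then show ?thesis by (simp add: v_def[abs_def] comp_def)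
  qed
  have "continuous_on {\<alpha>..\<beta>} k"
    unfolding k_def
    by (intro continuous_intros continuous_on_compose2[OF holomorphic_on_imp_continuous_on[OF holomorphic_deriv[OF h S]] cC])
      (use seg in auto)
  from segment_length_area[OF ab der _ this]
  have "ennreal ((norm (v \<beta> - v \<alpha>))\<^sup>2) \<le> ennreal (\<beta> - \<alpha>) * (\<integral>\<^sup>+t\<in>{\<alpha>..\<beta>}. ennreal ((k t)\<^sup>2) \<partial>lborel)"
    by (simp add: k_def norm_mult)
  also have "\<dots> \<le> ennreal (\<beta> - \<alpha>) * (\<integral>\<^sup>+t. energy h S (Complex x t) \<partial>lborel)"
    using seg by (intro mult_left_mono nn_integral_mono) (auto simp: indicator_def energy_def k_def)
  finally show ?thesis by (simp add: v_def)
qed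

lemma small_from_length_area:
  assumes le: "ennreal (d\<^sup>2) \<le> ennreal l * J" and l: "l \<le> 2 * \<rho>" and \<rho>: "0 < \<rho>"
    and J: "ennreal \<rho> * J < ennreal (\<delta>\<^sup>2 / 2)" and \<delta>: "0 < \<delta>"
  shows "d < \<delta>"
proof -
  have "ennreal (d\<^sup>2) \<le> ennreal (2 * \<rho>) * J"
    using le l by (meson ennreal_leI mult_right_mono order_trans zero_le)
  also have "\<dots> = 2 * (ennreal \<rho> * J)" using \<rho> by (simp add: ennreal_mult mult.assoc)
  also have "\<dots> < 2 * ennreal (\<delta>\<^sup>2 / 2)" using J by (intro ennreal_mult_strict_left_mono) auto
  also have "\<dots> = ennreal (\<delta>\<^sup>2)"
  proof -
    have "2 * ennreal (\<delta>\<^sup>2 / 2) = ennreal 2 * ennreal (\<delta>\<^sup>2 / 2)" by simp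
    also have "\<dots> = ennreal (2 * (\<delta>\<^sup>2 / 2))" by (rule ennreal_mult[symmetric]) auto
    finally show ?thesis by simp
  qed
  finally have "d\<^sup>2 < \<delta>\<^sup>2" by (simp add: ennreal_less_iff)
  then show ?thesis using \<delta> by (simp add: power2_less_imp_less)
qed

context annulus_chart
begin

text \<open>The chart in the logarithmic coordinate: \<open>h\<close> is a map from the strip \<open>x0 < Re w < x1\<close> onto \<open>U\<close> with period
  \<open>2 \<pi> \<i>\<close>, injective modulo the period.\<close>

definition x0 :: real where "x0 = ln r1"
definition x1 :: real where "x1 = ln r2"
definition strip :: "complex set" where "strip = {w. x0 < Re w \<and> Re w < x1}"
definition h :: "complex \<Rightarrow> complex" where "h w = g (exp w)"

lemma x01: "x0 < x1" using r1 r12 by (simp add: x0_def x1_def)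

lemma open_strip: "open strip"
  unfolding strip_def by (intro open_Collect_conj open_Collect_less continuous_intros)

lemma exp_strip: "w \<in> strip \<longleftrightarrow> exp w \<in> round_annulus r1 r2"
proof -
  have "x0 < Re w \<longleftrightarrow> r1 < exp (Re w)" "Re w < x1 \<longleftrightarrow> exp (Re w) < r2"
    unfolding x0_def x1_def using r1 r12 by (metis exp_less_cancel_iff exp_ln order_less_trans)+
  then show ?thesis by (simp add: strip_def round_annulus_def)
qed

lemma h_hol: "h holomorphic_on strip"
proof -
  have "g \<circ> exp holomorphic_on strip"
    by (rule holomorphic_on_compose_gen[OF _ g_hol]) (auto intro: holomorphic_intros simp: exp_strip)
  then show ?thesis by (simp add: h_def[abs_def] comp_def)
qed

lemma h_cont: "continuous_on strip h" by (rule holomorphic_on_imp_continuous_on[OF h_hol])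

lemma h_U: "w \<in> strip \<Longrightarrow> h w \<in> U" by (simp add: h_def gU exp_strip)

lemma h_eq: "w \<in> strip \<Longrightarrow> w' \<in> strip \<Longrightarrow> h w = h w' \<Longrightarrow> exp w = exp w'"
  unfolding h_def exp_strip using fg by metis

lemma h_inj: "w \<in> strip \<Longrightarrow> w' \<in> strip \<Longrightarrow> h w = h w' \<Longrightarrow> \<bar>Im w - Im w'\<bar> < 2 * pi \<Longrightarrow> w = w'"
  using h_eq[of w w'] exp_complex_eqI[of w w'] by blast

lemma h_surj: "z \<in> U \<Longrightarrow> \<exists>w\<in>strip. h w = z"
proof -
  assume z: "z \<in> U"
  have "f z \<noteq> 0" using fA[OF z] r1 by (auto simp: round_annulus_def)
  then have "exp (Ln (f z)) = f z" by simp
  then show ?thesis using fA[OF z] gf[OF z] by (intro bexI[of _ "Ln (f z)"]) (auto simp: exp_strip h_def)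
qed

text \<open>On a period rectangle the energy of \<open>h\<close> is the area of its image, which is finite.\<close>

lemma half_strip_finite_energy:
  assumes S: "S = strip \<inter> {w. \<bar>Im w - y0\<bar> < pi}"
  shows "open S" "h holomorphic_on S" "inj_on h S" "(\<integral>\<^sup>+z. energy h S z \<partial>lborel) < \<infinity>"
proof -
  show o: "open S" unfolding S by (intro open_Int open_strip open_Collect_less continuous_intros)
  show hol: "h holomorphic_on S" using h_hol S by (auto intro: holomorphic_on_subset)
  show inj: "inj_on h S"
  proof (rule inj_onI)
    fix x y assume "x \<in> S" "y \<in> S" "h x = h y"
    then show "x = y" using h_inj[of x y] unfolding S by auto
  qed
  have "(\<integral>\<^sup>+z. energy h S z \<partial>lborel) = (\<integral>\<^sup>+z\<in>S. ennreal (1 * (norm (deriv h z))\<^sup>2) \<partial>lborel)"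
    by (simp add: energy_def)
  also have "\<dots> \<le> (\<integral>\<^sup>+z\<in>h ` S. ennreal 1 \<partial>lborel)"
    by (rule nn_integral_holomorphic_image[OF o hol inj, of "\<lambda>_. 1"]) auto
  also have "\<dots> \<le> (\<integral>\<^sup>+z. indicator D z \<partial>lborel)"
    using h_U by (intro nn_integral_mono) (auto simp: indicator_def S U_def)
  also have "\<dots> = emeasure lborel D" using D_open by simp
  also have "\<dots> < \<infinity>" unfolding D_eq by (rule emeasure_lborel_ball_finite)
  finally show "(\<integral>\<^sup>+z. energy h S z \<partial>lborel) < \<infinity>" .
qed

end

context ring_domain
begin

text \<open>The neighbourhoods of \<open>local_structure\<close> can be chosen of uniform size, by a Lebesgue number.\<close>

lemma uniform_local_structure:
  assumes \<epsilon>: "0 < \<epsilon>"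
  obtains l where "0 < l"
    "\<And>x. x \<in> frontier C \<Longrightarrow> \<exists>N. open N \<and> ball x l \<subseteq> N \<and> N \<subseteq> ball x \<epsilon> \<and> connected (C \<inter> N)"
proof -
  define \<N> where "\<N> = {N. open N \<and> connected (C \<inter> N) \<and> (\<exists>p. N \<subseteq> ball p (\<epsilon> / 2))}"
  have "compact (frontier C)"
    using compact_closure_C by (metis bounded_closure bounded_subset closure_subset compact_eq_bounded_closed compact_frontier_bounded)
  moreover have "frontier C \<subseteq> \<Union>\<N>"
  proof
    fix p assume "p \<in> frontier C"
    from local_structure[OF this, of "\<epsilon> / 2"] \<epsilon>
    obtain N where "open N" "p \<in> N" "N \<subseteq> ball p (\<epsilon> / 2)" "connected (C \<inter> N)" by auto
    then show "p \<in> \<Union>\<N>" unfolding \<N>_def by blast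
  qed
  ultimately obtain l where l: "0 < l" "\<And>x. x \<in> frontier C \<Longrightarrow> \<exists>N\<in>\<N>. ball x l \<subseteq> N"
    using Heine_Borel_lemma[of "frontier C" \<N>] unfolding \<N>_def by blast
  have "\<exists>N. open N \<and> ball x l \<subseteq> N \<and> N \<subseteq> ball x \<epsilon> \<and> connected (C \<inter> N)" if x: "x \<in> frontier C" for x
  proof -
    obtain N where N: "N \<in> \<N>" "ball x l \<subseteq> N" using l(2)[OF x] by blast
    then obtain p where p: "N \<subseteq> ball p (\<epsilon> / 2)" unfolding \<N>_def by blast
    have "x \<in> N" using N(2) l(1) by (meson centre_in_ball subsetD)
    have "N \<subseteq> ball x \<epsilon>"
    proof
      fix y assume "y \<in> N"
      then have "dist p y < \<epsilon> / 2" "dist p x < \<epsilon> / 2" using subsetD[OF p \<open>y \<in> N\<close>] subsetD[OF p \<open>x \<in> N\<close>] by auto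
      then show "y \<in> ball x \<epsilon>" using dist_triangle3[of x y p] by simp
    qed
    then show ?thesis using N unfolding \<N>_def by blast
  qed
  then show thesis using that l(1) by blast
qed

end

context oriented_chart
begin

lemma h_inner:
  assumes "open W" "closure C \<subseteq> W"
  obtains s where "x0 < s" "s < x1" "\<And>w. w \<in> strip \<Longrightarrow> Re w < s \<Longrightarrow> h w \<in> W"
proof -
  obtain t where t: "r1 < t" "\<And>z. r1 < norm z \<Longrightarrow> norm z < t \<Longrightarrow> z \<in> round_annulus r1 r2 \<Longrightarrow> g z \<in> W"
    using inner assms unfolding inner_to_C_def by meson
  have "ln r1 < ln t" using t r1 by simp
  then have "x0 < min (ln t) x1" using x01 by (simp add: x0_def)
  then obtain s where s: "x0 < s" "s < min (ln t) x1" using dense by blast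
  have "h w \<in> W" if "w \<in> strip" "Re w < s" for w
  proof -
    have "exp (Re w) < exp (ln t)" using that s by simp
    then have "norm (exp w) < t" using t r1 by simp
    then show ?thesis using t(2)[of "exp w"] that(1) exp_strip[of w] by (simp add: h_def round_annulus_def)
  qed
  then show thesis using that[of s] s by simp
qed

lemma closure_h_image:
  assumes B: "compact B" "\<And>w. w \<in> B \<Longrightarrow> x0 \<le> Re w \<and> Re w < x1"
  shows "closure (h ` (B \<inter> strip)) \<subseteq> h ` (B \<inter> strip) \<union> closure C"
proof
  fix z assume z: "z \<in> closure (h ` (B \<inter> strip))"
  show "z \<in> h ` (B \<inter> strip) \<union> closure C"
  proof (cases "z \<in> closure C")
    case False
    then obtain \<delta> where \<delta>: "0 < \<delta>" "cball z \<delta> \<subseteq> - closure C"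
      using open_contains_cball[of "- closure C"] by auto
    obtain s where s: "x0 < s" "s < x1" "\<And>w. w \<in> strip \<Longrightarrow> Re w < s \<Longrightarrow> h w \<in> - cball z \<delta>"
    proof (rule h_inner[of "- cball z \<delta>"])
      show "open (- cball z \<delta>)" by (simp add: open_Compl)
      show "closure C \<subseteq> - cball z \<delta>" using \<delta>(2) by blast
      fix s assume "x0 < s" "s < x1" "\<And>w. w \<in> strip \<Longrightarrow> Re w < s \<Longrightarrow> h w \<in> - cball z \<delta>"
      then show thesis by (rule that)
    qed
    define B' where "B' = B \<inter> {w. s \<le> Re w}"
    have "closed {w. s \<le> Re w}" by (intro closed_Collect_le continuous_intros)
    then have "compact B'" unfolding B'_def using B(1) by blast
    moreover have B's: "B' \<subseteq> B \<inter> strip" using B(2) s by (fastforce simp: B'_def strip_def)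
    ultimately have "compact (h ` B')"
      using h_cont by (intro compact_continuous_image) (auto intro: continuous_on_subset)
    then have cl: "closed (h ` B')" by (rule compact_imp_closed)
    have "ball z \<delta> \<inter> h ` (B \<inter> strip) \<subseteq> h ` B'"
    proof
      fix y assume y: "y \<in> ball z \<delta> \<inter> h ` (B \<inter> strip)"
      then obtain w where w: "w \<in> B" "w \<in> strip" "y = h w" by blast
      have "\<not> Re w < s" using s(3)[OF w(2)] y w(3) by auto
      then show "y \<in> h ` B'" using w by (auto simp: B'_def)
    qed
    then have "closure (ball z \<delta> \<inter> h ` (B \<inter> strip)) \<subseteq> h ` B'" using cl by (rule closure_minimal)
    moreover have "z \<in> closure (ball z \<delta> \<inter> h ` (B \<inter> strip))"
      using open_Int_closure_subset[of "ball z \<delta>" "h ` (B \<inter> strip)"] z \<delta>(1) by auto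
    ultimately show ?thesis using B's by blast
  qed simp
qed

text \<open>If \<open>h ` Q\<close> had a point outside of the disc \<open>cball x \<epsilon>\<close>, it could be joined to \<open>h w0\<close> in the complement of the closure
  of \<open>C\<close>, and also in the complement of \<open>K \<union> E\<close>.  As the intersection \<open>E\<close> of these two closed sets is connected,
  Janiszewski's theorem joins the points in the complement of their union, in which \<open>h ` Q\<close> is open and closed.\<close>

lemma separating_crosscut:
  assumes Q: "Q \<subseteq> strip" "open Q" "inj_on h (Q \<union> {w0})" "w0 \<in> strip" "w0 \<notin> Q"
    and K: "closed K" "closure (h ` Q) \<subseteq> h ` Q \<union> K \<union> closure C" "K \<inter> h ` Q = {}"
    and x: "K \<union> E \<subseteq> cball x \<epsilon>" "connected E" "closed E" "E \<subseteq> closure C" "K \<inter> closure C \<subseteq> E"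
    and w0: "h w0 \<notin> cball x \<epsilon>"
  shows "h ` Q \<subseteq> cball x \<epsilon>"
proof
  fix z assume z: "z \<in> h ` Q"
  show "z \<in> cball x \<epsilon>"
  proof (rule ccontr)
    assume nz: "z \<notin> cball x \<epsilon>"
    have zU: "z \<in> U" using z Q(1) h_U by blast
    have c1: "connected_component (- closure C) z (h w0)"
      unfolding connected_component_def
      using conn_U zU h_U[OF Q(4)] by (intro exI[of _ U]) (auto simp: U_def)
    have c2: "connected_component (- (K \<union> E)) z (h w0)"
    proof -
      have "connected (- cball x \<epsilon>)" by (intro connected_complement_bounded_convex) auto
      then show ?thesis unfolding connected_component_def
        using x(1) nz w0 by (intro exI[of _ "- cball x \<epsilon>"]) auto
    qed
    have "closure C \<inter> (K \<union> E) = E" using x(4,5) by blast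
    then have c3: "connected (closure C \<inter> (K \<union> E))" using x(2) by simp
    have "connected_component (- (closure C \<union> (K \<union> E))) z (h w0)"
      by (rule Janiszewski[OF compact_closure_C closed_Un[OF K(1) x(3)] c3 c1 c2])
    then obtain M where M: "connected M" "M \<subseteq> - (closure C \<union> (K \<union> E))" "z \<in> M" "h w0 \<in> M"
      unfolding connected_component_def by blast
    have oQ: "open (h ` Q)"
    proof (rule open_mapping_thm3)
      show "h holomorphic_on Q" using h_hol Q(1) by (rule holomorphic_on_subset)
      show "inj_on h Q" using Q(3) by (rule inj_on_subset) auto
    qed (fact Q(2))
    have "M \<subseteq> h ` Q \<union> - closure (h ` Q)" using M(2) K(2) by blast
    then have "h ` Q \<inter> M = {} \<or> - closure (h ` Q) \<inter> M = {}"
      using closure_subset[of "h ` Q"] by (intro connectedD[OF M(1) oQ]) auto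
    then have "h w0 \<in> h ` Q"
    proof
      assume "- closure (h ` Q) \<inter> M = {}"
      then have "h w0 \<in> closure (h ` Q)" using M(4) by blast
      then show ?thesis using K(2) M(2,4) by blast
    qed (use z M(3) in blast)
    then obtain w where "w \<in> Q" "h w = h w0" by (metis imageE)
    then show False using inj_onD[OF Q(3), of w w0] Q(5) by auto
  qed
qed

text \<open>Small rectangles at the inner edge of the strip have small images: the three remaining sides
  of a suitable rectangle form a crosscut of small diameter, which together with a small connected
  piece of the closure of \<open>C\<close> separates the image of the rectangle from the rest of the domain.\<close>

lemma small_rectangle:
  assumes \<epsilon>: "0 < \<epsilon>"
  obtains \<rho> x where "0 < \<rho>" "\<rho> < x1 - x0"
    "\<And>w. x0 < Re w \<Longrightarrow> Re w < x0 + \<rho> \<Longrightarrow> \<bar>Im w - y0\<bar> < \<rho> \<Longrightarrow> dist x (h w) \<le> \<epsilon>"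
proof -
  define xm where "xm = (x0 + x1) / 2"
  have xm: "x0 < xm" "xm < x1" using x01 by (auto simp: xm_def)
  \<comment> \<open>two points with distinct images, so that no disc of small radius \<open>\<epsilon>'\<close> contains both images\<close>
  define a1 where "a1 = Complex xm y0"
  define a2 where "a2 = Complex xm (y0 + 1)"
  have as: "a1 \<in> strip" "a2 \<in> strip" using xm by (auto simp: a1_def a2_def strip_def)
  have "h a1 \<noteq> h a2"
  proof
    assume e: "h a1 = h a2"
    have "\<bar>Im a1 - Im a2\<bar> < 2 * pi" using pi_gt3 by (simp add: a1_def a2_def)
    with as e have "a1 = a2" by (rule h_inj)
    then show False by (simp add: a1_def a2_def)
  qed
  then have d0: "0 < dist (h a1) (h a2)" by simp
  define \<epsilon>' where "\<epsilon>' = min \<epsilon> (dist (h a1) (h a2) / 3)"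
  have "\<epsilon>' \<le> dist (h a1) (h a2) / 3" "0 < \<epsilon>'" "\<epsilon>' \<le> \<epsilon>" using \<epsilon> d0 by (simp_all add: \<epsilon>'_def)
  then have \<epsilon>': "0 < \<epsilon>'" "\<epsilon>' \<le> \<epsilon>" "2 * \<epsilon>' < dist (h a1) (h a2)" using d0 by linarith+
  obtain l0 where l0: "0 < l0"
    "\<And>x. x \<in> frontier C \<Longrightarrow> \<exists>N. open N \<and> ball x l0 \<subseteq> N \<and> N \<subseteq> ball x \<epsilon>' \<and> connected (C \<inter> N)"
    using uniform_local_structure[OF \<epsilon>'(1)] by metis
  define l where "l = min l0 \<epsilon>'"
  have l: "0 < l" "l \<le> l0" "l \<le> \<epsilon>'" using l0 \<epsilon>' by (auto simp: l_def)
  \<comment> \<open>the image of the crosscut will have diameter at most \<open>4 \<delta> < l\<close>\<close>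
  define \<delta> where "\<delta> = l / 5"
  have \<delta>: "0 < \<delta>" using l by (simp add: \<delta>_def)
  define S where "S = strip \<inter> {w. \<bar>Im w - y0\<bar> < pi}"
  note S = half_strip_finite_energy[OF S_def]
  have "0 < min 3 (xm - x0)" "0 < \<delta>\<^sup>2 / 2" using xm \<delta> by auto
  then obtain \<rho> where \<rho>: "0 < \<rho>" "\<rho> < min 3 (xm - x0)"
    and J1: "ennreal \<rho> * (\<integral>\<^sup>+x. energy h S (Complex x (y0 + \<rho>)) \<partial>lborel) < ennreal (\<delta>\<^sup>2 / 2)"
    and J2: "ennreal \<rho> * (\<integral>\<^sup>+x. energy h S (Complex x (y0 - \<rho>)) \<partial>lborel) < ennreal (\<delta>\<^sup>2 / 2)"
    and J3: "ennreal \<rho> * (\<integral>\<^sup>+y. energy h S (Complex (x0 + \<rho>) y) \<partial>lborel) < ennreal (\<delta>\<^sup>2 / 2)"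
    using exists_small_crosscut[OF measurable_energy[OF S(1,2)] S(4)] by metis
  have \<rho>': "\<rho> < 3" "x0 + \<rho> < xm" using \<rho> by auto
  have memS: "Complex x y \<in> S" if "x0 < x" "x \<le> x0 + \<rho>" "\<bar>y - y0\<bar> \<le> \<rho>" for x y
    using that \<rho>' xm pi_gt3 by (auto simp: S_def strip_def)
  have hor: "dist (h (Complex x y)) (h (Complex x' y)) < \<delta>"
    if xx: "x0 < x" "x \<le> x'" "x' \<le> x0 + \<rho>" and y: "y = y0 + \<rho> \<or> y = y0 - \<rho>" for x x' y
  proof -
    have "Complex t y \<in> S" if "t \<in> {x..x'}" for t using that xx y \<rho>(1) by (intro memS) auto
    from horizontal_length_area[OF S(1,2) xx(2) this]
    have "norm (h (Complex x' y) - h (Complex x y)) < \<delta>"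
    proof (rule small_from_length_area)
      show "x' - x \<le> 2 * \<rho>" using xx \<rho>(1) by simp
      show "ennreal \<rho> * (\<integral>\<^sup>+t. energy h S (Complex t y) \<partial>lborel) < ennreal (\<delta>\<^sup>2 / 2)" using y J1 J2 by auto
    qed (use \<rho>(1) \<delta> in auto)
    then show ?thesis by (simp add: dist_norm norm_minus_commute)
  qed
  have ver: "dist (h (Complex (x0 + \<rho>) y)) (h (Complex (x0 + \<rho>) y')) < \<delta>"
    if yy: "y0 - \<rho> \<le> y" "y \<le> y'" "y' \<le> y0 + \<rho>" for y y'
  proof -
    have "Complex (x0 + \<rho>) t \<in> S" if "t \<in> {y..y'}" for t using that yy \<rho>(1) by (intro memS) auto
    from vertical_length_area[OF S(1,2) yy(2) this]
    have "norm (h (Complex (x0 + \<rho>) y') - h (Complex (x0 + \<rho>) y)) < \<delta>"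
      by (rule small_from_length_area) (use yy \<rho>(1) \<delta> J3 in auto)
    then show ?thesis by (simp add: dist_norm norm_minus_commute)
  qed
  define R where "R = {w. x0 \<le> Re w \<and> Re w \<le> x0 + \<rho> \<and> \<bar>Im w - y0\<bar> \<le> \<rho>}"
  define k where "k = R \<inter> ({w. Re w = x0 + \<rho>} \<union> {w. \<bar>Im w - y0\<bar> = \<rho>})"
  define Q where "Q = {w. x0 < Re w \<and> Re w < x0 + \<rho> \<and> \<bar>Im w - y0\<bar> < \<rho>}"
  have Req: "R = cbox (Complex x0 (y0 - \<rho>)) (Complex (x0 + \<rho>) (y0 + \<rho>))"
    by (auto simp: R_def in_cbox_complex_iff)
  have cR: "compact R" unfolding Req by (rule compact_cbox)
  have ck: "compact k"
    unfolding k_def by (intro compact_Int_closed cR closed_Un closed_Collect_eq continuous_intros)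
  have Rx: "x0 \<le> Re w \<and> Re w < x1" if "w \<in> R" for w using that \<rho>' xm by (auto simp: R_def)
  have kx: "x0 \<le> Re w \<and> Re w < x1" if "w \<in> k" for w using that Rx by (auto simp: k_def)
  define K where "K = closure (h ` (k \<inter> strip))"
  have K1: "K \<subseteq> h ` (k \<inter> strip) \<union> closure C" unfolding K_def by (rule closure_h_image[OF ck kx])
  have Rs: "R \<inter> strip = Q \<union> k \<inter> strip"
    using \<rho>' xm \<rho>(1) by (auto simp: R_def Q_def k_def strip_def)
  have Qs: "Q \<subseteq> R \<inter> strip" unfolding Rs by blast
  have K2: "closure (h ` Q) \<subseteq> h ` Q \<union> K \<union> closure C"
  proof -
    have "closure (h ` Q) \<subseteq> closure (h ` (R \<inter> strip))" by (intro closure_mono image_mono Qs)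
    also have "\<dots> \<subseteq> h ` (R \<inter> strip) \<union> closure C" by (rule closure_h_image[OF cR Rx])
    also have "h ` (R \<inter> strip) = h ` Q \<union> h ` (k \<inter> strip)" unfolding Rs by (rule image_Un)
    also have "h ` (k \<inter> strip) \<subseteq> K" unfolding K_def by (rule closure_subset)
    finally show ?thesis by blast
  qed
  have imd: "\<bar>Im w - Im w'\<bar> < 2 * pi" if "\<bar>Im w - y0\<bar> \<le> \<rho>" "\<bar>Im w' - y0\<bar> \<le> \<rho>" for w w'
    using that \<rho>' pi_gt3 by linarith
  have K3: "K \<inter> h ` Q = {}"
  proof (rule ccontr)
    assume "K \<inter> h ` Q \<noteq> {}"
    then obtain w where w: "w \<in> Q" "h w \<in> K" by blast
    have ws: "w \<in> strip" using w Qs by blast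
    have "h w \<notin> closure C" using h_U[OF ws] by (simp add: U_def)
    then have "h w \<in> h ` (k \<inter> strip)" using w(2) K1 by blast
    then obtain w' where w': "w' \<in> k" "w' \<in> strip" "h w = h w'" by blast
    have "\<bar>Im w - y0\<bar> \<le> \<rho>" "\<bar>Im w' - y0\<bar> \<le> \<rho>" using w w' by (auto simp: Q_def k_def R_def)
    then have "w = w'" using h_inj[OF ws w'(2,3)] imd by blast
    then show False using w w' by (auto simp: Q_def k_def)
  qed
  define c where "c = Complex (x0 + \<rho>) (y0 - \<rho>)"
  define c' where "c' = Complex (x0 + \<rho>) (y0 + \<rho>)"
  have cc': "dist (h c) (h c') < \<delta>" unfolding c_def c'_def using \<rho>(1) by (intro ver) auto
  have kd: "dist (h c) (h w) \<le> 2 * \<delta>" if w: "w \<in> k" "w \<in> strip" for w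
  proof -
    have x: "x0 < Re w" "Re w \<le> x0 + \<rho>" "y0 - \<rho> \<le> Im w" "Im w \<le> y0 + \<rho>" using w by (auto simp: k_def R_def strip_def abs_le_iff)
    have we: "w = Complex (Re w) (Im w)" by simp
    have "Re w = x0 + \<rho> \<or> Im w = y0 + \<rho> \<or> Im w = y0 - \<rho>" using w(1) by (auto simp: k_def abs_if split: if_splits)
    then show ?thesis
    proof (elim disjE)
      assume e: "Re w = x0 + \<rho>"
      have "dist (h (Complex (x0 + \<rho>) (y0 - \<rho>))) (h (Complex (x0 + \<rho>) (Im w))) < \<delta>" using x by (intro ver) auto
      then show ?thesis using \<delta> unfolding c_def by (metis e we add_mono less_eq_real_def mult_2 add.right_neutral)
    next
      assume e: "Im w = y0 + \<rho>"
      have "dist (h (Complex (Re w) (y0 + \<rho>))) (h (Complex (x0 + \<rho>) (y0 + \<rho>))) < \<delta>" using x by (intro hor) auto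
      then have "dist (h w) (h c') < \<delta>" unfolding c'_def by (metis e we)
      then show ?thesis using cc' dist_triangle[of "h c" "h w" "h c'"] by (simp add: dist_commute)
    next
      assume e: "Im w = y0 - \<rho>"
      have "dist (h (Complex (Re w) (y0 - \<rho>))) (h (Complex (x0 + \<rho>) (y0 - \<rho>))) < \<delta>" using x by (intro hor) auto
      then have "dist (h w) (h c) < \<delta>" unfolding c_def by (metis e we)
      then show ?thesis using \<delta> by (simp add: dist_commute)
    qed
  qed
  have Kd: "K \<subseteq> cball (h c) (2 * \<delta>)"
    unfolding K_def by (rule closure_minimal) (use kd in auto)
  have KU: "K \<subseteq> closure U" unfolding K_def using h_U by (intro closure_mono) blast
  have KC: "K \<inter> C = {}"
  proof -
    have "C \<inter> U = {}" using closure_subset[of C] by (auto simp: U_def)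
    then have "C \<inter> closure U = {}" using open_Int_closure_eq_empty[OF open_C] by blast
    then show ?thesis using KU by blast
  qed
  have "K \<inter> closure C \<noteq> {}"
  proof
    assume e: "K \<inter> closure C = {}"
    have oK: "open (- K)" by (simp add: K_def open_Compl)
    obtain s where s: "x0 < s" "s < x1" "\<And>w. w \<in> strip \<Longrightarrow> Re w < s \<Longrightarrow> h w \<in> - K"
    proof (rule h_inner[OF oK])
      show "closure C \<subseteq> - K" using e by blast
      fix s assume "x0 < s" "s < x1" "\<And>w. w \<in> strip \<Longrightarrow> Re w < s \<Longrightarrow> h w \<in> - K"
      then show thesis by (rule that)
    qed
    obtain t where t: "x0 < t" "t < min s (x0 + \<rho>)" using dense[of x0 "min s (x0 + \<rho>)"] s \<rho>(1) by auto
    define w where "w = Complex t (y0 + \<rho>)"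
    have w: "w \<in> k" "w \<in> strip" "Re w < s" using t s \<rho>(1) by (auto simp: w_def k_def R_def strip_def)
    then have "h w \<in> K" unfolding K_def by (intro subsetD[OF closure_subset]) blast
    then show False using s(3)[OF w(2,3)] by simp
  qed
  then obtain x where x: "x \<in> K" "x \<in> closure C" by blast
  then have xF: "x \<in> frontier C" using KC open_C by (auto simp: frontier_def interior_open)
  have Kx: "K \<subseteq> ball x l"
  proof
    fix q assume "q \<in> K"
    then have "dist (h c) q \<le> 2 * \<delta>" "dist (h c) x \<le> 2 * \<delta>" using Kd x by auto
    then have "dist x q \<le> 4 * \<delta>" using dist_triangle3[of x q "h c"] by simp
    then show "q \<in> ball x l" using l by (simp add: \<delta>_def)
  qed
  obtain N where N: "open N" "ball x l0 \<subseteq> N" "N \<subseteq> ball x \<epsilon>'" "connected (C \<inter> N)" using l0(2)[OF xF] by blast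
  \<comment> \<open>the connected piece of the closure of \<open>C\<close> that contains all points where the crosscut ends\<close>
  define E where "E = closure (C \<inter> N)"
  have E1: "connected E" "closed E" "E \<subseteq> closure C"
    unfolding E_def by (rule connected_imp_connected_closure[OF N(4)], simp, rule closure_mono, simp)
  have E2: "K \<union> E \<subseteq> cball x \<epsilon>'"
  proof -
    have "E \<subseteq> cball x \<epsilon>'" unfolding E_def by (rule closure_minimal) (use N(3) in \<open>auto dest!: subsetD simp: less_imp_le\<close>)
    moreover have "K \<subseteq> cball x \<epsilon>'" using Kx l(3) by (meson ball_subset_cball subset_cball order_trans)
    ultimately show ?thesis by blast
  qed
  have E3: "K \<inter> closure C \<subseteq> E"
  proof
    fix q assume q: "q \<in> K \<inter> closure C"
    have "ball x l \<subseteq> ball x l0" using l(2) by (rule subset_ball)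
    then have "q \<in> N" using q Kx N(2) by blast
    then show "q \<in> E" using open_Int_closure_subset[OF N(1), of C] q unfolding E_def by (auto simp: Int_commute)
  qed
  have "\<not> (h a1 \<in> cball x \<epsilon>' \<and> h a2 \<in> cball x \<epsilon>')"
    using dist_triangle3[of "h a1" "h a2" x] \<epsilon>'(3) by auto
  then obtain w0 where w0: "w0 = a1 \<or> w0 = a2" "h w0 \<notin> cball x \<epsilon>'" by blast
  have w0s: "w0 \<in> strip" "\<bar>Im w0 - y0\<bar> \<le> 1" "Re w0 = xm" using w0(1) as by (auto simp: a1_def a2_def)
  have "h ` Q \<subseteq> cball x \<epsilon>'"
  proof (rule separating_crosscut[OF _ _ _ w0s(1) _ _ K2 K3 E2 E1 E3 w0(2)])
    show "Q \<subseteq> strip" using Qs by blast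
    show "open Q" unfolding Q_def by (intro open_Collect_conj open_Collect_less continuous_intros)
    show "w0 \<notin> Q" using w0s \<rho>' by (auto simp: Q_def)
    show "closed K" by (simp add: K_def)
    show "inj_on h (Q \<union> {w0})"
    proof (rule inj_onI)
      fix u v assume uv: "u \<in> Q \<union> {w0}" "v \<in> Q \<union> {w0}" "h u = h v"
      have b: "w \<in> strip \<and> \<bar>Im w - y0\<bar> < 3" if "w \<in> Q \<union> {w0}" for w
        using that w0s Qs \<rho>' by (auto simp: Q_def)
      have "\<bar>Im u - Im v\<bar> < 2 * pi" using b[OF uv(1)] b[OF uv(2)] pi_gt3 by linarith
      then show "u = v" using h_inj[of u v] b[OF uv(1)] b[OF uv(2)] uv(3) by blast
    qed
  qed
  then have "dist x (h w) \<le> \<epsilon>" if "x0 < Re w" "Re w < x0 + \<rho>" "\<bar>Im w - y0\<bar> < \<rho>" for w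
    using that \<epsilon>'(2) by (force simp: Q_def)
  moreover have "\<rho> < x1 - x0" using \<rho>' xm by simp
  ultimately show thesis using that \<rho>(1) by blast
qed

end

section \<open>The homeomorphism with a half-open annulus\<close>

text \<open>A radial affine stretching.\<close>

lemma homeomorphic_half_open_annuli:
  assumes a: "0 < a" "a < b" and c: "0 < c" "c < d"
  shows "{\<zeta>::complex. a \<le> norm \<zeta> \<and> norm \<zeta> < b} homeomorphic {\<zeta>::complex. c \<le> norm \<zeta> \<and> norm \<zeta> < d}"
proof -
  define F where "F a b c d \<zeta> = of_real ((c + (norm \<zeta> - a) * ((d - c) / (b - a))) / norm \<zeta>) * \<zeta>"
    for a b c d :: real and \<zeta> :: complex
  have F: "norm (F a b c d \<zeta>) = c + (norm \<zeta> - a) * ((d - c) / (b - a))"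
    if "0 < a" "a < b" "0 < c" "c < d" "a \<le> norm \<zeta>" for a b c d \<zeta>
  proof -
    have "0 \<le> (norm \<zeta> - a) * ((d - c) / (b - a))" using that by (intro mult_nonneg_nonneg divide_nonneg_nonneg) auto
    moreover have "0 < norm \<zeta>" using that by linarith
    moreover define N where "N = c + (norm \<zeta> - a) * ((d - c) / (b - a))"
    ultimately have N: "0 < N" "0 < norm \<zeta>" using that(3) by linarith+
    have "F a b c d \<zeta> = of_real (N / norm \<zeta>) * \<zeta>" by (simp only: F_def N_def)
    then have "norm (F a b c d \<zeta>) = \<bar>N / norm \<zeta>\<bar> * norm \<zeta>" by (simp only: norm_mult norm_of_real)
    also have "\<dots> = N" using N by simp
    finally show ?thesis by (simp only: N_def)
  qed
  have Fim: "F a b c d \<zeta> \<in> {\<zeta>. c \<le> norm \<zeta> \<and> norm \<zeta> < d}"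
    if "0 < a" "a < b" "0 < c" "c < d" "\<zeta> \<in> {\<zeta>. a \<le> norm \<zeta> \<and> norm \<zeta> < b}" for a b c d \<zeta>
  proof -
    have z: "a \<le> norm \<zeta>" "norm \<zeta> < b" using that by auto
    have q: "0 < (d - c) / (b - a)" using that by simp
    have "0 \<le> (norm \<zeta> - a) * ((d - c) / (b - a))" using q z by (intro mult_nonneg_nonneg) auto
    moreover have "(norm \<zeta> - a) * ((d - c) / (b - a)) < (b - a) * ((d - c) / (b - a))"
      using q z by (intro mult_strict_right_mono) auto
    ultimately show ?thesis using F[OF that(1-4) z(1)] that(2) by simp
  qed
  have FF: "F c d a b (F a b c d \<zeta>) = \<zeta>"
    if "0 < a" "a < b" "0 < c" "c < d" "\<zeta> \<in> {\<zeta>. a \<le> norm \<zeta> \<and> norm \<zeta> < b}" for a b c d \<zeta>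
  proof -
    have z: "a \<le> norm \<zeta>" "norm \<zeta> \<noteq> 0" using that by auto
    define N where "N = c + (norm \<zeta> - a) * ((d - c) / (b - a))"
    have nF: "norm (F a b c d \<zeta>) = N" using F[OF that(1-4) z(1)] by (simp add: N_def)
    have N0: "N \<noteq> 0" using Fim[OF that] that(3) nF by auto
    have "a + (N - c) * ((b - a) / (d - c)) = norm \<zeta>" using that by (simp add: N_def)
    then have "F c d a b (F a b c d \<zeta>) = of_real (norm \<zeta> / N) * F a b c d \<zeta>"
      by (subst F_def) (simp add: nF)
    also have "\<dots> = of_real (norm \<zeta> / N) * (of_real (N / norm \<zeta>) * \<zeta>)" by (simp add: F_def N_def)
    also have "\<dots> = \<zeta>" using N0 z(2) by simp
    finally show ?thesis .
  qed
  have Fc: "continuous_on {\<zeta>. a \<le> norm \<zeta> \<and> norm \<zeta> < b} (F a b c d)" if "0 < a" for a b c d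
    unfolding F_def using that by (intro continuous_intros) auto
  show ?thesis
    unfolding homeomorphic_def
  proof (intro exI)
    show "homeomorphism {\<zeta>. a \<le> norm \<zeta> \<and> norm \<zeta> < b} {\<zeta>. c \<le> norm \<zeta> \<and> norm \<zeta> < d} (F a b c d) (F c d a b)"
      by (rule homeomorphismI[OF Fc[OF a(1)] Fc[OF c(1)] image_subsetI[OF Fim[OF a c]] image_subsetI[OF Fim[OF c a]]
            FF[OF a c] FF[OF c a]])
  qed
qed

context oriented_chart
begin

text \<open>The unrestricted limit of \<open>h\<close> at the boundary point \<open>x0 + \<i> y\<close> of the strip.\<close>

definition edge_limit :: "real \<Rightarrow> complex \<Rightarrow> bool" where "edge_limit y l \<longleftrightarrow>
  (\<forall>\<epsilon>>0. \<exists>\<rho>>0. \<rho> < x1 - x0 \<and> (\<forall>w. x0 < Re w \<longrightarrow> Re w < x0 + \<rho> \<longrightarrow> \<bar>Im w - y\<bar> < \<rho> \<longrightarrow> dist l (h w) \<le> \<epsilon>))"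

lemma edge_limit_unique:
  assumes "edge_limit y l" "edge_limit y l'" shows "l = l'"
proof (rule ccontr)
  assume "l \<noteq> l'"
  then have "0 < dist l l' / 3" by simp
  then obtain \<rho> \<rho>' where \<rho>: "0 < \<rho>" "\<And>w. x0 < Re w \<Longrightarrow> Re w < x0 + \<rho> \<Longrightarrow> \<bar>Im w - y\<bar> < \<rho> \<Longrightarrow> dist l (h w) \<le> dist l l' / 3"
    and \<rho>': "0 < \<rho>'" "\<And>w. x0 < Re w \<Longrightarrow> Re w < x0 + \<rho>' \<Longrightarrow> \<bar>Im w - y\<bar> < \<rho>' \<Longrightarrow> dist l' (h w) \<le> dist l l' / 3"
    using assms unfolding edge_limit_def by metis
  define w where "w = Complex (x0 + min \<rho> \<rho>' / 2) y"
  have "dist l (h w) \<le> dist l l' / 3" "dist l' (h w) \<le> dist l l' / 3"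
    using \<rho> \<rho>' by (auto simp: w_def)
  then show False using dist_triangle2[of l l' "h w"] \<open>0 < dist l l' / 3\<close> by linarith
qed

text \<open>Values of \<open>h\<close> near the boundary point satisfy the Cauchy criterion, by \<open>small_rectangle\<close>.\<close>

lemma edge_limit_exists: "\<exists>l. edge_limit y l"
proof -
  define p where "p n = Complex (x0 + (x1 - x0) / real (n + 2)) y" for n
  have small: "\<exists>M. \<forall>n\<ge>M. (x1 - x0) / real (n + 2) < \<rho>" if "0 < \<rho>" for \<rho>
  proof -
    obtain M where M: "(x1 - x0) / \<rho> < real M" using reals_Archimedean2 by blast
    have "(x1 - x0) / real (n + 2) < \<rho>" if "M \<le> n" for n
    proof -
      have "(x1 - x0) / \<rho> < real (n + 2)" using M that by linarith
      then show ?thesis using \<open>0 < \<rho>\<close> by (simp add: field_simps)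
    qed
    then show ?thesis by blast
  qed
  have pos: "0 < (x1 - x0) / real (n + 2)" for n using x01 by simp
  have near: "\<exists>M \<rho> x. 0 < \<rho> \<and> \<rho> < x1 - x0 \<and> (\<forall>w. x0 < Re w \<longrightarrow> Re w < x0 + \<rho> \<longrightarrow> \<bar>Im w - y\<bar> < \<rho> \<longrightarrow> dist x (h w) \<le> \<epsilon>)
      \<and> (\<forall>n\<ge>M. dist x (h (p n)) \<le> \<epsilon>)" if \<epsilon>: "0 < \<epsilon>" for \<epsilon>
  proof -
    obtain \<rho> x where \<rho>: "0 < \<rho>" "\<rho> < x1 - x0"
      "\<And>w. x0 < Re w \<Longrightarrow> Re w < x0 + \<rho> \<Longrightarrow> \<bar>Im w - y\<bar> < \<rho> \<Longrightarrow> dist x (h w) \<le> \<epsilon>"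
    proof (rule small_rectangle[OF \<epsilon>, of y])
      fix \<rho> x assume "0 < \<rho>" "\<rho> < x1 - x0"
        "\<And>w. x0 < Re w \<Longrightarrow> Re w < x0 + \<rho> \<Longrightarrow> \<bar>Im w - y\<bar> < \<rho> \<Longrightarrow> dist x (h w) \<le> \<epsilon>"
      then show thesis by (rule that)
    qed
    obtain M where M: "\<And>n. M \<le> n \<Longrightarrow> (x1 - x0) / real (n + 2) < \<rho>" using small[OF \<rho>(1)] by blast
    have "dist x (h (p n)) \<le> \<epsilon>" if "M \<le> n" for n
      by (rule \<rho>(3)) (use M[OF that] pos[of n] \<rho>(1) in \<open>simp_all add: p_def\<close>)
    then show ?thesis using \<rho> by blast
  qed
  have "Cauchy (\<lambda>n. h (p n))"
  proof (rule metric_CauchyI)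
    fix e :: real assume "0 < e"
    then obtain M x where M: "\<And>n. M \<le> n \<Longrightarrow> dist x (h (p n)) \<le> e / 3" using near[of "e / 3"] by auto
    have "dist (h (p m)) (h (p n)) < e" if "M \<le> m" "M \<le> n" for m n
      using M[OF that(1)] M[OF that(2)] dist_triangle3[of "h (p m)" "h (p n)" x] \<open>0 < e\<close> by linarith
    then show "\<exists>M. \<forall>m\<ge>M. \<forall>n\<ge>M. dist (h (p m)) (h (p n)) < e" by blast
  qed
  then obtain l where l: "(\<lambda>n. h (p n)) \<longlonglongrightarrow> l" using Cauchy_convergent convergent_def by blast
  have "edge_limit y l" unfolding edge_limit_def
  proof (intro allI impI)
    fix \<epsilon> :: real assume "0 < \<epsilon>"
    then obtain M \<rho> x where \<rho>: "0 < \<rho>" "\<rho> < x1 - x0"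
      "\<And>w. x0 < Re w \<Longrightarrow> Re w < x0 + \<rho> \<Longrightarrow> \<bar>Im w - y\<bar> < \<rho> \<Longrightarrow> dist x (h w) \<le> \<epsilon> / 2"
      and M: "\<And>n. M \<le> n \<Longrightarrow> dist x (h (p n)) \<le> \<epsilon> / 2" using near[of "\<epsilon> / 2"] by auto
    have "dist x l \<le> \<epsilon> / 2"
    proof (rule LIMSEQ_le_const2)
      show "(\<lambda>n. dist x (h (p n))) \<longlonglongrightarrow> dist x l" by (intro tendsto_intros l)
      show "\<exists>N. \<forall>n\<ge>N. dist x (h (p n)) \<le> \<epsilon> / 2" using M by blast
    qed
    then have "dist l (h w) \<le> \<epsilon>" if "x0 < Re w" "Re w < x0 + \<rho>" "\<bar>Im w - y\<bar> < \<rho>" for w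
      using \<rho>(3)[OF that] dist_triangle3[of l "h w" x] by linarith
    then show "\<exists>\<rho>>0. \<rho> < x1 - x0 \<and> (\<forall>w. x0 < Re w \<longrightarrow> Re w < x0 + \<rho> \<longrightarrow> \<bar>Im w - y\<bar> < \<rho> \<longrightarrow> dist l (h w) \<le> \<epsilon>)"
      using \<rho>(1,2) by blast
  qed
  then show ?thesis ..
qed

text \<open>The boundary value; the choice is determined by \<open>edge_limit_unique\<close>.\<close>

definition edge :: "real \<Rightarrow> complex" where "edge y = (SOME l. edge_limit y l)"
lemma edge: "edge_limit y (edge y)" unfolding edge_def using edge_limit_exists by (rule someI_ex)

text \<open>The extension of \<open>h\<close> to the left edge of the strip.  The definition gives \<open>H\<close> values to the left of the edge
  as well, which play no role.\<close>

definition H :: "complex \<Rightarrow> complex" where "H w = (if x0 < Re w then h w else edge (Im w))"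
definition half_closed_strip :: "complex set" where "half_closed_strip = {w. x0 \<le> Re w \<and> Re w < x1}"

lemma H_strip: "w \<in> strip \<Longrightarrow> H w = h w" by (simp add: H_def strip_def)

lemma edge_near:
  assumes "0 < \<epsilon>"
  obtains \<rho> where "0 < \<rho>" "\<rho> < x1 - x0"
    "\<And>w. x0 \<le> Re w \<Longrightarrow> Re w < x0 + \<rho> \<Longrightarrow> \<bar>Im w - y\<bar> < \<rho> \<Longrightarrow> dist (edge y) (H w) \<le> \<epsilon>"
proof -
  have e2: "0 < \<epsilon> / 2" using assms by simp
  then obtain \<rho> where \<rho>: "0 < \<rho>" "\<rho> < x1 - x0"
    "\<And>w. x0 < Re w \<Longrightarrow> Re w < x0 + \<rho> \<Longrightarrow> \<bar>Im w - y\<bar> < \<rho> \<Longrightarrow> dist (edge y) (h w) \<le> \<epsilon> / 2"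
    using edge[of y] unfolding edge_limit_def by metis
  have "dist (edge y) (H w) \<le> \<epsilon>" if w: "x0 \<le> Re w" "Re w < x0 + \<rho>" "\<bar>Im w - y\<bar> < \<rho>" for w
  proof (cases "x0 < Re w")
    case True
    then show ?thesis using \<rho>(3)[OF True w(2,3)] e2 by (simp add: H_def)
  next
    case False
    obtain \<rho>' where \<rho>': "0 < \<rho>'"
      "\<And>v. x0 < Re v \<Longrightarrow> Re v < x0 + \<rho>' \<Longrightarrow> \<bar>Im v - Im w\<bar> < \<rho>' \<Longrightarrow> dist (edge (Im w)) (h v) \<le> \<epsilon> / 2"
      using edge[of "Im w"] e2 unfolding edge_limit_def by metis
    define v where "v = Complex (x0 + min \<rho> \<rho>' / 2) (Im w)"
    have "dist (edge y) (h v) \<le> \<epsilon> / 2" by (rule \<rho>(3)) (use \<rho>(1) \<rho>'(1) w in \<open>auto simp: v_def\<close>)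
    moreover have "dist (edge (Im w)) (h v) \<le> \<epsilon> / 2" by (rule \<rho>'(2)) (use \<rho>(1) \<rho>'(1) in \<open>auto simp: v_def\<close>)
    ultimately show ?thesis using False dist_triangle2[of "edge y" "edge (Im w)" "h v"] by (simp add: H_def)
  qed
  then show thesis using that \<rho>(1,2) by blast
qed

lemma H_cont: "continuous_on half_closed_strip H"
  unfolding continuous_on_eq_continuous_within
proof
  fix w assume w: "w \<in> half_closed_strip"
  show "continuous (at w within half_closed_strip) H"
  proof (cases "x0 < Re w")
    case True
    then have ws: "w \<in> strip" using w by (simp add: strip_def half_closed_strip_def)
    have "continuous_on strip H" using h_cont by (rule continuous_on_eq) (simp add: H_strip)
    then have "isCont H w" using open_strip ws by (simp add: continuous_on_eq_continuous_at)
    then show ?thesis by (rule continuous_at_imp_continuous_at_within)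
  next
    case False
    then have Hw: "H w = edge (Im w)" "Re w = x0" using w by (auto simp: H_def half_closed_strip_def)
    show ?thesis unfolding continuous_within_eps_delta
    proof (intro allI impI)
      fix e :: real assume e: "0 < e"
      obtain \<rho> where \<rho>: "0 < \<rho>" "\<rho> < x1 - x0"
        "\<And>v. x0 \<le> Re v \<Longrightarrow> Re v < x0 + \<rho> \<Longrightarrow> \<bar>Im v - Im w\<bar> < \<rho> \<Longrightarrow> dist (edge (Im w)) (H v) \<le> e / 2"
      proof (rule edge_near[of "e / 2" "Im w"])
        show "0 < e / 2" using e by simp
        fix \<rho> assume "0 < \<rho>" "\<rho> < x1 - x0"
          "\<And>v. x0 \<le> Re v \<Longrightarrow> Re v < x0 + \<rho> \<Longrightarrow> \<bar>Im v - Im w\<bar> < \<rho> \<Longrightarrow> dist (edge (Im w)) (H v) \<le> e / 2"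
        then show thesis by (rule that)
      qed
      have "dist (H v) (H w) < e" if v: "v \<in> half_closed_strip" "dist v w < \<rho>" for v
      proof -
        have "\<bar>Re (v - w)\<bar> \<le> norm (v - w)" "\<bar>Im (v - w)\<bar> \<le> norm (v - w)" by (rule abs_Re_le_cmod abs_Im_le_cmod)+
        then have "\<bar>Re v - x0\<bar> < \<rho>" "\<bar>Im v - Im w\<bar> < \<rho>" using v(2) Hw(2) by (simp_all add: dist_norm)
        moreover have "x0 \<le> Re v" using v(1) by (simp add: half_closed_strip_def)
        ultimately have "dist (edge (Im w)) (H v) \<le> e / 2" by (intro \<rho>(3)) auto
        then show ?thesis using Hw(1) e by (simp add: dist_commute)
      qed
      then show "\<exists>d>0. \<forall>x'\<in>half_closed_strip. dist x' w < d \<longrightarrow> dist (H x') (H w) < e" using \<rho>(1) by blast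
    qed
  qed
qed

lemma h_shift: "h (w + 2 * complex_of_real pi * \<i>) = h w" by (simp add: h_def)

lemma edge_shift: "edge (y + 2 * pi) = edge y"
proof -
  have "edge_limit (y + 2 * pi) (edge y)"
    unfolding edge_limit_def
  proof (intro allI impI)
    fix \<epsilon> :: real assume "0 < \<epsilon>"
    then obtain \<rho> where \<rho>: "0 < \<rho>" "\<rho> < x1 - x0"
      "\<And>w. x0 < Re w \<Longrightarrow> Re w < x0 + \<rho> \<Longrightarrow> \<bar>Im w - y\<bar> < \<rho> \<Longrightarrow> dist (edge y) (h w) \<le> \<epsilon>"
      using edge[of y] unfolding edge_limit_def by metis
    have "dist (edge y) (h w) \<le> \<epsilon>" if "x0 < Re w" "Re w < x0 + \<rho>" "\<bar>Im w - (y + 2 * pi)\<bar> < \<rho>" for w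
    proof -
      have "dist (edge y) (h (w - 2 * complex_of_real pi * \<i>)) \<le> \<epsilon>" by (rule \<rho>(3)) (use that in auto)
      then show ?thesis using h_shift[of "w - 2 * complex_of_real pi * \<i>"] by simp
    qed
    then show "\<exists>\<rho>>0. \<rho> < x1 - x0 \<and> (\<forall>w. x0 < Re w \<longrightarrow> Re w < x0 + \<rho> \<longrightarrow> \<bar>Im w - (y + 2 * pi)\<bar> < \<rho> \<longrightarrow> dist (edge y) (h w) \<le> \<epsilon>)"
      using \<rho>(1,2) by blast
  qed
  then show ?thesis using edge edge_limit_unique by blast
qed

lemma H_shift: "H (w + 2 * complex_of_real pi * \<i>) = H w"
  using h_shift[of w] edge_shift[of "Im w"] by (simp add: H_def)

lemma H_descends:
  assumes "exp w = exp v" shows "H w = H v"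
  by (rule descend_eq[of UNIV H]) (use assms H_shift in auto)

text \<open>Boundary values are limits of points of \<open>U\<close> that approach the closure of \<open>C\<close>.\<close>

lemma edge_frontier: "edge y \<in> frontier C"
proof -
  have ex: "\<exists>w\<in>strip. Re w < s \<and> dist (h w) (edge y) < e" if "0 < e" "x0 < s" for e s
  proof -
    have e2: "0 < e / 2" using that(1) by simp
    then obtain \<rho> where \<rho>: "0 < \<rho>" "\<rho> < x1 - x0"
      "\<And>w. x0 < Re w \<Longrightarrow> Re w < x0 + \<rho> \<Longrightarrow> \<bar>Im w - y\<bar> < \<rho> \<Longrightarrow> dist (edge y) (h w) \<le> e / 2"
      using edge[of y] unfolding edge_limit_def by metis
    have "x0 < min s (x0 + \<rho>)" using that \<rho>(1) by simp
    then obtain t where t: "x0 < t" "t < min s (x0 + \<rho>)" using dense by blast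
    have "dist (edge y) (h (Complex t y)) \<le> e / 2" by (rule \<rho>(3)) (use t \<rho>(1) in auto)
    then show ?thesis using t \<rho>(2) that(1)
      by (intro bexI[of _ "Complex t y"]) (auto simp: strip_def dist_commute)
  qed
  have "edge y \<in> closure U"
    unfolding closure_approachable using ex[OF _ x01] h_U by blast
  moreover have "C \<inter> closure U = {}"
  proof -
    have "C \<inter> U = {}" using closure_subset[of C] by (auto simp: U_def)
    then show ?thesis using open_Int_closure_eq_empty[OF open_C] by blast
  qed
  ultimately have nC: "edge y \<notin> C" by blast
  have "edge y \<in> closure C"
  proof (rule ccontr)
    assume "edge y \<notin> closure C"
    then obtain \<delta> where \<delta>: "0 < \<delta>" "cball (edge y) \<delta> \<subseteq> - closure C"
      using open_contains_cball[of "- closure C"] by auto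
    obtain s where s: "x0 < s" "s < x1" "\<And>w. w \<in> strip \<Longrightarrow> Re w < s \<Longrightarrow> h w \<in> - cball (edge y) \<delta>"
    proof (rule h_inner[of "- cball (edge y) \<delta>"])
      show "open (- cball (edge y) \<delta>)" by (simp add: open_Compl)
      show "closure C \<subseteq> - cball (edge y) \<delta>" using \<delta>(2) by blast
      fix s assume "x0 < s" "s < x1" "\<And>w. w \<in> strip \<Longrightarrow> Re w < s \<Longrightarrow> h w \<in> - cball (edge y) \<delta>"
      then show thesis by (rule that)
    qed
    obtain w where "w \<in> strip" "Re w < s" "dist (h w) (edge y) < \<delta>" using ex[OF \<delta>(1) s(1)] by blast
    then show False using s(3)[of w] by (simp add: dist_commute)
  qed
  then show ?thesis using nC open_C by (simp add: frontier_def interior_open)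
qed

lemma h_outer:
  assumes "t < r"
  obtains s where "x0 < s" "s < x1" "\<And>w. w \<in> strip \<Longrightarrow> s < Re w \<Longrightarrow> t < dist a (h w)"
proof -
  obtain t' where t: "t' < r2" "\<And>z. z \<in> round_annulus r1 r2 \<Longrightarrow> t' < norm z \<Longrightarrow> t < dist a (g z)"
    using outer assms unfolding outer_to_D_def by meson
  define t'' where "t'' = max t' r1"
  have t'': "0 < t''" "t'' < r2" using t r1 r12 by (auto simp: t''_def)
  then have "ln t'' < ln r2" by simp
  then have "max x0 (ln t'') < x1" using x01 by (simp add: x1_def)
  then obtain s where s: "max x0 (ln t'') < s" "s < x1" using dense by blast
  have "t < dist a (h w)" if "w \<in> strip" "s < Re w" for w
  proof -
    have "exp (ln t'') < exp (Re w)" using that s by simp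
    then have "t'' < norm (exp w)" using exp_ln[OF t''(1)] by (simp only: norm_exp_eq_Re)
    then have "t' < norm (exp w)" by (simp add: t''_def)
    then show ?thesis using t(2)[of "exp w"] that(1) exp_strip[of w] by (simp add: h_def)
  qed
  then show thesis using that[of s] s by simp
qed

text \<open>Near a frontier point, \<open>U\<close> is contained in the closed image of a compact rectangle of height \<open>2 \<pi>\<close>.\<close>

lemma edge_surj:
  assumes p: "p \<in> frontier C" shows "\<exists>y\<in>{0..2*pi}. edge y = p"
proof -
  have "dist a p < r" using frontier_C_notin[OF p] D_eq by simp
  then obtain t where t: "dist a p < t" "t < r" using dense by blast
  obtain s where s: "x0 < s" "s < x1" "\<And>w. w \<in> strip \<Longrightarrow> s < Re w \<Longrightarrow> t < dist a (h w)"
  proof (rule h_outer[OF t(2)])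
    fix s assume "x0 < s" "s < x1" "\<And>w. w \<in> strip \<Longrightarrow> s < Re w \<Longrightarrow> t < dist a (h w)"
    then show thesis by (rule that)
  qed
  define K where "K = cbox (Complex x0 0) (Complex s (2 * pi))"
  have K: "compact K" "K \<subseteq> half_closed_strip"
    using s by (auto simp: K_def in_cbox_complex_iff half_closed_strip_def)
  then have "compact (H ` K)" using H_cont by (intro compact_continuous_image) (auto intro: continuous_on_subset)
  then have cl: "closed (H ` K)" by (rule compact_imp_closed)
  have "ball a t \<inter> U \<subseteq> H ` K"
  proof
    fix z assume z: "z \<in> ball a t \<inter> U"
    then obtain w where w: "w \<in> strip" "h w = z" using h_surj by blast
    define n where "n = \<lfloor>Im w / (2 * pi)\<rfloor>"
    define v where "v = w - 2 * pi * of_int n * \<i>"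
    have n: "of_int n \<le> Im w / (2 * pi)" "Im w / (2 * pi) < of_int n + 1" unfolding n_def by linarith+
    have i: "0 \<le> Im v" "Im v \<le> 2 * pi" using n by (auto simp: v_def field_simps)
    have "exp v = exp w" unfolding v_def exp_eq by (intro exI[of _ "- n"]) simp
    then have hv: "h v = z" "v \<in> strip" using w by (auto simp: h_def exp_strip)
    have "\<not> s < Re v" using s(3)[OF hv(2)] hv(1) z by auto
    then have "v \<in> K" using i hv(2) by (auto simp: K_def in_cbox_complex_iff strip_def)
    then show "z \<in> H ` K" using H_strip[OF hv(2)] hv(1) by (metis imageI)
  qed
  then have "closure (ball a t \<inter> U) \<subseteq> H ` K" using cl by (rule closure_minimal)
  moreover have "p \<in> closure (ball a t \<inter> U)"
    using open_Int_closure_subset[of "ball a t" U] frontier_C_closure_U[OF p] t by auto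
  ultimately obtain w where w: "w \<in> K" "H w = p" by blast
  have "\<not> x0 < Re w"
  proof
    assume "x0 < Re w"
    then have "w \<in> strip" using w(1) K(2) by (auto simp: strip_def half_closed_strip_def)
    then have "p \<in> U" using H_strip h_U w(2) by metis
    then show False using frontier_C_notin[OF p] by blast
  qed
  then have "edge (Im w) = p" using w(2) by (simp add: H_def)
  then show ?thesis using w(1) by (intro bexI[of _ "Im w"]) (auto simp: K_def in_cbox_complex_iff)
qed

end

context oriented_chart
begin

lemma normalize_Im:
  obtains v where "exp v = exp w" "Re v = Re w" "y \<le> Im v" "Im v < y + 2 * pi"
proof -
  define n where "n = \<lfloor>(Im w - y) / (2 * pi)\<rfloor>"
  define v where "v = w - 2 * pi * of_int n * \<i>"
  have n: "of_int n \<le> (Im w - y) / (2 * pi)" "(Im w - y) / (2 * pi) < of_int n + 1" unfolding n_def by linarith+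
  have "exp v = exp w" unfolding v_def exp_eq by (intro exI[of _ "- n"]) simp
  moreover have "y \<le> Im v" "Im v < y + 2 * pi" using n by (auto simp: v_def field_simps)
  ultimately show thesis using that[of v] by (simp add: v_def)
qed

text \<open>If the boundary values were constant on an interval, \<open>h\<close> could be continued by this constant across the edge, and
  would be constant.\<close>

lemma edge_not_locally_constant:
  assumes ab: "\<alpha> < \<beta>" and c: "\<And>y. \<alpha> < y \<Longrightarrow> y < \<beta> \<Longrightarrow> edge y = p"
  shows False
proof -
  define S where "S = {w. 2 * x0 - x1 < Re w \<and> Re w < x1 \<and> \<alpha> < Im w \<and> Im w < \<beta>}"
  define F where "F w = H (Complex (max (Re w) x0) (Im w))" for w
  have Sb: "S = box (Complex (2 * x0 - x1) \<alpha>) (Complex x1 \<beta>)" by (auto simp: S_def in_box_complex_iff)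
  have oS: "open S" and cS: "connected S" unfolding Sb by (rule open_box, rule convex_connected[OF convex_box(2)])
  have S': "Complex (max (Re w) x0) (Im w) \<in> half_closed_strip" if "w \<in> S" for w
    using that x01 by (auto simp: half_closed_strip_def S_def)
  have Fc: "continuous_on S F"
    unfolding F_def by (rule continuous_on_compose2[OF H_cont])
      (use S' in \<open>auto intro!: continuous_intros\<close>)
  have Fl: "F w = p" if "w \<in> S" "Re w \<le> x0" for w
    using that c[of "Im w"] by (simp add: F_def H_def S_def)
  have Fr: "w \<in> strip \<and> F w = h w" if "w \<in> S" "x0 < Re w" for w
    using that by (simp add: F_def H_def S_def strip_def)
  have hF: "F holomorphic_on S"
  proof (rule holomorphic_on_paste_across_line[OF oS, of 1 _ x0])
    have "(\<lambda>_. p) holomorphic_on (S \<inter> {z. 1 \<bullet> z < x0})" by (rule holomorphic_on_const)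
    then show "F holomorphic_on (S \<inter> {z. 1 \<bullet> z < x0})"
      by (rule holomorphic_transform) (use Fl in \<open>auto simp: inner_complex_def\<close>)
    have "h holomorphic_on (S \<inter> {z. x0 < 1 \<bullet> z})"
      by (rule holomorphic_on_subset[OF h_hol]) (use Fr in \<open>auto simp: inner_complex_def\<close>)
    then show "F holomorphic_on (S \<inter> {z. x0 < 1 \<bullet> z})"
      by (rule holomorphic_transform) (use Fr in \<open>auto simp: inner_complex_def\<close>)
  qed (use Fc in auto)
  define T where "T = S \<inter> {w. Re w < x0}"
  define ym where "ym = (\<alpha> + \<beta>) / 2"
  have ym: "\<alpha> < ym" "ym < \<beta>" using ab by (auto simp: ym_def)
  have oT: "open T" unfolding T_def by (intro open_Int oS open_Collect_less continuous_intros)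
  have "Complex (x0 - (x1 - x0) / 2) ym \<in> T" using x01 ym by (simp add: T_def S_def field_simps)
  then have neT: "T \<noteq> {}" by blast
  define w where "w = Complex (x0 + (x1 - x0) / 2) ym"
  have w: "w \<in> S" "x0 < Re w" using x01 ym by (auto simp: w_def S_def field_simps)
  have "F w = p"
  proof (rule analytic_continuation_open[OF oT oS neT cS _ hF holomorphic_on_const _ w(1)])
    show "T \<subseteq> S" by (auto simp: T_def)
    show "F z = p" if "z \<in> T" for z using Fl that by (simp add: T_def)
  qed
  then have "p \<in> U" using Fr[OF w] h_U by metis
  moreover have "p \<in> frontier C" using edge_frontier[of ym] c[OF ym] by simp
  ultimately show False using frontier_C_notin by blast
qed

text \<open>A horizontal ray whose boundary value is not \<open>p\<close> stays away from \<open>p\<close>.\<close>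

lemma ray_avoids:
  assumes p: "p \<in> frontier C" and ne: "edge y \<noteq> p"
  obtains \<epsilon> where "0 < \<epsilon>" "\<And>w. w \<in> strip \<Longrightarrow> Im w = y \<Longrightarrow> \<epsilon> \<le> dist p (h w)"
proof -
  define \<epsilon>1 where "\<epsilon>1 = dist (edge y) p / 2"
  have \<epsilon>1: "0 < \<epsilon>1" using ne by (simp add: \<epsilon>1_def)
  obtain \<rho> where \<rho>: "0 < \<rho>" "\<rho> < x1 - x0"
    "\<And>w. x0 < Re w \<Longrightarrow> Re w < x0 + \<rho> \<Longrightarrow> \<bar>Im w - y\<bar> < \<rho> \<Longrightarrow> dist (edge y) (h w) \<le> \<epsilon>1"
    using edge[of y] \<epsilon>1 unfolding edge_limit_def by metis
  have "dist a p < r" using frontier_C_notin[OF p] D_eq by simp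
  then obtain t where t: "dist a p < t" "t < r" using dense by blast
  obtain s where s: "x0 < s" "s < x1" "\<And>w. w \<in> strip \<Longrightarrow> s < Re w \<Longrightarrow> t < dist a (h w)"
  proof (rule h_outer[OF t(2)])
    fix s assume "x0 < s" "s < x1" "\<And>w. w \<in> strip \<Longrightarrow> s < Re w \<Longrightarrow> t < dist a (h w)"
    then show thesis by (rule that)
  qed
  define K where "K = cbox (Complex (x0 + \<rho>) y) (Complex s y)"
  have K: "compact K" "K \<subseteq> strip" using s \<rho>(1) by (auto simp: K_def in_cbox_complex_iff strip_def)
  then have "compact (h ` K)" using h_cont by (intro compact_continuous_image) (auto intro: continuous_on_subset)
  then have "open (- (h ` K))" by (simp add: compact_imp_closed open_Compl)
  moreover have "p \<in> - (h ` K)" using K(2) h_U frontier_C_notin[OF p] by blast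
  ultimately obtain \<epsilon>2 where \<epsilon>2: "0 < \<epsilon>2" "ball p \<epsilon>2 \<subseteq> - (h ` K)" using open_contains_ball by blast
  define \<epsilon> where "\<epsilon> = min (min \<epsilon>1 \<epsilon>2) (t - dist a p)"
  have \<epsilon>: "0 < \<epsilon>" "\<epsilon> \<le> \<epsilon>1" "\<epsilon> \<le> \<epsilon>2" "\<epsilon> \<le> t - dist a p" using \<epsilon>1 \<epsilon>2(1) t(1) by (auto simp: \<epsilon>_def)
  have "\<epsilon> \<le> dist p (h w)" if w: "w \<in> strip" "Im w = y" for w
  proof -
    consider "Re w < x0 + \<rho>" | "s < Re w" | "x0 + \<rho> \<le> Re w" "Re w \<le> s" by linarith
    then show ?thesis
    proof cases
      case 1
      then have "dist (edge y) (h w) \<le> \<epsilon>1" using w \<rho>(1) by (intro \<rho>(3)) (auto simp: strip_def)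
      then have "\<epsilon>1 \<le> dist p (h w)" using dist_triangle2[of "edge y" p "h w"] unfolding \<epsilon>1_def by linarith
      then show ?thesis using \<epsilon>(2) by linarith
    next
      case 2
      then have "t < dist a (h w)" using s(3) w by blast
      then show ?thesis using dist_triangle[of a "h w" p] \<epsilon>(4) by linarith
    next
      case 3
      then have "w \<in> K" using w(2) by (simp add: K_def in_cbox_complex_iff)
      then have "h w \<notin> ball p \<epsilon>2" using \<epsilon>2(2) by blast
      then show ?thesis using \<epsilon>(3) by simp
    qed
  qed
  then show thesis using that \<epsilon>(1) by blast
qed

lemma ray_meets:
  assumes "open N" "edge y \<in> N"
  shows "\<exists>w\<in>strip. Im w = y \<and> h w \<in> N"
proof -
  obtain e where e: "0 < e" "ball (edge y) e \<subseteq> N" using assms open_contains_ball by blast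
  have "0 < e / 2" using e by simp
  then obtain \<rho> where \<rho>: "0 < \<rho>" "\<rho> < x1 - x0"
    "\<And>w. x0 < Re w \<Longrightarrow> Re w < x0 + \<rho> \<Longrightarrow> \<bar>Im w - y\<bar> < \<rho> \<Longrightarrow> dist (edge y) (h w) \<le> e / 2"
    using edge[of y] unfolding edge_limit_def by metis
  define w where "w = Complex (x0 + \<rho> / 2) y"
  have "dist (edge y) (h w) \<le> e / 2" by (rule \<rho>(3)) (use \<rho>(1) in \<open>auto simp: w_def\<close>)
  then have "h w \<in> ball (edge y) e" using e(1) by simp
  moreover have "w \<in> strip" "Im w = y" using \<rho>(1,2) by (auto simp: w_def strip_def)
  ultimately show ?thesis using e(2) by blast
qed

text \<open>Suppose that \<open>p\<close> is the boundary value at two heights.  On each of the two intervals into which they cut the period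
  there is a height with a boundary value other than \<open>p\<close>.  The rays at these two heights avoid a neighbourhood of \<open>p\<close> and cut
  the exterior of \<open>C\<close> near \<open>p\<close> into two parts, both of which are approached by rays that end at \<open>p\<close>.  This contradicts the
  local connectivity of the exterior.\<close>

lemma edge_inj:
  assumes y: "y1 < y2" "y2 < y1 + 2 * pi" shows "edge y1 \<noteq> edge y2"
proof
  assume e: "edge y1 = edge y2"
  define p where "p = edge y1"
  have p: "p \<in> frontier C" "edge y2 = p" "edge (y1 + 2 * pi) = p"
    using e edge_frontier edge_shift by (simp_all add: p_def)
  obtain y3 where y3: "y1 < y3" "y3 < y2" "edge y3 \<noteq> p" using edge_not_locally_constant[OF y(1)] by blast
  obtain y4 where y4: "y2 < y4" "y4 < y1 + 2 * pi" "edge y4 \<noteq> p" using edge_not_locally_constant[OF y(2)] by blast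
  obtain \<epsilon>3 where \<epsilon>3: "0 < \<epsilon>3" "\<And>w. w \<in> strip \<Longrightarrow> Im w = y3 \<Longrightarrow> \<epsilon>3 \<le> dist p (h w)"
    using ray_avoids[OF p(1) y3(3)] by metis
  obtain \<epsilon>4 where \<epsilon>4: "0 < \<epsilon>4" "\<And>w. w \<in> strip \<Longrightarrow> Im w = y4 \<Longrightarrow> \<epsilon>4 \<le> dist p (h w)"
    using ray_avoids[OF p(1) y4(3)] by metis
  have "0 < min \<epsilon>3 \<epsilon>4" using \<epsilon>3(1) \<epsilon>4(1) by simp
  then obtain N where N: "open N" "p \<in> N" "N \<subseteq> ball p (min \<epsilon>3 \<epsilon>4)" "N \<subseteq> D" "connected (N - closure C)"
    using local_structure[OF p(1)] by meson
  define P where "P = strip \<inter> {w. y3 < Im w \<and> Im w < y4}"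
  define Q where "Q = strip \<inter> {w. y4 < Im w \<and> Im w < y3 + 2 * pi}"
  have op: "open (h ` R)" if R: "R \<subseteq> strip" "open R" "\<And>w w'. w \<in> R \<Longrightarrow> w' \<in> R \<Longrightarrow> \<bar>Im w - Im w'\<bar> < 2 * pi" for R
  proof (rule open_mapping_thm3)
    show "h holomorphic_on R" by (rule holomorphic_on_subset[OF h_hol R(1)])
    show "inj_on h R"
    proof (rule inj_onI)
      fix w w' assume w: "w \<in> R" "w' \<in> R" "h w = h w'"
      show "w = w'" using h_inj[OF _ _ w(3) R(3)[OF w(1,2)]] w(1,2) R(1) by blast
    qed
  qed (fact R(2))
  have oP: "open (h ` P)"
  proof (rule op)
    show "open P" unfolding P_def by (intro open_Int open_strip open_Collect_conj open_Collect_less continuous_intros)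
  qed (use y3 y4 in \<open>auto simp: P_def\<close>)
  have oQ: "open (h ` Q)"
  proof (rule op)
    show "open Q" unfolding Q_def by (intro open_Int open_strip open_Collect_conj open_Collect_less continuous_intros)
  qed (use y3 y4 in \<open>auto simp: Q_def\<close>)
  have disj: "h ` P \<inter> h ` Q = {}"
  proof (rule ccontr)
    assume "h ` P \<inter> h ` Q \<noteq> {}"
    then obtain w w' where w: "w \<in> P" "w' \<in> Q" "h w = h w'" by blast
    have s: "w \<in> strip" "w' \<in> strip" "\<bar>Im w - Im w'\<bar> < 2 * pi" "Im w < y4" "y4 < Im w'"
      using w(1,2) by (auto simp: P_def Q_def)
    then have "w = w'" using h_inj[OF s(1,2) w(3)] by blast
    then show False using s by simp
  qed
  have cov: "N - closure C \<subseteq> h ` P \<union> h ` Q"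
  proof
    fix z assume z: "z \<in> N - closure C"
    then have zU: "z \<in> U" using N(4) by (auto simp: U_def)
    then obtain w where w: "w \<in> strip" "h w = z" using h_surj by blast
    obtain v where v: "exp v = exp w" "Re v = Re w" "y3 \<le> Im v" "Im v < y3 + 2 * pi" by (rule normalize_Im)
    have vs: "v \<in> strip" "h v = z" using v(1) w by (auto simp: exp_strip h_def)
    have d: "dist p z < min \<epsilon>3 \<epsilon>4" using z N(3) by auto
    have "Im v \<noteq> y3" using \<epsilon>3(2)[OF vs(1)] vs(2) d by auto
    moreover have "Im v \<noteq> y4" using \<epsilon>4(2)[OF vs(1)] vs(2) d by auto
    ultimately have "v \<in> P \<or> v \<in> Q" using v(3,4) vs(1) by (auto simp: P_def Q_def)
    then show "z \<in> h ` P \<union> h ` Q" using vs(2) by blast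
  qed
  obtain w2 where w2: "w2 \<in> strip" "Im w2 = y2" "h w2 \<in> N" using ray_meets[OF N(1), of y2] p(2) N(2) by auto
  obtain w1 where w1: "w1 \<in> strip" "Im w1 = y1 + 2 * pi" "h w1 \<in> N"
    using ray_meets[OF N(1), of "y1 + 2 * pi"] p(3) N(2) by auto
  have nC: "h w \<notin> closure C" if "w \<in> strip" for w using h_U[OF that] by (simp add: U_def)
  have 1: "h w2 \<in> h ` P \<inter> (N - closure C)" using w2 y3 y4 nC by (auto simp: P_def)
  have 2: "h w1 \<in> h ` Q \<inter> (N - closure C)" using w1 y3 y4 nC by (auto simp: Q_def)
  have "h ` P \<inter> (N - closure C) = {} \<or> h ` Q \<inter> (N - closure C) = {}"
    by (rule connectedD[OF N(5) oP oQ _ cov]) (use disj in blast)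
  then show False using 1 2 by blast
qed

text \<open>The extended chart descends to a continuous bijection \<open>G\<close>, which is a homeomorphism because the preimages of
  closed discs \<open>cball a t\<close> with \<open>t < r\<close> are contained in compact sets.\<close>

theorem homeomorphic_annulus: "{\<zeta>::complex. r1 \<le> norm \<zeta> \<and> norm \<zeta> < r2} homeomorphic (D - C)"
proof -
  define A where "A = {\<zeta>::complex. r1 \<le> norm \<zeta> \<and> norm \<zeta> < r2}"
  define G where "G \<zeta> = H (Ln \<zeta>)" for \<zeta>
  have A0: "\<zeta> \<noteq> 0" if "\<zeta> \<in> A" for \<zeta> using that r1 by (auto simp: A_def)
  have expA: "exp w \<in> A \<longleftrightarrow> w \<in> half_closed_strip" for w
  proof -
    have "x0 \<le> Re w \<longleftrightarrow> r1 \<le> exp (Re w)" "Re w < x1 \<longleftrightarrow> exp (Re w) < r2"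
      unfolding x0_def x1_def using r1 r12 by (metis exp_le_cancel_iff exp_less_cancel_iff exp_ln order_less_trans)+
    then show ?thesis by (simp add: A_def half_closed_strip_def)
  qed
  have LnA: "Ln \<zeta> \<in> half_closed_strip" if "\<zeta> \<in> A" for \<zeta> using expA[of "Ln \<zeta>"] A0[OF that] that by simp
  have Gexp: "G (exp w) = H w" for w unfolding G_def by (rule H_descends) simp
  have DC: "D - C = U \<union> frontier C"
  proof -
    have "frontier C = closure C - C" using open_C by (simp add: frontier_def interior_open)
    then show ?thesis using closure_C_D closure_subset[of C] by (auto simp: U_def)
  qed
  have HD: "H w \<in> D - C" if "w \<in> half_closed_strip" for w
  proof (cases "x0 < Re w")
    case True
    then have "w \<in> strip" using that by (simp add: strip_def half_closed_strip_def)
    then show ?thesis using H_strip h_U DC by simp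
  next
    case False
    then show ?thesis using edge_frontier DC by (simp add: H_def)
  qed
  have Gim: "G ` A = D - C"
  proof (intro equalityI subsetI)
    fix z assume "z \<in> G ` A" then show "z \<in> D - C" using HD LnA by (auto simp: G_def)
  next
    fix z assume "z \<in> D - C"
    then consider "z \<in> U" | "z \<in> frontier C" using DC by blast
    then obtain w where w: "w \<in> half_closed_strip" "H w = z"
    proof cases
      case 1
      then obtain w where w: "w \<in> strip" "h w = z" using h_surj by blast
      then show thesis using that[of w] H_strip by (simp add: strip_def half_closed_strip_def)
    next
      case 2
      then obtain y where "edge y = z" using edge_surj by blast
      then show thesis using that[of "Complex x0 y"] x01 by (simp add: H_def half_closed_strip_def)
    qed
    then show "z \<in> G ` A" using Gexp expA by (metis imageI)
  qed
  have Hinj: "exp w = exp v" if wv: "w \<in> half_closed_strip" "v \<in> half_closed_strip" "H w = H v" for w v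
  proof -
    have sU: "u \<in> half_closed_strip \<Longrightarrow> (x0 < Re u \<longrightarrow> u \<in> strip \<and> H u = h u \<and> H u \<in> U) \<and>
        (\<not> x0 < Re u \<longrightarrow> Re u = x0 \<and> H u = edge (Im u) \<and> H u \<notin> U)" for u
      using h_U edge_frontier[of "Im u"] frontier_C_notin by (auto simp: H_def strip_def half_closed_strip_def)
    show ?thesis
    proof (cases "x0 < Re w")
      case True
      then show ?thesis using sU[OF wv(1)] sU[OF wv(2)] wv(3) h_eq by metis
    next
      case False
      then have f: "Re w = x0" "Re v = x0" "edge (Im w) = edge (Im v)"
        using sU[OF wv(1)] sU[OF wv(2)] wv(3) by metis+
      obtain u where u: "exp u = exp v" "Re u = Re v" "Im w \<le> Im u" "Im u < Im w + 2 * pi" by (rule normalize_Im)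
      have "H u = H v" using H_descends[OF u(1)] .
      then have "edge (Im u) = edge (Im w)" using f u(2) by (simp add: H_def)
      then have "Im u = Im w" using edge_inj[of "Im w" "Im u"] u(3,4) by (cases "Im w = Im u") auto
      then have "u = w" using f u(2) by (simp add: complex_eq_iff)
      then show ?thesis using u(1) by simp
    qed
  qed
  have Ginj: "inj_on G A"
  proof (rule inj_onI)
    fix \<zeta> \<xi> assume z: "\<zeta> \<in> A" "\<xi> \<in> A" "G \<zeta> = G \<xi>"
    then have "exp (Ln \<zeta>) = exp (Ln \<xi>)" using Hinj LnA by (simp add: G_def)
    then show "\<zeta> = \<xi>" using A0 z by simp
  qed
  have Gc: "continuous_on A G"
    unfolding continuous_on_eq_continuous_within
  proof
    fix \<zeta>0 assume \<zeta>0: "\<zeta>0 \<in> A"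
    define w0 where "w0 = Ln \<zeta>0"
    have n0: "\<zeta>0 \<noteq> 0" using A0 \<zeta>0 by blast
    define V where "V = {\<zeta>. 0 < Re (\<zeta> / \<zeta>0)}"
    \<comment> \<open>a branch of the logarithm that is continuous near \<open>\<zeta>0\<close>\<close>
    define L where "L \<zeta> = w0 + Ln (\<zeta> / \<zeta>0)" for \<zeta>
    have eL: "exp (L \<zeta>) = \<zeta>" if "\<zeta> \<in> V" for \<zeta>
    proof -
      have "\<zeta> / \<zeta>0 \<noteq> 0" using that by (auto simp: V_def)
      then show ?thesis using n0 by (simp add: L_def w0_def exp_add)
    qed
    have oV: "open V" unfolding V_def using n0 by (intro open_Collect_less continuous_intros) auto
    have V0: "\<zeta>0 \<in> V" using n0 by (simp add: V_def)
    have Lc: "continuous_on (A \<inter> V) L"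
      unfolding L_def using n0 by (intro continuous_intros) (auto simp: V_def complex_nonpos_Reals_iff)
    have LS: "L ` (A \<inter> V) \<subseteq> half_closed_strip"
    proof
      fix w assume "w \<in> L ` (A \<inter> V)"
      then obtain \<zeta> where "\<zeta> \<in> A" "\<zeta> \<in> V" "w = L \<zeta>" by blast
      then show "w \<in> half_closed_strip" using expA[of w] eL[of \<zeta>] by simp
    qed
    have "continuous_on (A \<inter> V) (\<lambda>\<zeta>. H (L \<zeta>))"
      by (rule continuous_on_compose2[OF H_cont Lc LS])
    then have "continuous_on (A \<inter> V) G"
      by (rule continuous_on_eq) (use eL Gexp in \<open>metis IntD2\<close>)
    then have "continuous (at \<zeta>0 within A \<inter> V) G" using \<zeta>0 V0 by (simp add: continuous_on_eq_continuous_within)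
    moreover have "at \<zeta>0 within A \<inter> V = at \<zeta>0 within A" by (rule at_within_nhd[OF V0 oV]) blast
    ultimately show "continuous (at \<zeta>0 within A) G" by simp
  qed
  define g' where "g' = inv_into A G"
  have g'G: "g' (G \<zeta>) = \<zeta>" if "\<zeta> \<in> A" for \<zeta> using that Ginj by (simp add: g'_def)
  have g'c: "continuous_on (D - C) g'"
    unfolding continuous_on_eq_continuous_within
  proof
    fix z assume z: "z \<in> D - C"
    then have "dist a z < r" by (simp add: D_eq)
    then obtain t where t: "dist a z < t" "t < r" using dense by blast
    obtain s where s: "x0 < s" "s < x1" "\<And>w. w \<in> strip \<Longrightarrow> s < Re w \<Longrightarrow> t < dist a (h w)"
    proof (rule h_outer[OF t(2)])
      fix s assume "x0 < s" "s < x1" "\<And>w. w \<in> strip \<Longrightarrow> s < Re w \<Longrightarrow> t < dist a (h w)"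
      then show thesis by (rule that)
    qed
    define K where "K = {\<zeta>::complex. r1 \<le> norm \<zeta> \<and> norm \<zeta> \<le> exp s}"
    have "exp s < r2" using s(2) r1 r12 unfolding x1_def by (metis exp_less_cancel_iff exp_ln order_less_trans)
    then have KA: "K \<subseteq> A" by (auto simp: K_def A_def)
    have "K = cball 0 (exp s) - ball 0 r1" by (auto simp: K_def)
    then have cK: "compact K" by (simp add: compact_diff)
    have "continuous_on (G ` K) g'"
      by (rule continuous_on_inv[OF continuous_on_subset[OF Gc KA] cK]) (use g'G KA in blast)
    moreover have sub: "(D - C) \<inter> ball a t \<subseteq> G ` K"
    proof
      fix u assume u: "u \<in> (D - C) \<inter> ball a t"
      then obtain \<zeta> where \<zeta>: "\<zeta> \<in> A" "u = G \<zeta>" using Gim by (metis IntD1 imageE)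
      have "\<not> exp s < norm \<zeta>"
      proof
        assume gt: "exp s < norm \<zeta>"
        have e: "exp (Ln \<zeta>) = \<zeta>" using A0[OF \<zeta>(1)] by simp
        then have "exp s < exp (Re (Ln \<zeta>))" using gt by (metis norm_exp_eq_Re)
        then have sl: "s < Re (Ln \<zeta>)" by simp
        then have st: "Ln \<zeta> \<in> strip" using LnA[OF \<zeta>(1)] s(1) by (simp add: strip_def half_closed_strip_def)
        then have "u = h (Ln \<zeta>)" using \<zeta>(2) H_strip by (simp add: G_def)
        then show False using s(3)[OF st sl] u by simp
      qed
      then have "\<zeta> \<in> K" using \<zeta>(1) by (simp add: K_def A_def)
      then show "u \<in> G ` K" using \<zeta>(2) by blast
    qed
    ultimately have "continuous_on ((D - C) \<inter> ball a t) g'" using continuous_on_subset by blast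
    moreover have zt: "z \<in> ball a t" using t by simp
    ultimately have "continuous (at z within (D - C) \<inter> ball a t) g'"
      using z by (simp add: continuous_on_eq_continuous_within)
    moreover have "at z within (D - C) \<inter> ball a t = at z within (D - C)"
      by (rule at_within_nhd[OF zt open_ball]) blast
    ultimately show "continuous (at z within D - C) g'" by simp
  qed
  have "homeomorphism A (D - C) G g'"
  proof (rule homeomorphismI[OF Gc g'c])
    show "G ` A \<subseteq> D - C" using Gim by simp
    show "g' ` (D - C) \<subseteq> A" unfolding g'_def Gim[symmetric] by (auto intro: inv_into_into)
    show "G (g' z) = z" if "z \<in> D - C" for z using that unfolding g'_def Gim[symmetric] by (rule f_inv_into_f)
  qed (rule g'G)
  then show ?thesis unfolding A_def homeomorphic_def by blast
qed

corollary half_open_annulus: "half_open_topological_annulus (D - C)"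
proof -
  have "(D - C) homeomorphic {\<zeta>::complex. r1 \<le> norm \<zeta> \<and> norm \<zeta> < r2}" using homeomorphic_annulus by (rule homeomorphic_sym[THEN iffD1])
  also have "\<dots> homeomorphic {\<zeta>::complex. 1 \<le> norm \<zeta> \<and> norm \<zeta> < 2}"
    by (rule homeomorphic_half_open_annuli) (use r1 r12 in auto)
  finally show ?thesis unfolding half_open_topological_annulus_def .
qed

end

section \<open>The weighted area inequality\<close>

text \<open>Freezing a function to the left of a critical point \<open>a\<close> keeps it differentiable.  All truncations below have this
  form, so that they are continuously differentiable.\<close>

lemma has_real_derivative_max:
  fixes F F' :: "real \<Rightarrow> real"
  assumes F: "\<And>x. a \<le> x \<Longrightarrow> (F has_real_derivative F' x) (at x)" and F'a: "F' a = 0"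
  shows "((\<lambda>x. F (max x a)) has_real_derivative F' (max x a)) (at x)"
proof -
  consider "x < a" | "a < x" | "x = a" by linarith
  then show ?thesis
  proof cases
    case 1
    have "((\<lambda>_. F a) has_real_derivative 0) (at x)" by simp
    then have "((\<lambda>x. F (max x a)) has_real_derivative 0) (at x)"
      by (rule has_field_derivative_transform_within_open[where S = "{..<a}"]) (use 1 in auto)
    then show ?thesis using 1 F'a by simp
  next
    case 2
    then have "(F has_real_derivative F' x) (at x)" by (intro F) simp
    then have "((\<lambda>x. F (max x a)) has_real_derivative F' x) (at x)"
      by (rule has_field_derivative_transform_within_open[where S = "{a<..}"]) (use 2 in auto)
    then show ?thesis using 2 by simp
  next
    case 3
    have "((\<lambda>y. (F y - F a) / (y - a)) \<longlongrightarrow> 0) (at a)"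
      using F[of a] F'a by (simp add: has_field_derivative_iff)
    then have "((\<lambda>y. norm ((F y - F a) / (y - a))) \<longlongrightarrow> 0) (at a)" by (rule tendsto_norm_zero)
    then have "((\<lambda>y. (F (max y a) - F (max a a)) / (y - a)) \<longlongrightarrow> 0) (at a)"
      by (rule Lim_null_comparison[rotated]) (auto intro!: always_eventually simp: max_def)
    then show ?thesis using 3 F'a by (simp add: has_field_derivative_iff)
  qed
qed

lemma nn_integral_parts_eq:
  fixes f :: "'a \<Rightarrow> real"
  assumes f: "integrable M f"
  shows "integral\<^sup>L M f = 0 \<longleftrightarrow> (\<integral>\<^sup>+x. ennreal (f x) \<partial>M) = (\<integral>\<^sup>+x. ennreal (- f x) \<partial>M)"
proof -
  have fin: "(\<integral>\<^sup>+x. ennreal (f x) \<partial>M) \<noteq> \<infinity>" "(\<integral>\<^sup>+x. ennreal (- f x) \<partial>M) \<noteq> \<infinity>"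
    using f by (auto simp: real_integrable_def)
  have "integral\<^sup>L M f = enn2real (\<integral>\<^sup>+x. ennreal (f x) \<partial>M) - enn2real (\<integral>\<^sup>+x. ennreal (- f x) \<partial>M)"
    by (rule real_lebesgue_integral_def[OF f])
  also have "\<dots> = 0 \<longleftrightarrow> (\<integral>\<^sup>+x. ennreal (f x) \<partial>M) = (\<integral>\<^sup>+x. ennreal (- f x) \<partial>M)"
    using fin
    by (cases "\<integral>\<^sup>+x. ennreal (f x) \<partial>M"; cases "\<integral>\<^sup>+x. ennreal (- f x) \<partial>M") auto
  finally show ?thesis .
qed

lemma integral_derivative_zero:
  fixes F G :: "real \<Rightarrow> real"
  assumes d: "\<And>x. (F has_real_derivative G x) (at x)" and c: "continuous_on UNIV G"
    and M: "\<And>x. M < \<bar>x\<bar> \<Longrightarrow> F x = 0 \<and> G x = 0"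
  shows "(\<integral>\<^sup>+x. ennreal (G x) \<partial>lborel) = (\<integral>\<^sup>+x. ennreal (- G x) \<partial>lborel)"
proof -
  define B where "B = \<bar>M\<bar> + 1"
  have B: "- B \<le> B" "F B = 0" "F (- B) = 0" using M[of B] M[of "- B"] by (auto simp: B_def)
  have "has_bochner_integral lborel (\<lambda>x. indicator {- B..B} x *\<^sub>R G x) (F B - F (- B))"
    by (rule has_bochner_integral_FTC_Icc[OF B(1)])
      (use d c in \<open>auto simp: has_real_derivative_iff_has_vector_derivative intro: has_vector_derivative_at_within continuous_on_subset\<close>)
  moreover have "(\<lambda>x. indicator {- B..B} x *\<^sub>R G x) = G"
  proof
    fix x show "indicator {- B..B} x *\<^sub>R G x = G x"
    proof (cases "\<bar>x\<bar> \<le> B")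
      case False
      then have "M < \<bar>x\<bar>" by (simp add: B_def)
      then show ?thesis using M by simp
    qed (simp add: indicator_def abs_le_iff)
  qed
  ultimately have "has_bochner_integral lborel G 0" using B by simp
  then show ?thesis using nn_integral_parts_eq[of lborel G] by (auto simp: has_bochner_integral_iff)
qed

lemma integral_partial_derivative_zero:
  fixes f f' :: "complex \<Rightarrow> real"
  assumes c: "continuous_on UNIV f'" and M: "\<And>z. M < norm z \<Longrightarrow> f z = 0 \<and> f' z = 0"
    and d: "(\<forall>x y. ((\<lambda>x. f (Complex x y)) has_real_derivative f' (Complex x y)) (at x)) \<or>
      (\<forall>x y. ((\<lambda>y. f (Complex x y)) has_real_derivative f' (Complex x y)) (at y))"
  shows "integrable lborel f'" "integral\<^sup>L lborel f' = 0"
proof -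
  have "integrable lborel (\<lambda>z. indicator (cball 0 M) z *\<^sub>R f' z)"
    by (rule borel_integrable_compact[OF compact_cball]) (use c continuous_on_subset in blast)
  moreover have "(\<lambda>z. indicator (cball 0 M) z *\<^sub>R f' z) = f'" using M by (fastforce simp: indicator_def)
  ultimately show i: "integrable lborel f'" by simp
  have m: "(\<lambda>z. ennreal (f' z)) \<in> borel_measurable borel" "(\<lambda>z. ennreal (- f' z)) \<in> borel_measurable borel"
    using borel_measurable_continuous_onI[OF c] by auto
  have big: "M < norm (Complex x y)" if "M < \<bar>x\<bar> \<or> M < \<bar>y\<bar>" for x y
    using that abs_Re_le_cmod[of "Complex x y"] abs_Im_le_cmod[of "Complex x y"] by auto
  have cx: "continuous_on UNIV (\<lambda>x. f' (Complex x y))" "continuous_on UNIV (\<lambda>y. f' (Complex x y))" for x y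
    by (rule continuous_on_compose2[OF c], auto intro!: continuous_intros)+
  have "(\<integral>\<^sup>+z. ennreal (f' z) \<partial>lborel) = (\<integral>\<^sup>+z. ennreal (- f' z) \<partial>lborel)"
    using d
  proof
    assume d: "\<forall>x y. ((\<lambda>x. f (Complex x y)) has_real_derivative f' (Complex x y)) (at x)"
    have "(\<integral>\<^sup>+x. ennreal (f' (Complex x y)) \<partial>lborel) = (\<integral>\<^sup>+x. ennreal (- f' (Complex x y)) \<partial>lborel)" for y
      by (rule integral_derivative_zero[OF d[rule_format] cx(1)]) (use M big in blast)
    then show ?thesis unfolding nn_integral_complex_iterated(1)[OF m(1)] nn_integral_complex_iterated(1)[OF m(2)] by simp
  next
    assume d: "\<forall>x y. ((\<lambda>y. f (Complex x y)) has_real_derivative f' (Complex x y)) (at y)"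
    have "(\<integral>\<^sup>+y. ennreal (f' (Complex x y)) \<partial>lborel) = (\<integral>\<^sup>+y. ennreal (- f' (Complex x y)) \<partial>lborel)" for x
      by (rule integral_derivative_zero[OF d[rule_format] cx(2)]) (use M big in blast)
    then show ?thesis unfolding nn_integral_complex_iterated(2)[OF m(1)] nn_integral_complex_iterated(2)[OF m(2)] by simp
  qed
  then show "integral\<^sup>L lborel f' = 0" using nn_integral_parts_eq[OF i] by simp
qed

context proper_disc
begin

text \<open>Here \<open>sqn\<close> is \<open>u = |\<phi>|\<^sup>2\<close>, \<open>dens\<close> is the area density \<open>|\<phi>'|\<^sup>2\<close>, \<open>dsqn\<close> is the derivative \<open>\<partial>u\<close>, and \<open>ddsqn\<close> is the
  second derivative \<open>\<partial>\<partial>u\<close>.  The mixed derivative of \<open>u\<close> is \<open>dens\<close>.\<close>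

definition sqn :: "complex \<Rightarrow> real" where "sqn z = (norm (\<phi> z))\<^sup>2"
definition dens :: "complex \<Rightarrow> real" where "dens z = (norm (map_deriv \<phi> z))\<^sup>2"
definition dsqn :: "complex \<Rightarrow> complex"
  where "dsqn z = (\<Sum>i\<in>UNIV. cnj (\<phi> z $ i) * deriv (\<lambda>w. \<phi> w $ i) z)"
definition ddsqn :: "complex \<Rightarrow> complex"
  where "ddsqn z = (\<Sum>i\<in>UNIV. cnj (\<phi> z $ i) * deriv (deriv (\<lambda>w. \<phi> w $ i)) z)"

lemma sqn_sum: "sqn z = (\<Sum>i\<in>UNIV. (norm (\<phi> z $ i))\<^sup>2)"
  by (simp add: sqn_def norm_vec_def L2_set_def sum_nonneg)
lemma dens_sum: "dens z = (\<Sum>i\<in>UNIV. (norm (deriv (\<lambda>w. \<phi> w $ i) z))\<^sup>2)"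
  by (simp add: dens_def norm_vec_def L2_set_def sum_nonneg map_deriv_def)

text \<open>The Cauchy-Schwarz inequality.\<close>

lemma dsqn_le: "(norm (dsqn z))\<^sup>2 \<le> sqn z * dens z"
proof -
  have "norm (dsqn z) \<le> (\<Sum>i\<in>UNIV. norm (\<phi> z $ i) * norm (map_deriv \<phi> z $ i))"
    unfolding dsqn_def by (rule order_trans[OF norm_sum]) (simp add: norm_mult map_deriv_def)
  also have "\<dots> \<le> L2_set (\<lambda>i. norm (\<phi> z $ i)) UNIV * L2_set (\<lambda>i. norm (map_deriv \<phi> z $ i)) UNIV"
    using L2_set_mult_ineq[of "\<lambda>i. norm (\<phi> z $ i)" "\<lambda>i. norm (map_deriv \<phi> z $ i)" UNIV] by simp
  finally have "norm (dsqn z) \<le> norm (\<phi> z) * norm (map_deriv \<phi> z)" by (simp add: norm_vec_def)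
  then have "(norm (dsqn z))\<^sup>2 \<le> (norm (\<phi> z) * norm (map_deriv \<phi> z))\<^sup>2" by (intro power_mono) auto
  then show ?thesis by (simp add: sqn_def dens_def power_mult_distrib)
qed

lemma hol_derivs: "deriv (\<lambda>w. \<phi> w $ i) holomorphic_on D" "deriv (deriv (\<lambda>w. \<phi> w $ i)) holomorphic_on D"
  by (intro holomorphic_deriv hol_comp open_D)+

lemma continuous_densities: "continuous_on D sqn" "continuous_on D dens" "continuous_on D dsqn" "continuous_on D ddsqn"
  unfolding sqn_sum[abs_def] dens_sum[abs_def] dsqn_def[abs_def] ddsqn_def[abs_def]
  by (intro continuous_intros holomorphic_on_imp_continuous_on hol_comp hol_derivs)+

lemma comp_derivative:
  assumes "\<gamma> t \<in> D" "(\<gamma> has_vector_derivative e) (at t)"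
  shows "((\<lambda>t. \<phi> (\<gamma> t) $ i) has_vector_derivative e * deriv (\<lambda>w. \<phi> w $ i) (\<gamma> t)) (at t)"
    and "((\<lambda>t. deriv (\<lambda>w. \<phi> w $ i) (\<gamma> t)) has_vector_derivative e * deriv (deriv (\<lambda>w. \<phi> w $ i)) (\<gamma> t)) (at t)"
  using field_vector_diff_chain_at[OF assms(2) holomorphic_derivI[OF hol_comp open_D assms(1)]]
    field_vector_diff_chain_at[OF assms(2) holomorphic_derivI[OF hol_derivs(1) open_D assms(1)]]
  by (auto simp: comp_def)

lemma sqn_derivative:
  assumes "\<gamma> t \<in> D" "(\<gamma> has_vector_derivative e) (at t)"
  shows "((\<lambda>t. sqn (\<gamma> t)) has_real_derivative 2 * Re (dsqn (\<gamma> t) * e)) (at t)"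
proof -
  have *: "((\<lambda>t. (norm (F t))\<^sup>2) has_real_derivative 2 * Re (cnj (F t) * F')) (at t)"
    if "(F has_vector_derivative F') (at t)" for F F' and t :: real
  proof -
    have "((\<lambda>t. Re (F t)) has_real_derivative Re F') (at t)" "((\<lambda>t. Im (F t)) has_real_derivative Im F') (at t)"
      using that by (auto simp: has_vector_derivative_complex_iff)
    from DERIV_add[OF DERIV_power[OF this(1), of 2] DERIV_power[OF this(2), of 2]]
    show ?thesis unfolding cmod_power2 by (simp add: algebra_simps)
  qed
  have "((\<lambda>t. \<Sum>i\<in>UNIV. (norm (\<phi> (\<gamma> t) $ i))\<^sup>2) has_real_derivative
      (\<Sum>i\<in>UNIV. 2 * Re (cnj (\<phi> (\<gamma> t) $ i) * (e * deriv (\<lambda>w. \<phi> w $ i) (\<gamma> t))))) (at t)"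
    by (intro DERIV_sum * comp_derivative assms)
  moreover have "(\<Sum>i\<in>UNIV. 2 * Re (cnj (\<phi> (\<gamma> t) $ i) * (e * deriv (\<lambda>w. \<phi> w $ i) (\<gamma> t)))) = 2 * Re (dsqn (\<gamma> t) * e)"
    unfolding dsqn_def sum_distrib_right Re_sum sum_distrib_left by (intro sum.cong refl) (simp add: algebra_simps)
  ultimately show ?thesis unfolding sqn_sum by simp
qed

lemma dsqn_derivative:
  assumes "\<gamma> t \<in> D" "(\<gamma> has_vector_derivative e) (at t)"
  shows "((\<lambda>t. dsqn (\<gamma> t)) has_vector_derivative cnj e * of_real (dens (\<gamma> t)) + e * ddsqn (\<gamma> t)) (at t)"
proof -
  have "((\<lambda>t. dsqn (\<gamma> t)) has_vector_derivative
      (\<Sum>i\<in>UNIV. cnj (\<phi> (\<gamma> t) $ i) * (e * deriv (deriv (\<lambda>w. \<phi> w $ i)) (\<gamma> t))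
        + cnj (e * deriv (\<lambda>w. \<phi> w $ i) (\<gamma> t)) * deriv (\<lambda>w. \<phi> w $ i) (\<gamma> t))) (at t)"
    unfolding dsqn_def
    by (intro has_vector_derivative_sum has_vector_derivative_mult has_vector_derivative_cnj comp_derivative assms)
  moreover have "(\<Sum>i\<in>UNIV. cnj (\<phi> (\<gamma> t) $ i) * (e * deriv (deriv (\<lambda>w. \<phi> w $ i)) (\<gamma> t))
        + cnj (e * deriv (\<lambda>w. \<phi> w $ i) (\<gamma> t)) * deriv (\<lambda>w. \<phi> w $ i) (\<gamma> t))
      = cnj e * of_real (dens (\<gamma> t)) + e * ddsqn (\<gamma> t)"
  proof -
    have sq: "cnj (e * w) * w = cnj e * of_real ((norm w)\<^sup>2)" for w
      unfolding complex_norm_square by (simp add: mult.commute)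
    show ?thesis
      unfolding sq dens_sum ddsqn_def of_real_sum sum_distrib_left sum.distrib[symmetric]
      by (intro sum.cong refl) (simp only: ac_simps)
  qed
  ultimately show ?thesis by simp
qed

text \<open>The antiholomorphic derivative of the compactly supported function \<open>P = G(u) \<partial>u\<close> has integral zero.  It equals
  \<open>G(u) |\<phi>'|\<^sup>2 + G'(u) |\<partial>u|\<^sup>2\<close>.\<close>

lemma integral_dbar_zero:
  fixes G G' :: "real \<Rightarrow> real"
  assumes G: "\<And>s. (G has_real_derivative G' s) (at s)" and G'c: "continuous_on UNIV G'"
    and t: "t < R1" and supp: "\<And>z. z \<in> D \<Longrightarrow> t < norm (\<phi> z) \<Longrightarrow> G (sqn z) = 0 \<and> G' (sqn z) = 0"
  defines "W \<equiv> \<lambda>z. if z \<in> D then G (sqn z) * dens z + G' (sqn z) * (norm (dsqn z))\<^sup>2 else 0"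
  shows "integrable lborel W" "integral\<^sup>L lborel W = 0"
proof -
  define K where "K = {z \<in> D. norm (\<phi> z) \<le> t}"
  have K: "compact K" "K \<subseteq> D" unfolding K_def using compact_sublevel[OF t] by auto
  have oK: "open (- K)" using K(1) by (simp add: compact_imp_closed open_Compl)
  have z0: "G (sqn z) = 0 \<and> G' (sqn z) = 0" if "z \<in> D" "z \<notin> K" for z using supp that by (auto simp: K_def)
  have Gc: "continuous_on UNIV G" using G by (meson DERIV_continuous_on has_field_derivative_at_within)
  define P where "P z = (if z \<in> D then of_real (G (sqn z)) * dsqn z else 0)" for z
  define P' where "P' e z = (if z \<in> D then of_real (G' (sqn z) * (2 * Re (dsqn z * e))) * dsqn z
      + of_real (G (sqn z)) * (cnj e * of_real (dens z) + e * ddsqn z) else 0)" for e z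
  have cont: "continuous_on UNIV (P' e)" for e
  proof -
    have "continuous_on D (\<lambda>z. of_real (G' (sqn z) * (2 * Re (dsqn z * e))) * dsqn z
      + of_real (G (sqn z)) * (cnj e * of_real (dens z) + e * ddsqn z))"
      by (intro continuous_intros continuous_densities continuous_on_compose2[OF G'c] continuous_on_compose2[OF Gc]) auto
    then have "continuous_on D (P' e)" by (rule continuous_on_eq) (simp add: P'_def)
    moreover have "continuous_on (- K) (P' e)"
      by (rule continuous_on_eq[OF continuous_on_const[of _ 0]]) (use z0 in \<open>auto simp: P'_def\<close>)
    ultimately have "continuous_on (D \<union> - K) (P' e)" by (intro continuous_on_open_Un open_D oK)
    moreover have "D \<union> - K = UNIV" using K(2) by auto
    ultimately show ?thesis by simp
  qed
  have der: "((\<lambda>t. P (\<gamma> t)) has_vector_derivative P' e (\<gamma> t)) (at t)"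
    if \<gamma>: "(\<gamma> has_vector_derivative e) (at t)" for \<gamma> t e
  proof (cases "\<gamma> t \<in> D")
    case True
    have "((\<lambda>t. of_real (G (sqn (\<gamma> t)))) has_vector_derivative complex_of_real (G' (sqn (\<gamma> t)) * (2 * Re (dsqn (\<gamma> t) * e)))) (at t)"
      using DERIV_chain2[OF G sqn_derivative[OF True \<gamma>]]
      by (intro has_vector_derivative_of_real) (simp add: has_real_derivative_iff_has_vector_derivative)
    from has_vector_derivative_mult[OF this dsqn_derivative[OF True \<gamma>]]
    have *: "((\<lambda>t. of_real (G (sqn (\<gamma> t))) * dsqn (\<gamma> t)) has_vector_derivative P' e (\<gamma> t)) (at t)"
      using True by (simp add: P'_def add.commute)
    have "isCont \<gamma> t" using \<gamma> by (rule has_vector_derivative_continuous)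
    then have "\<forall>\<^sub>F s in at t. \<gamma> s \<in> D" using open_D True by (simp add: continuous_at topological_tendstoD)
    then have "\<forall>\<^sub>F s in nhds t. \<gamma> s \<in> D" using True by (simp add: eventually_nhds_conv_at)
    then have "\<forall>\<^sub>F s in nhds t. of_real (G (sqn (\<gamma> s))) * dsqn (\<gamma> s) = P (\<gamma> s)"
      by (rule eventually_mono) (simp add: P_def)
    then show ?thesis using * True by (subst (asm) has_vector_derivative_cong_ev) (auto simp: P_def)
  next
    case False
    have "isCont \<gamma> t" using \<gamma> by (rule has_vector_derivative_continuous)
    moreover have tK: "\<gamma> t \<in> - K" using False K(2) by blast
    ultimately have "\<forall>\<^sub>F s in at t. \<gamma> s \<in> - K"
      using topological_tendstoD[OF _ oK tK, of \<gamma> "at t"] by (simp only: continuous_at)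
    then have "\<forall>\<^sub>F s in nhds t. \<gamma> s \<in> - K" using tK by (simp add: eventually_nhds_conv_at)
    then have ev: "\<forall>\<^sub>F s in nhds t. 0 = P (\<gamma> s)"
      by (rule eventually_mono) (use z0 in \<open>auto simp: P_def\<close>)
    have "((\<lambda>s. 0) has_vector_derivative 0) (at t)" by (rule has_vector_derivative_const)
    then have "((\<lambda>s. P (\<gamma> s)) has_vector_derivative 0) (at t)" using ev False by (subst (asm) has_vector_derivative_cong_ev) (auto simp: P_def)
    then show ?thesis using False by (simp add: P'_def)
  qed
  obtain M where M: "\<And>z. z \<in> D \<Longrightarrow> norm z \<le> M" using bounded_D unfolding bounded_iff by blast
  have zero: "P z = 0" "P' e z = 0" if "M < norm z" for z e using M[of z] that by (auto simp: P_def P'_def)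
  have d1: "((\<lambda>x. P (Complex x y)) has_vector_derivative P' 1 (Complex x y)) (at x)" for x y
    by (rule der) (auto simp: has_vector_derivative_complex_iff intro!: derivative_eq_intros)
  have d2: "((\<lambda>y. P (Complex x y)) has_vector_derivative P' \<i> (Complex x y)) (at y)" for x y
    by (rule der) (auto simp: has_vector_derivative_complex_iff intro!: derivative_eq_intros)
  have I1: "integrable lborel (\<lambda>z. Re (P' 1 z))" "integral\<^sup>L lborel (\<lambda>z. Re (P' 1 z)) = 0"
    using d1 zero by (intro integral_partial_derivative_zero[where f = "\<lambda>z. Re (P z)" and M = M] continuous_intros cont
        disjI1; auto simp: has_vector_derivative_complex_iff)+
  have I2: "integrable lborel (\<lambda>z. Im (P' \<i> z))" "integral\<^sup>L lborel (\<lambda>z. Im (P' \<i> z)) = 0"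
    using d2 zero by (intro integral_partial_derivative_zero[where f = "\<lambda>z. Im (P z)" and M = M] continuous_intros cont
        disjI2; auto simp: has_vector_derivative_complex_iff)+
  have W: "W = (\<lambda>z. (Re (P' 1 z) - Im (P' \<i> z)) / 2)"
  proof
    fix z
    show "W z = (Re (P' 1 z) - Im (P' \<i> z)) / 2"
      unfolding W_def cmod_power2 by (simp add: P'_def power2_eq_square algebra_simps)
  qed
  show "integrable lborel W" unfolding W using I1(1) I2(1) by (intro integrable_divide Bochner_Integration.integrable_diff)
  show "integral\<^sup>L lborel W = 0" unfolding W using I1 I2 by simp
qed

text \<open>The area with the weight \<open>1 / max u R0\<^sup>2\<close> is controlled by the area itself.  The function
  \<open>T s = (1 + log (s / s0)) / s\<close>, constant for \<open>s \<le> s0 = R0\<^sup>2\<close>, solves \<open>(s T)' = 1 / s\<close> for \<open>s > s0\<close>.  If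
  \<open>G = max (T - c) 0\<close> were smooth, the preceding identity and \<open>|\<partial>u|\<^sup>2 \<le> u |\<phi>'|\<^sup>2\<close> would give
  \<open>\<integral> (1 / max u s0 - c) |\<phi>'|\<^sup>2 \<le> 0\<close> on the set \<open>T(u) > c\<close>, which is relatively compact for \<open>c > T (R1\<^sup>2) = \<kappa>\<close>.  The kink is
  smoothed by \<open>\<eta> t = t\<^sup>2 / (t + \<epsilon>)\<close>, for which \<open>\<eta> t \<ge> t - \<epsilon>\<close> and \<open>0 \<le> \<eta>' \<le> 1\<close>.  The choices \<open>c = 3/2 \<kappa>\<close> and
  \<open>\<epsilon> = \<kappa>/2\<close> give the constant \<open>c + \<epsilon> = 2 \<kappa>\<close>; the loss of the factor 2 is harmless.\<close>

lemma weighted_area: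
  assumes R0: "0 < R0" "R0 < R1"
  shows "(\<integral>\<^sup>+z\<in>D. ennreal (dens z / max (sqn z) (R0\<^sup>2)) \<partial>lborel)
    \<le> ennreal (2 * (1 + 2 * ln (R1 / R0)) / R1\<^sup>2) * image_area \<phi> D"
proof -
  define s0 where "s0 = R0\<^sup>2"
  define T where "T s = (1 + ln (s / s0)) / s" for s
  define T' where "T' s = - ln (s / s0) / s\<^sup>2" for s
  define \<kappa> where "\<kappa> = (1 + 2 * ln (R1 / R0)) / R1\<^sup>2"
  define c where "c = 3 / 2 * \<kappa>"
  define \<epsilon> where "\<epsilon> = \<kappa> / 2"
  define \<eta> where "\<eta> t = t\<^sup>2 / (t + \<epsilon>)" for t
  define \<eta>' where "\<eta>' t = 1 - \<epsilon>\<^sup>2 / (t + \<epsilon>)\<^sup>2" for t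
  define M where "M s = max s s0" for s
  define G where "G s = \<eta> (max (T (M s) - c) 0)" for s
  define G' where "G' s = \<eta>' (max (T (M s) - c) 0) * T' (M s)" for s
  have s0: "0 < s0" using R0 by (simp add: s0_def)
  have "0 < ln (R1 / R0)" using R0 by simp
  then have \<kappa>: "0 < \<kappa>" using R1_pos by (simp add: \<kappa>_def)
  then have \<epsilon>: "0 < \<epsilon>" by (simp add: \<epsilon>_def)
  have M: "s0 \<le> M s" "0 < M s" "s \<le> M s" for s using s0 by (auto simp: M_def)
  have dT: "(T has_real_derivative T' s) (at s)" if "s0 \<le> s" for s
  proof -
    have s: "0 < s" using that s0 by simp
    have "(T has_real_derivative ((1 / (s / s0) * (1 / s0)) * s - (1 + ln (s / s0)) * 1) / (s * s)) (at s)"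
      unfolding T_def[abs_def] using s s0 by (auto intro!: derivative_eq_intros)
    moreover have "((1 / (s / s0) * (1 / s0)) * s - (1 + ln (s / s0)) * 1) / (s * s) = T' s"
      using s s0 by (simp add: T'_def power2_eq_square)
    ultimately show ?thesis by simp
  qed
  have dTM: "((\<lambda>s. T (M s)) has_real_derivative T' (M s)) (at s)" for s
    unfolding M_def by (rule has_real_derivative_max[OF dT]) (use s0 in \<open>auto simp: T'_def\<close>)
  have d\<eta>: "(\<eta> has_real_derivative \<eta>' t) (at t)" if "0 \<le> t" for t
  proof -
    have t: "t + \<epsilon> \<noteq> 0" using that \<epsilon> by linarith
    have "(\<eta> has_real_derivative (2 * t * (t + \<epsilon>) - t\<^sup>2 * 1) / ((t + \<epsilon>) * (t + \<epsilon>))) (at t)"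
      unfolding \<eta>_def[abs_def] using t by (auto intro!: derivative_eq_intros)
    moreover have "(2 * t * (t + \<epsilon>) - t\<^sup>2 * 1) / ((t + \<epsilon>) * (t + \<epsilon>)) = \<eta>' t"
    proof -
      have "\<eta>' t = ((t + \<epsilon>)\<^sup>2 - \<epsilon>\<^sup>2) / (t + \<epsilon>)\<^sup>2" using t by (simp add: \<eta>'_def diff_divide_distrib)
      also have "(t + \<epsilon>)\<^sup>2 - \<epsilon>\<^sup>2 = 2 * t * (t + \<epsilon>) - t\<^sup>2 * 1" by (simp add: power2_eq_square algebra_simps)
      finally show ?thesis by (simp add: power2_eq_square)
    qed
    ultimately show ?thesis by simp
  qed
  have d\<eta>m: "((\<lambda>t. \<eta> (max t 0)) has_real_derivative \<eta>' (max t 0)) (at t)" for t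
    by (rule has_real_derivative_max[OF d\<eta>]) (use \<epsilon> in \<open>auto simp: \<eta>'_def\<close>)
  have dG: "(G has_real_derivative G' s) (at s)" for s
  proof -
    have "((\<lambda>s. T (M s) - c) has_real_derivative T' (M s)) (at s)"
      using DERIV_diff[OF dTM DERIV_const[of c]] by simp
    from DERIV_chain2[OF d\<eta>m this] show ?thesis by (simp add: G_def[abs_def] G'_def)
  qed
  have TMc: "continuous_on UNIV (\<lambda>s. T (M s))"
    using dTM by (meson DERIV_continuous_on has_field_derivative_at_within)
  have "M s / s0 \<noteq> 0" "M s \<noteq> 0" "0 < M s / s0" for s using M(2)[of s] s0 by auto
  moreover have "max x 0 + \<epsilon> \<noteq> 0" for x using \<epsilon> by (simp add: max_def)
  moreover have "continuous_on UNIV M" unfolding M_def by (intro continuous_intros)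
  ultimately have G'c: "continuous_on UNIV G'"
    unfolding G'_def \<eta>'_def T'_def by (intro continuous_intros TMc) auto
  have Ms1: "M (R1\<^sup>2) = R1\<^sup>2"
    using R0 by (auto simp: M_def s0_def max_def intro: power_mono)
  have "ln (R1\<^sup>2 / s0) = 2 * ln (R1 / R0)"
    using R0 R1_pos by (simp add: s0_def power_divide[symmetric] ln_realpow)
  then have "T (M (R1\<^sup>2)) = \<kappa>" unfolding Ms1 by (simp add: T_def \<kappa>_def)
  then have lim: "T (M (R1\<^sup>2)) < c" using \<kappa> by (simp add: c_def)
  have "isCont (\<lambda>\<rho>. T (M (\<rho>\<^sup>2))) R1"
    by (rule continuous_on_interior[of UNIV]) (auto intro!: continuous_on_compose2[OF TMc] continuous_intros)
  then have "\<forall>\<^sub>F \<rho> in at R1. T (M (\<rho>\<^sup>2)) < c"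
    using lim by (intro order_tendstoD(2)) (simp_all add: continuous_at)
  then obtain d where d: "0 < d" "\<And>\<rho>. \<rho> \<noteq> R1 \<Longrightarrow> dist \<rho> R1 < d \<Longrightarrow> T (M (\<rho>\<^sup>2)) < c"
    unfolding eventually_at by blast
  define t where "t = R1 - d"
  have t: "t < R1" using d by (simp add: t_def)
  have small: "T (M (sqn z)) < c" if "z \<in> D" "t < norm (\<phi> z)" for z
    unfolding sqn_def by (rule d(2)) (use norm_less[OF that(1)] that(2) in \<open>auto simp: t_def dist_real_def\<close>)
  have G0: "G (sqn z) = 0 \<and> G' (sqn z) = 0" if "T (M (sqn z)) \<le> c" for z
    using that \<epsilon> by (simp add: G_def G'_def \<eta>_def \<eta>'_def max_def)
  define W where "W = (\<lambda>z. if z \<in> D then G (sqn z) * dens z + G' (sqn z) * (norm (dsqn z))\<^sup>2 else 0)"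
  have Gs: "G (sqn z) = 0 \<and> G' (sqn z) = 0" if "z \<in> D" "t < norm (\<phi> z)" for z
    using G0 small[OF that] by simp
  have W: "integrable lborel W" "integral\<^sup>L lborel W = 0"
    unfolding W_def by (rule integral_dbar_zero[OF dG G'c t Gs]; assumption)+
  define V where "V = {z \<in> D. c < T (M (sqn z))}"
  define K where "K = {z \<in> D. norm (\<phi> z) \<le> t}"
  have K: "compact K" "K \<subseteq> D" unfolding K_def using compact_sublevel[OF t] by auto
  have VK: "V \<subseteq> K" using small by (force simp: V_def K_def)
  have "continuous_on D (\<lambda>z. T (M (sqn z)))"
    by (rule continuous_on_compose2[OF TMc continuous_densities(1)]) simp
  then have "open (D \<inter> (\<lambda>z. T (M (sqn z))) -` {c<..})" by (intro continuous_open_preimage open_D) auto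
  moreover have "D \<inter> (\<lambda>z. T (M (sqn z))) -` {c<..} = V" by (auto simp: V_def)
  ultimately have oV: "open V" by simp
  \<comment> \<open>the pointwise lower bound for the integrand of total mass zero\<close>
  have key: "(1 / M (sqn z) - 2 * \<kappa>) * dens z \<le> W z" if z: "z \<in> V" for z
  proof -
    define m where "m = M (sqn z)"
    define x where "x = T m - c"
    have x: "0 < x" using z by (simp add: V_def x_def m_def)
    have m: "s0 \<le> m" "0 < m" "sqn z \<le> m" using M by (auto simp: m_def)
    have dn: "0 \<le> dens z" by (simp add: dens_def)
    have "x - \<epsilon> \<le> \<eta> x"
    proof -
      have "(x - \<epsilon>) * (x + \<epsilon>) \<le> x\<^sup>2" by (simp add: algebra_simps power2_eq_square)
      then show ?thesis using x \<epsilon> by (simp add: \<eta>_def field_simps)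
    qed
    then have 1: "(x - \<epsilon>) * dens z \<le> \<eta> x * dens z" using dn by (rule mult_right_mono)
    have T'0: "T' m \<le> 0" using m s0 by (simp add: T'_def)
    have \<eta>'1: "\<eta>' x \<le> 1" "0 \<le> \<eta>' x"
    proof -
      have "\<epsilon>\<^sup>2 \<le> (x + \<epsilon>)\<^sup>2" using x \<epsilon> by (intro power_mono) auto
      then show "\<eta>' x \<le> 1" "0 \<le> \<eta>' x" using x \<epsilon> by (auto simp: \<eta>'_def)
    qed
    have "(norm (dsqn z))\<^sup>2 \<le> m * dens z" using dsqn_le[of z] m(3) dn by (meson mult_right_mono order_trans)
    then have "T' m * (m * dens z) \<le> T' m * (norm (dsqn z))\<^sup>2" using T'0 by (rule mult_left_mono_neg)
    also have "\<dots> \<le> \<eta>' x * (T' m * (norm (dsqn z))\<^sup>2)"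
    proof -
      have "T' m * (norm (dsqn z))\<^sup>2 \<le> 0" using T'0 by (simp add: mult_nonpos_nonneg)
      then show ?thesis using mult_right_mono_neg[OF \<eta>'1(1), of "T' m * (norm (dsqn z))\<^sup>2"] by simp
    qed
    finally have 2: "T' m * (m * dens z) \<le> (\<eta>' x * T' m) * (norm (dsqn z))\<^sup>2" by (simp add: mult.assoc)
    have "(x - \<epsilon>) + T' m * m = 1 / m - 2 * \<kappa>"
      using m by (simp add: x_def T_def T'_def c_def \<epsilon>_def add_divide_distrib power2_eq_square)
    then have "(1 / m - 2 * \<kappa>) * dens z = (x - \<epsilon>) * dens z + T' m * (m * dens z)"
      by (metis distrib_right mult.assoc)
    also have "\<dots> \<le> \<eta> x * dens z + (\<eta>' x * T' m) * (norm (dsqn z))\<^sup>2" using 1 2 by linarith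
    also have "\<dots> = W z" using z x by (simp add: W_def G_def G'_def V_def x_def m_def)
    finally show ?thesis by (simp add: m_def)
  qed
  have int: "integrable lborel (\<lambda>z. indicator V z *\<^sub>R F z)" if F: "continuous_on D F" for F :: "complex \<Rightarrow> real"
  proof -
    have "set_integrable lborel K F"
      unfolding set_integrable_def using F K by (intro borel_integrable_compact) (auto intro: continuous_on_subset)
    then have "set_integrable lborel V F" by (rule set_integrable_subset[OF _ _ VK]) (use oV in simp)
    then show ?thesis by (simp add: set_integrable_def)
  qed
  define l where "l z = indicator V z *\<^sub>R (dens z / M (sqn z))" for z
  define k where "k z = indicator V z *\<^sub>R (2 * \<kappa> * dens z)" for z
  have cM: "continuous_on D (\<lambda>z. M (sqn z))" unfolding M_def by (intro continuous_intros continuous_densities)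
  have Mn: "M s \<noteq> 0" for s using M(2)[of s] by simp
  have il: "integrable lborel l" unfolding l_def by (rule int) (intro continuous_intros continuous_densities cM, use Mn in auto)
  have ik: "integrable lborel k" unfolding k_def by (rule int) (intro continuous_intros continuous_densities)
  have "integral\<^sup>L lborel (\<lambda>z. l z - k z) \<le> integral\<^sup>L lborel W"
  proof (rule integral_mono)
    show "integrable lborel (\<lambda>z. l z - k z)" using il ik by simp
    show "l z - k z \<le> W z" for z
    proof (cases "z \<in> V")
      case True
      then show ?thesis using key[OF True] by (simp add: l_def k_def algebra_simps)
    next
      case False
      then have "W z = 0" using G0[of z] by (auto simp: W_def V_def)
      then show ?thesis using False by (simp add: l_def k_def)
    qed
  qed (rule W(1))
  then have lk: "integral\<^sup>L lborel l \<le> integral\<^sup>L lborel k" using il ik W(2) by simp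
  have pos: "0 \<le> dens z" "0 \<le> dens z / M (sqn z)" for z using M(2)[of "sqn z"] by (auto simp: dens_def)
  have l0: "0 \<le> l z" and k0: "0 \<le> k z" for z using pos \<kappa> by (simp_all add: l_def k_def indicator_def)
  have nlk: "(\<integral>\<^sup>+z. ennreal (l z) \<partial>lborel) \<le> (\<integral>\<^sup>+z. ennreal (k z) \<partial>lborel)"
    using lk l0 k0 by (simp add: nn_integral_eq_integral[OF il] nn_integral_eq_integral[OF ik] ennreal_leI)
  define R where "R z = ennreal (2 * \<kappa> * dens z) * indicator D z * indicator (- V) z" for z
  have lm: "(\<lambda>z. ennreal (l z)) \<in> borel_measurable lborel" "(\<lambda>z. ennreal (k z)) \<in> borel_measurable lborel"
    using borel_measurable_integrable[OF il] borel_measurable_integrable[OF ik] by auto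
  have Dm: "(\<lambda>z. ennreal (2 * \<kappa> * dens z) * indicator D z) \<in> borel_measurable borel"
    by (rule measurable_restrict_open_ennreal[OF open_D]) (intro continuous_intros continuous_densities)
  have Vm: "(indicator (- V) :: complex \<Rightarrow> ennreal) \<in> borel_measurable borel"
    using oV by (intro borel_measurable_indicator) auto
  have Rm: "R \<in> borel_measurable lborel" unfolding R_def[abs_def] using Dm Vm by measurable
  have "(\<integral>\<^sup>+z\<in>D. ennreal (dens z / max (sqn z) (R0\<^sup>2)) \<partial>lborel) \<le> (\<integral>\<^sup>+z. ennreal (l z) + R z \<partial>lborel)"
  proof (rule nn_integral_mono)
    fix z
    show "ennreal (dens z / max (sqn z) (R0\<^sup>2)) * indicator D z \<le> ennreal (l z) + R z"
    proof (cases "z \<in> D")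
      case True
      show ?thesis
      proof (cases "z \<in> V")
        case True
        then show ?thesis by (auto simp: l_def M_def s0_def indicator_def)
      next
        case False
        then have "T (M (sqn z)) \<le> c" using True by (simp add: V_def)
        moreover have "1 / M (sqn z) \<le> T (M (sqn z))"
          using M[of "sqn z"] s0 by (simp add: T_def divide_right_mono)
        ultimately have "1 / M (sqn z) \<le> 2 * \<kappa>" using \<kappa> by (simp add: c_def)
        from mult_right_mono[OF this pos(1)[of z]]
        have "dens z / max (sqn z) (R0\<^sup>2) \<le> 2 * \<kappa> * dens z" by (simp add: M_def s0_def)
        then show ?thesis using True False by (simp add: R_def l_def ennreal_leI)
      qed
    qed simp
  qed
  also have "\<dots> = (\<integral>\<^sup>+z. ennreal (l z) \<partial>lborel) + (\<integral>\<^sup>+z. R z \<partial>lborel)"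
    by (rule nn_integral_add[OF lm(1) Rm])
  also have "\<dots> \<le> (\<integral>\<^sup>+z. ennreal (k z) \<partial>lborel) + (\<integral>\<^sup>+z. R z \<partial>lborel)"
    by (rule add_right_mono[OF nlk])
  also have "\<dots> = (\<integral>\<^sup>+z. ennreal (k z) + R z \<partial>lborel)"
    by (rule nn_integral_add[OF lm(2) Rm, symmetric])
  also have "\<dots> = (\<integral>\<^sup>+z. ennreal (2 * \<kappa>) * (ennreal (dens z) * indicator D z) \<partial>lborel)"
  proof (rule nn_integral_cong)
    fix z
    have e: "ennreal (2 * \<kappa> * dens z) = ennreal (2 * \<kappa>) * ennreal (dens z)"
      using \<kappa> pos(1) by (intro ennreal_mult) auto
    show "ennreal (k z) + R z = ennreal (2 * \<kappa>) * (ennreal (dens z) * indicator D z)"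
      using e by (auto simp: k_def R_def indicator_def V_def)
  qed
  also have "\<dots> = ennreal (2 * \<kappa>) * (\<integral>\<^sup>+z\<in>D. ennreal (dens z) \<partial>lborel)"
    using measurable_restrict_open_ennreal[OF open_D continuous_densities(2)] by (intro nn_integral_cmult) simp
  also have "\<dots> = ennreal (2 * (1 + 2 * ln (R1 / R0)) / R1\<^sup>2) * image_area \<phi> D"
    by (simp add: \<kappa>_def image_area_def dens_def)
  finally show ?thesis .
qed

end

section \<open>The lower bound for the modulus\<close>

context proper_disc_component
begin

text \<open>The length-area estimate.  Along every horizontal segment of the strip \<open>|\<phi>|\<close> tends from at most \<open>R0\<close> to \<open>R1\<close>, so the
  function \<open>T(u)\<close> increases by at least \<open>log (R1 / R0)\<close>, where \<open>T s\<close> is \<open>(1 + log (s / s0)) / 2\<close> for \<open>s \<ge> s0 = R0\<^sup>2\<close> and is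
  continued linearly to the left, so that \<open>T' s = 1 / (2 max s s0)\<close>.  The truncation is needed because \<open>|\<phi>|\<close> may be
  smaller than \<open>R0\<close> on other components of the sublevel set.  The square of the gradient of \<open>T(u)\<close> is at most
  \<open>\<omega> = |\<phi>'|\<^sup>2 / max u s0\<close>; the Cauchy-Schwarz inequality on each segment and integration over the period conclude.\<close>

lemma length_area_modulus:
  assumes chart: "oriented_chart D a r C p1 p2 f g"
  shows "ennreal (2 * pi * (ln (R1 / R0))\<^sup>2) \<le>
    ennreal (ln (p2 / p1)) * (\<integral>\<^sup>+z\<in>D. ennreal (dens z / max (sqn z) (R0\<^sup>2)) \<partial>lborel)"
proof -
  interpret X: oriented_chart D a r C p1 p2 f g by (rule chart)
  define s0 where "s0 = R0\<^sup>2"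
  define M where "M s = max s s0" for s
  define F where "F s = (1 + ln (s / s0)) / 2 - s / (2 * s0)" for s
  define T where "T s = s / (2 * s0) + F (M s)" for s
  define \<omega> where "\<omega> z = dens z / M (sqn z)" for z
  define L where "L = ln (R1 / R0)"
  define l where "l = X.x1 - X.x0"
  have s0: "0 < s0" using R0_pos by (simp add: s0_def)
  have L: "0 < L" using R0_pos R0_less by (simp add: L_def)
  have l: "0 < l" using X.x01 by (simp add: l_def)
  have M: "0 < M s" "s \<le> M s" "s0 \<le> M s" for s using s0 by (auto simp: M_def)
  have \<omega>0: "0 \<le> \<omega> z" for z using M(1)[of "sqn z"] by (simp add: \<omega>_def dens_def)
  have dT: "(T has_real_derivative 1 / (2 * M s)) (at s)" for s
  proof -
    have "(F has_real_derivative 1 / (2 * s) - 1 / (2 * s0)) (at s)" if "s0 \<le> s" for s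
    proof -
      have s: "0 < s" using that s0 by simp
      have "(F has_real_derivative (1 / (s / s0) * (1 / s0)) / 2 - 1 / (2 * s0)) (at s)"
        unfolding F_def[abs_def] using s s0 by (auto intro!: derivative_eq_intros)
      moreover have "(1 / (s / s0) * (1 / s0)) / 2 = 1 / (2 * s)" using s s0 by simp
      ultimately show ?thesis by (simp only:)
    qed
    from has_real_derivative_max[OF this, where a = s0]
    have "((\<lambda>s. F (M s)) has_real_derivative 1 / (2 * M s) - 1 / (2 * s0)) (at s)" by (simp add: M_def)
    then show ?thesis unfolding T_def[abs_def] using s0 by (auto intro!: derivative_eq_intros)
  qed
  have Tmono: "T s \<le> T s'" if "s \<le> s'" for s s'
    by (rule DERIV_nonneg_imp_nondecreasing[OF that]) (use dT M(1) in \<open>meson divide_nonneg_pos less_imp_le mult_pos_pos zero_le_one zero_less_numeral\<close>)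
  have Tval: "T (\<rho>\<^sup>2) = 1 / 2 + ln (\<rho> / R0)" if "R0 \<le> \<rho>" for \<rho>
  proof -
    have "s0 \<le> \<rho>\<^sup>2" using that R0_pos by (auto simp: s0_def intro: power_mono)
    moreover have "ln (\<rho>\<^sup>2 / s0) = 2 * ln (\<rho> / R0)"
      using that R0_pos by (simp add: s0_def power_divide[symmetric] ln_realpow)
    ultimately show ?thesis by (simp add: T_def F_def M_def max_def)
  qed
  define S where "S = X.strip \<inter> {w. \<bar>Im w - pi\<bar> < pi}"
  note S = X.half_strip_finite_energy[OF S_def]
  have SD: "X.h w \<in> D" if "w \<in> X.strip" for w using X.h_U[OF that] by (simp add: U_def)
  have \<omega>c: "continuous_on D \<omega>"
  proof -
    have "M s \<noteq> 0" for s using M(1)[of s] by simp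
    moreover have "continuous_on D (\<lambda>z. M (sqn z))" unfolding M_def by (intro continuous_intros continuous_densities)
    ultimately show ?thesis unfolding \<omega>_def by (intro continuous_intros continuous_densities) auto
  qed
  define e where "e w = ennreal (\<omega> (X.h w) * (norm (deriv X.h w))\<^sup>2) * indicator S w" for w
  have hc: "continuous_on S X.h" "continuous_on S (deriv X.h)"
    by (intro holomorphic_on_imp_continuous_on holomorphic_deriv S)+
  have hS: "X.h ` S \<subseteq> D" using SD by (auto simp: S_def)
  have em: "e \<in> borel_measurable borel"
    unfolding e_def[abs_def]
    by (rule measurable_restrict_open_ennreal[OF S(1)])
      (intro continuous_intros hc(2) continuous_on_compose2[OF \<omega>c hc(1) hS])
  have ray: "ennreal (L\<^sup>2) \<le> ennreal l * (\<integral>\<^sup>+x. e (Complex x y) \<partial>lborel)" if y: "0 < y" "y < 2 * pi" for y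
  proof -
    have step: "ennreal ((L - 2 * \<delta>)\<^sup>2) \<le> ennreal l * (\<integral>\<^sup>+x. e (Complex x y) \<partial>lborel)"
      if \<delta>: "0 < \<delta>" "2 * \<delta> < L" for \<delta>
    proof -
      have e1: "R0 < R0 * exp \<delta>" using R0_pos \<delta> by simp
      have cC0: "closure C \<subseteq> {z \<in> D. norm (\<phi> z) < R0 * exp \<delta>}" using closure_C_sub e1 by force
      obtain s where s: "X.x0 < s" "s < X.x1"
        "\<And>w. w \<in> X.strip \<Longrightarrow> Re w < s \<Longrightarrow> X.h w \<in> {z \<in> D. norm (\<phi> z) < R0 * exp \<delta>}"
      proof (rule X.h_inner[OF open_sublevel cC0])
        fix s assume "X.x0 < s" "s < X.x1"
          "\<And>w. w \<in> X.strip \<Longrightarrow> Re w < s \<Longrightarrow> X.h w \<in> {z \<in> D. norm (\<phi> z) < R0 * exp \<delta>}"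
        then show thesis by (rule that)
      qed
      obtain \<alpha> where \<alpha>: "X.x0 < \<alpha>" "\<alpha> < s" using dense s(1) by blast
      have "R1 * exp (- \<delta>) < R1" using R1_pos \<delta> by simp
      then have cK: "compact {z \<in> D. norm (\<phi> z) \<le> R1 * exp (- \<delta>)}" by (rule compact_sublevel)
      obtain t where t: "0 < t" "t < r" "{z \<in> D. norm (\<phi> z) \<le> R1 * exp (- \<delta>)} \<subseteq> ball a t"
        by (rule inner_radius[OF cK]) auto
      obtain s' where s': "X.x0 < s'" "s' < X.x1" "\<And>w. w \<in> X.strip \<Longrightarrow> s' < Re w \<Longrightarrow> t < dist a (X.h w)"
      proof (rule X.h_outer[OF t(2)])
        fix s assume "X.x0 < s" "s < X.x1" "\<And>w. w \<in> X.strip \<Longrightarrow> s < Re w \<Longrightarrow> t < dist a (X.h w)"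
        then show thesis by (rule that)
      qed
      have "max s' \<alpha> < X.x1" using s' \<alpha> s by simp
      then obtain \<beta> where \<beta>: "max s' \<alpha> < \<beta>" "\<beta> < X.x1" using dense by blast
      have mem: "Complex x y \<in> S" if "x \<in> {\<alpha>..\<beta>}" for x
        using that \<alpha> \<beta> y by (auto simp: S_def X.strip_def abs_less_iff)
      have mem': "Complex x y \<in> X.strip" if "x \<in> {\<alpha>..\<beta>}" for x using mem[OF that] by (simp add: S_def)
      define v where "v x = T (sqn (X.h (Complex x y)))" for x
      define v' where "v' x = 1 / (2 * M (sqn (X.h (Complex x y)))) *
        (2 * Re (dsqn (X.h (Complex x y)) * deriv X.h (Complex x y)))" for x
      define k where "k x = sqrt (\<omega> (X.h (Complex x y))) * norm (deriv X.h (Complex x y))" for x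
      have ab: "\<alpha> \<le> \<beta>" using \<beta> by simp
      have der: "(v has_vector_derivative v' x) (at x within {\<alpha>..\<beta>})" if x: "x \<in> {\<alpha>..\<beta>}" for x
      proof -
        have "(X.h has_field_derivative deriv X.h (Complex x y)) (at (Complex x y))"
          using holomorphic_derivI[OF X.h_hol X.open_strip mem'[OF x]] .
        moreover have "((\<lambda>x. Complex x y) has_vector_derivative 1) (at x)"
          by (auto simp: has_vector_derivative_complex_iff intro!: derivative_eq_intros)
        ultimately have "((\<lambda>x. X.h (Complex x y)) has_vector_derivative deriv X.h (Complex x y)) (at x)"
          using field_vector_diff_chain_at[of "\<lambda>x. Complex x y" 1 x X.h] by (simp add: comp_def)
        from DERIV_chain2[OF dT sqn_derivative[OF SD[OF mem'[OF x]] this]]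
        have "(v has_real_derivative v' x) (at x)" by (simp only: v_def[abs_def] v'_def)
        then show ?thesis
          by (simp add: has_real_derivative_iff_has_vector_derivative has_vector_derivative_at_within)
      qed
      have bound: "norm (v' x) \<le> k x" for x
      proof -
        define z where "z = X.h (Complex x y)"
        define d where "d = deriv X.h (Complex x y)"
        have m: "0 < M (sqn z)" "sqn z \<le> M (sqn z)" using M by auto
        have "(norm (dsqn z) / M (sqn z))\<^sup>2 \<le> \<omega> z"
        proof -
          have "(norm (dsqn z))\<^sup>2 \<le> M (sqn z) * dens z"
            using dsqn_le[of z] mult_right_mono[OF m(2), of "dens z"] by (simp add: dens_def)
          then have "(norm (dsqn z))\<^sup>2 / (M (sqn z))\<^sup>2 \<le> (M (sqn z) * dens z) / (M (sqn z))\<^sup>2"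
            by (rule divide_right_mono) simp
          then show ?thesis using m(1) by (simp add: \<omega>_def power_divide power2_eq_square)
        qed
        then have b: "norm (dsqn z) / M (sqn z) \<le> sqrt (\<omega> z)" by (rule real_le_rsqrt)
        have "1 / (2 * c) * (2 * q) = q / c" for c q :: real by simp
        then have "v' x = Re (dsqn z * d) / M (sqn z)" unfolding v'_def z_def d_def .
        then have "norm (v' x) = \<bar>Re (dsqn z * d)\<bar> / M (sqn z)"
          using m(1) by (simp only: real_norm_def abs_divide abs_of_pos)
        also have "\<dots> \<le> norm (dsqn z * d) / M (sqn z)"
          using m(1) by (intro divide_right_mono abs_Re_le_cmod less_imp_le)
        also have "\<dots> = (norm (dsqn z) / M (sqn z)) * norm d" by (simp add: norm_mult)
        also have "\<dots> \<le> sqrt (\<omega> z) * norm d" using b by (rule mult_right_mono) simp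
        finally show ?thesis by (simp add: k_def z_def d_def)
      qed
      have cC: "continuous_on {\<alpha>..\<beta>} (\<lambda>x. Complex x y)" by (intro continuous_intros)
      have cS: "(\<lambda>x. Complex x y) ` {\<alpha>..\<beta>} \<subseteq> S" using mem by blast
      have ch: "continuous_on {\<alpha>..\<beta>} (\<lambda>x. X.h (Complex x y))" "continuous_on {\<alpha>..\<beta>} (\<lambda>x. deriv X.h (Complex x y))"
        using continuous_on_compose2[OF hc(1) cC cS] continuous_on_compose2[OF hc(2) cC cS] by auto
      have hD: "(\<lambda>x. X.h (Complex x y)) ` {\<alpha>..\<beta>} \<subseteq> D" using SD mem' by blast
      have kc: "continuous_on {\<alpha>..\<beta>} k"
        unfolding k_def by (intro continuous_intros continuous_on_compose2[OF \<omega>c ch(1) hD] ch(2))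
      have "L - 2 * \<delta> \<le> v \<beta> - v \<alpha>"
      proof -
        have "norm (\<phi> (X.h (Complex \<alpha> y))) < R0 * exp \<delta>"
          using s(3)[of "Complex \<alpha> y"] mem'[of \<alpha>] \<alpha> ab by simp
        then have "sqn (X.h (Complex \<alpha> y)) \<le> (R0 * exp \<delta>)\<^sup>2" unfolding sqn_def by (intro power_mono) auto
        then have "v \<alpha> \<le> T ((R0 * exp \<delta>)\<^sup>2)" unfolding v_def by (rule Tmono)
        also have "\<dots> = 1 / 2 + \<delta>" using Tval[of "R0 * exp \<delta>"] e1 R0_pos by simp
        finally have 1: "v \<alpha> \<le> 1 / 2 + \<delta>" .
        have "t < dist a (X.h (Complex \<beta> y))" using s'(3)[of "Complex \<beta> y"] mem'[of \<beta>] \<beta> ab by simp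
        then have "X.h (Complex \<beta> y) \<notin> ball a t" by simp
        then have n: "R1 * exp (- \<delta>) < norm (\<phi> (X.h (Complex \<beta> y)))"
          using t(3) SD[OF mem'[of \<beta>]] ab by force
        have "(R1 * exp (- \<delta>))\<^sup>2 \<le> sqn (X.h (Complex \<beta> y))" unfolding sqn_def using n R1_pos by (intro power_mono) auto
        then have 2: "T ((R1 * exp (- \<delta>))\<^sup>2) \<le> v \<beta>" unfolding v_def by (rule Tmono)
        have lnR: "ln (R1 * exp (- \<delta>) / R0) = L - \<delta>"
          using R1_pos R0_pos by (simp add: L_def ln_mult ln_div)
        have "0 < R1 * exp (- \<delta>) / R0" using R1_pos R0_pos by simp
        moreover have "0 < ln (R1 * exp (- \<delta>) / R0)" unfolding lnR using \<delta> by simp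
        ultimately have "1 < R1 * exp (- \<delta>) / R0" by (simp only: ln_gt_zero_iff)
        then have "R0 \<le> R1 * exp (- \<delta>)" using R0_pos by (simp add: field_simps)
        from Tval[OF this] lnR 2 have "1 / 2 + (L - \<delta>) \<le> v \<beta>" by simp
        then show ?thesis using 1 by linarith
      qed
      then have "(L - 2 * \<delta>)\<^sup>2 \<le> (norm (v \<beta> - v \<alpha>))\<^sup>2" using \<delta> by (intro power_mono) auto
      then have "ennreal ((L - 2 * \<delta>)\<^sup>2) \<le> ennreal ((norm (v \<beta> - v \<alpha>))\<^sup>2)" by (rule ennreal_leI)
      also have "\<dots> \<le> ennreal (\<beta> - \<alpha>) * (\<integral>\<^sup>+x\<in>{\<alpha>..\<beta>}. ennreal ((k x)\<^sup>2) \<partial>lborel)"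
        by (rule segment_length_area[OF ab der bound kc])
      also have "\<dots> \<le> ennreal l * (\<integral>\<^sup>+x. e (Complex x y) \<partial>lborel)"
      proof (intro mult_mono ennreal_leI nn_integral_mono)
        show "\<beta> - \<alpha> \<le> l" using \<alpha> \<beta> by (simp add: l_def)
        have k2: "(k x)\<^sup>2 = \<omega> (X.h (Complex x y)) * (norm (deriv X.h (Complex x y)))\<^sup>2" for x
          using \<omega>0 by (simp add: k_def power_mult_distrib)
        show "ennreal ((k x)\<^sup>2) * indicator {\<alpha>..\<beta>} x \<le> e (Complex x y)" for x
          unfolding k2 e_def using mem[of x] by (auto simp: indicator_def)
      qed auto
      finally show ?thesis .
    qed
    show ?thesis
    proof (rule ccontr)
      define Z where "Z = ennreal l * (\<integral>\<^sup>+x. e (Complex x y) \<partial>lborel)"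
      assume "\<not> ennreal (L\<^sup>2) \<le> ennreal l * (\<integral>\<^sup>+x. e (Complex x y) \<partial>lborel)"
      then have "Z < ennreal (L\<^sup>2)" by (simp add: Z_def)
      then obtain x where x: "Z = ennreal x" "0 \<le> x" "x < L\<^sup>2"
        by (cases Z) (auto simp: ennreal_less_iff)
      have sx: "sqrt x < L" using x(2,3) L by (simp add: real_less_lsqrt)
      define \<delta> where "\<delta> = (L - sqrt x) / 4"
      have "0 \<le> sqrt x" using x(2) by simp
      have d4: "4 * \<delta> = L - sqrt x" by (simp add: \<delta>_def)
      have d: "0 < \<delta>" "2 * \<delta> < L" using d4 \<open>0 \<le> sqrt x\<close> sx L by linarith+
      have "sqrt x < L - 2 * \<delta>" using d4 sx by linarith
      then have "(sqrt x)\<^sup>2 < (L - 2 * \<delta>)\<^sup>2" using \<open>0 \<le> sqrt x\<close> by (intro power_strict_mono) auto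
      then have "x < (L - 2 * \<delta>)\<^sup>2" using x(2) by simp
      then show False using step[OF d] x(1,2) unfolding Z_def[symmetric] by simp
    qed
  qed
  have Jm: "(\<lambda>y. \<integral>\<^sup>+x. e (Complex x y) \<partial>lborel) \<in> borel_measurable lborel"
    using measurable_slices(1)[OF em] by simp
  have "ennreal (2 * pi * L\<^sup>2) = ennreal (L\<^sup>2) * emeasure lborel {0<..<2*pi}"
    by (simp add: ennreal_mult[symmetric] mult.commute)
  also have "\<dots> = (\<integral>\<^sup>+y. ennreal (L\<^sup>2) * indicator {0<..<2*pi} y \<partial>lborel)"
    by (rule nn_integral_cmult_indicator[symmetric]) simp
  also have "\<dots> \<le> (\<integral>\<^sup>+y. ennreal l * (\<integral>\<^sup>+x. e (Complex x y) \<partial>lborel) \<partial>lborel)"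
    using ray by (intro nn_integral_mono) (auto simp: indicator_def)
  also have "\<dots> = ennreal l * (\<integral>\<^sup>+y. \<integral>\<^sup>+x. e (Complex x y) \<partial>lborel \<partial>lborel)"
    by (rule nn_integral_cmult[OF Jm])
  also have "\<dots> = ennreal l * (\<integral>\<^sup>+w. e w \<partial>lborel)" by (simp only: nn_integral_complex_iterated(1)[OF em])
  also have "\<dots> \<le> ennreal l * (\<integral>\<^sup>+z\<in>X.h ` S. ennreal (\<omega> z) \<partial>lborel)"
    unfolding e_def
    by (intro mult_left_mono nn_integral_holomorphic_image S)
      (use SD S_def \<omega>0 in \<open>auto intro: continuous_on_subset[OF \<omega>c]\<close>)
  also have "\<dots> \<le> ennreal l * (\<integral>\<^sup>+z\<in>D. ennreal (\<omega> z) \<partial>lborel)"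
    using SD by (intro mult_left_mono nn_integral_mono) (auto simp: indicator_def S_def)
  finally have "ennreal (2 * pi * L\<^sup>2) \<le> ennreal l * (\<integral>\<^sup>+z\<in>D. ennreal (\<omega> z) \<partial>lborel)" .
  moreover have "l = ln (p2 / p1)" using X.r1 X.r12 by (simp add: l_def X.x0_def X.x1_def ln_div)
  ultimately show ?thesis by (simp add: L_def \<omega>_def M_def s0_def)
qed

text \<open>The combination of the two estimates has the factor \<open>2 \<pi> / 2 = \<pi>\<close> to spare.\<close>

theorem modulus_lower_bound:
  assumes "has_modulus (D - closure C) m"
  shows "ennreal (ln (R1 / R0)) / (image_area \<phi> D / ennreal (R1\<^sup>2) * ennreal (2 + 1 / ln (R1 / R0))) \<le> ennreal m"
proof -
  define L where "L = ln (R1 / R0)"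
  have L: "0 < L" using R0_pos R0_less by (simp add: L_def)
  obtain p1 p2 where p: "0 < p1" "p1 < p2" "conformally_equivalent U (round_annulus p1 p2)" "m = ln (p2 / p1)"
    using assms unfolding has_modulus_def U_def by blast
  obtain f g where "oriented_chart D a r C p1 p2 f g" by (rule obtain_oriented_chart[OF p(1-3)])
  from length_area_modulus[OF this]
  have "ennreal (2 * pi * L\<^sup>2) \<le> ennreal m * (\<integral>\<^sup>+z\<in>D. ennreal (dens z / max (sqn z) (R0\<^sup>2)) \<partial>lborel)"
    by (simp add: L_def p(4))
  also have "\<dots> \<le> ennreal m * (ennreal (2 * (1 + 2 * L) / R1\<^sup>2) * image_area \<phi> D)"
    using weighted_area[OF R0_pos R0_less] by (intro mult_left_mono) (auto simp: L_def)
  finally have main: "ennreal (2 * pi * L\<^sup>2) \<le> ennreal m * (ennreal (2 * (1 + 2 * L) / R1\<^sup>2) * image_area \<phi> D)" .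
  have m: "0 < m" using p by simp
  show ?thesis
  proof (cases "image_area \<phi> D")
    case (real A)
    define B where "B = A / R1\<^sup>2 * (2 + 1 / L)"
    have "0 \<le> 2 * (1 + 2 * L) / R1\<^sup>2" using L by simp
    then have "ennreal m * (ennreal (2 * (1 + 2 * L) / R1\<^sup>2) * image_area \<phi> D) = ennreal (m * (2 * (1 + 2 * L) / R1\<^sup>2 * A))"
      unfolding real(2) using m real(1) by (simp only: ennreal_mult mult_nonneg_nonneg less_imp_le)
    then have "2 * pi * L\<^sup>2 \<le> m * (2 * (1 + 2 * L) / R1\<^sup>2 * A)"
      using main m L real by (simp add: ennreal_le_iff)
    also have "\<dots> = 2 * (m * B * L)" using L R1_pos by (simp add: B_def field_simps)
    finally have "pi * L * L \<le> m * B * L" by (simp add: power2_eq_square mult.assoc)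
    then have "pi * L \<le> m * B" using L by simp
    moreover have "L \<le> pi * L" using L pi_gt3 by simp
    ultimately have mB: "L \<le> m * B" by linarith
    then have "0 < m * B" using L by linarith
    then have B: "0 < B" using m by (simp add: zero_less_mult_iff)
    have "image_area \<phi> D / ennreal (R1\<^sup>2) * ennreal (2 + 1 / L) = ennreal B"
    proof -
      have "ennreal A / ennreal (R1\<^sup>2) = ennreal (A / R1\<^sup>2)" using real(1) R1_pos by (intro divide_ennreal) auto
      then show ?thesis unfolding real(2) B_def using real(1) L by (simp only: ennreal_mult'' add_nonneg_nonneg divide_nonneg_nonneg less_imp_le zero_le_numeral zero_le_one)
    qed
    then have "ennreal L / (image_area \<phi> D / ennreal (R1\<^sup>2) * ennreal (2 + 1 / L)) = ennreal (L / B)"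
      using B L by (simp add: divide_ennreal)
    also have "\<dots> \<le> ennreal m" using mB B by (intro ennreal_leI) (simp add: field_simps)
    finally show ?thesis by (simp add: L_def)
  next
    case top
    have "0 < 2 + 1 / L" using L by (intro add_pos_pos) auto
    then have "ennreal (2 + 1 / L) \<noteq> 0" by simp
    moreover have "image_area \<phi> D / ennreal (R1\<^sup>2) = top" using top by (simp add: ennreal_top_divide)
    ultimately show ?thesis by (simp add: L_def[symmetric] ennreal_top_mult ennreal_divide_top)
  qed
qed

lemma topological_disk_C: "topological_disk C"
  using simply_connected_C C_ne simply_connected_eq_homeomorphic_to_disc[OF open_C]
  by (simp add: topological_disk_def)

lemma has_modulus_exists: "\<exists>m. has_modulus (D - closure C) m"
  using conformal_annulus unfolding has_modulus_def U_def by blast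

lemma half_open_annulus_D_C: "half_open_topological_annulus (D - C)"
proof -
  obtain p1 p2 where p: "0 < p1" "p1 < p2" "conformally_equivalent U (round_annulus p1 p2)"
    using conformal_annulus by blast
  obtain f g where "oriented_chart D a r C p1 p2 f g" by (rule obtain_oriented_chart[OF p])
  then show ?thesis by (rule oriented_chart.half_open_annulus)
qed

end

theorem theorem3p1:
  fixes \<phi> :: "complex \<Rightarrow> complex ^ 'n"
    and D :: "complex set" and a :: complex and r R0 R1 :: real
  assumes "0 < r" and "D = ball a r"
    and "0 < R0" and "R0 < R1"
    and "holomorphic_map_on \<phi> D"
    and "\<phi> ` D \<subseteq> ball 0 R1"
    and "proper_map (top_of_set D) (top_of_set (ball 0 R1)) \<phi>"
  shows "(\<forall>C \<in> components (D \<inter> \<phi> -` ball 0 R0). topological_disk C) \<and>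
    (\<forall>C \<in> components (D \<inter> \<phi> -` ball 0 R0).
       half_open_topological_annulus (D - C) \<and>
       (\<exists>m. has_modulus (D - closure C) m) \<and>
       (\<forall>m. has_modulus (D - closure C) m \<longrightarrow>
          ennreal m \<ge> ennreal (ln (R1 / R0)) /
            (image_area \<phi> D / ennreal (R1\<^sup>2) * ennreal (2 + 1 / ln (R1 / R0)))))"
proof -
  have "proper_disc_component \<phi> D a r R1 R0 C" if "C \<in> components (D \<inter> \<phi> -` ball 0 R0)" for C
  proof
    have "D \<inter> \<phi> -` ball 0 R0 = {z \<in> D. norm (\<phi> z) < R0}" by auto
    then show "C \<in> components {z \<in> D. norm (\<phi> z) < R0}" using that by simp
  qed (use assms in auto)
  note pdc = this
  show ?thesis
    using proper_disc_component.topological_disk_C[OF pdc] proper_disc_component.half_open_annulus_D_C[OF pdc]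
      proper_disc_component.has_modulus_exists[OF pdc] proper_disc_component.modulus_lower_bound[OF pdc]
    by blast
qed

end
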